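(* Let $(\mathcal{T}_m,\tau_m)_{m\in\mathbb{N}}$ be a sequence of discretisations satisfying the hypotheses (Seq) of the context and, for each $m$, let $[u_i]_{\mathcal{M}_m},[u_i]_{\mathcal{T}_m},[\phi]_{\mathcal{T}_m}$, etc. be the functions built from a solution of the scheme (S1)-(S6) for $(\mathcal{T}_m,\tau_m)$. Consider a subsequence (still denoted with index $m$) and functions $u_i\in L^\infty((0,T)\times\Omega)$, $i=0,\dots,n$, with $u_0,\sqrt{u_0}\in L^2(0,T;H^1(\Omega))$ and $\sqrt{u_0}u_i\in L^2(0,T;H^1(\Omega))$ for $i=1,\dots,n$, and $\phi\in L^2(0,T;H^1_D(\Omega)+\phi^D)$, such that, as $m\to\infty$ along the subsequence: (i) for all $i=1,\dots,n$, $[u_i]_{\mathcal{M}_m}\to u_i$ for the weak-$\star$ topology of $L^\infty((0,T)\times\Omega)$; (ii) $[u_0]_{\mathcal{M}_m}$ and $[u_0]_{\mathcal{T}_m}$ converge to $u_0$ in $L^2((0,T)\times\Omega)$, $[u_0]_{\mathcal{T}_m}\to u_0$ weakly in $L^2(0,T;H^1(\Omega))$ and $[\sqrt{u_0}]_{\mathcal{T}_m}\to\sqrt{u_0}$ weakly in $L^2(0,T;H^1(\Omega))$; (iii) for all $i=1,\dots,n$, $[\sqrt{u_0}u_i]_{\mathcal{M}_m}$ and $[\sqrt{u_0}u_i]_{\mathcal{T}_m}$ converge to $\sqrt{u_0}u_i$ in $L^2((0,T)\times\Omega)$, and $[\sqrt{u_0}u_i]_{\mathcal{T}_m}\to\sqrt{u_0}u_i$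 weakly in $L^2(0,T;H^1(\Omega))$; (iv) $[\phi]_{\mathcal{T}_m}\to\phi$ in $L^2((0,T)\times\Omega)$ and weakly in $L^2(0,T;H^1(\Omega))$. Then $(u_0,\dots,u_n,\phi)$ is a weak solution in the sense defined in the context.
   Context: **Data.** $d\in\{2,3\}$; $\Omega\subset\mathbb{R}^d$ is a bounded connected open polytopal set, with regular boundary $\partial\Omega=\Gamma_D\cup\Gamma_N$ regularly partitioned into $\Gamma_D,\Gamma_N$; $T>0$; $\lambda,\beta>0$; $n\ge 1$; $z_i\in\mathbb{R}$ and $D_i>0$ for $i=1,\dots,n$; $u_i^{\rm ini}\in L^\infty(\Omega)$, $i=0,\dots,n$, with $u_i^{\rm ini}\ge 0$, $\sum_{i=0}^n u_i^{\rm ini}=1$ a.e. and $M_i=\int_\Omega u_i^{\rm ini}\,dx>0$ for $i=0,\dots,n$; $\phi^D\in H^1(\Omega)$; $f\in L^2(\Omega)$. $H^1_D(\Omega)$ is the set of elements of $H^1(\Omega)$ with zero trace on $\Gamma_D$; it is assumed that there is $C_P>0$ with $\|v\|_{L^2(\Omega)}\le C_P\|\nabla v\|_{L^2(\Omega)}$ for all $v\in H^1_D(\Omega)$. **Weak solution.** $(u_0,\dots,u_n,\phi)$ is a weak solution if $u_0,\dots,u_n:(0,T)\times\Omega\to[0,1]$ and $\phi:(0,T)\times\Omega\to\mathbb{R}$ are measurable and: - $\sqrt{u_0}\in L^2(0,T;H^1(\Omega))$, $\sqrt{u_0}u_i\in L^2(0,T;H^1(\Omega))$ for $i=1,\dots,n$,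 and $\phi\in L^2(0,T;H^1_D(\Omega)+\phi^D)$; - for all $i=1,\dots,n$ and $\psi\in C^\infty_c([0,T)\times\mathbb{R}^d)$, $-\int_0^T\!\int_\Omega u_i\partial_t\psi\,dx\,dt-\int_\Omega u_i^{\rm ini}\psi(0,x)\,dx+D_i\int_0^T\!\int_\Omega\big(\sqrt{u_0}\nabla(\sqrt{u_0}u_i)-3\sqrt{u_0}u_i\nabla(\sqrt{u_0})+u_0u_i\beta z_i\nabla\phi\big)\cdot\nabla\psi\,dx\,dt=0$; - for all $v\in H^1_D(\Omega)$ and $\xi\in C_c^\infty((0,T))$, $\lambda^2\int_0^T\xi(t)\int_\Omega\nabla\phi(t,x)\cdot\nabla v(x)\,dx\,dt=\int_0^T\xi(t)\int_\Omega\big(\sum_{i=1}^nz_iu_i(t,x)+f(x)\big)v(x)\,dx\,dt$; - $\sum_{i=0}^nu_i=1$ a.e. on $[0,T]\times\Omega$. **Mesh.** $\mathcal{T}$ is a finite collection of disjoint open simplices with $\bigcup_{S\in\mathcal{T}}\overline S=\overline\Omega$, conforming (no hanging nodes). Its vertices are $\{x_K, K\in\mathcal{M}\}$. $\mathcal{M}_S$ is the set of (indices of) vertices of $S$, $\mathcal{T}_K$ the set of simplices having $x_K$ as a vertex, $\mathcal{M}_D$ the set of (indices of) vertices located on $\Gamma_D$. $h_S$ is the diameter of $S$, $\rho_S$ its maximal inscribed ball radius, $|\mathcal{T}|=\max_S h_S$, $\theta_{\mathcal{T}}=\max_S h_S/\rho_S$. $V_{\mathcal{T}}$ is the conforming $\mathbb{P}_1$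 finite element space with nodal basis $(e_K)_{K\in\mathcal{M}}$; for $v\in V_{\mathcal{T}}$, $\nabla v(S)$ is the constant value of $\nabla v$ in $S$. $V_{\mathcal{T},D}=\{v\in V_{\mathcal{T}}: v(x_K)=0\ \forall K\in\mathcal{M}_D\}$. The dual cell, also denoted $K$, is $\{x\in\Omega: e_K(x)>e_L(x)\ \forall L\ne K\}$, with measure $|K|$. $\phi^D_{\mathcal{T}}\in V_{\mathcal{T}}$ is a given discrete lifting and $(\phi^D_{\mathcal{T}})_K=\phi^D_{\mathcal{T}}(x_K)$. Time sequence $\tau$: $0=t^0<t^1<\dots<t^{N_T}=T$, $\tau^k=t^k-t^{k-1}$, $|\tau|=\max_k\tau^k$. **Scheme.** Unknowns: reals $\mu_{i,K}^k$ ($i=1,\dots,n$) and $\phi_K^k$, $K\in\mathcal{M}$, $k=1,\dots,N_T$. (S1) $u_{i,K}^0=\frac1{|K|}\int_K u_i^{\rm ini}\,dx$, $i=0,\dots,n$. (S2) $u_{0,K}^k=\frac{1}{1+\sum_{j=1}^n\exp(\mu_{j,K}^k)}$ and $u_{i,K}^k=u_{0,K}^k\exp(\mu_{i,K}^k)$, $i=1,\dots,n$, $k\ge1$. (S3) for $i=1,\dots,n$, $K\in\mathcal{M}$, $k=1,\dots,N_T$: $|K|\frac{u_{i,K}^k-u_{i,K}^{k-1}}{\tau^k}+\sum_{S\in\mathcal{T}_K}\sum_{L\in\mathcal{M}_S}u_{0,S}^k u_{i,S}^k F_{i,K,L}^{k,S}=0$. (S4) $F_{i,K,L}^{k,S}=D_i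 a_{KL}^S\big((\mu_{i,K}^k-\mu_{i,L}^k)+\beta z_i(\phi_K^k-\phi_L^k)\big)$ with $a_{KL}^S=-|S|\nabla e_K(S)\cdot\nabla e_L(S)$. (S5) Either (max): $u_{j,S}^k=\max_{L\in\mathcal{M}_S}u_{j,L}^k$ for $j=0,\dots,n$; or (ave): $u_{j,S}^k=\frac1{d+1}\sum_{L\in\mathcal{M}_S}u_{j,L}^k$ for $j=0,\dots,n$. (The result holds for either choice.) (S6) $\phi_K^k=(\phi^D_{\mathcal{T}})_K$ for $K\in\mathcal{M}_D$, and $\lambda^2\sum_{S\in\mathcal{T}_K}\sum_{L\in\mathcal{M}_S}a_{KL}^S(\phi_K^k-\phi_L^k)=|K|\sum_{i=1}^n z_iu_{i,K}^k+\int_K f\,dx$ for $K\in\mathcal{M}\setminus\mathcal{M}_D$. **Reconstructions.** For $v=(v_K^k)$, $[v]_{\mathcal{T}}$ (resp. $[v]_{\mathcal{M}}$) is the function on $(0,T]\times\Omega$ which, for $t\in(t^{k-1},t^k]$, equals the element of $V_{\mathcal{T}}$ with value $v_K^k$ at each $x_K$ (resp. the function equal to $v_K^k$ a.e. on each dual cell $K$). For a function $g$ of the unknowns, $[g(u_0,u_i)]$ is the reconstruction of the nodal values $g(u_{0,K}^k,u_{i,K}^k)$. **Hypotheses (Seq).** There is $\theta>0$ such that $\lim_m|\mathcal{T}_m|=\lim_m|\tau_m|=0$ and $\sup_m\theta_{\mathcal{T}_m}\le\theta$; $V_{\mathcal{T}_m,D}\subset H^1_D(\Omega)$; the $H^1(\Omega)$-orthogonal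 projections $\mathcal{P}_m:H^1_D(\Omega)\to V_{\mathcal{T}_m,D}$ satisfy $\|v-\mathcal{P}_m(v)\|_{H^1(\Omega)}\to0$ for all $v\in H^1_D(\Omega)$; $\phi^D_{\mathcal{T}_m}\in V_{\mathcal{T}_m}$ converges to $\phi^D$ in $H^1(\Omega)$. $\mathcal{M}_m$ denotes the dual mesh of $\mathcal{T}_m$. *)

theory Defs
  imports "HOL-Analysis.Analysis"
begin

section \<open>Smooth functions and Lebesgue spaces\<close>

definition grad :: "('a::euclidean_space \<Rightarrow> real) \<Rightarrow> 'a \<Rightarrow> 'a" where
  "grad f x = (THE D. GDERIV f x :> D)"

text \<open>C-infinity on the whole space: every iterated partial derivative exists and is
  Frechet differentiable at every point.\<close>

definition smooth :: "('a::euclidean_space \<Rightarrow> real) \<Rightarrow> bool" where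
  "smooth f \<longleftrightarrow>
     (\<forall>bs x. set bs \<subseteq> Basis \<longrightarrow> foldr (\<lambda>b g y. grad g y \<bullet> b) bs f differentiable (at x))"

text \<open>For open \<open>U\<close>, an element of \<open>C\<^sub>c\<^sup>\<infinity>(U)\<close> is identified with its extension by zero.\<close>

definition Cc_infty :: "'a::euclidean_space set \<Rightarrow> ('a \<Rightarrow> real) set" where
  "Cc_infty U = {\<psi>. smooth \<psi> \<and> compact (closure {x. \<psi> x \<noteq> 0}) \<and> closure {x. \<psi> x \<noteq> 0} \<subseteq> U}"

text \<open>Elements of \<open>L\<^sup>2\<close>, \<open>L\<^sup>\<infinity>\<close> and of the Sobolev spaces below are represented by functions; all
  notions are insensitive to changes on null sets and to values outside the domain.\<close>

definition L2 :: "'a measure \<Rightarrow> ('a \<Rightarrow> 'b::euclidean_space) set" where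
  "L2 M = {f \<in> borel_measurable M. integrable M (\<lambda>x. (norm (f x))\<^sup>2)}"

definition L2_norm :: "'a measure \<Rightarrow> ('a \<Rightarrow> 'b::euclidean_space) \<Rightarrow> real" where
  "L2_norm M f = sqrt (LINT x|M. (norm (f x))\<^sup>2)"

definition L2_conv :: "'a measure \<Rightarrow> (nat \<Rightarrow> 'a \<Rightarrow> real) \<Rightarrow> ('a \<Rightarrow> real) \<Rightarrow> bool" where
  "L2_conv M F f \<longleftrightarrow> (\<forall>m. F m \<in> L2 M) \<and> f \<in> L2 M \<and>
     (\<lambda>m. L2_norm M (\<lambda>x. F m x - f x)) \<longlonglongrightarrow> 0"

definition Linf :: "'a measure \<Rightarrow> ('a \<Rightarrow> real) set" where
  "Linf M = {f \<in> borel_measurable M. \<exists>C. AE x in M. \<bar>f x\<bar> \<le> C}"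

definition Linf_weak_star_conv ::
  "'a measure \<Rightarrow> (nat \<Rightarrow> 'a \<Rightarrow> real) \<Rightarrow> ('a \<Rightarrow> real) \<Rightarrow> bool" where
  "Linf_weak_star_conv M F f \<longleftrightarrow> (\<forall>m. F m \<in> Linf M) \<and> f \<in> Linf M \<and>
     (\<forall>g::'a \<Rightarrow> real. integrable M g \<longrightarrow>
        (\<lambda>m. LINT x|M. F m x * g x) \<longlonglongrightarrow> (LINT x|M. f x * g x))"

section \<open>The space \<open>H\<^sup>1(\<Omega>)\<close>\<close>

definition weak_gradient ::
  "'a::euclidean_space set \<Rightarrow> ('a \<Rightarrow> real) \<Rightarrow> ('a \<Rightarrow> 'a) \<Rightarrow> bool" where
  "weak_gradient \<Omega> v g \<longleftrightarrow>
     (\<forall>\<psi>\<in>Cc_infty \<Omega>. (LINT x|lebesgue_on \<Omega>. v x *\<^sub>R grad \<psi> x)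
                      = - (LINT x|lebesgue_on \<Omega>. \<psi> x *\<^sub>R g x))"

definition H1 :: "'a::euclidean_space set \<Rightarrow> ('a \<Rightarrow> real) set" where
  "H1 \<Omega> = {v \<in> L2 (lebesgue_on \<Omega>). \<exists>g\<in>L2 (lebesgue_on \<Omega>). weak_gradient \<Omega> v g}"

definition wgrad :: "'a::euclidean_space set \<Rightarrow> ('a \<Rightarrow> real) \<Rightarrow> 'a \<Rightarrow> 'a" where
  "wgrad \<Omega> v = (SOME g. g \<in> L2 (lebesgue_on \<Omega>) \<and> weak_gradient \<Omega> v g)"

definition H1_inner ::
  "'a::euclidean_space set \<Rightarrow> ('a \<Rightarrow> real) \<Rightarrow> ('a \<Rightarrow> real) \<Rightarrow> real" where
  "H1_inner \<Omega> v w = (LINT x|lebesgue_on \<Omega>. v x * w x)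
                   + (LINT x|lebesgue_on \<Omega>. wgrad \<Omega> v x \<bullet> wgrad \<Omega> w x)"

definition H1_norm :: "'a::euclidean_space set \<Rightarrow> ('a \<Rightarrow> real) \<Rightarrow> real" where
  "H1_norm \<Omega> v = sqrt (H1_inner \<Omega> v v)"

definition H1_conv ::
  "'a::euclidean_space set \<Rightarrow> (nat \<Rightarrow> 'a \<Rightarrow> real) \<Rightarrow> ('a \<Rightarrow> real) \<Rightarrow> bool" where
  "H1_conv \<Omega> F f \<longleftrightarrow> (\<forall>m. F m \<in> H1 \<Omega>) \<and> f \<in> H1 \<Omega> \<and>
     (\<lambda>m. H1_norm \<Omega> (\<lambda>x. F m x - f x)) \<longlonglongrightarrow> 0"

definition H1_orthogonal_projection ::
  "'a::euclidean_space set \<Rightarrow> ('a \<Rightarrow> real) set \<Rightarrow> ('a \<Rightarrow> real) set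
     \<Rightarrow> (('a \<Rightarrow> real) \<Rightarrow> 'a \<Rightarrow> real) \<Rightarrow> bool" where
  "H1_orthogonal_projection \<Omega> H V \<P> \<longleftrightarrow>
     (\<forall>v\<in>H. \<P> v \<in> V \<and> (\<forall>w\<in>V. H1_inner \<Omega> (\<lambda>x. v x - \<P> v x) w = 0))"

section \<open>Traces\<close>

text \<open>\<open>s\<close>-dimensional Hausdorff outer measure (for \<open>s \<ge> 1\<close>), normalised so as to agree with
  \<open>s\<close>-dimensional area on flat pieces.  The surface measure is the \<open>(d-1)\<close>-dimensional one, on
  Borel sets.\<close>

definition hausdorff_outer :: "nat \<Rightarrow> 'a::euclidean_space set \<Rightarrow> ennreal" where
  "hausdorff_outer s A = (SUP \<delta>\<in>{0<..}.
     INF C\<in>{C::nat \<Rightarrow> 'a set. A \<subseteq> (\<Union>i. C i) \<and> (\<forall>i. bounded (C i) \<and> diameter (C i) \<le> \<delta>)}.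
       (\<Sum>i. ennreal (unit_ball_vol (real s) * (diameter (C i) / 2) ^ s)))"

definition surface_measure :: "'a::euclidean_space measure" where
  "surface_measure = measure_of UNIV (sets borel) (hausdorff_outer (DIM('a) - 1))"

text \<open>The trace operator is the continuous extension to \<open>H\<^sup>1(\<Omega>)\<close>, with values in
  \<open>L\<^sup>2(\<partial>\<Omega>)\<close>, of the restriction to \<open>\<partial>\<Omega>\<close> of functions that are smooth up to the boundary.\<close>

definition has_trace ::
  "'a::euclidean_space set \<Rightarrow> ('a \<Rightarrow> real) \<Rightarrow> ('a \<Rightarrow> real) \<Rightarrow> bool" where
  "has_trace \<Omega> v g \<longleftrightarrow> g \<in> borel_measurable borel \<and>
     (\<exists>w. (\<forall>k. smooth (w k)) \<and> H1_conv \<Omega> w v \<and>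
        (\<lambda>k. \<integral>\<^sup>+x\<in>frontier \<Omega>. ennreal ((w k x - g x)\<^sup>2) \<partial>surface_measure) \<longlonglongrightarrow> 0)"

definition H1D :: "'a::euclidean_space set \<Rightarrow> 'a set \<Rightarrow> ('a \<Rightarrow> real) set" where
  "H1D \<Omega> \<Gamma>D = {v \<in> H1 \<Omega>. \<exists>g. has_trace \<Omega> v g \<and> (AE x in surface_measure. x \<in> \<Gamma>D \<longrightarrow> g x = 0)}"

section \<open>The space \<open>L\<^sup>2(0,T;H\<^sup>1(\<Omega>))\<close>\<close>

definition cyl :: "real \<Rightarrow> 'a::euclidean_space set \<Rightarrow> (real \<times> 'a) measure" where
  "cyl T \<Omega> = lebesgue_on ({0<..<T} \<times> \<Omega>)"

text \<open>A function \<open>t \<mapsto> v(t)\<close> with values in \<open>H\<^sup>1(\<Omega>)\<close> is represented by \<open>(t,x) \<mapsto> v(t)(x)\<close>.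
  Embedding \<open>H\<^sup>1(\<Omega>)\<close> in \<open>L\<^sup>2(\<Omega>)\<^sup>1\<^sup>+\<^sup>d\<close> by \<open>w \<mapsto> (w, \<nabla>w)\<close>, strong measurability amounts to joint
  measurability (up to a choice of representatives) of \<open>v\<close> and of its space gradient.\<close>

definition is_space_grad ::
  "real \<Rightarrow> 'a::euclidean_space set \<Rightarrow> (real \<times> 'a \<Rightarrow> real) \<Rightarrow> (real \<times> 'a \<Rightarrow> 'a) \<Rightarrow> bool" where
  "is_space_grad T \<Omega> v G \<longleftrightarrow> G \<in> L2 (cyl T \<Omega>) \<and>
     (AE t in lebesgue_on {0<..<T}. weak_gradient \<Omega> (\<lambda>x. v (t, x)) (\<lambda>x. G (t, x)))"

definition L2H1 :: "real \<Rightarrow> 'a::euclidean_space set \<Rightarrow> (real \<times> 'a \<Rightarrow> real) set" where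
  "L2H1 T \<Omega> = {v \<in> L2 (cyl T \<Omega>).
     (AE t in lebesgue_on {0<..<T}. (\<lambda>x. v (t, x)) \<in> H1 \<Omega>) \<and> (\<exists>G. is_space_grad T \<Omega> v G)}"

definition space_grad ::
  "real \<Rightarrow> 'a::euclidean_space set \<Rightarrow> (real \<times> 'a \<Rightarrow> real) \<Rightarrow> real \<times> 'a \<Rightarrow> 'a" where
  "space_grad T \<Omega> v = (SOME G. is_space_grad T \<Omega> v G)"

definition L2H1_norm :: "real \<Rightarrow> 'a::euclidean_space set \<Rightarrow> (real \<times> 'a \<Rightarrow> real) \<Rightarrow> real" where
  "L2H1_norm T \<Omega> v =
     sqrt ((L2_norm (cyl T \<Omega>) v)\<^sup>2 + (L2_norm (cyl T \<Omega>) (space_grad T \<Omega> v))\<^sup>2)"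

text \<open>Continuous linear functionals on \<open>L\<^sup>2(0,T;H\<^sup>1(\<Omega>))\<close>; the bound by the norm makes them
  well defined on equivalence classes.\<close>

definition L2H1_functional ::
  "real \<Rightarrow> 'a::euclidean_space set \<Rightarrow> ((real \<times> 'a \<Rightarrow> real) \<Rightarrow> real) \<Rightarrow> bool" where
  "L2H1_functional T \<Omega> \<Lambda> \<longleftrightarrow>
     (\<forall>v\<in>L2H1 T \<Omega>. \<forall>w\<in>L2H1 T \<Omega>. \<Lambda> (\<lambda>p. v p + w p) = \<Lambda> v + \<Lambda> w) \<and>
     (\<forall>c. \<forall>v\<in>L2H1 T \<Omega>. \<Lambda> (\<lambda>p. c * v p) = c * \<Lambda> v) \<and>
     (\<exists>C. \<forall>v\<in>L2H1 T \<Omega>. \<bar>\<Lambda> v\<bar> \<le> C * L2H1_norm T \<Omega> v)"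

definition L2H1_weak_conv ::
  "real \<Rightarrow> 'a::euclidean_space set \<Rightarrow> (nat \<Rightarrow> real \<times> 'a \<Rightarrow> real) \<Rightarrow> (real \<times> 'a \<Rightarrow> real) \<Rightarrow> bool"
where
  "L2H1_weak_conv T \<Omega> F f \<longleftrightarrow> (\<forall>m. F m \<in> L2H1 T \<Omega>) \<and> f \<in> L2H1 T \<Omega> \<and>
     (\<forall>\<Lambda>. L2H1_functional T \<Omega> \<Lambda> \<longrightarrow> (\<lambda>m. \<Lambda> (F m)) \<longlonglongrightarrow> \<Lambda> f)"

definition L2H1D_shift ::
  "real \<Rightarrow> 'a::euclidean_space set \<Rightarrow> 'a set \<Rightarrow> ('a \<Rightarrow> real) \<Rightarrow> (real \<times> 'a \<Rightarrow> real) set" where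
  "L2H1D_shift T \<Omega> \<Gamma>D g = {v \<in> L2H1 T \<Omega>.
     AE t in lebesgue_on {0<..<T}. (\<lambda>x. v (t, x) - g x) \<in> H1D \<Omega> \<Gamma>D}"

section \<open>Data of the continuous problem\<close>

definition polytopal :: "'a::euclidean_space set \<Rightarrow> bool" where
  "polytopal \<Omega> \<longleftrightarrow> (\<exists>\<P>. finite \<P> \<and> (\<forall>p\<in>\<P>. polytope p) \<and> closure \<Omega> = \<Union>\<P>)"

text \<open>Near each boundary point, \<open>\<Omega>\<close> is the strict epigraph, in some direction \<open>e\<close>, of a Lipschitz
  function of the component orthogonal to \<open>e\<close>.\<close>

definition lipschitz_boundary :: "'a::euclidean_space set \<Rightarrow> bool" where
  "lipschitz_boundary \<Omega> \<longleftrightarrow>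
     (\<forall>x\<in>frontier \<Omega>. \<exists>e \<gamma> L r. norm e = 1 \<and> 0 < r \<and> L-lipschitz_on UNIV \<gamma> \<and>
        \<Omega> \<inter> ball x r = {y \<in> ball x r. \<gamma> (y - (y \<bullet> e) *\<^sub>R e) < y \<bullet> e})"

definition regular_partition ::
  "'a::euclidean_space set \<Rightarrow> 'a set \<Rightarrow> 'a set \<Rightarrow> bool" where
  "regular_partition \<Omega> \<Gamma>D \<Gamma>N \<longleftrightarrow>
     \<Gamma>D \<union> \<Gamma>N = frontier \<Omega> \<and> \<Gamma>D \<inter> \<Gamma>N = {} \<and> \<Gamma>D \<in> sets borel \<and> \<Gamma>N \<in> sets borel \<and>
     emeasure surface_measure (closure \<Gamma>D \<inter> closure \<Gamma>N) = 0"

record 'a problem =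
  dom_Omega :: "'a set"
  Gamma_D :: "'a set"
  Gamma_N :: "'a set"
  horizon :: real
  lam :: real
  beta :: real
  nspec :: nat
  charge :: "nat \<Rightarrow> real"
  diffus :: "nat \<Rightarrow> real"
  u_ini :: "nat \<Rightarrow> 'a \<Rightarrow> real"
  phi_D :: "'a \<Rightarrow> real"
  f_source :: "'a \<Rightarrow> real"

definition admissible_problem :: "'a::euclidean_space problem \<Rightarrow> bool" where
  "admissible_problem P \<longleftrightarrow> (let \<Omega> = dom_Omega P; M = lebesgue_on \<Omega>; n = nspec P in
     open \<Omega> \<and> bounded \<Omega> \<and> connected \<Omega> \<and> polytopal \<Omega> \<and> lipschitz_boundary \<Omega> \<and>
     regular_partition \<Omega> (Gamma_D P) (Gamma_N P) \<and>
     0 < horizon P \<and> 0 < lam P \<and> 0 < beta P \<and> 1 \<le> n \<and>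
     (\<forall>i\<in>{1..n}. 0 < diffus P i) \<and>
     (\<forall>i\<in>{0..n}. u_ini P i \<in> Linf M \<and> (AE x in M. 0 \<le> u_ini P i x) \<and>
        0 < (LINT x|M. u_ini P i x)) \<and>
     (AE x in M. (\<Sum>i=0..n. u_ini P i x) = 1) \<and>
     phi_D P \<in> H1 \<Omega> \<and> f_source P \<in> L2 M \<and>
     (\<exists>C>0. \<forall>v\<in>H1D \<Omega> (Gamma_D P). L2_norm M v \<le> C * L2_norm M (wgrad \<Omega> v)))"

text \<open>The test space \<open>C\<^sub>c\<^sup>\<infinity>([0,T) \<times> \<real>\<^sup>d)\<close> consists of the restrictions to nonnegative times of
  smooth functions with compact support in \<open>(-\<infinity>,T) \<times> \<real>\<^sup>d\<close>.  The bounds on the \<open>u i\<close> are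
  almost everywhere bounds since the \<open>u i\<close> are representatives.\<close>

definition weak_solution ::
  "'a::euclidean_space problem \<Rightarrow> (nat \<Rightarrow> real \<times> 'a \<Rightarrow> real) \<Rightarrow> (real \<times> 'a \<Rightarrow> real) \<Rightarrow> bool" where
  "weak_solution P u \<phi> \<longleftrightarrow> (let \<Omega> = dom_Omega P; T = horizon P; n = nspec P;
        I = lebesgue_on {0<..<T}; M = lebesgue_on \<Omega>; Q = cyl T \<Omega>;
        s = (\<lambda>p. sqrt (u 0 p)) in
     (\<forall>i\<in>{0..n}. u i \<in> borel_measurable Q \<and> (AE p in Q. 0 \<le> u i p \<and> u i p \<le> 1)) \<and>
     \<phi> \<in> borel_measurable Q \<and>
     s \<in> L2H1 T \<Omega> \<and>
     (\<forall>i\<in>{1..n}. (\<lambda>p. s p * u i p) \<in> L2H1 T \<Omega>) \<and>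
     \<phi> \<in> L2H1D_shift T \<Omega> (Gamma_D P) (phi_D P) \<and>
     (\<forall>i\<in>{1..n}. \<forall>\<psi>\<in>Cc_infty ({..<T} \<times> UNIV).
        - (LINT t|I. LINT x|M. u i (t, x) * deriv (\<lambda>r. \<psi> (r, x)) t)
        - (LINT x|M. u_ini P i x * \<psi> (0, x))
        + diffus P i * (LINT t|I. LINT x|M.
            (s (t, x) *\<^sub>R space_grad T \<Omega> (\<lambda>p. s p * u i p) (t, x)
             - (3 * s (t, x) * u i (t, x)) *\<^sub>R space_grad T \<Omega> s (t, x)
             + (u 0 (t, x) * u i (t, x) * beta P * charge P i) *\<^sub>R space_grad T \<Omega> \<phi> (t, x))
            \<bullet> grad (\<lambda>y. \<psi> (t, y)) x) = 0) \<and>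
     (\<forall>v\<in>H1D \<Omega> (Gamma_D P). \<forall>\<xi>\<in>Cc_infty {0<..<T}.
        (lam P)\<^sup>2 * (LINT t|I. \<xi> t * (LINT x|M. space_grad T \<Omega> \<phi> (t, x) \<bullet> wgrad \<Omega> v x))
        = (LINT t|I. \<xi> t * (LINT x|M. ((\<Sum>i=1..n. charge P i * u i (t, x)) + f_source P x) * v x))) \<and>
     (AE p in Q. (\<Sum>i=0..n. u i p) = 1))"

section \<open>Meshes and finite elements\<close>

text \<open>A mesh is a set of open simplices; its vertices serve as their own indices \<open>K\<close>.\<close>

definition is_mesh :: "'a::euclidean_space set \<Rightarrow> 'a set set \<Rightarrow> bool" where
  "is_mesh \<Omega> \<T> \<longleftrightarrow> finite \<T> \<and>
     (\<forall>S\<in>\<T>. \<exists>\<sigma>. int DIM('a) simplex \<sigma> \<and> S = interior \<sigma>) \<and>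
     pairwise disjnt \<T> \<and> (\<Union>S\<in>\<T>. closure S) = closure \<Omega> \<and> triangulation (closure ` \<T>)"

definition verts :: "'a::euclidean_space set \<Rightarrow> 'a set" where
  "verts S = {x. x extreme_point_of closure S}"

definition mesh_verts :: "'a::euclidean_space set set \<Rightarrow> 'a set" where
  "mesh_verts \<T> = (\<Union>S\<in>\<T>. verts S)"

definition simplices_at :: "'a::euclidean_space set set \<Rightarrow> 'a \<Rightarrow> 'a set set" where
  "simplices_at \<T> K = {S \<in> \<T>. K \<in> verts S}"

definition inradius :: "'a::euclidean_space set \<Rightarrow> real" where
  "inradius S = Sup {r. \<exists>x. ball x r \<subseteq> S}"

definition mesh_size :: "'a::euclidean_space set set \<Rightarrow> real" where
  "mesh_size \<T> = Max (diameter ` \<T>)"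

definition mesh_regularity :: "'a::euclidean_space set set \<Rightarrow> real" where
  "mesh_regularity \<T> = Max ((\<lambda>S. diameter S / inradius S) ` \<T>)"

text \<open>Finite element functions are normalised to vanish outside the closed meshed domain.\<close>

definition P1 :: "'a::euclidean_space set set \<Rightarrow> ('a \<Rightarrow> real) set" where
  "P1 \<T> = {v. continuous_on (\<Union>S\<in>\<T>. closure S) v \<and>
     (\<forall>S\<in>\<T>. \<exists>a c. \<forall>x\<in>S. v x = a \<bullet> x + c) \<and> (\<forall>x. x \<notin> (\<Union>S\<in>\<T>. closure S) \<longrightarrow> v x = 0)}"

definition P1D :: "'a::euclidean_space set \<Rightarrow> 'a set set \<Rightarrow> ('a \<Rightarrow> real) set" where
  "P1D \<Gamma>D \<T> = {v \<in> P1 \<T>. \<forall>K\<in>mesh_verts \<T> \<inter> \<Gamma>D. v K = 0}"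

definition nodal_basis :: "'a::euclidean_space set set \<Rightarrow> 'a \<Rightarrow> 'a \<Rightarrow> real" where
  "nodal_basis \<T> K =
     (THE e. e \<in> P1 \<T> \<and> (\<forall>L\<in>mesh_verts \<T>. e L = (if L = K then 1 else 0)))"

definition simplex_grad :: "'a::euclidean_space set \<Rightarrow> ('a \<Rightarrow> real) \<Rightarrow> 'a" where
  "simplex_grad S v = (THE g. \<forall>x\<in>S. GDERIV v x :> g)"

definition stiffness :: "'a::euclidean_space set set \<Rightarrow> 'a set \<Rightarrow> 'a \<Rightarrow> 'a \<Rightarrow> real" where
  "stiffness \<T> S K L = - measure lebesgue S *
     (simplex_grad S (nodal_basis \<T> K) \<bullet> simplex_grad S (nodal_basis \<T> L))"

definition dual_cell :: "'a::euclidean_space set \<Rightarrow> 'a set set \<Rightarrow> 'a \<Rightarrow> 'a set" where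
  "dual_cell \<Omega> \<T> K =
     {x \<in> \<Omega>. \<forall>L\<in>mesh_verts \<T> - {K}. nodal_basis \<T> L x < nodal_basis \<T> K x}"

section \<open>The scheme\<close>

record 'a discretisation =
  mesh :: "'a set set"
  nsteps :: nat
  tgrid :: "nat \<Rightarrow> real"
  lift_D :: "'a \<Rightarrow> real"

definition is_discretisation ::
  "'a::euclidean_space problem \<Rightarrow> 'a discretisation \<Rightarrow> bool" where
  "is_discretisation P \<D> \<longleftrightarrow> is_mesh (dom_Omega P) (mesh \<D>) \<and>
     tgrid \<D> 0 = 0 \<and> (\<forall>k<nsteps \<D>. tgrid \<D> k < tgrid \<D> (Suc k)) \<and>
     tgrid \<D> (nsteps \<D>) = horizon P \<and> lift_D \<D> \<in> P1 (mesh \<D>)"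

definition time_step :: "'a discretisation \<Rightarrow> nat \<Rightarrow> real" where
  "time_step \<D> k = tgrid \<D> k - tgrid \<D> (k - 1)"

definition max_time_step :: "'a discretisation \<Rightarrow> real" where
  "max_time_step \<D> = Max (time_step \<D> ` {1..nsteps \<D>})"

abbreviation vol :: "'a::euclidean_space problem \<Rightarrow> 'a discretisation \<Rightarrow> 'a \<Rightarrow> real" where
  "vol P \<D> K \<equiv> measure lebesgue (dual_cell (dom_Omega P) (mesh \<D>) K)"

text \<open>Discrete unknowns: \<open>\<mu> i k K\<close> and \<open>\<phi> k K\<close>, with species \<open>i\<close>, time index \<open>k\<close>, vertex \<open>K\<close>;
  \<open>u_disc P \<D> \<mu> i k K\<close> is the discrete density.\<close>

definition u0_disc ::
  "'a problem \<Rightarrow> (nat \<Rightarrow> nat \<Rightarrow> 'a \<Rightarrow> real) \<Rightarrow> nat \<Rightarrow> 'a \<Rightarrow> real" where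
  "u0_disc P \<mu> k K = 1 / (1 + (\<Sum>j=1..nspec P. exp (\<mu> j k K)))"

definition u_disc ::
  "'a::euclidean_space problem \<Rightarrow> 'a discretisation \<Rightarrow> (nat \<Rightarrow> nat \<Rightarrow> 'a \<Rightarrow> real)
     \<Rightarrow> nat \<Rightarrow> nat \<Rightarrow> 'a \<Rightarrow> real" where
  "u_disc P \<D> \<mu> i k K =
     (if k = 0 then
        1 / vol P \<D> K * (LINT x|lebesgue_on (dual_cell (dom_Omega P) (mesh \<D>) K). u_ini P i x)
      else if i = 0 then u0_disc P \<mu> k K
      else u0_disc P \<mu> k K * exp (\<mu> i k K))"

datatype simplex_rule = Maximum | Average

definition simplex_value ::
  "simplex_rule \<Rightarrow> 'a::euclidean_space set \<Rightarrow> ('a \<Rightarrow> real) \<Rightarrow> real" where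
  "simplex_value \<rho> S w = (case \<rho> of
      Maximum \<Rightarrow> Max (w ` verts S)
    | Average \<Rightarrow> 1 / (real DIM('a) + 1) * (\<Sum>L\<in>verts S. w L))"

definition flux ::
  "'a::euclidean_space problem \<Rightarrow> 'a discretisation \<Rightarrow> (nat \<Rightarrow> nat \<Rightarrow> 'a \<Rightarrow> real)
     \<Rightarrow> (nat \<Rightarrow> 'a \<Rightarrow> real) \<Rightarrow> nat \<Rightarrow> nat \<Rightarrow> 'a set \<Rightarrow> 'a \<Rightarrow> 'a \<Rightarrow> real" where
  "flux P \<D> \<mu> \<phi> i k S K L = diffus P i * stiffness (mesh \<D>) S K L *
     ((\<mu> i k K - \<mu> i k L) + beta P * charge P i * (\<phi> k K - \<phi> k L))"

definition scheme_solution ::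
  "simplex_rule \<Rightarrow> 'a::euclidean_space problem \<Rightarrow> 'a discretisation
     \<Rightarrow> (nat \<Rightarrow> nat \<Rightarrow> 'a \<Rightarrow> real) \<Rightarrow> (nat \<Rightarrow> 'a \<Rightarrow> real) \<Rightarrow> bool" where
  "scheme_solution \<rho> P \<D> \<mu> \<phi> \<longleftrightarrow> (let \<T> = mesh \<D>; u = u_disc P \<D> \<mu> in
     (\<forall>i\<in>{1..nspec P}. \<forall>k\<in>{1..nsteps \<D>}. \<forall>K\<in>mesh_verts \<T>.
        vol P \<D> K * ((u i k K - u i (k - 1) K) / time_step \<D> k)
        + (\<Sum>S\<in>simplices_at \<T> K. \<Sum>L\<in>verts S.
             simplex_value \<rho> S (u 0 k) * simplex_value \<rho> S (u i k) * flux P \<D> \<mu> \<phi> i k S K L) = 0) \<and>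
     (\<forall>k\<in>{1..nsteps \<D>}. \<forall>K\<in>mesh_verts \<T>.
        if K \<in> Gamma_D P then \<phi> k K = lift_D \<D> K
        else (lam P)\<^sup>2 * (\<Sum>S\<in>simplices_at \<T> K. \<Sum>L\<in>verts S. stiffness \<T> S K L * (\<phi> k K - \<phi> k L))
             = vol P \<D> K * (\<Sum>i=1..nspec P. charge P i * u i k K)
               + (LINT x|lebesgue_on (dual_cell (dom_Omega P) \<T> K). f_source P x)))"

section \<open>Reconstructions\<close>

text \<open>\<open>w k K\<close> is the nodal value at time index \<open>k\<close> and vertex \<open>K\<close>.\<close>

definition recon_T ::
  "'a::euclidean_space discretisation \<Rightarrow> (nat \<Rightarrow> 'a \<Rightarrow> real) \<Rightarrow> real \<times> 'a \<Rightarrow> real" where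
  "recon_T \<D> w = (\<lambda>(t, x). \<Sum>k=1..nsteps \<D>. indicat_real {tgrid \<D> (k - 1)<..tgrid \<D> k} t *
     (\<Sum>K\<in>mesh_verts (mesh \<D>). w k K * nodal_basis (mesh \<D>) K x))"

definition recon_M ::
  "'a::euclidean_space problem \<Rightarrow> 'a discretisation \<Rightarrow> (nat \<Rightarrow> 'a \<Rightarrow> real)
     \<Rightarrow> real \<times> 'a \<Rightarrow> real" where
  "recon_M P \<D> w = (\<lambda>(t, x). \<Sum>k=1..nsteps \<D>. indicat_real {tgrid \<D> (k - 1)<..tgrid \<D> k} t *
     (\<Sum>K\<in>mesh_verts (mesh \<D>).
        w k K * indicat_real (dual_cell (dom_Omega P) (mesh \<D>) K) x))"

end

theory Submission
  imports Defs
begin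

text \<open>Pairing the discrete transport equation with the nodal values of a test function leaves the cell
  values of \<open>u\<^sub>i\<close> against a discrete time derivative, and the flux \<open>u\<^sub>0 u\<^sub>i \<nabla>(\<mu>\<^sub>i + \<beta> z\<^sub>i \<phi>)\<close> on each
  simplex against the gradient of the interpolant, which converges uniformly.  The point is to
  replace \<open>u\<^sub>0 u\<^sub>i \<nabla>\<mu>\<^sub>i\<close>, whose factors need not converge separately, by
  \<open>\<surd>u\<^sub>0 \<nabla>(\<surd>u\<^sub>0 u\<^sub>i) - 3 \<surd>u\<^sub>0 u\<^sub>i \<nabla>\<surd>u\<^sub>0\<close>, where strong times weak convergence applies.  The two expressions
  agree for smooth functions because \<open>\<mu>\<^sub>i = log (u\<^sub>i / u\<^sub>0)\<close>; discretely they differ on a simplex of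
  diameter at most \<open>h\<close> by at most \<open>C \<surd>h\<close> times
  \<open>1 + u\<^sub>0 u\<^sub>i |\<nabla>\<mu>\<^sub>i|\<^sup>2 + |\<nabla>\<surd>u\<^sub>0|\<^sup>2 + |\<nabla>(\<surd>u\<^sub>0 u\<^sub>i)|\<^sup>2\<close>.  The integral of this is bounded: weakly convergent
  gradients are bounded in \<open>L\<^sup>2\<close>, and testing the scheme with \<open>\<mu>\<^sub>i\<close> gives an entropy inequality that
  bounds \<open>u\<^sub>0 u\<^sub>i |\<nabla>\<mu>\<^sub>i|\<^sup>2\<close> in terms of \<open>|\<nabla>\<phi>|\<^sup>2\<close>.  The Poisson equation is linear and is tested with
  the projections of the test function.\<close>

section \<open>Square-integrable functions\<close>

text \<open>Where u_0 degenerates, the oscillation of u_i over a simplex is not controlled: the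
  available bounds concern sqrt u_0 and sqrt u_0 u_i. The two flux expressions are therefore
  compared edge by edge with a threshold \<eta> on sqrt u_0. Below it both carry a small factor;
  above it either the oscillation over the simplex is comparable to \<eta>, or sqrt u_0 stays away
  from 0 at both ends and logarithmic increments can be exchanged for ordinary ones. The errors are
  of order \<eta> and h / \<eta>, hence \<eta> = sqrt h. The remainder is thus small in L^1 only,
  which suffices because the gradients of interpolated smooth functions are uniformly bounded.
  Species 0 has no equation of its own; its entropy is recovered from the constraint that the
  densities sum to 1. Some analytic groundwork is unavoidable: Lebesgue measure on the cylinder is a
  completion, so Fubini needs Borel representatives; gradients are chosen representatives, known
  almost everywhere; and boundedness of weakly convergent gradients must be extracted from their
  definition through functionals.\<close>

lemma L2_inner_integrable:
  fixes f g :: "'a \<Rightarrow> 'b::euclidean_space"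
  assumes "f \<in> L2 M" "g \<in> L2 M"
  shows "integrable M (\<lambda>x. f x \<bullet> g x)"
proof (rule Bochner_Integration.integrable_bound)
  show "integrable M (\<lambda>x. (norm (f x))\<^sup>2 + (norm (g x))\<^sup>2)"
    using assms by (auto simp: L2_def)
  show "(\<lambda>x. f x \<bullet> g x) \<in> borel_measurable M"
    using assms by (auto simp: L2_def)
  have "\<bar>a \<bullet> b\<bar> \<le> (norm a)\<^sup>2 + (norm b)\<^sup>2" for a b :: 'b
  proof -
    have "\<bar>a \<bullet> b\<bar> \<le> norm a * norm b" by (rule Cauchy_Schwarz_ineq2)
    moreover have "0 \<le> (norm a - norm b)\<^sup>2" by simp
    ultimately show ?thesis
      using mult_nonneg_nonneg[OF norm_ge_zero norm_ge_zero, of a b] unfolding power2_diff by linarith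
  qed
  then show "AE x in M. norm (f x \<bullet> g x) \<le> norm ((norm (f x))\<^sup>2 + (norm (g x))\<^sup>2)"
    by (auto intro!: AE_I2)
qed

lemma L2_norm_nonneg [simp]: "0 \<le> L2_norm M f"
  by (simp add: L2_norm_def)

lemma L2_norm_power2: "(L2_norm M f)\<^sup>2 = (LINT x|M. (norm (f x))\<^sup>2)"
  by (simp add: L2_norm_def)

lemma L2_norm_scaleR: "L2_norm M (\<lambda>x. c *\<^sub>R f x) = \<bar>c\<bar> * L2_norm M f"
  by (simp add: L2_norm_def power_mult_distrib real_sqrt_mult)

text \<open>The squared norm of f + t g is a nonnegative quadratic in t, so its discriminant is not
  positive; a vanishing leading coefficient is treated apart.\<close>

lemma L2_Cauchy_Schwarz:
  fixes f g :: "'a \<Rightarrow> 'b::euclidean_space"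
  assumes f: "f \<in> L2 M" and g: "g \<in> L2 M"
  shows "\<bar>LINT x|M. f x \<bullet> g x\<bar> \<le> L2_norm M f * L2_norm M g"
proof -
  let ?a = "LINT x|M. (norm (f x))\<^sup>2" and ?b = "LINT x|M. f x \<bullet> g x"
  let ?c = "LINT x|M. (norm (g x))\<^sup>2"
  have i: "integrable M (\<lambda>x. f x \<bullet> g x)" "integrable M (\<lambda>x. (norm (f x))\<^sup>2)"
    "integrable M (\<lambda>x. (norm (g x))\<^sup>2)"
    using L2_inner_integrable[OF f g] f g by (auto simp: L2_def)
  have q: "0 \<le> ?a + 2 * t * ?b + t\<^sup>2 * ?c" for t
  proof -
    have "0 \<le> (LINT x|M. (norm (f x + t *\<^sub>R g x))\<^sup>2)" by simp
    also have "\<dots> = (LINT x|M. (norm (f x))\<^sup>2 + 2 * t * (f x \<bullet> g x) + t\<^sup>2 * (norm (g x))\<^sup>2)"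
      by (intro Bochner_Integration.integral_cong refl, unfold power2_norm_eq_inner)
        (simp add: algebra_simps inner_commute power2_eq_square)
    also have "\<dots> = ?a + 2 * t * ?b + t\<^sup>2 * ?c"
      using i by simp
    finally show ?thesis .
  qed
  have "?b\<^sup>2 \<le> ?a * ?c"
  proof (cases "?c = 0")
    case True
    have "?b = 0"
    proof (rule ccontr)
      assume b: "?b \<noteq> 0"
      \<comment> \<open>The quadratic is affine here, and this t would give it the value -1.\<close>
      have "0 \<le> ?a + 2 * (- (?a + 1) / (2 * ?b)) * ?b"
        using q[of "- (?a + 1) / (2 * ?b)"] True by simp
      then show False using b by (simp add: field_simps)
    qed
    then show ?thesis by simp
  next
    case False
    then have c: "0 < ?c" by (simp add: order.not_eq_order_implies_strict)
    \<comment> \<open>The minimiser t = - ?b / ?c.\<close>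
    have "0 \<le> ?a + 2 * (- ?b / ?c) * ?b + (- ?b / ?c)\<^sup>2 * ?c" by (rule q)
    also have "\<dots> = ?a - ?b\<^sup>2 / ?c"
      using c by (simp add: field_simps power2_eq_square)
    finally show ?thesis using c by (simp add: field_simps)
  qed
  then have "\<bar>?b\<bar> \<le> sqrt (?a * ?c)"
    using real_le_rsqrt by (metis power2_abs)
  then show ?thesis by (simp add: L2_norm_def real_sqrt_mult)
qed

lemma L2_add:
  fixes f g :: "'a \<Rightarrow> 'b::euclidean_space"
  assumes f: "f \<in> L2 M" and g: "g \<in> L2 M"
  shows "(\<lambda>x. f x + g x) \<in> L2 M"
proof -
  have "integrable M (\<lambda>x. (norm (f x))\<^sup>2 + 2 * (f x \<bullet> g x) + (norm (g x))\<^sup>2)"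
    using L2_inner_integrable[OF f g] f g by (auto simp: L2_def)
  then show ?thesis
    using f g by (auto simp: L2_def power2_norm_eq_inner algebra_simps inner_commute)
qed

lemma L2_scaleR:
  fixes f :: "'a \<Rightarrow> 'b::euclidean_space"
  assumes f: "f \<in> L2 M"
  shows "(\<lambda>x. c *\<^sub>R f x) \<in> L2 M"
  using assms by (auto simp: L2_def power_mult_distrib)

lemma L2_mult_const: "f \<in> L2 M \<Longrightarrow> (\<lambda>x. c * f x) \<in> L2 M" for f :: "'a \<Rightarrow> real"
  using L2_scaleR[of f M c] by simp

lemma L2_diff:
  fixes f g :: "'a \<Rightarrow> 'b::euclidean_space"
  assumes f: "f \<in> L2 M" and g: "g \<in> L2 M"
  shows "(\<lambda>x. f x - g x) \<in> L2 M"
  using L2_add[OF f L2_scaleR[OF g, of "-1"]] by simp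

lemma L2_norm_fun: "f \<in> L2 M \<Longrightarrow> (\<lambda>x. norm (f x)) \<in> L2 M"
  by (auto simp: L2_def)

lemma L2_bounded:
  fixes f :: "'a \<Rightarrow> 'b::euclidean_space"
  assumes "g \<in> L2 M" "f \<in> borel_measurable M" "AE x in M. norm (f x) \<le> C * norm (g x)"
  shows "f \<in> L2 M"
proof -
  have "integrable M (\<lambda>x. (norm (f x))\<^sup>2)"
  proof (rule Bochner_Integration.integrable_bound)
    show "integrable M (\<lambda>x. C\<^sup>2 * (norm (g x))\<^sup>2)" using assms by (auto simp: L2_def)
    show "(\<lambda>x. (norm (f x))\<^sup>2) \<in> borel_measurable M" using assms by auto
    show "AE x in M. norm ((norm (f x))\<^sup>2) \<le> norm (C\<^sup>2 * (norm (g x))\<^sup>2)"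
      using assms(3)
    proof eventually_elim
      case (elim x)
      have "(norm (f x))\<^sup>2 \<le> (C * norm (g x))\<^sup>2"
        by (rule power_mono) (use elim in auto)
      then show ?case by (simp add: power_mult_distrib)
    qed
  qed
  then show ?thesis using assms by (auto simp: L2_def)
qed

lemma L2_const: "finite_measure M \<Longrightarrow> (\<lambda>x. c) \<in> L2 M"
  by (auto simp: L2_def finite_measure.integrable_const)

text \<open>On a finite measure space the norm of f is integrable as its product with the constant
  1.\<close>

lemma L2_integrable:
  fixes f :: "'a \<Rightarrow> 'b::euclidean_space"
  assumes "finite_measure M" "f \<in> L2 M"
  shows "integrable M f"
proof -
  have "integrable M (\<lambda>x. norm (f x) \<bullet> (1::real))"
    by (rule L2_inner_integrable) (use assms L2_const L2_norm_fun in blast)+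
  then show ?thesis
    using assms by (auto simp: L2_def integrable_norm_iff)
qed

text \<open>The parallelogram identity with the square of the difference dropped.\<close>

lemma L2_norm_diff_sq:
  fixes f g :: "'a \<Rightarrow> 'b::euclidean_space"
  assumes f: "f \<in> L2 M" and g: "g \<in> L2 M"
  shows "(LINT x|M. (norm (f x + g x))\<^sup>2) \<le> 2 * (LINT x|M. (norm (f x))\<^sup>2) + 2 * (LINT x|M. (norm (g x))\<^sup>2)"
proof -
  have *: "(norm (a + b))\<^sup>2 \<le> 2 * (norm a)\<^sup>2 + 2 * (norm b)\<^sup>2" for a b :: 'b
  proof -
    have "(norm (a + b))\<^sup>2 + (norm (a - b))\<^sup>2 = 2 * (norm a)\<^sup>2 + 2 * (norm b)\<^sup>2"
      by (simp add: power2_norm_eq_inner algebra_simps inner_commute)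
    then show ?thesis by (smt (verit) zero_le_power2)
  qed
  have "(LINT x|M. (norm (f x + g x))\<^sup>2) \<le> (LINT x|M. 2 * (norm (f x))\<^sup>2 + 2 * (norm (g x))\<^sup>2)"
    by (rule integral_mono) (use L2_add[OF f g] f g * in \<open>auto simp: L2_def\<close>)
  also have "\<dots> = 2 * (LINT x|M. (norm (f x))\<^sup>2) + 2 * (LINT x|M. (norm (g x))\<^sup>2)"
    using f g by (auto simp: L2_def)
  finally show ?thesis .
qed

section \<open>Strong and weak convergence in L^2\<close>

lemma L2_tendsto_inner_const:
  fixes A :: "nat \<Rightarrow> 'a \<Rightarrow> 'b::euclidean_space"
  assumes A: "\<And>m. A m \<in> L2 M" "B \<in> L2 M" and conv: "(\<lambda>m. L2_norm M (\<lambda>x. A m x - B x)) \<longlonglongrightarrow> 0"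
    and g: "g \<in> L2 M"
  shows "(\<lambda>m. LINT x|M. A m x \<bullet> g x) \<longlonglongrightarrow> (LINT x|M. B x \<bullet> g x)"
proof -
  have "(\<lambda>m. (LINT x|M. A m x \<bullet> g x) - (LINT x|M. B x \<bullet> g x)) \<longlonglongrightarrow> 0"
  proof (rule Lim_null_comparison)
    show "\<forall>\<^sub>F m in sequentially. norm ((LINT x|M. A m x \<bullet> g x) - (LINT x|M. B x \<bullet> g x))
       \<le> L2_norm M (\<lambda>x. A m x - B x) * L2_norm M g"
    proof (rule always_eventually, intro allI)
      fix m
      have "(LINT x|M. A m x \<bullet> g x) - (LINT x|M. B x \<bullet> g x) = (LINT x|M. (A m x - B x) \<bullet> g x)"
        using L2_inner_integrable[OF A(1) g] L2_inner_integrable[OF A(2) g]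
        by (simp add: inner_diff_left)
      then show "norm ((LINT x|M. A m x \<bullet> g x) - (LINT x|M. B x \<bullet> g x))
       \<le> L2_norm M (\<lambda>x. A m x - B x) * L2_norm M g"
        using L2_Cauchy_Schwarz[OF L2_diff[OF A] g] by simp
    qed
    show "(\<lambda>m. L2_norm M (\<lambda>x. A m x - B x) * L2_norm M g) \<longlonglongrightarrow> 0"
      using tendsto_mult_right[OF conv, of "L2_norm M g"] by (simp add: tendsto_mult_left_zero conv)
  qed
  then show ?thesis by (rule LIM_zero_cancel)
qed

text \<open>Write A_m . G_m = (A_m - B) . G_m + B . G_m; Cauchy-Schwarz and the bound on G_m dispose
  of the first term. Weak convergence of G_m enters only through its pairing with the fixed function
  B, and \<open>l\<close> is whatever that pairing tends to.\<close>

lemma L2_strong_weak: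
  fixes A :: "nat \<Rightarrow> 'a \<Rightarrow> 'b::euclidean_space"
  assumes A: "\<And>m. A m \<in> L2 M" "B \<in> L2 M" and conv: "(\<lambda>m. L2_norm M (\<lambda>x. A m x - B x)) \<longlonglongrightarrow> 0"
    and G: "\<And>m. G m \<in> L2 M" "\<And>m. L2_norm M (G m) \<le> C"
    and weak: "(\<lambda>m. LINT x|M. B x \<bullet> G m x) \<longlonglongrightarrow> l"
  shows "(\<lambda>m. LINT x|M. A m x \<bullet> G m x) \<longlonglongrightarrow> l"
proof -
  have "(\<lambda>m. LINT x|M. (A m x - B x) \<bullet> G m x) \<longlonglongrightarrow> 0"
  proof (rule Lim_null_comparison)
    have "norm (LINT x|M. (A m x - B x) \<bullet> G m x) \<le> L2_norm M (\<lambda>x. A m x - B x) * C" for m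
      unfolding real_norm_def
      by (rule order_trans[OF L2_Cauchy_Schwarz[OF L2_diff[OF A(1) A(2)] G(1)]])
        (rule mult_left_mono[OF G(2) L2_norm_nonneg])
    then show "\<forall>\<^sub>F m in sequentially. norm (LINT x|M. (A m x - B x) \<bullet> G m x)
       \<le> L2_norm M (\<lambda>x. A m x - B x) * C" by simp
    show "(\<lambda>m. L2_norm M (\<lambda>x. A m x - B x) * C) \<longlonglongrightarrow> 0"
      using conv by (simp add: tendsto_mult_left_zero)
  qed
  from tendsto_add[OF this weak]
  have "(\<lambda>m. (LINT x|M. (A m x - B x) \<bullet> G m x) + (LINT x|M. B x \<bullet> G m x)) \<longlonglongrightarrow> l" by simp
  moreover have "(LINT x|M. (A m x - B x) \<bullet> G m x) + (LINT x|M. B x \<bullet> G m x) = (LINT x|M. A m x \<bullet> G m x)" for m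
    using L2_inner_integrable[OF A(1) G(1)] L2_inner_integrable[OF A(2) G(1)]
    by (simp add: inner_diff_left)
  ultimately show ?thesis by simp
qed

lemma L2_conv_zeroI:
  fixes A :: "nat \<Rightarrow> 'a \<Rightarrow> 'b::euclidean_space"
  assumes "\<And>m. (LINT x|M. (norm (A m x))\<^sup>2) \<le> c m" "c \<longlonglongrightarrow> 0"
  shows "(\<lambda>m. L2_norm M (A m)) \<longlonglongrightarrow> 0"
proof (rule tendsto_sandwich[of "\<lambda>_. 0" _ _ "\<lambda>m. sqrt (c m)"])
  show "(\<lambda>m. sqrt (c m)) \<longlonglongrightarrow> 0"
    using tendsto_real_sqrt[OF assms(2)] by simp
  show "\<forall>\<^sub>F m in sequentially. L2_norm M (A m) \<le> sqrt (c m)"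
    using assms(1) by (simp add: L2_norm_def)
qed auto

lemma L2_conv_sqD:
  "(\<lambda>m. L2_norm M (A m)) \<longlonglongrightarrow> 0 \<Longrightarrow> (\<lambda>m. LINT x|M. (norm (A m x))\<^sup>2) \<longlonglongrightarrow> 0"
  using tendsto_power[of "\<lambda>m. L2_norm M (A m)" 0 sequentially 2] by (simp add: L2_norm_power2)

lemma L2_conv_zero_add:
  fixes A B :: "nat \<Rightarrow> 'a \<Rightarrow> 'b::euclidean_space"
  assumes "\<And>m. A m \<in> L2 M" "\<And>m. B m \<in> L2 M"
    "(\<lambda>m. L2_norm M (A m)) \<longlonglongrightarrow> 0" "(\<lambda>m. L2_norm M (B m)) \<longlonglongrightarrow> 0"
  shows "(\<lambda>m. L2_norm M (\<lambda>x. A m x + B m x)) \<longlonglongrightarrow> 0"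
proof (rule L2_conv_zeroI)
  show "(LINT x|M. (norm (A m x + B m x))\<^sup>2)
     \<le> 2 * (LINT x|M. (norm (A m x))\<^sup>2) + 2 * (LINT x|M. (norm (B m x))\<^sup>2)" for m
    by (rule L2_norm_diff_sq) (use assms in auto)
  show "(\<lambda>m. 2 * (LINT x|M. (norm (A m x))\<^sup>2) + 2 * (LINT x|M. (norm (B m x))\<^sup>2)) \<longlonglongrightarrow> 0"
    using tendsto_add[OF tendsto_mult_left[OF L2_conv_sqD[OF assms(3)], of 2]
      tendsto_mult_left[OF L2_conv_sqD[OF assms(4)], of 2]] by simp
qed

text \<open>The two sequences may take values in different Euclidean spaces, so that vector errors
  can be dominated by scalar ones.\<close>

lemma L2_conv_zero_dominated:
  fixes A :: "nat \<Rightarrow> 'a \<Rightarrow> 'b::euclidean_space" and B :: "nat \<Rightarrow> 'a \<Rightarrow> 'c::euclidean_space"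
  assumes B: "\<And>m. B m \<in> L2 M" and conv: "(\<lambda>m. L2_norm M (B m)) \<longlonglongrightarrow> 0"
    and A: "\<And>m. A m \<in> borel_measurable M" and le: "\<And>m. AE x in M. norm (A m x) \<le> C * norm (B m x)"
  shows "(\<lambda>m. L2_norm M (A m)) \<longlonglongrightarrow> 0"
proof (rule L2_conv_zeroI)
  show "(LINT x|M. (norm (A m x))\<^sup>2) \<le> C\<^sup>2 * (LINT x|M. (norm (B m x))\<^sup>2)" for m
  proof -
    have "(LINT x|M. (norm (A m x))\<^sup>2) \<le> (LINT x|M. C\<^sup>2 * (norm (B m x))\<^sup>2)"
    proof (rule integral_mono_AE)
      show "integrable M (\<lambda>x. (norm (A m x))\<^sup>2)"
        using L2_bounded[OF B A le] by (auto simp: L2_def)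
      show "integrable M (\<lambda>x. C\<^sup>2 * (norm (B m x))\<^sup>2)" using B by (auto simp: L2_def)
      show "AE x in M. (norm (A m x))\<^sup>2 \<le> C\<^sup>2 * (norm (B m x))\<^sup>2"
        using le[of m] by (rule AE_mp)
          (auto intro!: AE_I2 simp flip: power_mult_distrib intro: power_mono)
    qed
    then show ?thesis by simp
  qed
  show "(\<lambda>m. C\<^sup>2 * (LINT x|M. (norm (B m x))\<^sup>2)) \<longlonglongrightarrow> 0"
    using tendsto_mult_left[OF L2_conv_sqD[OF conv], of "C\<^sup>2"] by simp
qed

section \<open>Lebesgue measure on the space-time cylinder\<close>

text \<open>The scalar statement is applied to each coordinate, and the finitely many exceptional
  null sets are united.\<close>

lemma borel_rep_completion:
  fixes f :: "'a \<Rightarrow> 'b::euclidean_space"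
  assumes "f \<in> borel_measurable (completion M)"
  shows "\<exists>f'\<in>borel_measurable M. AE x in M. f x = f' x"
proof -
  have "\<exists>h. h \<in> borel_measurable M \<and> (AE x in M. f x \<bullet> b = h x)" for b
    using completion_ex_borel_measurable_real[of "\<lambda>x. f x \<bullet> b" M] assms by auto
  then obtain h where h: "\<And>b. h b \<in> borel_measurable M" "\<And>b. AE x in M. f x \<bullet> b = h b x"
    by metis
  show ?thesis
  proof (intro bexI[of _ "\<lambda>x. \<Sum>b\<in>Basis. h b x *\<^sub>R b"])
    have "AE x in M. \<forall>b\<in>Basis. f x \<bullet> b = h b x"
      using h(2) by (simp add: AE_ball_countable countable_finite)
    then show "AE x in M. f x = (\<Sum>b\<in>Basis. h b x *\<^sub>R b)"
    proof eventually_elim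
      case (elim x)
      have "f x = (\<Sum>b\<in>Basis. (f x \<bullet> b) *\<^sub>R b)" by (simp add: euclidean_representation)
      also have "\<dots> = (\<Sum>b\<in>Basis. h b x *\<^sub>R b)" by (rule sum.cong) (use elim in auto)
      finally show ?case .
    qed
    show "(\<lambda>x. \<Sum>b\<in>Basis. h b x *\<^sub>R b) \<in> borel_measurable M"
      using h(1) by measurable
  qed
qed

lemma AE_lebesgue_on_iff:
  assumes "A \<in> sets borel"
  shows "(AE x in lebesgue_on A. P x) \<longleftrightarrow> (AE x in lborel. x \<in> A \<longrightarrow> P x)"
  using assms by (subst AE_restrict_space_iff) (auto simp: AE_completion_iff)

text \<open>Lebesgue measure on a product space is the completion of the Borel product measure, so
  Fubini applies directly to Borel functions only. Measurable functions on a Borel set are therefore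
  replaced by Borel ones, extended by 0 so that integrals over \<open>A\<close> become integrals
  over the whole space.\<close>

lemma borel_rep_lebesgue_on:
  fixes f :: "'a::euclidean_space \<Rightarrow> 'b::euclidean_space"
  assumes A: "A \<in> sets borel" and f: "f \<in> borel_measurable (lebesgue_on A)"
  obtains f' where "f' \<in> borel_measurable borel" "\<And>x. x \<notin> A \<Longrightarrow> f' x = 0"
    "AE x in lborel. x \<in> A \<longrightarrow> f x = f' x"
proof -
  have "(\<lambda>x. if x \<in> A then f x else 0) \<in> borel_measurable lebesgue"
    using borel_measurable_if_I[OF f] A by auto
  from borel_rep_completion[OF this] obtain h where
    h: "h \<in> borel_measurable borel" "AE x in lborel. (if x \<in> A then f x else 0) = h x" by auto
  show ?thesis
  proof (rule that[of "\<lambda>x. indicator A x *\<^sub>R h x"])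
    show "AE x in lborel. x \<in> A \<longrightarrow> f x = indicator A x *\<^sub>R h x"
      using h(2) by eventually_elim auto
    show "(\<lambda>x. indicator A x *\<^sub>R h x) \<in> borel_measurable borel"
      using A h(1) by measurable
  qed auto
qed

lemma measurable_lebesgue_onI:
  fixes f :: "'a::euclidean_space \<Rightarrow> 'b::euclidean_space"
  assumes A: "A \<in> sets borel" and f': "f' \<in> borel_measurable borel"
    and ae: "AE x in lborel. x \<in> A \<longrightarrow> f x = f' x"
  shows "f \<in> borel_measurable (lebesgue_on A)"
proof (rule borel_measurable_if_D, rule borel_measurable_AE)
  have "(\<lambda>x. if x \<in> A then f' x else 0) \<in> borel_measurable borel"
    using A f' by measurable
  then show "(\<lambda>x. if x \<in> A then f' x else 0) \<in> borel_measurable lebesgue"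
    by (intro measurable_completion) simp
  show "AE x in lebesgue. (if x \<in> A then f' x else 0) = (if x \<in> A then f x else 0)"
    unfolding AE_completion_iff using ae by eventually_elim auto
qed

lemma
  fixes f :: "'a::euclidean_space \<Rightarrow> 'b::euclidean_space"
  assumes A: "A \<in> sets borel" and f': "f' \<in> borel_measurable borel" "\<And>x. x \<notin> A \<Longrightarrow> f' x = 0"
    and ae: "AE x in lborel. x \<in> A \<longrightarrow> f x = f' x"
  shows integrable_lebesgue_on_rep: "integrable (lebesgue_on A) f \<longleftrightarrow> integrable lborel f'"
    and integral_lebesgue_on_rep: "integral\<^sup>L (lebesgue_on A) f = integral\<^sup>L lborel f'"
proof -
  have f: "f \<in> borel_measurable (lebesgue_on A)" by (rule measurable_lebesgue_onI[OF A f'(1) ae])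
  have f'': "f' \<in> borel_measurable (lebesgue_on A)"
    by (rule measurable_lebesgue_onI[OF A f'(1)]) simp
  have ae': "AE x in lebesgue_on A. f x = f' x"
    using ae by (simp add: AE_lebesgue_on_iff[OF A])
  have eq: "(\<lambda>x. indicator A x *\<^sub>R f' x) = f'" using f'(2) by (auto simp: indicator_def)
  have "integrable (lebesgue_on A) f \<longleftrightarrow> integrable (lebesgue_on A) f'"
    by (rule integrable_cong_AE[OF f f'' ae'])
  also have "\<dots> \<longleftrightarrow> integrable lebesgue f'"
    using A by (subst integrable_restrict_space) (auto simp: eq)
  also have "\<dots> \<longleftrightarrow> integrable lborel f'"
    by (rule integrable_completion) (use f' in auto)
  finally show "integrable (lebesgue_on A) f \<longleftrightarrow> integrable lborel f'" .
  have "integral\<^sup>L (lebesgue_on A) f = integral\<^sup>L (lebesgue_on A) f'"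
    by (rule integral_cong_AE[OF f f'' ae'])
  also have "\<dots> = integral\<^sup>L lebesgue f'"
    using A by (subst integral_restrict_space) (auto simp: eq)
  also have "\<dots> = integral\<^sup>L lborel f'"
    by (rule integral_completion) (use f' in auto)
  finally show "integral\<^sup>L (lebesgue_on A) f = integral\<^sup>L lborel f'" .
qed

lemma borel_cyl: "\<Omega> \<in> sets borel \<Longrightarrow> {0<..<T::real} \<times> \<Omega> \<in> sets borel"
  by (rule borel_Times) auto

lemma borel_rep_cyl:
  fixes f :: "real \<times> 'a::euclidean_space \<Rightarrow> 'b::euclidean_space"
  assumes \<Omega>: "\<Omega> \<in> sets borel" and f: "f \<in> borel_measurable (cyl T \<Omega>)"
  obtains f' where "f' \<in> borel_measurable borel" "\<And>p. p \<notin> {0<..<T} \<times> \<Omega> \<Longrightarrow> f' p = 0"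
    "AE p in lborel. p \<in> {0<..<T} \<times> \<Omega> \<longrightarrow> f p = f' p"
  by (rule borel_rep_lebesgue_on[OF borel_cyl[OF \<Omega>] f[unfolded cyl_def]]) (rule that)

lemma space_cyl [simp]: "space (cyl T \<Omega>) = {0<..<T} \<times> \<Omega>"
  by (simp add: cyl_def)

lemma AE_lborel_pair:
  assumes "AE p in (lborel :: (real \<times> 'a::euclidean_space) measure). P p"
  shows "AE t in lborel. AE x in lborel. P (t, x)"
  by (rule lborel_pair.AE_pair) (simp only: lborel_prod assms)

text \<open>The exceptional set need not be Borel. It is enlarged to a Borel null set
  \<open>N\<close> before its product with the time axis is seen to be null.\<close>

lemma AE_cyl_snd:
  fixes \<Omega> :: "'a::euclidean_space set"
  assumes \<Omega>: "\<Omega> \<in> sets borel"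
    and ae: "AE x in lebesgue_on \<Omega>. P x"
  shows "AE p in cyl T \<Omega>. P (snd p)"
proof -
  have "AE x in lborel. x \<in> \<Omega> \<longrightarrow> P x" using ae by (simp add: AE_lebesgue_on_iff[OF \<Omega>])
  then obtain N where N: "N \<in> null_sets lborel" "{x. \<not> (x \<in> \<Omega> \<longrightarrow> P x)} \<subseteq> N"
    by (auto simp: eventually_ae_filter)
  have "{p :: real \<times> 'a. snd p \<in> - N} \<in> sets borel"
    using measurable_sets[OF borel_measurable_continuous_onI[OF continuous_on_snd[OF continuous_on_id]], of "- N"] N(1)
    by (auto simp: vimage_def null_sets_def)
  then have "AE p in (lborel \<Otimes>\<^sub>M lborel) :: (real \<times> 'a) measure. snd p \<in> - N"
    by (intro lborel_pair.AE_pair_measure)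
      (use AE_not_in[OF N(1)] in \<open>simp_all only: lborel_prod space_lborel space_borel sets_lborel UNIV_I simp_thms snd_conv Compl_iff\<close>, simp)
  then show "AE p in cyl T \<Omega>. P (snd p)"
    unfolding cyl_def AE_lebesgue_on_iff[OF borel_cyl[OF \<Omega>]] lborel_prod
    by eventually_elim (use N(2) in auto)
qed

text \<open>Null slices do not make a set null unless it is measurable. For Borel representatives
  the set of agreement is Borel, and equality on almost all slices then gives equality almost
  everywhere.\<close>

lemma AE_cylI_eq:
  fixes f g :: "real \<times> 'a::euclidean_space \<Rightarrow> 'b::euclidean_space"
  assumes \<Omega>: "\<Omega> \<in> sets borel"
    and f: "f \<in> borel_measurable (cyl T \<Omega>)" and g: "g \<in> borel_measurable (cyl T \<Omega>)"
    and ae: "AE t in lebesgue_on {0<..<T}. AE x in lebesgue_on \<Omega>. f (t, x) = g (t, x)"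
  shows "AE p in cyl T \<Omega>. f p = g p"
proof -
  obtain f' where f': "f' \<in> borel_measurable borel" "\<And>p. p \<notin> {0<..<T} \<times> \<Omega> \<Longrightarrow> f' p = 0"
    "AE p in lborel. p \<in> {0<..<T} \<times> \<Omega> \<longrightarrow> f p = f' p"
    by (rule borel_rep_cyl[OF \<Omega> f]) (rule that)
  obtain g' where g': "g' \<in> borel_measurable borel" "\<And>p. p \<notin> {0<..<T} \<times> \<Omega> \<Longrightarrow> g' p = 0"
    "AE p in lborel. p \<in> {0<..<T} \<times> \<Omega> \<longrightarrow> g p = g' p"
    by (rule borel_rep_cyl[OF \<Omega> g]) (rule that)
  have ae': "AE t in lborel. t \<in> {0<..<T} \<longrightarrow> (AE x in lborel. x \<in> \<Omega> \<longrightarrow> f (t, x) = g (t, x))"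
    using ae by (simp add: AE_lebesgue_on_iff[OF \<Omega>] AE_lebesgue_on_iff)
  have "{p \<in> space (lborel \<Otimes>\<^sub>M lborel). f' p = g' p} \<in> sets (lborel \<Otimes>\<^sub>M lborel)"
    unfolding lborel_prod using f'(1) g'(1) by simp
  moreover have "AE t in lborel. AE x in lborel. f' (t, x) = g' (t, x)"
    using ae' AE_lborel_pair[OF f'(3)] AE_lborel_pair[OF g'(3)]
  proof eventually_elim
    case (elim t)
    show ?case
    proof (cases "t \<in> {0<..<T}")
      case True
      with elim(1) have "AE x in lborel. x \<in> \<Omega> \<longrightarrow> f (t, x) = g (t, x)" by simp
      then show ?thesis using elim(2,3)
      proof eventually_elim
        case (elim x)
        then show ?case using True f'(2)[of "(t,x)"] g'(2)[of "(t,x)"] by (cases "x \<in> \<Omega>") auto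
      qed
    next
      case False
      then show ?thesis using f'(2) g'(2) by auto
    qed
  qed
  ultimately have "AE p in lborel \<Otimes>\<^sub>M lborel. f' p = g' p"
    by (rule lborel_pair.AE_pair_measure)
  then have "AE p in lborel. f' p = g' p" by (simp only: lborel_prod)
  with f'(3) g'(3) show ?thesis
    unfolding cyl_def AE_lebesgue_on_iff[OF borel_cyl[OF \<Omega>]]
    by eventually_elim auto
qed

lemma measurable_cyl_snd:
  fixes f :: "'a::euclidean_space \<Rightarrow> 'b::euclidean_space"
  assumes \<Omega>: "\<Omega> \<in> sets borel" and f: "f \<in> borel_measurable (lebesgue_on \<Omega>)"
  shows "(\<lambda>p. f (snd p)) \<in> borel_measurable (cyl T \<Omega>)"
proof -
  obtain f' where f': "f' \<in> borel_measurable borel" "AE x in lborel. x \<in> \<Omega> \<longrightarrow> f x = f' x"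
    by (rule borel_rep_lebesgue_on[OF \<Omega> f]) (rule that)
  have "AE p in cyl T \<Omega>. f (snd p) = f' (snd p)"
    by (rule AE_cyl_snd[OF \<Omega>]) (use f'(2) in \<open>simp add: AE_lebesgue_on_iff[OF \<Omega>]\<close>)
  moreover have "(\<lambda>p :: real \<times> 'a. f' (snd p)) \<in> borel_measurable borel"
    using measurable_compose[OF borel_measurable_continuous_onI[OF continuous_on_snd[OF continuous_on_id]] f'(1)] .
  ultimately show ?thesis
    unfolding cyl_def AE_lebesgue_on_iff[OF borel_cyl[OF \<Omega>]]
    by (intro measurable_lebesgue_onI[OF borel_cyl[OF \<Omega>]]) auto
qed

lemma cyl_borel_measurable:
  fixes f :: "real \<times> 'a::euclidean_space \<Rightarrow> 'b::euclidean_space"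
  assumes \<Omega>: "\<Omega> \<in> sets borel" and "f \<in> borel_measurable borel"
  shows "f \<in> borel_measurable (cyl T \<Omega>)"
  unfolding cyl_def by (rule measurable_lebesgue_onI[OF borel_cyl[OF \<Omega>] assms(2)]) simp

lemma measurable_section:
  fixes f :: "real \<times> 'a::euclidean_space \<Rightarrow> 'b::euclidean_space"
  assumes \<Omega>: "\<Omega> \<in> sets borel" and f: "f \<in> borel_measurable (cyl T \<Omega>)"
  shows "AE t in lebesgue_on {0<..<T}. (\<lambda>x. f (t, x)) \<in> borel_measurable (lebesgue_on \<Omega>)"
proof -
  obtain f' where f': "f' \<in> borel_measurable borel" "\<And>p. p \<notin> {0<..<T} \<times> \<Omega> \<Longrightarrow> f' p = 0"
    "AE p in lborel. p \<in> {0<..<T} \<times> \<Omega> \<longrightarrow> f p = f' p"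
    by (rule borel_rep_cyl[OF \<Omega> f]) (rule that)
  have "AE t in lborel. t \<in> {0<..<T} \<longrightarrow> (\<lambda>x. f (t, x)) \<in> borel_measurable (lebesgue_on \<Omega>)"
    using AE_lborel_pair[OF f'(3)]
  proof eventually_elim
    case (elim t)
    have "(\<lambda>x. f' (t, x)) \<in> borel_measurable borel"
      by (rule measurable_compose[OF borel_measurable_continuous_onI f'(1)]) (intro continuous_intros)
    then show ?case
      using elim by (intro impI measurable_lebesgue_onI[OF \<Omega>]) auto
  qed
  then show ?thesis by (simp add: AE_lebesgue_on_iff)
qed

text \<open>Fubini on the cylinder, read off a Borel representative. The sections of f itself are
  integrable for almost every t only; the conventional value of the integral on the exceptional
  slices does no harm.\<close>

lemma
  fixes f :: "real \<times> 'a::euclidean_space \<Rightarrow> 'b::euclidean_space"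
  assumes \<Omega>: "\<Omega> \<in> sets borel" and int: "integrable (cyl T \<Omega>) f"
  shows integrable_section: "AE t in lebesgue_on {0<..<T}. integrable (lebesgue_on \<Omega>) (\<lambda>x. f (t, x))"
    and integral_cyl_iterated: "(LINT t|lebesgue_on {0<..<T}. LINT x|lebesgue_on \<Omega>. f (t, x)) = (LINT p|cyl T \<Omega>. f p)"
proof -
  have f: "f \<in> borel_measurable (cyl T \<Omega>)" using int by auto
  obtain f' where f': "f' \<in> borel_measurable borel" "\<And>p. p \<notin> {0<..<T} \<times> \<Omega> \<Longrightarrow> f' p = 0"
    "AE p in lborel. p \<in> {0<..<T} \<times> \<Omega> \<longrightarrow> f p = f' p"
    by (rule borel_rep_cyl[OF \<Omega> f]) (rule that)
  note rep = integrable_lebesgue_on_rep[OF borel_cyl[OF \<Omega>] f'] integral_lebesgue_on_rep[OF borel_cyl[OF \<Omega>] f']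
  have int': "integrable (lborel \<Otimes>\<^sub>M lborel) f'"
    using int rep(1) by (simp add: cyl_def lborel_prod)
  have m: "(\<lambda>x. f' (t, x)) \<in> borel_measurable borel" for t
    by (rule measurable_compose[OF borel_measurable_continuous_onI f'(1)]) (intro continuous_intros)
  let ?J = "\<lambda>t. LINT x|lborel. f' (t, x)"
  have J: "integrable lborel ?J" "integral\<^sup>L lborel ?J = integral\<^sup>L lborel f'"
    using lborel_pair.integrable_fst'[OF int'] lborel_pair.integral_fst'[OF int'] by (simp_all add: lborel_prod)
  have s: "AE t in lborel. t \<in> {0<..<T} \<longrightarrow> integrable (lebesgue_on \<Omega>) (\<lambda>x. f (t, x)) \<and>
      (LINT x|lebesgue_on \<Omega>. f (t, x)) = ?J t"
    using AE_lborel_pair[OF f'(3)] lborel_pair.AE_integrable_fst'[OF int']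
  proof eventually_elim
    case (elim t)
    show ?case
    proof
      assume t: "t \<in> {0<..<T}"
      have *: "AE x in lborel. x \<in> \<Omega> \<longrightarrow> f (t, x) = f' (t, x)"
        using elim(1) t by auto
      have z: "\<And>x. x \<notin> \<Omega> \<Longrightarrow> f' (t, x) = 0" using f'(2) by auto
      show "integrable (lebesgue_on \<Omega>) (\<lambda>x. f (t, x)) \<and> (LINT x|lebesgue_on \<Omega>. f (t, x)) = ?J t"
        using integrable_lebesgue_on_rep[OF \<Omega> m z *] integral_lebesgue_on_rep[OF \<Omega> m z *] elim(2) by simp
    qed
  qed
  have z: "\<And>t. t \<notin> {0<..<T} \<Longrightarrow> ?J t = 0" using f'(2) by auto
  have mJ: "?J \<in> borel_measurable borel" using J(1) by auto
  have ae: "AE t in lborel. t \<in> {0<..<T} \<longrightarrow> (LINT x|lebesgue_on \<Omega>. f (t, x)) = ?J t"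
    using s by eventually_elim simp
  show "AE t in lebesgue_on {0<..<T}. integrable (lebesgue_on \<Omega>) (\<lambda>x. f (t, x))"
    using s by (simp add: AE_lebesgue_on_iff) (auto elim: eventually_mono)
  show "(LINT t|lebesgue_on {0<..<T}. LINT x|lebesgue_on \<Omega>. f (t, x)) = (LINT p|cyl T \<Omega>. f p)"
    using integral_lebesgue_on_rep[OF _ mJ z ae] J(2) rep(2) by (simp add: cyl_def)
qed

lemma L2_section:
  fixes f :: "real \<times> 'a::euclidean_space \<Rightarrow> 'b::euclidean_space"
  assumes \<Omega>: "\<Omega> \<in> sets borel" and f: "f \<in> L2 (cyl T \<Omega>)"
  shows "AE t in lebesgue_on {0<..<T}. (\<lambda>x. f (t, x)) \<in> L2 (lebesgue_on \<Omega>)"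
proof -
  have "f \<in> borel_measurable (cyl T \<Omega>)" "integrable (cyl T \<Omega>) (\<lambda>p. (norm (f p))\<^sup>2)"
    using f by (auto simp: L2_def)
  from measurable_section[OF \<Omega> this(1)] integrable_section[OF \<Omega> this(2)]
  show ?thesis by eventually_elim (auto simp: L2_def)
qed

lemma integrable_cyl_snd:
  fixes f :: "'a::euclidean_space \<Rightarrow> real"
  assumes \<Omega>: "\<Omega> \<in> sets borel" and f: "integrable (lebesgue_on \<Omega>) f" "\<And>x. 0 \<le> f x"
  shows "integrable (cyl T \<Omega>) (\<lambda>p. f (snd p))"
proof -
  obtain f' where f': "f' \<in> borel_measurable borel" "\<And>x. x \<notin> \<Omega> \<Longrightarrow> f' x = 0" "AE x in lborel. x \<in> \<Omega> \<longrightarrow> f x = f' x"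
    by (rule borel_rep_lebesgue_on[OF \<Omega> borel_measurable_integrable[OF f(1)]]) (rule that)
  have i: "integrable lborel f'"
    using integrable_lebesgue_on_rep[OF \<Omega> f'] f by simp
  define h where "h = (\<lambda>p::real \<times> 'a. indicator {0<..<T} (fst p) * f' (snd p))"
  have hm: "h \<in> borel_measurable (lborel \<Otimes>\<^sub>M lborel)"
    unfolding h_def using f'(1) by measurable
  have "integrable (lborel \<Otimes>\<^sub>M lborel) h"
  proof (rule lborel_pair.Fubini_integrable[OF hm])
    have "(\<lambda>x. LINT y|lborel. norm (h (x, y))) = (\<lambda>x. indicator {0<..<T} x * (LINT y|lborel. \<bar>f' y\<bar>))"
      by (auto simp: h_def abs_mult)
    moreover have "integrable lborel (indicat_real {0<..<T})"
      by (cases "0 \<le> T") (auto simp: integrable_indicator_iff emeasure_lborel_Ioo)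
    ultimately show "integrable lborel (\<lambda>x. LINT y|lborel. norm (h (x, y)))" by simp
    show "AE x in lborel. integrable lborel (\<lambda>y. h (x, y))"
      using i by (auto simp: h_def)
  qed
  then have hi: "integrable lborel h" by (simp add: lborel_prod)
  have hb: "h \<in> borel_measurable borel" using hm by (simp add: lborel_prod)
  have hz: "h p = 0" if "p \<notin> {0<..<T} \<times> \<Omega>" for p
    using that f'(2)[of "snd p"] by (cases p) (auto simp: h_def indicator_def)
  have "AE p in cyl T \<Omega>. f (snd p) = f' (snd p)"
    by (rule AE_cyl_snd[OF \<Omega>]) (use f'(3) in \<open>simp add: AE_lebesgue_on_iff[OF \<Omega>]\<close>)
  then have ae: "AE p in lborel. p \<in> {0<..<T} \<times> \<Omega> \<longrightarrow> f (snd p) = h p"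
    unfolding cyl_def AE_lebesgue_on_iff[OF borel_cyl[OF \<Omega>]]
    by eventually_elim (auto simp: h_def)
  show ?thesis
    unfolding cyl_def
    using integrable_lebesgue_on_rep[OF borel_cyl[OF \<Omega>] hb hz ae] hi by blast
qed

lemma L2_cyl_snd:
  fixes f :: "'a::euclidean_space \<Rightarrow> 'b::euclidean_space"
  assumes \<Omega>: "\<Omega> \<in> sets borel" and f: "f \<in> L2 (lebesgue_on \<Omega>)"
  shows "(\<lambda>p. f (snd p)) \<in> L2 (cyl T \<Omega>)"
  using measurable_cyl_snd[OF \<Omega>, of f T] integrable_cyl_snd[OF \<Omega>, of "\<lambda>x. (norm (f x))\<^sup>2" T] f
  by (auto simp: L2_def)

lemma L2_norm_cyl_snd:
  fixes f :: "'a::euclidean_space \<Rightarrow> 'b::euclidean_space"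
  assumes \<Omega>: "\<Omega> \<in> sets borel" and f: "f \<in> L2 (lebesgue_on \<Omega>)" and T: "0 \<le> T"
  shows "L2_norm (cyl T \<Omega>) (\<lambda>p. f (snd p)) = sqrt T * L2_norm (lebesgue_on \<Omega>) f"
proof -
  have "integrable (cyl T \<Omega>) (\<lambda>p. (norm (f (snd p)))\<^sup>2)"
    using L2_cyl_snd[OF assms(1,2), of T] by (auto simp: L2_def)
  from integral_cyl_iterated[OF \<Omega> this]
  show ?thesis
    using T by (simp add: L2_norm_def measure_restrict_space flip: real_sqrt_mult)
qed

lemma finite_measure_lebesgue_on_bounded:
  assumes "\<Omega> \<in> sets borel" "bounded \<Omega>"
  shows "finite_measure (lebesgue_on \<Omega>)"
proof -
  have "\<Omega> \<in> lmeasurable"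
    by (rule bounded_set_imp_lmeasurable) (use assms in auto)
  then show ?thesis by (rule finite_measure_lebesgue_on)
qed

lemma finite_measure_cyl:
  fixes \<Omega> :: "'a::euclidean_space set"
  assumes "\<Omega> \<in> sets borel" "bounded \<Omega>"
  shows "finite_measure (cyl T \<Omega>)"
  unfolding cyl_def
  by (rule finite_measure_lebesgue_on_bounded)
    (use assms borel_cyl bounded_Times[OF bounded_Ioo] in auto)

section \<open>Smooth functions with compact support\<close>

lemma grad_eq:
  assumes "GDERIV f x :> D"
  shows "grad f x = D"
proof -
  have "D' = D" if "GDERIV f x :> D'" for D'
  proof -
    have "(\<lambda>h. h \<bullet> D') = (\<lambda>h. h \<bullet> D)"
      using that assms has_derivative_unique unfolding gderiv_def by blast
    then have "\<forall>h. h \<bullet> D' = h \<bullet> D" by metis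
    then show ?thesis by (simp only: vector_eq_ldot)
  qed
  with assms show ?thesis unfolding grad_def by blast
qed

text \<open>Riesz representation in coordinates. As \<open>grad\<close> is a definite description,
  existence is shown here and uniqueness in \<open>grad_eq\<close> before it can be computed
  with.\<close>

lemma GDERIV_grad:
  fixes f :: "'a::euclidean_space \<Rightarrow> real"
  assumes "f differentiable (at x)"
  shows "GDERIV f x :> grad f x"
proof -
  obtain f' where f': "(f has_derivative f') (at x)" using assms by (auto simp: differentiable_def)
  interpret bounded_linear f' using f' by (rule has_derivative_bounded_linear)
  have "f' h = h \<bullet> (\<Sum>b\<in>Basis. f' b *\<^sub>R b)" for h
  proof -
    have "f' h = f' (\<Sum>b\<in>Basis. (h \<bullet> b) *\<^sub>R b)" by (simp add: euclidean_representation)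
    also have "\<dots> = (\<Sum>b\<in>Basis. (h \<bullet> b) * f' b)" by (simp add: sum scaleR)
    also have "\<dots> = h \<bullet> (\<Sum>b\<in>Basis. f' b *\<^sub>R b)" by (simp add: inner_sum_right mult.commute)
    finally show ?thesis .
  qed
  then have "f' = (\<lambda>h. h \<bullet> (\<Sum>b\<in>Basis. f' b *\<^sub>R b))" by blast
  with f' have "GDERIV f x :> (\<Sum>b\<in>Basis. f' b *\<^sub>R b)" unfolding gderiv_def by simp
  with grad_eq show ?thesis by metis
qed

lemma smooth_differentiable: "smooth f \<Longrightarrow> f differentiable (at x)"
  unfolding smooth_def using empty_subsetI by (metis foldr_Nil id_apply list.set(1))

lemma smooth_GDERIV: "smooth f \<Longrightarrow> GDERIV f x :> grad f x"
  by (rule GDERIV_grad[OF smooth_differentiable])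

lemma smooth_continuous: "smooth f \<Longrightarrow> continuous_on A f"
  by (meson continuous_at_imp_continuous_on differentiable_imp_continuous_within smooth_differentiable)

lemma smooth_grad_continuous:
  assumes "smooth f" shows "continuous_on A (grad f)"
proof (rule continuous_at_imp_continuous_on, intro ballI, subst continuous_componentwise, intro ballI)
  fix x and b :: 'a assume "b \<in> Basis"
  \<comment> \<open>The case of a one-letter list of directions in \<open>smooth\<close>: the first
    partial derivatives are differentiable, hence continuous.\<close>
  then have "(\<lambda>y. grad f y \<bullet> b) differentiable (at x)"
    using assms unfolding smooth_def by (elim allE[of _ "[b]"]) auto
  then show "continuous (at x) (\<lambda>y. grad f y \<bullet> b)" by (rule differentiable_imp_continuous_within)
qed

lemma grad_outside_support:
  assumes "x \<notin> closure {x. f x \<noteq> 0}"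
  shows "grad f x = 0"
proof (rule grad_eq)
  have "GDERIV (\<lambda>x. 0) x :> 0" by (rule GDERIV_const)
  then show "GDERIV f x :> 0"
    unfolding gderiv_def
  proof (rule has_derivative_transform_within_open)
    show "open (- closure {x. f x \<noteq> 0})" by auto
    show "\<And>y. y \<in> - closure {x. f x \<noteq> 0} \<Longrightarrow> 0 = f y"
      using closure_subset[of "{x. f x \<noteq> 0}"] by auto
  qed (use assms in auto)
qed

lemma Cc_infty_D:
  assumes "\<psi> \<in> Cc_infty U"
  shows "smooth \<psi>" "compact (closure {x. \<psi> x \<noteq> 0})" "closure {x. \<psi> x \<noteq> 0} \<subseteq> U"
    "\<And>x. x \<notin> U \<Longrightarrow> \<psi> x = 0" "\<And>x. x \<notin> U \<Longrightarrow> grad \<psi> x = 0"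
  using assms closure_subset[of "{x. \<psi> x \<noteq> 0}"] grad_outside_support[of _ \<psi>] by (auto simp: Cc_infty_def)

lemma Cc_infty_mono: "U \<subseteq> V \<Longrightarrow> Cc_infty U \<subseteq> Cc_infty V"
  by (auto simp: Cc_infty_def)

lemma bounded_continuous_compact_support:
  fixes g :: "'a::euclidean_space \<Rightarrow> 'b::euclidean_space"
  assumes "continuous_on UNIV g" "compact K" "\<And>x. x \<notin> K \<Longrightarrow> g x = 0"
  obtains B where "0 \<le> B" "\<And>x. norm (g x) \<le> B"
proof -
  have "bounded (g ` K)"
    using assms by (intro compact_imp_bounded compact_continuous_image) (auto intro: continuous_on_subset)
  then obtain B where "0 < B" "\<And>x. x \<in> K \<Longrightarrow> norm (g x) \<le> B"
    by (metis bounded_pos imageI)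
  then show ?thesis using assms(3) that[of B] by (metis norm_zero order_less_imp_le)
qed

lemma Cc_infty_bounded:
  assumes "\<psi> \<in> Cc_infty U"
  obtains B where "0 \<le> B" "\<And>x. \<bar>\<psi> x\<bar> \<le> B" "\<And>x. norm (grad \<psi> x) \<le> B"
proof -
  note D = Cc_infty_D[OF assms]
  obtain B1 where B1: "0 \<le> B1" "\<And>x. norm (\<psi> x) \<le> B1"
    by (rule bounded_continuous_compact_support[OF smooth_continuous[OF D(1)] D(2)])
      (use closure_subset[of "{x. \<psi> x \<noteq> 0}"] in auto)
  obtain B2 where B2: "0 \<le> B2" "\<And>x. norm (grad \<psi> x) \<le> B2"
    by (rule bounded_continuous_compact_support[OF smooth_grad_continuous[OF D(1)] D(2)])
      (use grad_outside_support in auto)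
  show ?thesis
    by (rule that[of "max B1 B2"]) (use B1 B2 in \<open>auto simp: le_max_iff_disj\<close>)
qed

section \<open>Smooth bump functions\<close>

definition flat_exp :: "nat \<Rightarrow> real \<Rightarrow> real" where
  "flat_exp k r = (if r > 0 then (1 / r) ^ k * exp (- (1 / r)) else 0)"

lemma flat_exp_tendsto_0: "(flat_exp k \<longlongrightarrow> 0) (at 0)"
  unfolding filterlim_split_at_real
proof (rule filterlim_split_at)
  \<comment> \<open>Substituting 1 / r turns the limit at 0 from the right into the decay of x^k /
    exp x at infinity.\<close>
  have "((\<lambda>r. inverse r ^ k / exp (inverse r)) \<longlongrightarrow> (0::real)) (at_right 0)"
    using filterlim_compose[OF tendsto_power_div_exp_0[of k] filterlim_inverse_at_top_right] .
  then show "(flat_exp k \<longlongrightarrow> 0) (at_right 0)"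
  proof (rule Lim_transform_eventually)
    show "\<forall>\<^sub>F r in at_right 0. inverse r ^ k / exp (inverse r) = flat_exp k r"
      by (auto simp: eventually_at_right_field flat_exp_def exp_minus field_simps intro!: exI[of _ 1])
  qed
  show "(flat_exp k \<longlongrightarrow> 0) (at_left 0)"
    by (rule Lim_transform_eventually[OF tendsto_const])
      (auto simp: eventually_at_left_field flat_exp_def intro!: exI[of _ "-1"])
qed

text \<open>\<open>flat_exp k\<close> is r^(-k) exp (-1/r) extended by 0. The whole family is
  considered because differentiation only raises k, so that one argument covers derivatives of all
  orders.\<close>

lemma flat_exp_DERIV:
  "DERIV (flat_exp k) r :> flat_exp (k + 2) r - real k * flat_exp (k + 1) r"
proof -
  consider "r > 0" | "r < 0" | "r = 0" by linarith
  then show ?thesis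
  proof cases
    case 1
    have "DERIV (\<lambda>r. (1 / r) ^ k * exp (- (1 / r))) r :> flat_exp (k + 2) r - real k * flat_exp (k + 1) r"
    proof (cases k)
      case (Suc n)
      have d: "DERIV (\<lambda>r. 1 / r) r :> - ((1 / r) * (1 / r))"
        using 1 by (auto intro!: derivative_eq_intros simp: field_simps)
      have "DERIV (\<lambda>r. (1 / r) ^ Suc n * exp (- (1 / r))) r :>
          (1 + real n) * (- ((1 / r) * (1 / r)) * (1 / r) ^ n) * exp (- (1 / r))
          + exp (- (1 / r)) * - (- ((1 / r) * (1 / r))) * (1 / r) ^ Suc n"
        by (intro DERIV_mult DERIV_power_Suc DERIV_fun_exp DERIV_minus d)
      then show ?thesis
        using 1 unfolding Suc by (elim DERIV_cong) (simp add: flat_exp_def algebra_simps)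
    qed (use 1 in \<open>auto intro!: derivative_eq_intros simp: flat_exp_def field_simps power2_eq_square\<close>)
    then show ?thesis
      by (rule has_field_derivative_transform_within_open[of _ _ _ "{0<..}"])
        (use 1 in \<open>auto simp: flat_exp_def\<close>)
  next
    case 2
    have "DERIV (\<lambda>r. 0) r :> flat_exp (k + 2) r - real k * flat_exp (k + 1) r"
      using 2 by (auto simp: flat_exp_def)
    then show ?thesis
      by (rule has_field_derivative_transform_within_open[of _ _ _ "{..<0}"])
        (use 2 in \<open>auto simp: flat_exp_def\<close>)
  next
    case 3
    \<comment> \<open>At 0 the difference quotient of the k-th function is exactly the next function
      of the family, which tends to 0.\<close>
    have "(\<lambda>h. (flat_exp k (0 + h) - flat_exp k 0) / h) = flat_exp (k + 1)"
      by (rule ext) (auto simp: flat_exp_def)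
    moreover have "flat_exp (k + 2) 0 - real k * flat_exp (k + 1) 0 = 0"
      by (simp add: flat_exp_def)
    ultimately show ?thesis
      using flat_exp_tendsto_0[of "k + 1"] unfolding 3 DERIV_def by simp
  qed
qed

text \<open>An algebra closed under directional derivatives: smoothness of its members, which
  concerns all iterated partial derivatives, becomes an induction over the list of directions. It
  contains the bumps below, which are products of flat functions of affine forms.\<close>

inductive_set flat_algebra :: "('a::euclidean_space \<Rightarrow> real) set" where
  const: "(\<lambda>x. c) \<in> flat_algebra"
| flat: "(\<lambda>x. flat_exp k (x \<bullet> v + d)) \<in> flat_algebra"
| add: "f \<in> flat_algebra \<Longrightarrow> g \<in> flat_algebra \<Longrightarrow> (\<lambda>x. f x + g x) \<in> flat_algebra"
| mult: "f \<in> flat_algebra \<Longrightarrow> g \<in> flat_algebra \<Longrightarrow> (\<lambda>x. f x * g x) \<in> flat_algebra"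

lemma flat_algebra_GDERIV:
  assumes "f \<in> flat_algebra"
  shows "\<exists>g. (\<forall>x. GDERIV f x :> g x) \<and> (\<forall>w. (\<lambda>x. g x \<bullet> w) \<in> flat_algebra)"
  using assms
proof induction
  case (const c)
  show ?case by (rule exI[of _ "\<lambda>x. 0"]) (auto intro: GDERIV_const flat_algebra.const)
next
  case (flat k v d)
  let ?h = "\<lambda>r. flat_exp (k + 2) r - real k * flat_exp (k + 1) r"
  have "GDERIV (\<lambda>x. flat_exp k (x \<bullet> v + d)) x :> ?h (x \<bullet> v + d) *\<^sub>R v" for x
  proof (rule GDERIV_DERIV_compose[OF _ flat_exp_DERIV])
    show "GDERIV (\<lambda>x. x \<bullet> v + d) x :> v"
      unfolding gderiv_def by (auto intro!: derivative_eq_intros)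
  qed
  moreover have "(\<lambda>x. (?h (x \<bullet> v + d) *\<^sub>R v) \<bullet> w) \<in> flat_algebra" for w
  proof -
    have "(\<lambda>x. (flat_exp (k + 2) (x \<bullet> v + d) + (- real k) * flat_exp (k + 1) (x \<bullet> v + d)) * (v \<bullet> w)) \<in> flat_algebra"
      by (intro flat_algebra.intros)
    then show ?thesis by simp
  qed
  ultimately show ?case by (intro exI[of _ "\<lambda>x. ?h (x \<bullet> v + d) *\<^sub>R v"]) blast
next
  case (add f g)
  then obtain f' g' where "\<forall>x. GDERIV f x :> f' x" "\<forall>w. (\<lambda>x. f' x \<bullet> w) \<in> flat_algebra"
    "\<forall>x. GDERIV g x :> g' x" "\<forall>w. (\<lambda>x. g' x \<bullet> w) \<in> flat_algebra" by blast
  then show ?case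
    by (intro exI[of _ "\<lambda>x. f' x + g' x"]) (auto intro!: GDERIV_add flat_algebra.add simp: inner_add_left)
next
  case (mult f g)
  then obtain f' g' where *: "\<forall>x. GDERIV f x :> f' x" "\<forall>w. (\<lambda>x. f' x \<bullet> w) \<in> flat_algebra"
    "\<forall>x. GDERIV g x :> g' x" "\<forall>w. (\<lambda>x. g' x \<bullet> w) \<in> flat_algebra" by blast
  show ?case
    by (intro exI[of _ "\<lambda>x. f x *\<^sub>R g' x + g x *\<^sub>R f' x"])
      (use * mult in \<open>auto intro!: GDERIV_mult flat_algebra.add flat_algebra.mult simp: inner_add_left\<close>)
qed

lemma flat_algebra_smooth:
  assumes "f \<in> flat_algebra" shows "smooth f"
proof -
  have "foldr (\<lambda>b g y. grad g y \<bullet> b) bs f \<in> flat_algebra" for bs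
  proof (induction bs)
    case (Cons b bs)
    let ?F = "foldr (\<lambda>b g y. grad g y \<bullet> b) bs f"
    obtain g where g: "\<forall>x. GDERIV ?F x :> g x" "\<forall>w. (\<lambda>x. g x \<bullet> w) \<in> flat_algebra"
      using flat_algebra_GDERIV[OF Cons] by blast
    have "grad ?F = g" using g(1) grad_eq by blast
    then show ?case using g(2) by simp
  qed (use assms in simp)
  then show ?thesis
    unfolding smooth_def using flat_algebra_GDERIV unfolding gderiv_def differentiable_def by blast
qed

text \<open>A tensor product over the coordinates. The shift by 1 keeps the support at distance at
  least 1/(j+1) from the faces of the box; the factor j+1 sends the arguments to infinity inside it,
  so that the bumps tend to the indicator of the box while staying between 0 and 1.\<close>

definition box_bump :: "'a::euclidean_space \<Rightarrow> 'a \<Rightarrow> nat \<Rightarrow> 'a \<Rightarrow> real" where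
  "box_bump a b j x = (\<Prod>i\<in>Basis.
     flat_exp 0 (real (Suc j) * (x \<bullet> i - a \<bullet> i) - 1) * flat_exp 0 (real (Suc j) * (b \<bullet> i - x \<bullet> i) - 1))"

lemma flat_exp_0_bounds: "0 \<le> flat_exp 0 r" "flat_exp 0 r \<le> 1"
  by (auto simp: flat_exp_def)

lemma box_bump_bounds: "0 \<le> box_bump a b j x" "box_bump a b j x \<le> 1"
  unfolding box_bump_def
  by (auto intro!: prod_nonneg prod_le_1 mult_nonneg_nonneg mult_le_one flat_exp_0_bounds)

lemma smooth_box_bump: "smooth (box_bump a b j)"
proof (rule flat_algebra_smooth)
  have p: "(\<lambda>x. \<Prod>i\<in>I. f i x) \<in> flat_algebra" if "finite I" "\<And>i. i \<in> I \<Longrightarrow> f i \<in> flat_algebra"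
    for I and f :: "'a \<Rightarrow> 'a \<Rightarrow> real"
    using that by (induction I rule: finite_induct) (auto intro: flat_algebra.intros)
  have 1: "(\<lambda>x. flat_exp 0 (real (Suc j) * (x \<bullet> i - a \<bullet> i) - 1)) \<in> flat_algebra" for i
    using flat_algebra.flat[of 0 "real (Suc j) *\<^sub>R i" "- real (Suc j) * (a \<bullet> i) - 1"]
    by (simp add: algebra_simps)
  have 2: "(\<lambda>x. flat_exp 0 (real (Suc j) * (b \<bullet> i - x \<bullet> i) - 1)) \<in> flat_algebra" for i
    using flat_algebra.flat[of 0 "- real (Suc j) *\<^sub>R i" "real (Suc j) * (b \<bullet> i) - 1"]
    by (simp add: algebra_simps)
  show "box_bump a b j \<in> flat_algebra"
    unfolding box_bump_def[abs_def] by (rule p) (simp, intro flat_algebra.mult 1 2)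
qed

lemma box_bump_Cc_infty: "box_bump a b j \<in> Cc_infty (box a b)"
proof -
  let ?d = "1 / real (Suc j)"
  let ?K = "cbox (a + ?d *\<^sub>R One) (b - ?d *\<^sub>R One)"
  have "x \<in> ?K" if "box_bump a b j x \<noteq> 0" for x
  proof -
    have "flat_exp 0 (real (Suc j) * (x \<bullet> i - a \<bullet> i) - 1) \<noteq> 0 \<and> flat_exp 0 (real (Suc j) * (b \<bullet> i - x \<bullet> i) - 1) \<noteq> 0"
      if "i \<in> Basis" for i
      using \<open>box_bump a b j x \<noteq> 0\<close> that unfolding box_bump_def by auto
    then have "?d \<le> x \<bullet> i - a \<bullet> i \<and> ?d \<le> b \<bullet> i - x \<bullet> i" if "i \<in> Basis" for i
      using that by (fastforce simp: flat_exp_def field_simps split: if_splits)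
    then show ?thesis by (force simp: mem_box inner_add_left inner_diff_left)
  qed
  then have cl: "closure {x. box_bump a b j x \<noteq> 0} \<subseteq> ?K"
    by (intro closure_minimal closed_cbox) auto
  moreover have "?K \<subseteq> box a b"
  proof
    fix x assume "x \<in> ?K"
    then have "a \<bullet> i + ?d \<le> x \<bullet> i \<and> x \<bullet> i \<le> b \<bullet> i - ?d" if "i \<in> Basis" for i
      using that by (auto simp: mem_box inner_add_left inner_diff_left)
    moreover have "0 < ?d" by simp
    ultimately show "x \<in> box a b" by (smt (verit) mem_box(1))
  qed
  moreover have "compact (closure {x. box_bump a b j x \<noteq> 0})"
    using cl by (meson bounded_cbox bounded_closure bounded_subset closure_subset compact_closure order_trans)
  ultimately show ?thesis by (auto simp: Cc_infty_def smooth_box_bump)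
qed

lemma box_bump_tendsto: "(\<lambda>j. box_bump a b j x) \<longlonglongrightarrow> indicator (box a b) x"
proof (cases "x \<in> box a b")
  case True
  have f: "((\<lambda>r. flat_exp 0 r) \<longlongrightarrow> 1) at_top"
  proof (rule Lim_transform_eventually)
    have "((\<lambda>r::real. exp (- (1 / r))) \<longlongrightarrow> exp (- 0)) at_top"
      by (intro tendsto_intros real_tendsto_divide_at_top[OF tendsto_const] filterlim_ident)
    then show "((\<lambda>r::real. exp (- (1 / r))) \<longlongrightarrow> 1) at_top" by simp
    show "\<forall>\<^sub>F r in at_top. exp (- (1 / r)) = flat_exp 0 r"
      using eventually_gt_at_top[of "0::real"] by eventually_elim (simp add: flat_exp_def)
  qed
  have g: "filterlim (\<lambda>j. real (Suc j) * c - 1) at_top sequentially" if "0 < c" for c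
  proof -
    have "filterlim (\<lambda>j. - 1 + c * real (Suc j)) at_top sequentially"
      by (intro filterlim_tendsto_add_at_top[OF tendsto_const]
        filterlim_tendsto_pos_mult_at_top[OF tendsto_const that]
        filterlim_compose[OF filterlim_real_sequentially filterlim_Suc])
    moreover have "(\<lambda>j. real (Suc j) * c - 1) = (\<lambda>j. - 1 + c * real (Suc j))"
      by (auto simp: algebra_simps)
    ultimately show ?thesis by simp
  qed
  have "(\<lambda>j. box_bump a b j x) \<longlonglongrightarrow> (\<Prod>i\<in>(Basis::'a set). 1 * 1)"
    unfolding box_bump_def
    by (intro tendsto_prod tendsto_mult filterlim_compose[OF f] g) (use True in \<open>auto simp: mem_box\<close>)
  with True show ?thesis by simp
next
  case False
  then have "box_bump a b j x = 0" for j
    using Cc_infty_D(4)[OF box_bump_Cc_infty] by blast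
  with False show ?thesis by simp
qed

section \<open>The fundamental lemma of the calculus of variations\<close>

lemma sets_borel_box: "sets borel = sigma_sets UNIV (range (\<lambda>(a, b). box a b :: 'a::euclidean_space set))"
  by (subst borel_eq_box) (rule sets_measure_of, simp)

text \<open>Bumps tend boundedly to indicators of boxes, so f integrates to 0 over every box in
  \<Omega>. Boxes are stable under intersection and generate the Borel sets, which extends this to
  all Borel parts of a box; countably many boxes exhaust \<Omega>.\<close>

lemma fundamental_lemma_real:
  fixes f :: "'a::euclidean_space \<Rightarrow> real"
  assumes \<Omega>: "open \<Omega>" and f: "integrable (lebesgue_on \<Omega>) f"
    and zero: "\<And>\<psi>. \<psi> \<in> Cc_infty \<Omega> \<Longrightarrow> (LINT x|lebesgue_on \<Omega>. \<psi> x * f x) = 0"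
  shows "AE x in lebesgue_on \<Omega>. f x = 0"
proof -
  have \<Omega>b: "\<Omega> \<in> sets borel" using \<Omega> by simp
  obtain f' where f': "f' \<in> borel_measurable borel" "\<And>x. x \<notin> \<Omega> \<Longrightarrow> f' x = 0" "AE x in lborel. x \<in> \<Omega> \<longrightarrow> f x = f' x"
    by (rule borel_rep_lebesgue_on[OF \<Omega>b borel_measurable_integrable[OF f(1)]]) (rule that)
  have fi: "integrable lborel f'"
    using integrable_lebesgue_on_rep[OF \<Omega>b f'] f by simp
  have box0: "(LINT x|lborel. indicator (box a b) x * f' x) = 0" if sub: "box a b \<subseteq> \<Omega>" for a b
  proof -
    have "(\<lambda>j. LINT x|lborel. box_bump a b j x * f' x) \<longlonglongrightarrow> (LINT x|lborel. indicator (box a b) x * f' x)"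
    proof (rule integral_dominated_convergence)
      show "integrable lborel (\<lambda>x. \<bar>f' x\<bar>)" using fi by simp
      show "(\<lambda>x. box_bump a b j x * f' x) \<in> borel_measurable lborel" for j
        using f'(1) borel_measurable_continuous_onI[OF smooth_continuous[OF smooth_box_bump[of a b j]]] by simp
      show "AE x in lborel. norm (box_bump a b j x * f' x) \<le> \<bar>f' x\<bar>" for j
        using box_bump_bounds[of a b j] by (auto simp: abs_mult intro!: AE_I2 mult_left_le_one_le)
      show "AE x in lborel. (\<lambda>j. box_bump a b j x * f' x) \<longlonglongrightarrow> indicator (box a b) x * f' x"
        by (auto intro!: AE_I2 tendsto_mult box_bump_tendsto)
    qed (use f'(1) in auto)
    moreover have "(LINT x|lborel. box_bump a b j x * f' x) = 0" for j
    proof -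
      have m: "(\<lambda>x. box_bump a b j x * f' x) \<in> borel_measurable borel"
        using f'(1) borel_measurable_continuous_onI[OF smooth_continuous[OF smooth_box_bump[of a b j]]] by simp
      have "(LINT x|lebesgue_on \<Omega>. box_bump a b j x * f x) = (LINT x|lborel. box_bump a b j x * f' x)"
        by (rule integral_lebesgue_on_rep[OF \<Omega>b m]) (use f' in \<open>auto elim: eventually_mono\<close>)
      moreover have "box_bump a b j \<in> Cc_infty \<Omega>"
        using box_bump_Cc_infty Cc_infty_mono[OF sub] by blast
      ultimately show ?thesis using zero by simp
    qed
    ultimately show ?thesis by (simp add: LIMSEQ_const_iff)
  qed
  have ae_box: "AE x in lborel. x \<in> box a b \<longrightarrow> f' x = 0" if sub: "box a b \<subseteq> \<Omega>" for a b
  proof -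
    \<comment> \<open>Cutting down to one box gives a function on the whole space with total
      integral 0, as the complement step of the induction requires.\<close>
    define g where "g x = indicator (box a b) x * f' x" for x
    have gi: "integrable lborel g"
      unfolding g_def using integrable_mult_indicator[OF _ fi, of "box a b"] by simp
    have "(LINT x|lborel. indicator A x * g x) = 0" if "A \<in> sets borel" for A
    proof -
      have "Int_stable (range (\<lambda>(a, b). box a b :: 'a set))"
        by (auto simp: Int_stable_def box_Int_box)
      moreover have "range (\<lambda>(a, b). box a b :: 'a set) \<subseteq> Pow UNIV" by auto
      moreover have "A \<in> sigma_sets UNIV (range (\<lambda>(a, b). box a b))"
        using that sets_borel_box by blast
      ultimately show ?thesis
      proof (induction rule: sigma_sets_induct_disjoint)
        case (basic A)
        then obtain c d where A: "A = box c d" by auto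
        obtain p q where pq: "box c d \<inter> box a b = box p q" using box_Int_box[of c d a b] by blast
        have "(LINT x|lborel. indicator A x * g x) = (LINT x|lborel. indicator (box p q) x * f' x)"
          unfolding g_def A pq[symmetric] by (simp only: indicator_inter_arith mult.assoc)
        also have "\<dots> = 0" by (rule box0) (use pq sub in auto)
        finally show ?case .
      next
        case empty
        show ?case by simp
      next
        case (compl A)
        then have A: "A \<in> sets borel" using sets_borel_box by blast
        have "(LINT x|lborel. indicator (UNIV - A) x * g x) = (LINT x|lborel. g x - indicator A x * g x)"
          by (intro Bochner_Integration.integral_cong) (auto simp: indicator_def)
        also have "\<dots> = (LINT x|lborel. g x) - (LINT x|lborel. indicator A x * g x)"
          using gi integrable_mult_indicator[OF _ gi, of A] A by (intro Bochner_Integration.integral_diff) auto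
        also have "(LINT x|lborel. g x) = 0" unfolding g_def by (rule box0[OF sub])
        finally show ?case using compl by simp
      next
        case (union A)
        then have A: "A i \<in> sets lborel" for i
          using sets_borel_box by auto
        have "(LINT x:(\<Union>i. A i)|lborel. g x) = (\<Sum>i. LINT x:A i|lborel. g x)"
          by (rule lebesgue_integral_countable_add[OF A])
            (use union A gi integrable_mult_indicator[OF _ gi, of "\<Union>i. A i"] in \<open>auto simp: disjoint_family_on_def set_integrable_def\<close>)
        then show ?case using union by (simp add: set_lebesgue_integral_def)
      qed
    qed
    then have "AE x in lborel. g x = 0"
      using density_unique_real[OF gi, of "\<lambda>x. 0"] by (auto simp: set_lebesgue_integral_def)
    then show ?thesis by eventually_elim (auto simp: g_def)
  qed
  obtain \<B> :: "'a set set" where \<B>: "countable \<B>" "\<B> \<subseteq> Pow \<Omega>" "\<And>X. X \<in> \<B> \<Longrightarrow> \<exists>a b. X = box a b" "\<Union>\<B> = \<Omega>"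
    using open_countable_Union_open_box[OF \<Omega>] by metis
  have "AE x in lborel. \<forall>X\<in>\<B>. x \<in> X \<longrightarrow> f' x = 0"
    unfolding AE_ball_countable[OF \<B>(1)] using \<B>(2,3) ae_box by blast
  with f'(3) have "AE x in lborel. x \<in> \<Omega> \<longrightarrow> f x = 0"
    by eventually_elim (use \<B>(4) in auto)
  then show ?thesis by (simp add: AE_lebesgue_on_iff[OF \<Omega>b])
qed

lemma fundamental_lemma:
  fixes f :: "'a::euclidean_space \<Rightarrow> 'b::euclidean_space"
  assumes \<Omega>: "open \<Omega>" and f: "integrable (lebesgue_on \<Omega>) f"
    and zero: "\<And>\<psi>. \<psi> \<in> Cc_infty \<Omega> \<Longrightarrow> (LINT x|lebesgue_on \<Omega>. \<psi> x *\<^sub>R f x) = 0"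
  shows "AE x in lebesgue_on \<Omega>. f x = 0"
proof -
  have \<Omega>b: "\<Omega> \<in> sets borel" using \<Omega> by simp
  have "AE x in lebesgue_on \<Omega>. f x \<bullet> b = 0" for b
  proof (rule fundamental_lemma_real[OF \<Omega>])
    show "integrable (lebesgue_on \<Omega>) (\<lambda>x. f x \<bullet> b)" using f by simp
    fix \<psi> assume \<psi>: "\<psi> \<in> Cc_infty \<Omega>"
    obtain B where B: "\<And>x. \<bar>\<psi> x\<bar> \<le> B" using Cc_infty_bounded[OF \<psi>] by metis
    have m: "\<psi> \<in> borel_measurable (lebesgue_on \<Omega>)"
      by (rule measurable_lebesgue_onI[OF \<Omega>b borel_measurable_continuous_onI[OF smooth_continuous[OF Cc_infty_D(1)[OF \<psi>]]]]) simp
    have "integrable (lebesgue_on \<Omega>) (\<lambda>x. \<psi> x *\<^sub>R f x)"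
    proof (rule Bochner_Integration.integrable_bound)
      show "integrable (lebesgue_on \<Omega>) (\<lambda>x. B *\<^sub>R f x)" using f by simp
      show "(\<lambda>x. \<psi> x *\<^sub>R f x) \<in> borel_measurable (lebesgue_on \<Omega>)" using m f by auto
      show "AE x in lebesgue_on \<Omega>. norm (\<psi> x *\<^sub>R f x) \<le> norm (B *\<^sub>R f x)"
        using B by (auto intro!: AE_I2 mult_right_mono order_trans[OF B])
    qed
    from integral_inner_left[OF this, of b] zero[OF \<psi>]
    show "(LINT x|lebesgue_on \<Omega>. \<psi> x * (f x \<bullet> b)) = 0" by simp
  qed
  then have "AE x in lebesgue_on \<Omega>. \<forall>b\<in>Basis. f x \<bullet> b = 0"
    by (simp add: AE_ball_countable countable_finite)
  then show ?thesis by eventually_elim (auto intro: euclidean_eqI)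
qed

lemma differentiable_bound_GDERIV:
  fixes f :: "'a::euclidean_space \<Rightarrow> real"
  assumes "\<And>x. GDERIV f x :> g x" "\<And>x. norm (g x) \<le> B"
  shows "\<bar>f y - f x\<bar> \<le> B * norm (y - x)"
proof -
  have "norm (f y - f x) \<le> B * norm (y - x)"
  proof (rule differentiable_bound[OF convex_UNIV])
    show "(f has_derivative (\<lambda>h. h \<bullet> g z)) (at z within UNIV)" for z
      using assms(1) by (simp add: gderiv_def)
    show "onorm (\<lambda>h. h \<bullet> g z) \<le> B" for z
    proof (rule onorm_le)
      fix h
      have "norm (h \<bullet> g z) \<le> norm h * norm (g z)" by (simp add: Cauchy_Schwarz_ineq2)
      also have "\<dots> \<le> norm h * B" by (intro mult_left_mono assms) simp
      finally show "norm (h \<bullet> g z) \<le> B * norm h" by (simp add: mult.commute)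
    qed
  qed auto
  then show ?thesis by simp
qed

text \<open>Translation invariance makes the integrals of the difference quotients vanish.\<close>

lemma integral_gradient_zero:
  fixes f :: "'a::euclidean_space \<Rightarrow> real"
  assumes d: "\<And>x. GDERIV f x :> g x" and g: "continuous_on UNIV g"
    and K: "compact K" "\<And>x. x \<notin> K \<Longrightarrow> f x = 0" "\<And>x. x \<notin> K \<Longrightarrow> g x = 0"
  shows "(LINT x|lborel. g x \<bullet> b) = 0"
proof -
  have cont: "continuous_on UNIV f"
    using d by (meson GDERIV_grad continuous_at_imp_continuous_on differentiable_def gderiv_def
        has_derivative_continuous)
  obtain B where B: "0 \<le> B" "\<And>x. norm (g x) \<le> B"
    by (rule bounded_continuous_compact_support[OF g K(1,3)]) (auto intro: that)
  obtain A where A0: "0 \<le> A" and A: "\<And>x. norm (f x) \<le> A"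
    by (rule bounded_continuous_compact_support[OF cont K(1,2)]) (auto intro: that)
  obtain R where R: "\<And>x. x \<in> K \<Longrightarrow> norm x \<le> R" using compact_imp_bounded[OF K(1)] by (auto simp: bounded_iff)
  \<comment> \<open>The shifts have length at most \<open>norm b\<close>, so every difference
    quotient vanishes outside this ball and one integrable majorant serves all n.\<close>
  let ?C = "cball (0::'a) (R + norm b)"
  define q where "q n x = real (Suc n) * (f (x + (1 / real (Suc n)) *\<^sub>R b) - f x)" for n x
  have fm: "f \<in> borel_measurable borel" using borel_measurable_continuous_onI[OF cont] .
  have fi: "integrable lborel f"
  proof (rule Bochner_Integration.integrable_bound)
    show "integrable lborel (\<lambda>x. A * indicator K x)"
      using emeasure_compact_finite[OF K(1)] borel_compact[OF K(1)] by (simp add: integrable_indicator_iff)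
    show "AE x in lborel. norm (f x) \<le> norm (A * indicator K x)"
      using A0 A K(2) by (auto intro!: AE_I2 simp: indicator_def)
  qed (use fm in auto)
  have shift: "integrable lborel (\<lambda>x. f (x + c))" "(LINT x|lborel. f (x + c)) = (LINT x|lborel. f x)" for c
  proof -
    have *: "distr lborel borel ((+) c) = (lborel :: 'a measure)" by (rule lborel_distr_plus)
    have "integrable (distr lborel borel ((+) c)) f" unfolding * by (rule fi)
    then show "integrable lborel (\<lambda>x. f (x + c))"
      using fm by (subst (asm) integrable_distr_eq) (auto simp: add.commute)
    have "(LINT x|distr lborel borel ((+) c). f x) = (LINT x|lborel. f (c + x))"
      by (rule integral_distr) (use fm in auto)
    then show "(LINT x|lborel. f (x + c)) = (LINT x|lborel. f x)"
      unfolding * by (simp add: add.commute)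
  qed
  have q0: "(LINT x|lborel. q n x) = 0" for n
    unfolding q_def using shift[of "(1 / real (Suc n)) *\<^sub>R b"] fi by simp
  have "(\<lambda>n. LINT x|lborel. q n x) \<longlonglongrightarrow> (LINT x|lborel. g x \<bullet> b)"
  proof (rule integral_dominated_convergence)
    show "integrable lborel (\<lambda>x. B * norm b * indicator ?C x)"
      using emeasure_compact_finite[OF compact_cball, of "0::'a" "R + norm b"] by (simp add: integrable_indicator_iff)
    show "(\<lambda>x. g x \<bullet> b) \<in> borel_measurable lborel"
      using borel_measurable_continuous_onI[OF g] by simp
    show "q n \<in> borel_measurable lborel" for n
      unfolding q_def using fm by measurable
    show "AE x in lborel. norm (q n x) \<le> B * norm b * indicator ?C x" for n
    proof (rule AE_I2)
      fix x
      let ?y = "x + (1 / real (Suc n)) *\<^sub>R b"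
      show "norm (q n x) \<le> B * norm b * indicator ?C x"
      proof (cases "x \<in> ?C")
        case True
        have "\<bar>f ?y - f x\<bar> \<le> B * norm (?y - x)"
          by (rule differentiable_bound_GDERIV[OF d B(2)])
        also have "\<dots> = B * norm b / real (Suc n)" by simp
        finally have "real (Suc n) * \<bar>f ?y - f x\<bar> \<le> real (Suc n) * (B * norm b / real (Suc n))"
          by (rule mult_left_mono) simp
        then have "real (Suc n) * \<bar>f ?y - f x\<bar> \<le> B * norm b" by simp
        moreover have "norm (q n x) = real (Suc n) * \<bar>f ?y - f x\<bar>"
          unfolding q_def real_norm_def abs_mult by (simp only: abs_of_nat)
        ultimately show ?thesis using True by simp
      next
        case False
        then have x: "R + norm b < norm x" by simp
        have "norm x \<le> norm ?y + norm ((1 / real (Suc n)) *\<^sub>R b)"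
          using norm_triangle_ineq4[of ?y "(1 / real (Suc n)) *\<^sub>R b"] by simp
        moreover have "norm ((1 / real (Suc n)) *\<^sub>R b) \<le> norm b"
          by (simp add: field_simps)
        ultimately have "R < norm ?y" "R < norm x" using x norm_ge_zero[of b] by linarith+
        then have "f ?y = 0" "f x = 0" using R K(2) by (meson not_less)+
        then show ?thesis using False by (simp add: q_def)
      qed
    qed
    show "AE x in lborel. (\<lambda>n. q n x) \<longlonglongrightarrow> g x \<bullet> b"
    proof (rule AE_I2)
      fix x
      have "((\<lambda>t. f (x + t *\<^sub>R b)) has_vector_derivative (b \<bullet> g x)) (at 0)"
      proof -
        have "((\<lambda>t::real. x + t *\<^sub>R b) has_derivative (\<lambda>t. t *\<^sub>R b)) (at 0)"
          by (auto intro!: derivative_eq_intros)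
        moreover have "(f has_derivative (\<lambda>h. h \<bullet> g x)) (at (x + 0 *\<^sub>R b))"
          using d[of x] by (simp add: gderiv_def)
        ultimately have "((\<lambda>t. f (x + t *\<^sub>R b)) has_derivative (\<lambda>t. (t *\<^sub>R b) \<bullet> g x)) (at 0)"
          by (rule has_derivative_compose)
        then show ?thesis by (simp add: has_vector_derivative_def)
      qed
      then have "DERIV (\<lambda>t. f (x + t *\<^sub>R b)) 0 :> b \<bullet> g x"
        by (simp add: has_real_derivative_iff_has_vector_derivative)
      then have l: "((\<lambda>h. (f (x + h *\<^sub>R b) - f x) / h) \<longlongrightarrow> b \<bullet> g x) (at 0)"
        by (simp add: DERIV_def)
      have "filterlim (\<lambda>n. 1 / real (Suc n)) (at 0) sequentially"
        unfolding filterlim_at using lim_inverse_n' LIMSEQ_Suc[OF lim_inverse_n'] by auto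
      from filterlim_compose[OF l this]
      show "(\<lambda>n. q n x) \<longlonglongrightarrow> g x \<bullet> b"
        by (simp add: q_def inner_commute field_simps)
    qed
  qed
  then show ?thesis by (simp add: q0 LIMSEQ_const_iff)
qed

text \<open>The product (a . x + c) \<psi> has compact support, so its gradient integrates to 0 in
  every direction. This is the integration by parts that identifies the weak gradients of P1
  functions.\<close>

lemma affine_integration_by_parts:
  fixes a :: "'a::euclidean_space"
  assumes \<psi>: "\<psi> \<in> Cc_infty U"
  shows "(LINT x|lborel. (a \<bullet> x + c) *\<^sub>R grad \<psi> x) = - (LINT x|lborel. \<psi> x *\<^sub>R a)"
proof -
  note D = Cc_infty_D[OF \<psi>]
  let ?K = "closure {x. \<psi> x \<noteq> 0}"
  have z: "x \<notin> ?K \<Longrightarrow> \<psi> x = 0" for x using closure_subset[of "{x. \<psi> x \<noteq> 0}"] by auto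
  have c1: "continuous_on UNIV (\<lambda>x. (a \<bullet> x + c) *\<^sub>R grad \<psi> x)"
    by (intro continuous_intros smooth_grad_continuous D(1))
  have c2: "continuous_on UNIV (\<lambda>x. \<psi> x *\<^sub>R a)"
    by (intro continuous_intros smooth_continuous D(1))
  have int: "integrable lborel h" if h: "continuous_on UNIV h" "\<And>x. x \<notin> ?K \<Longrightarrow> h x = 0" for h :: "'a \<Rightarrow> 'a"
  proof -
    obtain A where A: "\<And>x. norm (h x) \<le> A"
      by (rule bounded_continuous_compact_support[OF h(1) D(2) h(2)]) (auto intro: that)
    show ?thesis
    proof (rule Bochner_Integration.integrable_bound)
      show "integrable lborel (\<lambda>x. A * indicator ?K x)"
        using emeasure_compact_finite[OF D(2)] borel_compact[OF D(2)] by (simp add: integrable_indicator_iff)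
      show "AE x in lborel. norm (h x) \<le> norm (A * indicator ?K x)"
        using A h(2) by (auto intro!: AE_I2 simp: indicator_def intro: order_trans[OF A])
    qed (use borel_measurable_continuous_onI[OF h(1)] in auto)
  qed
  have i1: "integrable lborel (\<lambda>x. (a \<bullet> x + c) *\<^sub>R grad \<psi> x)"
    by (rule int[OF c1]) (auto simp: grad_outside_support)
  have i2: "integrable lborel (\<lambda>x. \<psi> x *\<^sub>R a)"
    by (rule int[OF c2]) (metis z scaleR_zero_left)
  have orth: "(LINT x|lborel. ((a \<bullet> x + c) *\<^sub>R grad \<psi> x + \<psi> x *\<^sub>R a)) \<bullet> b = 0" for b
  proof -
    have "(LINT x|lborel. ((a \<bullet> x + c) *\<^sub>R grad \<psi> x + \<psi> x *\<^sub>R a) \<bullet> b) = 0"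
    proof (rule integral_gradient_zero[of "\<lambda>x. (a \<bullet> x + c) * \<psi> x"])
      show "GDERIV (\<lambda>x. (a \<bullet> x + c) * \<psi> x) x :> (a \<bullet> x + c) *\<^sub>R grad \<psi> x + \<psi> x *\<^sub>R a" for x
      proof (rule GDERIV_mult[OF _ smooth_GDERIV[OF D(1)]])
        show "GDERIV (\<lambda>x. a \<bullet> x + c) x :> a"
          unfolding gderiv_def by (auto intro!: derivative_eq_intros simp: inner_commute)
      qed
      show "continuous_on UNIV (\<lambda>x. (a \<bullet> x + c) *\<^sub>R grad \<psi> x + \<psi> x *\<^sub>R a)"
        by (intro continuous_intros c1 c2)
      show "compact ?K" by (rule D(2))
      show "(a \<bullet> x + c) * \<psi> x = 0" "(a \<bullet> x + c) *\<^sub>R grad \<psi> x + \<psi> x *\<^sub>R a = 0" if "x \<notin> ?K" for x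
        using z[OF that] grad_outside_support[OF that] by simp_all
    qed
    moreover have "integrable lborel (\<lambda>x. (a \<bullet> x + c) *\<^sub>R grad \<psi> x + \<psi> x *\<^sub>R a)"
      by (intro Bochner_Integration.integrable_add i1 i2)
    ultimately show ?thesis by (metis integral_inner_left)
  qed
  \<comment> \<open>Orthogonality to every direction is applied to the integral itself.\<close>
  have "(LINT x|lborel. ((a \<bullet> x + c) *\<^sub>R grad \<psi> x + \<psi> x *\<^sub>R a)) = 0"
    using orth[of "LINT x|lborel. ((a \<bullet> x + c) *\<^sub>R grad \<psi> x + \<psi> x *\<^sub>R a)"]
    by (simp only: inner_eq_zero_iff)
  then show ?thesis using i1 i2 by (simp add: eq_neg_iff_add_eq_0)
qed

section \<open>Weak gradients\<close>

lemma Cc_infty_lebesgue_on: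
  assumes \<Omega>: "open \<Omega>" and \<psi>: "\<psi> \<in> Cc_infty U"
  shows "\<psi> \<in> borel_measurable (lebesgue_on \<Omega>)" "grad \<psi> \<in> borel_measurable (lebesgue_on \<Omega>)"
  using borel_measurable_continuous_onI[OF smooth_continuous[OF Cc_infty_D(1)[OF \<psi>]]]
    borel_measurable_continuous_onI[OF smooth_grad_continuous[OF Cc_infty_D(1)[OF \<psi>]]] \<Omega>
  by (auto intro!: measurable_lebesgue_onI AE_I2)

lemma integrable_bounded_scaleR:
  fixes f :: "'a \<Rightarrow> 'b::euclidean_space"
  assumes f: "integrable M f" and m: "\<psi> \<in> borel_measurable M" and B: "\<And>x. \<bar>\<psi> x\<bar> \<le> B"
  shows "integrable M (\<lambda>x. \<psi> x *\<^sub>R f x)"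
proof (rule Bochner_Integration.integrable_bound)
  show "integrable M (\<lambda>x. B *\<^sub>R f x)" using f by simp
  show "(\<lambda>x. \<psi> x *\<^sub>R f x) \<in> borel_measurable M" using m f by auto
  have "\<bar>\<psi> x\<bar> \<le> \<bar>B\<bar>" for x using B[of x] by linarith
  then show "AE x in M. norm (\<psi> x *\<^sub>R f x) \<le> norm (B *\<^sub>R f x)"
    by (auto intro!: AE_I2 mult_right_mono)
qed

lemma integrable_scaleR_bounded:
  fixes f :: "'a \<Rightarrow> real" and g :: "'a \<Rightarrow> 'b::euclidean_space"
  assumes f: "integrable M f" and m: "g \<in> borel_measurable M" and B: "\<And>x. norm (g x) \<le> B"
  shows "integrable M (\<lambda>x. f x *\<^sub>R g x)"
proof (rule Bochner_Integration.integrable_bound)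
  show "integrable M (\<lambda>x. f x * B)" using f by simp
  show "(\<lambda>x. f x *\<^sub>R g x) \<in> borel_measurable M" using m f by auto
  have "norm (g x) \<le> \<bar>B\<bar>" for x using B[of x] by linarith
  then show "AE x in M. norm (f x *\<^sub>R g x) \<le> norm (f x * B)"
    by (auto intro!: AE_I2 mult_left_mono simp: abs_mult)
qed

text \<open>\<open>weak_gradient\<close> equates two Bochner integrals, and a non-integrable
  integrand has integral 0 by convention. Additivity and uniqueness of weak gradients thus need
  integrability on both sides, which bounded test functions on a bounded domain supply.\<close>

lemma
  assumes \<Omega>: "open \<Omega>" "bounded \<Omega>" and \<psi>: "\<psi> \<in> Cc_infty U"
  shows L2_scaleR_Cc: "g \<in> L2 (lebesgue_on \<Omega>) \<Longrightarrow> integrable (lebesgue_on \<Omega>) (\<lambda>x. \<psi> x *\<^sub>R g x)"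
    and L2_scaleR_grad_Cc: "v \<in> L2 (lebesgue_on \<Omega>) \<Longrightarrow> integrable (lebesgue_on \<Omega>) (\<lambda>x. v x *\<^sub>R grad \<psi> x)"
proof -
  note fin = finite_measure_lebesgue_on_bounded[OF borel_open[OF \<Omega>(1)] \<Omega>(2)]
  obtain B where B: "\<And>x. \<bar>\<psi> x\<bar> \<le> B" "\<And>x. norm (grad \<psi> x) \<le> B"
    using Cc_infty_bounded[OF \<psi>] by metis
  note m = Cc_infty_lebesgue_on[OF \<Omega>(1) \<psi>]
  show "integrable (lebesgue_on \<Omega>) (\<lambda>x. \<psi> x *\<^sub>R g x)" if "g \<in> L2 (lebesgue_on \<Omega>)"
    by (rule integrable_bounded_scaleR[OF L2_integrable[OF fin that] m(1) B(1)])
  show "integrable (lebesgue_on \<Omega>) (\<lambda>x. v x *\<^sub>R grad \<psi> x)" if "v \<in> L2 (lebesgue_on \<Omega>)"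
    by (rule integrable_scaleR_bounded[OF L2_integrable[OF fin that] m(2) B(2)])
qed

lemma weak_gradient_add:
  assumes \<Omega>: "open \<Omega>" "bounded \<Omega>"
    and v: "v \<in> L2 (lebesgue_on \<Omega>)" "w \<in> L2 (lebesgue_on \<Omega>)"
    and g: "g \<in> L2 (lebesgue_on \<Omega>)" "h \<in> L2 (lebesgue_on \<Omega>)"
    and "weak_gradient \<Omega> v g" "weak_gradient \<Omega> w h"
  shows "weak_gradient \<Omega> (\<lambda>x. v x + w x) (\<lambda>x. g x + h x)"
  using assms(7,8) L2_scaleR_Cc[OF \<Omega> _ g(1)] L2_scaleR_Cc[OF \<Omega> _ g(2)]
    L2_scaleR_grad_Cc[OF \<Omega> _ v(1)] L2_scaleR_grad_Cc[OF \<Omega> _ v(2)]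
  by (simp add: weak_gradient_def scaleR_add_left scaleR_add_right)

lemma weak_gradient_cmult:
  assumes "weak_gradient \<Omega> v g"
  shows "weak_gradient \<Omega> (\<lambda>x. c * v x) (\<lambda>x. c *\<^sub>R g x)"
proof -
  have *: "(\<lambda>x. (c * v x) *\<^sub>R h x) = (\<lambda>x. c *\<^sub>R (v x *\<^sub>R h x))" for h :: "'a \<Rightarrow> 'a" by auto
  have **: "(\<lambda>x. \<psi> x *\<^sub>R (c *\<^sub>R g x)) = (\<lambda>x. c *\<^sub>R (\<psi> x *\<^sub>R g x))" for \<psi> :: "'a \<Rightarrow> real"
    by (auto simp: mult.commute)
  show ?thesis
    using assms unfolding weak_gradient_def * ** integral_scaleR_right by simp
qed

lemma weak_gradient_unique:
  assumes \<Omega>: "open \<Omega>" "bounded \<Omega>"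
    and g: "g \<in> L2 (lebesgue_on \<Omega>)" "h \<in> L2 (lebesgue_on \<Omega>)"
    and w: "weak_gradient \<Omega> v g" "weak_gradient \<Omega> v h"
  shows "AE x in lebesgue_on \<Omega>. g x = h x"
proof -
  note fin = finite_measure_lebesgue_on_bounded[OF borel_open[OF \<Omega>(1)] \<Omega>(2)]
  have "AE x in lebesgue_on \<Omega>. g x - h x = 0"
  proof (rule fundamental_lemma[OF \<Omega>(1) L2_integrable[OF fin L2_diff[OF g]]])
    fix \<psi> assume \<psi>: "\<psi> \<in> Cc_infty \<Omega>"
    have "(LINT x|lebesgue_on \<Omega>. \<psi> x *\<^sub>R g x) = (LINT x|lebesgue_on \<Omega>. \<psi> x *\<^sub>R h x)"
      using w \<psi> unfolding weak_gradient_def by (metis neg_equal_iff_equal)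
    then show "(LINT x|lebesgue_on \<Omega>. \<psi> x *\<^sub>R (g x - h x)) = 0"
      using L2_scaleR_Cc[OF \<Omega> \<psi> g(1)] L2_scaleR_Cc[OF \<Omega> \<psi> g(2)] by (simp add: scaleR_diff_right)
  qed
  then show ?thesis by eventually_elim simp
qed

lemma integral_lebesgue_on_superset:
  fixes f :: "'a::euclidean_space \<Rightarrow> 'b::euclidean_space"
  assumes "U \<in> sets borel" "V \<in> sets borel" "U \<subseteq> V" "\<And>x. x \<in> V - U \<Longrightarrow> f x = 0"
  shows "(LINT x|lebesgue_on V. f x) = (LINT x|lebesgue_on U. f x)"
proof -
  have "(\<lambda>x. indicator V x *\<^sub>R f x) = (\<lambda>x. indicator U x *\<^sub>R f x)"
    using assms(3,4) by (auto simp: indicator_def fun_eq_iff)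
  then show ?thesis using assms(1,2) by (simp add: integral_restrict_space)
qed

text \<open>Test functions supported in \<open>U\<close> see only the affine formula. The identity
  is carried from \<Omega> to \<open>U\<close>, extended to the whole space where integration by
  parts holds, and brought back. Discrete gradients are identified in this way without constructing
  weak derivatives of piecewise affine functions: their existence is granted wherever the lemma is
  applied.\<close>

lemma weak_gradient_locally_affine:
  assumes \<Omega>: "open \<Omega>" "bounded \<Omega>" and g: "g \<in> L2 (lebesgue_on \<Omega>)" and w: "weak_gradient \<Omega> v g"
    and U: "open U" "U \<subseteq> \<Omega>" and v: "\<And>x. x \<in> U \<Longrightarrow> v x = a \<bullet> x + c"
  shows "AE x in lebesgue_on U. g x = a"
proof -
  note fin = finite_measure_lebesgue_on_bounded[OF borel_open[OF \<Omega>(1)] \<Omega>(2)]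
  have b: "U \<in> sets borel" "\<Omega> \<in> sets borel" using U \<Omega> by auto
  have finU: "finite_measure (lebesgue_on U)"
    using finite_measure_lebesgue_on_bounded[OF b(1)] U(2) \<Omega>(2) bounded_subset by blast
  have gi: "integrable (lebesgue_on U) g"
  proof -
    have "integrable lebesgue (\<lambda>x. indicator \<Omega> x *\<^sub>R g x)"
      using L2_integrable[OF fin g] b by (simp add: integrable_restrict_space)
    from integrable_mult_indicator[OF _ this, of U]
    have "integrable lebesgue (\<lambda>x. indicator U x *\<^sub>R indicator \<Omega> x *\<^sub>R g x)" using b by simp
    moreover have "(\<lambda>x. indicator U x *\<^sub>R indicator \<Omega> x *\<^sub>R g x) = (\<lambda>x. indicator U x *\<^sub>R g x)"
      using U(2) by (auto simp: indicator_def fun_eq_iff)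
    ultimately show ?thesis using b by (simp add: integrable_restrict_space)
  qed
  have ci: "integrable (lebesgue_on U) (\<lambda>x. a)" using finU by (simp add: finite_measure.integrable_const)
  have "AE x in lebesgue_on U. g x - a = 0"
  proof (rule fundamental_lemma[OF U(1)])
    show "integrable (lebesgue_on U) (\<lambda>x. g x - a)" using gi ci by simp
    fix \<psi> assume \<psi>: "\<psi> \<in> Cc_infty U"
    then have \<psi>': "\<psi> \<in> Cc_infty \<Omega>" using Cc_infty_mono[OF U(2)] by blast
    obtain B where B: "\<And>x. \<bar>\<psi> x\<bar> \<le> B" using Cc_infty_bounded[OF \<psi>] by metis
    note m = Cc_infty_lebesgue_on[OF U(1) \<psi>]
    have "(LINT x|lebesgue_on U. \<psi> x *\<^sub>R g x) = (LINT x|lebesgue_on \<Omega>. \<psi> x *\<^sub>R g x)"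
      by (rule integral_lebesgue_on_superset[symmetric]) (use b U Cc_infty_D(4)[OF \<psi>] in auto)
    also have "\<dots> = - (LINT x|lebesgue_on \<Omega>. v x *\<^sub>R grad \<psi> x)"
      using w \<psi>' by (simp add: weak_gradient_def)
    also have "(LINT x|lebesgue_on \<Omega>. v x *\<^sub>R grad \<psi> x) = (LINT x|lebesgue_on U. v x *\<^sub>R grad \<psi> x)"
      by (rule integral_lebesgue_on_superset) (use b U Cc_infty_D(5)[OF \<psi>] in auto)
    also have "\<dots> = (LINT x|lebesgue_on U. (a \<bullet> x + c) *\<^sub>R grad \<psi> x)"
      by (rule Bochner_Integration.integral_cong) (auto simp: v)
    also have "\<dots> = (LINT x|lebesgue_on UNIV. (a \<bullet> x + c) *\<^sub>R grad \<psi> x)"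
      by (rule integral_lebesgue_on_superset[symmetric]) (use b U Cc_infty_D(5)[OF \<psi>] in auto)
    also have "\<dots> = (LINT x|lborel. (a \<bullet> x + c) *\<^sub>R grad \<psi> x)"
      by (rule integral_lebesgue_on_rep)
        (auto intro!: borel_measurable_continuous_onI continuous_intros smooth_grad_continuous Cc_infty_D(1)[OF \<psi>])
    also have "\<dots> = - (LINT x|lborel. \<psi> x *\<^sub>R a)"
      by (rule affine_integration_by_parts[OF \<psi>])
    also have "(LINT x|lborel. \<psi> x *\<^sub>R a) = (LINT x|lebesgue_on UNIV. \<psi> x *\<^sub>R a)"
      by (rule integral_lebesgue_on_rep[symmetric])
        (auto intro!: borel_measurable_continuous_onI continuous_intros smooth_continuous Cc_infty_D(1)[OF \<psi>])
    also have "\<dots> = (LINT x|lebesgue_on U. \<psi> x *\<^sub>R a)"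
      by (rule integral_lebesgue_on_superset) (use b U Cc_infty_D(4)[OF \<psi>] in auto)
    finally show "(LINT x|lebesgue_on U. \<psi> x *\<^sub>R (g x - a)) = 0"
      using integrable_bounded_scaleR[OF gi m(1) B] integrable_bounded_scaleR[OF ci m(1) B]
      by (simp add: scaleR_diff_right)
  qed
  then show ?thesis by eventually_elim simp
qed

lemma wgrad:
  assumes "v \<in> H1 \<Omega>"
  shows "wgrad \<Omega> v \<in> L2 (lebesgue_on \<Omega>)" "weak_gradient \<Omega> v (wgrad \<Omega> v)"
proof -
  have "\<exists>g. g \<in> L2 (lebesgue_on \<Omega>) \<and> weak_gradient \<Omega> v g" using assms by (auto simp: H1_def)
  from someI_ex[OF this] show "wgrad \<Omega> v \<in> L2 (lebesgue_on \<Omega>)" "weak_gradient \<Omega> v (wgrad \<Omega> v)"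
    by (auto simp: wgrad_def)
qed

text \<open>\<open>wgrad\<close> is a choice among representatives, so even its compatibility with
  differences holds only almost everywhere and rests on uniqueness.\<close>

lemma H1_diff:
  assumes \<Omega>: "open \<Omega>" "bounded \<Omega>" and v: "v \<in> H1 \<Omega>" "w \<in> H1 \<Omega>"
  shows "(\<lambda>x. v x - w x) \<in> H1 \<Omega>"
    and "AE x in lebesgue_on \<Omega>. wgrad \<Omega> (\<lambda>x. v x - w x) x = wgrad \<Omega> v x - wgrad \<Omega> w x"
proof -
  have L: "v \<in> L2 (lebesgue_on \<Omega>)" "w \<in> L2 (lebesgue_on \<Omega>)" using v by (auto simp: H1_def)
  have g: "weak_gradient \<Omega> (\<lambda>x. v x - w x) (\<lambda>x. wgrad \<Omega> v x - wgrad \<Omega> w x)"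
    using weak_gradient_add[OF \<Omega> L(1) L2_mult_const[OF L(2), of "-1"] wgrad(1)[OF v(1)]
        L2_scaleR[OF wgrad(1)[OF v(2)], of "-1"] wgrad(2)[OF v(1)] weak_gradient_cmult[OF wgrad(2)[OF v(2)], of "-1"]]
    by simp
  have l: "(\<lambda>x. wgrad \<Omega> v x - wgrad \<Omega> w x) \<in> L2 (lebesgue_on \<Omega>)"
    by (intro L2_diff wgrad v)
  show H: "(\<lambda>x. v x - w x) \<in> H1 \<Omega>" using g l L2_diff[OF L] by (auto simp: H1_def)
  show "AE x in lebesgue_on \<Omega>. wgrad \<Omega> (\<lambda>x. v x - w x) x = wgrad \<Omega> v x - wgrad \<Omega> w x"
    by (rule weak_gradient_unique[OF \<Omega> wgrad(1)[OF H] l wgrad(2)[OF H] g])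
qed

lemma H1_norm_bounds:
  assumes "v \<in> H1 \<Omega>"
  shows "L2_norm (lebesgue_on \<Omega>) v \<le> H1_norm \<Omega> v" "L2_norm (lebesgue_on \<Omega>) (wgrad \<Omega> v) \<le> H1_norm \<Omega> v"
proof -
  have *: "(norm (v x))\<^sup>2 = v x * v x" for x by (simp add: power2_eq_square)
  show "L2_norm (lebesgue_on \<Omega>) v \<le> H1_norm \<Omega> v" "L2_norm (lebesgue_on \<Omega>) (wgrad \<Omega> v) \<le> H1_norm \<Omega> v"
    unfolding L2_norm_def H1_norm_def H1_inner_def * power2_norm_eq_inner
    by (simp_all add: integral_nonneg_AE)
qed

section \<open>Space gradients and weak convergence\<close>

lemma space_grad:
  assumes "v \<in> L2H1 T \<Omega>"
  shows "is_space_grad T \<Omega> v (space_grad T \<Omega> v)"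
proof -
  have "\<exists>G. is_space_grad T \<Omega> v G" using assms by (auto simp: L2H1_def)
  from someI_ex[OF this] show ?thesis by (simp add: space_grad_def)
qed

lemma space_grad_L2: "v \<in> L2H1 T \<Omega> \<Longrightarrow> space_grad T \<Omega> v \<in> L2 (cyl T \<Omega>)"
  using space_grad by (auto simp: is_space_grad_def)

text \<open>Weak gradients are unique on almost every slice. The joint measurability contained in
  \<open>is_space_grad\<close> permits gluing the slices by \<open>AE_cylI_eq\<close>.\<close>

lemma is_space_grad_unique:
  assumes \<Omega>: "open \<Omega>" "bounded \<Omega>" and G: "is_space_grad T \<Omega> v G" "is_space_grad T \<Omega> v H"
  shows "AE p in cyl T \<Omega>. G p = H p"
proof (rule AE_cylI_eq[OF borel_open[OF \<Omega>(1)]])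
  show "G \<in> borel_measurable (cyl T \<Omega>)" "H \<in> borel_measurable (cyl T \<Omega>)"
    using G by (auto simp: is_space_grad_def L2_def)
  have "AE t in lebesgue_on {0<..<T}. (\<lambda>x. G (t, x)) \<in> L2 (lebesgue_on \<Omega>)"
    "AE t in lebesgue_on {0<..<T}. (\<lambda>x. H (t, x)) \<in> L2 (lebesgue_on \<Omega>)"
    "AE t in lebesgue_on {0<..<T}. weak_gradient \<Omega> (\<lambda>x. v (t, x)) (\<lambda>x. G (t, x))"
    "AE t in lebesgue_on {0<..<T}. weak_gradient \<Omega> (\<lambda>x. v (t, x)) (\<lambda>x. H (t, x))"
    using G L2_section[OF borel_open[OF \<Omega>(1)], of G T] L2_section[OF borel_open[OF \<Omega>(1)], of H T]
    by (auto simp: is_space_grad_def)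
  then show "AE t in lebesgue_on {0<..<T}. AE x in lebesgue_on \<Omega>. G (t, x) = H (t, x)"
    by eventually_elim (rule weak_gradient_unique[OF \<Omega>])
qed

lemma
  assumes \<Omega>: "open \<Omega>" "bounded \<Omega>" and G: "is_space_grad T \<Omega> v G"
  shows space_grad_eq: "AE p in cyl T \<Omega>. space_grad T \<Omega> v p = G p"
    and space_grad_in_L2: "space_grad T \<Omega> v \<in> L2 (cyl T \<Omega>)"
proof -
  have *: "is_space_grad T \<Omega> v (space_grad T \<Omega> v)"
    unfolding space_grad_def by (rule someI[of "is_space_grad T \<Omega> v", OF G])
  show "AE p in cyl T \<Omega>. space_grad T \<Omega> v p = G p" by (rule is_space_grad_unique[OF \<Omega> * G])
  show "space_grad T \<Omega> v \<in> L2 (cyl T \<Omega>)" using * by (simp add: is_space_grad_def)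
qed

lemma is_space_grad_add:
  assumes \<Omega>: "open \<Omega>" "bounded \<Omega>" and v: "v \<in> L2H1 T \<Omega>" "w \<in> L2H1 T \<Omega>"
  shows "is_space_grad T \<Omega> (\<lambda>p. v p + w p) (\<lambda>p. space_grad T \<Omega> v p + space_grad T \<Omega> w p)"
proof -
  note b = borel_open[OF \<Omega>(1)]
  have L: "v \<in> L2 (cyl T \<Omega>)" "w \<in> L2 (cyl T \<Omega>)" using v by (simp_all add: L2H1_def)
  have G: "AE t in lebesgue_on {0<..<T}. weak_gradient \<Omega> (\<lambda>x. v (t, x)) (\<lambda>x. space_grad T \<Omega> v (t, x))"
    "AE t in lebesgue_on {0<..<T}. weak_gradient \<Omega> (\<lambda>x. w (t, x)) (\<lambda>x. space_grad T \<Omega> w (t, x))"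
    using space_grad[OF v(1)] space_grad[OF v(2)] by (simp_all add: is_space_grad_def)
  from L2_section[OF b L(1)] L2_section[OF b L(2)] L2_section[OF b space_grad_L2[OF v(1)]]
    L2_section[OF b space_grad_L2[OF v(2)]] G
  have "AE t in lebesgue_on {0<..<T}. weak_gradient \<Omega> (\<lambda>x. v (t, x) + w (t, x))
      (\<lambda>x. space_grad T \<Omega> v (t, x) + space_grad T \<Omega> w (t, x))"
    by eventually_elim (rule weak_gradient_add[OF \<Omega>])
  then show ?thesis
    using L2_add[OF space_grad_L2[OF v(1)] space_grad_L2[OF v(2)]] by (auto simp: is_space_grad_def)
qed

lemma is_space_grad_cmult:
  assumes v: "v \<in> L2H1 T \<Omega>"
  shows "is_space_grad T \<Omega> (\<lambda>p. c * v p) (\<lambda>p. c *\<^sub>R space_grad T \<Omega> v p)"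
proof -
  have "AE t in lebesgue_on {0<..<T}. weak_gradient \<Omega> (\<lambda>x. v (t, x)) (\<lambda>x. space_grad T \<Omega> v (t, x))"
    using space_grad[OF v] by (auto simp: is_space_grad_def)
  then have "AE t in lebesgue_on {0<..<T}. weak_gradient \<Omega> (\<lambda>x. c * v (t, x)) (\<lambda>x. c *\<^sub>R space_grad T \<Omega> v (t, x))"
    by eventually_elim (rule weak_gradient_cmult)
  then show ?thesis
    using L2_scaleR[OF space_grad_L2[OF v]] by (auto simp: is_space_grad_def)
qed

lemma L2_norm_space_grad_le: "L2_norm (cyl T \<Omega>) (space_grad T \<Omega> v) \<le> L2H1_norm T \<Omega> v"
  unfolding L2H1_norm_def by (rule real_le_rsqrt) simp

text \<open>Through these functionals weak convergence in \<open>L2H1\<close> becomes weak L^2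
  convergence of gradients against an arbitrary field \<open>H\<close>.\<close>

definition grad_pairing ::
  "real \<Rightarrow> 'a::euclidean_space set \<Rightarrow> (real \<times> 'a \<Rightarrow> 'a) \<Rightarrow> (real \<times> 'a \<Rightarrow> real) \<Rightarrow> real" where
  "grad_pairing T \<Omega> H v = (LINT p|cyl T \<Omega>. H p \<bullet> space_grad T \<Omega> v p)"

text \<open>The gradient of a sum is chosen independently of those of its terms. The local fact
  \<open>cong\<close> replaces the chosen gradient by any other space gradient under the integral,
  after which linearity is that of the integral.\<close>

lemma grad_pairing_linear:
  assumes \<Omega>: "open \<Omega>" "bounded \<Omega>" and H: "H \<in> L2 (cyl T \<Omega>)"
    and v: "v \<in> L2H1 T \<Omega>"
  shows "w \<in> L2H1 T \<Omega> \<Longrightarrow> grad_pairing T \<Omega> H (\<lambda>p. v p + w p) = grad_pairing T \<Omega> H v + grad_pairing T \<Omega> H w"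
    and "grad_pairing T \<Omega> H (\<lambda>p. c * v p) = c * grad_pairing T \<Omega> H v"
    and "\<bar>grad_pairing T \<Omega> H v\<bar> \<le> L2_norm (cyl T \<Omega>) H * L2_norm (cyl T \<Omega>) (space_grad T \<Omega> v)"
proof -
  let ?M = "cyl T \<Omega>"
  have m: "H \<in> borel_measurable ?M" using H by (simp add: L2_def)
  have sm: "f \<in> borel_measurable ?M" if "f \<in> L2 ?M" for f :: "real \<times> 'a \<Rightarrow> 'a"
    using that by (simp add: L2_def)
  have i: "integrable ?M (\<lambda>p. H p \<bullet> space_grad T \<Omega> v p)" if "v \<in> L2H1 T \<Omega>" for v
    by (rule L2_inner_integrable[OF H space_grad_L2[OF that]])
  have cong: "(LINT p|?M. H p \<bullet> space_grad T \<Omega> w p) = (LINT p|?M. H p \<bullet> G p)"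
    if G: "is_space_grad T \<Omega> w G" for w G
  proof (rule integral_cong_AE)
    show "(\<lambda>p. H p \<bullet> space_grad T \<Omega> w p) \<in> borel_measurable ?M"
      by (intro borel_measurable_inner m sm space_grad_in_L2[OF \<Omega> G])
    show "(\<lambda>p. H p \<bullet> G p) \<in> borel_measurable ?M"
      by (intro borel_measurable_inner m sm) (use G in \<open>simp add: is_space_grad_def\<close>)
    show "AE p in ?M. H p \<bullet> space_grad T \<Omega> w p = H p \<bullet> G p"
      using space_grad_eq[OF \<Omega> G] by eventually_elim simp
  qed
  show "grad_pairing T \<Omega> H (\<lambda>p. v p + w p) = grad_pairing T \<Omega> H v + grad_pairing T \<Omega> H w" if w: "w \<in> L2H1 T \<Omega>"
    using cong[OF is_space_grad_add[OF \<Omega> v w]] i[OF v] i[OF w]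
    by (simp add: grad_pairing_def inner_add_right)
  show "grad_pairing T \<Omega> H (\<lambda>p. c * v p) = c * grad_pairing T \<Omega> H v"
    using cong[OF is_space_grad_cmult[OF v]] by (simp add: grad_pairing_def)
  show "\<bar>grad_pairing T \<Omega> H v\<bar> \<le> L2_norm ?M H * L2_norm ?M (space_grad T \<Omega> v)"
    unfolding grad_pairing_def by (rule L2_Cauchy_Schwarz[OF H space_grad_L2[OF v]])
qed

lemma L2H1_weak_conv_grad:
  assumes \<Omega>: "open \<Omega>" "bounded \<Omega>" and F: "L2H1_weak_conv T \<Omega> F f" and H: "H \<in> L2 (cyl T \<Omega>)"
  shows "(\<lambda>m. LINT p|cyl T \<Omega>. H p \<bullet> space_grad T \<Omega> (F m) p) \<longlonglongrightarrow> (LINT p|cyl T \<Omega>. H p \<bullet> space_grad T \<Omega> f p)"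
proof -
  have "\<bar>grad_pairing T \<Omega> H v\<bar> \<le> L2_norm (cyl T \<Omega>) H * L2H1_norm T \<Omega> v" if "v \<in> L2H1 T \<Omega>" for v
    using grad_pairing_linear(3)[OF \<Omega> H that]
      mult_left_mono[OF L2_norm_space_grad_le L2_norm_nonneg] by (rule order_trans)
  then have "L2H1_functional T \<Omega> (grad_pairing T \<Omega> H)"
    unfolding L2H1_functional_def using grad_pairing_linear(1,2)[OF \<Omega> H] by blast
  with F have "(\<lambda>m. grad_pairing T \<Omega> H (F m)) \<longlonglongrightarrow> grad_pairing T \<Omega> H f"
    by (simp add: L2H1_weak_conv_def)
  then show ?thesis by (simp add: grad_pairing_def)
qed

text \<open>Uniform boundedness by a gliding hump: the functional violating convergence is a signed series
  \<open>\<Sum>j. \<epsilon>\<^sub>j 3\<^sup>-\<^sup>j \<Lambda>\<^sub>j\<close>, summed pointwise, so that no completeness of \<open>L\<^sup>2\<close> is needed.\<close>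

lemma gliding_hump:
  fixes N :: "nat \<Rightarrow> real" and \<Lambda> :: "nat \<Rightarrow> nat \<Rightarrow> real"
  assumes N: "\<And>m. 0 \<le> N m" and unb: "\<And>C. \<exists>m. N m > C"
    and le: "\<And>j m. \<bar>\<Lambda> j m\<bar> \<le> N m" and eq: "\<And>j. \<Lambda> j j = N j"
  obtains s :: "nat \<Rightarrow> real" and r :: "nat \<Rightarrow> nat" where "\<And>i. \<bar>s i\<bar> = 1"
    "\<And>C. \<exists>m. \<bar>\<Sum>i. s i * (1/3)^i * \<Lambda> (r i) m\<bar> > C"
proof -
  \<comment> \<open>Growth 4^j against weights 3^(-j) leaves humps of size (4/3)^j.\<close>
  have "\<exists>r. \<forall>j. N (r j) > 4 ^ j" by (intro choice allI unb)
  then obtain r where r: "\<And>j. N (r j) > 4 ^ j" by blast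
  \<comment> \<open>For x >= 0 one of |v + x| and |v - x| is at least x; the sign is chosen so that
    the partial sum v does not cancel the new term.\<close>
  define E where "E j v = (if \<bar>v + (1/3)^j * N (r j)\<bar> \<ge> (1/3)^j * N (r j) then 1 else - 1 :: real)" for j v
  \<comment> \<open>The sign at stage j depends on the partial sum at \<open>r j\<close>, hence a
    recursion on functions of m.\<close>
  define S where "S = rec_nat (\<lambda>m. 0) (\<lambda>j S m. S m + E j (S (r j)) * (1/3)^j * \<Lambda> (r j) m)"
  define s where "s j = E j (S j (r j))" for j
  have S: "S 0 = (\<lambda>m. 0)" "S (Suc j) m = S j m + s j * (1/3)^j * \<Lambda> (r j) m" for j m
    by (simp_all add: S_def s_def)
  have Ssum: "S j m = (\<Sum>i<j. s i * (1/3)^i * \<Lambda> (r i) m)" for j m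
    by (induction j) (simp_all add: S)
  have s1: "\<bar>s j\<bar> = 1" for j by (simp add: s_def E_def)
  have hump: "\<bar>S (Suc j) (r j)\<bar> \<ge> (1/3)^j * N (r j)" for j
  proof -
    have p: "0 \<le> (1/3)^j * N (r j)" using N by simp
    show ?thesis using p unfolding S s_def E_def eq by (auto simp: abs_if split: if_splits)
  qed
  have bnd: "\<bar>s i * (1/3)^i * \<Lambda> (r i) m\<bar> \<le> (1/3)^i * N m" for i m
    using le[of "r i" m] s1[of i] by (simp add: abs_mult)
  have summ: "summable (\<lambda>i. s i * (1/3)^i * \<Lambda> (r i) m)" for m
    by (rule summable_comparison_test'[where g = "\<lambda>i. (1/3)^i * N m" and N = 0])
      (use bnd in \<open>auto intro!: summable_mult2 summable_geometric\<close>)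
  \<comment> \<open>The weights after stage j add up to half the weight of stage j, so the tail
    destroys at most half of the hump.\<close>
  have tail: "\<bar>\<Sum>i. s (i + Suc j) * (1/3)^(i + Suc j) * \<Lambda> (r (i + Suc j)) m\<bar> \<le> (1/3)^j / 2 * N m" for j m
  proof -
    have g: "(\<lambda>i. (1/3)^(i + Suc j) * N m) sums ((1/3)^j / 2 * N m)"
    proof -
      have "(\<lambda>i. (1/3)^i * ((1/3)^Suc j * N m)) sums ((1 / (1 - 1/3)) * ((1/3)^Suc j * N m))"
        by (intro sums_mult2 geometric_sums) simp
      then show ?thesis by (simp add: power_add mult_ac)
    qed
    have "\<bar>\<Sum>i. s (i + Suc j) * (1/3)^(i + Suc j) * \<Lambda> (r (i + Suc j)) m\<bar> \<le> (\<Sum>i. (1/3)^(i + Suc j) * N m)"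
      unfolding real_norm_def[symmetric]
      by (rule norm_suminf_le[OF _ sums_summable[OF g]]) (use bnd in \<open>simp only: real_norm_def\<close>)
    then show ?thesis using sums_unique[OF g] by simp
  qed
  have big: "\<bar>\<Sum>i. s i * (1/3)^i * \<Lambda> (r i) (r j)\<bar> \<ge> (4/3)^j / 2" for j
  proof -
    have "(\<Sum>i. s i * (1/3)^i * \<Lambda> (r i) (r j)) =
        (\<Sum>i. s (i + Suc j) * (1/3)^(i + Suc j) * \<Lambda> (r (i + Suc j)) (r j)) + S (Suc j) (r j)"
      unfolding Ssum by (rule suminf_split_initial_segment[OF summ])
    then have "\<bar>\<Sum>i. s i * (1/3)^i * \<Lambda> (r i) (r j)\<bar> \<ge> (1/3)^j * N (r j) - (1/3)^j / 2 * N (r j)"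
      using tail[of j "r j"] hump[of j] by linarith
    also have "(1/3)^j * N (r j) - (1/3)^j / 2 * N (r j) = (1/3)^j / 2 * N (r j)" by simp
    moreover have "(1/3)^j / 2 * N (r j) \<ge> (1/3)^j / 2 * 4 ^ j"
      by (rule mult_left_mono) (use r[of j] in auto)
    moreover have "(1/3)^j / 2 * 4 ^ j = (4/3)^j / (2::real)" by (simp add: power_divide)
    ultimately show ?thesis by linarith
  qed
  show thesis
  proof (rule that[of s r])
    fix C :: real
    obtain j where "2 * C < (4/3) ^ j" using real_arch_pow[of "4/3" "2 * C"] by auto
    then show "\<exists>m. \<bar>\<Sum>i. s i * (1/3)^i * \<Lambda> (r i) m\<bar> > C"
      using big[of j] by (intro exI[of _ "r j"]) linarith
  qed (rule s1)
qed

text \<open>Pairings with the normalised gradients have norm at most 1 and attain the gradient norm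
  at their own index. Were the gradients unbounded, the gliding hump would produce from them a
  continuous functional that is unbounded along the sequence, whereas its values there
  converge.\<close>

lemma L2H1_weak_conv_bounded:
  assumes \<Omega>: "open \<Omega>" "bounded \<Omega>" and F: "L2H1_weak_conv T \<Omega> F f"
  obtains C where "0 \<le> C" "\<And>m. L2_norm (cyl T \<Omega>) (space_grad T \<Omega> (F m)) \<le> C"
proof -
  let ?M = "cyl T \<Omega>"
  let ?g = "\<lambda>v. L2_norm ?M (space_grad T \<Omega> v)"
  have Fm: "F m \<in> L2H1 T \<Omega>" for m using F by (simp add: L2H1_weak_conv_def)
  have "\<exists>C. \<forall>m. ?g (F m) \<le> C"
  proof (rule ccontr)
    assume "\<not> (\<exists>C. \<forall>m. ?g (F m) \<le> C)"
    then have unb: "\<exists>m. ?g (F m) > C" for C by (meson not_le)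
    \<comment> \<open>If the gradient has norm 0, the convention 1 / 0 = 0 makes \<open>D j\<close>
      vanish; hence \<open>nD\<close> is an inequality.\<close>
    define D where "D j = (\<lambda>p. (1 / ?g (F j)) *\<^sub>R space_grad T \<Omega> (F j) p)" for j
    have D: "D j \<in> L2 ?M" for j unfolding D_def by (rule L2_scaleR[OF space_grad_L2[OF Fm]])
    have nD: "L2_norm ?M (D j) \<le> 1" for j
    proof -
      have "L2_norm ?M (D j) = \<bar>1 / ?g (F j)\<bar> * ?g (F j)"
        unfolding D_def by (rule L2_norm_scaleR)
      then show ?thesis by simp
    qed
    have le: "\<bar>grad_pairing T \<Omega> (D j) v\<bar> \<le> ?g v" if "v \<in> L2H1 T \<Omega>" for j v
      using grad_pairing_linear(3)[OF \<Omega> D that, of j] mult_right_mono[OF nD[of j], of "?g v"] by simp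
    have eq: "grad_pairing T \<Omega> (D j) (F j) = ?g (F j)" for j
    proof -
      have "grad_pairing T \<Omega> (D j) (F j) = (1 / ?g (F j)) * (?g (F j))\<^sup>2"
        unfolding grad_pairing_def D_def L2_norm_power2 by (simp add: power2_norm_eq_inner)
      then show ?thesis by (simp add: power2_eq_square)
    qed
    obtain s r where s: "\<And>i. \<bar>s i\<bar> = (1::real)"
      and big: "\<And>C. \<exists>m. \<bar>\<Sum>i. s i * (1/3)^i * grad_pairing T \<Omega> (D (r i)) (F m)\<bar> > C"
      by (rule gliding_hump[of "\<lambda>m. ?g (F m)" "\<lambda>j m. grad_pairing T \<Omega> (D j) (F m)"])
        (use unb le[OF Fm] eq in auto)
    define L where "L v = (\<Sum>i. s i * (1/3)^i * grad_pairing T \<Omega> (D (r i)) v)" for v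
    have bnd: "\<bar>s i * (1/3)^i * grad_pairing T \<Omega> (D (r i)) v\<bar> \<le> (1/3)^i * ?g v" if "v \<in> L2H1 T \<Omega>" for i v
      using le[OF that, of "r i"] s[of i] by (simp add: abs_mult)
    \<comment> \<open>3/2 is the sum of the geometric series of ratio 1/3. The bound is needed on
      all of \<open>L2H1\<close>, not merely along \<open>F\<close>, for \<open>L\<close> to be an
      admissible functional.\<close>
    have gs: "(\<lambda>i. (1/3)^i * ?g v) sums (3/2 * ?g v)" for v
      using sums_mult2[OF geometric_sums[of "1/3::real"], of "?g v"] by simp
    have summ: "summable (\<lambda>i. s i * (1/3)^i * grad_pairing T \<Omega> (D (r i)) v)" if "v \<in> L2H1 T \<Omega>" for v
      by (rule summable_comparison_test'[OF sums_summable[OF gs[of v]], of 0]) (use bnd[OF that] in auto)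
    have "L2H1_functional T \<Omega> L"
      unfolding L2H1_functional_def
    proof (intro conjI ballI allI exI)
      fix v w assume v: "v \<in> L2H1 T \<Omega>" and w: "w \<in> L2H1 T \<Omega>"
      show "L (\<lambda>p. v p + w p) = L v + L w"
        unfolding L_def grad_pairing_linear(1)[OF \<Omega> D v w]
        by (subst suminf_add[OF summ[OF v] summ[OF w]]) (simp add: algebra_simps)
    next
      fix c v assume v: "v \<in> L2H1 T \<Omega>"
      show "L (\<lambda>p. c * v p) = c * L v"
        unfolding L_def grad_pairing_linear(2)[OF \<Omega> D v]
        by (subst suminf_mult[OF summ[OF v], symmetric]) (simp add: mult_ac)
    next
      fix v assume v: "v \<in> L2H1 T \<Omega>"
      have "\<bar>L v\<bar> \<le> (\<Sum>i. (1/3)^i * ?g v)"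
        unfolding L_def real_norm_def[symmetric]
        by (rule norm_suminf_le[OF _ sums_summable[OF gs[of v]]]) (use bnd[OF v] in \<open>simp only: real_norm_def\<close>)
      then have "\<bar>L v\<bar> \<le> 3/2 * ?g v" using sums_unique[OF gs[of v]] by simp
      then show "\<bar>L v\<bar> \<le> 3/2 * L2H1_norm T \<Omega> v"
        using L2_norm_space_grad_le[of T \<Omega> v] by linarith
    qed
    then have "(\<lambda>m. L (F m)) \<longlonglongrightarrow> L f" using F by (simp add: L2H1_weak_conv_def)
    then have "Bseq (\<lambda>m. L (F m))" by (intro convergent_imp_Bseq convergentI)
    then obtain C where "\<And>m. \<bar>L (F m)\<bar> \<le> C" by (auto simp: Bseq_def)
    then show False using big[of C] by (auto simp: L_def not_less[symmetric])
  qed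
  then obtain C where C: "\<And>m. ?g (F m) \<le> C" by blast
  then have "0 \<le> C" using L2_norm_nonneg order_trans by blast
  with C that show thesis by blast
qed

section \<open>Finite elements on a simplicial mesh\<close>

text \<open>Affine independence makes the differences to one fixed vertex linearly independent, so a
  linear form with the prescribed increments exists.\<close>

lemma affine_interpolation:
  fixes C :: "'a::euclidean_space set" and w :: "'a \<Rightarrow> real"
  assumes C: "\<not> affine_dependent C"
  shows "\<exists>a c. \<forall>x\<in>C. w x = a \<bullet> x + c"
proof (cases "C = {}")
  case False
  then obtain x0 where x0: "x0 \<in> C" by blast
  let ?B = "(\<lambda>x. - x0 + x) ` (C - {x0})"
  have "independent ?B" using C affine_dependent_iff_dependent2[OF x0] by blast
  from linear_independent_extend[OF this, of "\<lambda>y. w (x0 + y) - w x0"]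
  obtain f where f: "linear f" "\<And>y. y \<in> ?B \<Longrightarrow> f y = w (x0 + y) - w x0" by blast
  define a where "a = (\<Sum>b\<in>Basis. f b *\<^sub>R b)"
  have fa: "f y = a \<bullet> y" for y
  proof -
    have "f y = f (\<Sum>b\<in>Basis. (y \<bullet> b) *\<^sub>R b)" by (simp only: euclidean_representation)
    also have "\<dots> = (\<Sum>b\<in>Basis. (y \<bullet> b) * f b)"
      by (simp only: linear_sum[OF f(1)] linear_cmul[OF f(1)] real_scaleR_def)
    also have "\<dots> = a \<bullet> y" unfolding a_def by (simp add: inner_sum_left inner_commute[of y] mult.commute)
    finally show ?thesis .
  qed
  have "w x = a \<bullet> x + (w x0 - a \<bullet> x0)" if "x \<in> C" for x
  proof (cases "x = x0")
    case False
    then have "- x0 + x \<in> ?B" using that by blast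
    from f(2)[OF this] fa[of "- x0 + x"] show ?thesis by (simp add: inner_diff_right)
  qed simp
  then show ?thesis by blast
qed simp

text \<open>A Lipschitz domain is the interior of its closure. A mesh is only asked to cover the
  closure of \<Omega>, so it must be excluded that a simplex crosses a slit. From a point of
  \<open>S\<close> outside \<Omega>, a small move against e would lead to a point of
  \<open>S\<close> having a neighbourhood disjoint from \<Omega>.\<close>

lemma lipschitz_boundary_open_subset:
  fixes \<Omega> :: "'a::euclidean_space set"
  assumes \<Omega>: "open \<Omega>" "lipschitz_boundary \<Omega>" and S: "open S" "S \<subseteq> closure \<Omega>"
  shows "S \<subseteq> \<Omega>"
proof
  fix x assume x: "x \<in> S"
  show "x \<in> \<Omega>"
  proof (rule ccontr)
    assume n: "x \<notin> \<Omega>"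
    then have "x \<in> frontier \<Omega>" using x S \<Omega>(1) by (auto simp: frontier_def interior_open)
    then obtain e \<gamma> L r where e: "norm e = 1" "0 < r" "L-lipschitz_on UNIV \<gamma>"
      "\<Omega> \<inter> ball x r = {y \<in> ball x r. \<gamma> (y - (y \<bullet> e) *\<^sub>R e) < y \<bullet> e}"
      using \<Omega>(2) unfolding lipschitz_boundary_def by blast
    let ?F = "\<lambda>y. \<gamma> (y - (y \<bullet> e) *\<^sub>R e) - y \<bullet> e"
    have cont: "continuous_on UNIV ?F"
      by (intro continuous_intros continuous_on_compose2[OF lipschitz_on_continuous_on[OF e(3)]]) auto
    have Fx: "0 \<le> ?F x" using n e(2,4) by fastforce
    obtain s where s: "0 < s" "ball x s \<subseteq> S" using S x open_contains_ball by blast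
    \<comment> \<open>Half the smaller radius keeps y in both balls. The component orthogonal to e
      is unchanged, so \<gamma> keeps its value and \<open>?F\<close> increases.\<close>
    define y where "y = x - (min r s / 2) *\<^sub>R e"
    have ee: "e \<bullet> e = 1" using e(1) by (simp add: dot_square_norm)
    have "y - (y \<bullet> e) *\<^sub>R e = x - (x \<bullet> e) *\<^sub>R e"
      unfolding y_def by (simp add: inner_diff_left ee scaleR_diff_left)
    moreover have "y \<bullet> e = x \<bullet> e - min r s / 2" unfolding y_def by (simp add: inner_diff_left ee)
    ultimately have "0 < ?F y" using Fx e(2) s(1) by simp
    moreover have "dist x y < min r s" using e(1,2) s(1) unfolding y_def dist_norm by (auto simp: min_less_iff_disj)
    then have y: "y \<in> ball x r" "y \<in> ball x s" by auto
    let ?U = "{z. 0 < ?F z} \<inter> ball x r"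
    have "open {z. 0 < ?F z}" by (rule open_Collect_less[OF continuous_on_const cont])
    then have "open ?U" by auto
    moreover have "y \<in> ?U" using \<open>0 < ?F y\<close> y by blast
    moreover have "?U \<inter> \<Omega> = {}"
    proof -
      have "?F z < 0" if "z \<in> \<Omega>" "z \<in> ball x r" for z
        using that e(4) by (metis (no_types, lifting) IntI diff_less_0_iff_less mem_Collect_eq)
      then show ?thesis by force
    qed
    ultimately have "y \<notin> closure \<Omega>" by (meson disjoint_iff open_Int_closure_eq_empty)
    then show False using y(2) s(2) S(2) by blast
  qed
qed

locale fe_mesh =
  fixes \<Omega> :: "'a::euclidean_space set" and \<T> :: "'a set set"
  assumes open_domain: "open \<Omega>" and bounded_domain: "bounded \<Omega>" and nonempty_domain: "\<Omega> \<noteq> {}"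
    and lipschitz_domain: "lipschitz_boundary \<Omega>" and mesh: "is_mesh \<Omega> \<T>"
begin

lemma finite_mesh: "finite \<T>" using mesh by (simp add: is_mesh_def)

lemma closure_cover: "(\<Union>S\<in>\<T>. closure S) = closure \<Omega>" using mesh by (simp add: is_mesh_def)

lemma mesh_nonempty: "\<T> \<noteq> {}" using closure_cover nonempty_domain closure_eq_empty by (metis UN_empty)

text \<open>A simplex of full dimension spans the space, so its interior is its relative interior,
  is nonempty, and has the simplex as closure. Affine independence makes the generating points
  exactly the extreme points, which is how \<open>verts\<close> recovers the vertices from an open
  set.\<close>

lemma
  assumes S: "S \<in> \<T>"
  shows finite_verts: "finite (verts S)" and card_verts: "card (verts S) = Suc DIM('a)"
    and verts_independent: "\<not> affine_dependent (verts S)"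
    and closure_simplex: "closure S = convex hull (verts S)"
    and open_simplex: "open S" and simplex_nonempty: "S \<noteq> {}" and convex_simplex: "convex S"
    and bounded_simplex: "bounded S" and simplex_subset: "S \<subseteq> \<Omega>"
proof -
  obtain \<sigma> where \<sigma>: "int DIM('a) simplex \<sigma>" "S = interior \<sigma>" using mesh S by (auto simp: is_mesh_def)
  then obtain C where C: "finite C" "\<not> affine_dependent C" "int (card C) = int DIM('a) + 1" "\<sigma> = convex hull C"
    unfolding simplex by blast
  have cl: "closed \<sigma>" "convex \<sigma>" using \<sigma>(1) closed_simplex Polytope.convex_simplex by blast+
  have "aff_dim \<sigma> = int DIM('a)" using \<sigma>(1) by (rule aff_dim_simplex)
  then have "affine hull \<sigma> = UNIV" by (simp add: aff_dim_eq_full)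
  then have "rel_interior \<sigma> = interior \<sigma>" by (rule rel_interior_interior)
  moreover have "\<sigma> \<noteq> {}" using C(3,4) by auto
  ultimately have ne: "interior \<sigma> \<noteq> {}" using rel_interior_eq_empty[OF cl(2)] by simp
  have clS: "closure S = \<sigma>" using convex_closure_interior[OF cl(2) ne] cl(1) \<sigma>(2) by simp
  have vS: "verts S = C"
    unfolding verts_def clS C(4) using extreme_point_of_convex_hull_affine_independent[OF C(2)] by blast
  show "finite (verts S)" "card (verts S) = Suc DIM('a)" "\<not> affine_dependent (verts S)"
    "closure S = convex hull (verts S)" using vS C clS by auto
  show o: "open S" "S \<noteq> {}" "convex S" using \<sigma>(2) ne cl(2) by (auto simp: convex_interior)
  have "compact \<sigma>" using \<sigma>(1) by (rule compact_simplex)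
  then show "bounded S" using \<sigma>(2) bounded_subset compact_imp_bounded interior_subset by blast
  have "S \<subseteq> closure \<Omega>" using closure_cover S closure_subset by blast
  then show "S \<subseteq> \<Omega>" by (rule lipschitz_boundary_open_subset[OF open_domain lipschitz_domain o(1)])
qed

lemma closed_simplex_subset: "S \<in> \<T> \<Longrightarrow> closure S \<subseteq> closure \<Omega>"
  using closure_cover by blast

lemma verts_in_closure: "S \<in> \<T> \<Longrightarrow> verts S \<subseteq> closure S"
  by (simp add: closure_simplex hull_subset)

lemma verts_mesh_verts: "S \<in> \<T> \<Longrightarrow> verts S \<subseteq> mesh_verts \<T>"
  by (auto simp: mesh_verts_def)

lemma finite_mesh_verts: "finite (mesh_verts \<T>)"
  unfolding mesh_verts_def using finite_mesh finite_verts by blast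

lemma affine_on_simplex:
  assumes S: "S \<in> \<T>" and x: "x \<in> closure S"
  obtains t where "\<And>K. K \<in> verts S \<Longrightarrow> 0 \<le> t K" "sum t (verts S) = 1" "x = (\<Sum>K\<in>verts S. t K *\<^sub>R K)"
    "\<And>a c. a \<bullet> x + c = (\<Sum>K\<in>verts S. t K * (a \<bullet> K + c))"
proof -
  obtain t where t: "\<And>K. K \<in> verts S \<Longrightarrow> 0 \<le> t K" "sum t (verts S) = 1" "(\<Sum>K\<in>verts S. t K *\<^sub>R K) = x"
    using x unfolding closure_simplex[OF S] convex_hull_finite[OF finite_verts[OF S]] by blast
  have "a \<bullet> x + c = (\<Sum>K\<in>verts S. t K * (a \<bullet> K + c))" for a c
  proof -
    have "(\<Sum>K\<in>verts S. t K * (a \<bullet> K + c)) = (\<Sum>K\<in>verts S. t K * (a \<bullet> K)) + (\<Sum>K\<in>verts S. t K) * c"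
      by (simp add: distrib_left sum.distrib sum_distrib_right)
    then show ?thesis using t(2,3) by (auto simp: inner_sum_right)
  qed
  with t that show thesis by blast
qed

text \<open>Absence of hanging nodes in usable form: the intersection is a face of both simplices, a
  compact convex set is the hull of its extreme points, and extreme points of a face are extreme in
  the simplex.\<close>

lemma verts_of_intersection:
  assumes S: "S \<in> \<T>" and S': "S' \<in> \<T>" and x: "x \<in> closure S" "x \<in> closure S'"
  shows "x \<in> convex hull (verts S \<inter> verts S')"
proof -
  have tri: "triangulation (closure ` \<T>)" using mesh by (simp add: is_mesh_def)
  let ?F = "closure S \<inter> closure S'"
  have f: "?F face_of closure S" using tri S S' unfolding triangulation_def by blast
  have f': "?F face_of closure S'" using tri S S' unfolding triangulation_def by (metis Int_commute imageI)
  have "compact ?F" using bounded_simplex[OF S] by (simp add: compact_Int_closed)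
  moreover have "convex ?F" using convex_simplex S S' by (simp add: convex_Int convex_closure)
  ultimately have "?F = convex hull {y. y extreme_point_of ?F}" by (rule Krein_Milman_Minkowski)
  moreover have "{y. y extreme_point_of ?F} \<subseteq> verts S \<inter> verts S'"
    using extreme_point_of_face[OF f] extreme_point_of_face[OF f'] by (auto simp: verts_def)
  ultimately show ?thesis using x hull_mono by blast
qed

section \<open>P1 functions, the nodal basis and barycentric coordinates\<close>

lemma P1_affine:
  assumes v: "v \<in> P1 \<T>" and S: "S \<in> \<T>"
  obtains a c where "\<And>x. x \<in> closure S \<Longrightarrow> v x = a \<bullet> x + c"
proof -
  have "\<exists>a c. \<forall>x\<in>S. v x = a \<bullet> x + c" using v S unfolding P1_def by blast
  then obtain a c where ac: "\<And>x. x \<in> S \<Longrightarrow> v x = a \<bullet> x + c" by blast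
  have "continuous_on (closure S) v"
    using v closure_cover closed_simplex_subset[OF S] by (auto simp: P1_def intro: continuous_on_subset)
  then have "continuous_on (closure S) (\<lambda>x. v x - (a \<bullet> x + c))"
    by (intro continuous_intros)
  then have "v x - (a \<bullet> x + c) = 0" if "x \<in> closure S" for x
    by (rule continuous_constant_on_closure) (use ac that in auto)
  with that[of a c] show thesis by simp
qed

lemma P1_eqI:
  assumes v: "v \<in> P1 \<T>" "v' \<in> P1 \<T>" and eq: "\<And>K. K \<in> mesh_verts \<T> \<Longrightarrow> v K = v' K"
  shows "v = v'"
proof
  fix x
  show "v x = v' x"
  proof (cases "\<exists>S\<in>\<T>. x \<in> closure S")
    case True
    then obtain S where S: "S \<in> \<T>" "x \<in> closure S" by blast
    obtain a c where ac: "\<And>x. x \<in> closure S \<Longrightarrow> v x = a \<bullet> x + c" by (rule P1_affine[OF v(1) S(1)]) (rule that)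
    obtain a' c' where ac': "\<And>x. x \<in> closure S \<Longrightarrow> v' x = a' \<bullet> x + c'" by (rule P1_affine[OF v(2) S(1)]) (rule that)
    obtain t where t: "\<And>a c. a \<bullet> x + c = (\<Sum>K\<in>verts S. t K * (a \<bullet> K + c))"
      by (rule affine_on_simplex[OF S]) (rule that)
    have "(\<Sum>K\<in>verts S. t K * (a \<bullet> K + c)) = (\<Sum>K\<in>verts S. t K * (a' \<bullet> K + c'))"
    proof (rule sum.cong[OF refl])
      fix K assume "K \<in> verts S"
      then have "K \<in> closure S" "K \<in> mesh_verts \<T>" using verts_in_closure verts_mesh_verts S(1) by blast+
      then show "t K * (a \<bullet> K + c) = t K * (a' \<bullet> K + c')" using ac ac' eq by metis
    qed
    then show ?thesis using ac[OF S(2)] ac'[OF S(2)] t by simp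
  next
    case False
    then show ?thesis using v by (auto simp: P1_def)
  qed
qed

text \<open>The affine interpolants on two simplices agree at common vertices, hence on their hull,
  which contains the whole intersection. So the local interpolants glue to a continuous
  function.\<close>

lemma P1_exists: "\<exists>v\<in>P1 \<T>. \<forall>K\<in>mesh_verts \<T>. v K = w K"
proof -
  have "\<exists>a c. \<forall>x\<in>verts S. w x = a \<bullet> x + c" if "S \<in> \<T>" for S
    by (rule affine_interpolation[OF verts_independent[OF that]])
  then obtain a c where ac: "\<And>S x. S \<in> \<T> \<Longrightarrow> x \<in> verts S \<Longrightarrow> w x = a S \<bullet> x + c S"
    by metis
  have agree: "a S \<bullet> x + c S = a S' \<bullet> x + c S'"
    if S: "S \<in> \<T>" "S' \<in> \<T>" "x \<in> closure S" "x \<in> closure S'" for S S' x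
  proof -
    have "x \<in> convex hull (verts S \<inter> verts S')" by (rule verts_of_intersection[OF S])
    also have "\<dots> \<subseteq> {x. (a S - a S') \<bullet> x = c S' - c S}"
    proof (rule hull_minimal)
      show "convex {x. (a S - a S') \<bullet> x = c S' - c S}" by (rule convex_hyperplane)
      show "verts S \<inter> verts S' \<subseteq> {x. (a S - a S') \<bullet> x = c S' - c S}"
    proof
      fix K assume "K \<in> verts S \<inter> verts S'"
      then have "a S \<bullet> K + c S = a S' \<bullet> K + c S'" using ac S(1,2) by (metis IntD1 IntD2)
      then show "K \<in> {x. (a S - a S') \<bullet> x = c S' - c S}" by (simp add: inner_diff_left)
    qed
    qed
    finally show ?thesis by (simp add: inner_diff_left)
  qed
  \<comment> \<open>Which simplex containing x is selected does not matter, by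
    \<open>agree\<close>.\<close>
  define v where "v x = (if \<exists>S\<in>\<T>. x \<in> closure S then
      a (SOME S. S \<in> \<T> \<and> x \<in> closure S) \<bullet> x + c (SOME S. S \<in> \<T> \<and> x \<in> closure S) else 0)" for x
  have v: "v x = a S \<bullet> x + c S" if "S \<in> \<T>" "x \<in> closure S" for S x
  proof -
    let ?S = "SOME S. S \<in> \<T> \<and> x \<in> closure S"
    have "?S \<in> \<T> \<and> x \<in> closure ?S" by (rule someI_ex) (use that in blast)
    then have "a ?S \<bullet> x + c ?S = a S \<bullet> x + c S" using that by (intro agree) auto
    then show ?thesis using that unfolding v_def by auto
  qed
  have "continuous_on (\<Union>S\<in>\<T>. closure S) v"
  proof (rule continuous_on_closed_Union[OF finite_mesh])
    show "continuous_on (closure S) v" if "S \<in> \<T>" for S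
    proof -
      have "continuous_on (closure S) (\<lambda>x. a S \<bullet> x + c S)" by (intro continuous_intros)
      then show ?thesis by (rule continuous_on_eq) (use v that in auto)
    qed
  qed auto
  moreover have "\<forall>S\<in>\<T>. \<exists>a c. \<forall>x\<in>S. v x = a \<bullet> x + c" using v closure_subset by blast
  ultimately have "v \<in> P1 \<T>" by (auto simp: P1_def v_def)
  moreover have "v K = w K" if K: "K \<in> mesh_verts \<T>" for K
  proof -
    obtain S where S: "S \<in> \<T>" "K \<in> verts S" using K by (auto simp: mesh_verts_def)
    then have "K \<in> closure S" using verts_in_closure by blast
    then show ?thesis using v[OF S(1)] ac[OF S] by simp
  qed
  ultimately show ?thesis by blast
qed

abbreviation e :: "'a \<Rightarrow> 'a \<Rightarrow> real" where "e \<equiv> nodal_basis \<T>"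

lemma nodal: "e K \<in> P1 \<T>" "L \<in> mesh_verts \<T> \<Longrightarrow> e K L = (if L = K then 1 else 0)"
proof -
  have "\<exists>!v. v \<in> P1 \<T> \<and> (\<forall>L\<in>mesh_verts \<T>. v L = (if L = K then 1 else 0))"
  proof (rule ex_ex1I)
    show "\<exists>v. v \<in> P1 \<T> \<and> (\<forall>L\<in>mesh_verts \<T>. v L = (if L = K then 1 else 0))"
      using P1_exists[of "\<lambda>L. if L = K then 1 else 0"] by blast
  qed (rule P1_eqI, auto)
  from theI'[OF this]
  show "e K \<in> P1 \<T>" "L \<in> mesh_verts \<T> \<Longrightarrow> e K L = (if L = K then 1 else 0)"
    unfolding nodal_basis_def by auto
qed

abbreviation G :: "'a set \<Rightarrow> 'a \<Rightarrow> 'a" where "G S K \<equiv> simplex_grad S (e K)"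

lemma simplex_grad_affine:
  assumes "open S" "S \<noteq> {}" and v: "\<And>x. x \<in> S \<Longrightarrow> v x = a \<bullet> x + c"
  shows "simplex_grad S v = a"
proof -
  have d: "GDERIV v x :> a" if "x \<in> S" for x
  proof -
    have "GDERIV (\<lambda>x. a \<bullet> x + c) x :> a"
      unfolding gderiv_def by (auto intro!: derivative_eq_intros simp: inner_commute)
    then show ?thesis
      unfolding gderiv_def by (rule has_derivative_transform_within_open[OF _ assms(1) that]) (use v in auto)
  qed
  obtain x where x: "x \<in> S" using assms(2) by blast
  show ?thesis unfolding simplex_grad_def
  proof (rule the_equality)
    fix g assume "\<forall>x\<in>S. GDERIV v x :> g"
    then have "GDERIV v x :> g" using x by blast
    with d[OF x] show "g = a" using grad_eq by metis
  qed (use d in blast)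
qed

lemma P1_diff:
  assumes v: "v \<in> P1 \<T>" and S: "S \<in> \<T>" and x: "x \<in> closure S" "y \<in> closure S"
  shows "v x - v y = simplex_grad S v \<bullet> (x - y)"
proof -
  obtain a c where ac: "\<And>x. x \<in> closure S \<Longrightarrow> v x = a \<bullet> x + c" by (rule P1_affine[OF v S]) (rule that)
  have "simplex_grad S v = a"
    by (rule simplex_grad_affine[OF open_simplex[OF S] simplex_nonempty[OF S]])
      (use ac closure_subset in blast)
  then show ?thesis using ac x by (simp add: inner_diff_right)
qed

text \<open>On one simplex the nodal functions are the barycentric coordinates: they are affine
  there with values 0 and 1 at the vertices, so they reproduce the weights of the convex combination
  that represents x.\<close>

lemma barycentric:
  assumes S: "S \<in> \<T>" and x: "x \<in> closure S"
  shows "\<And>K. 0 \<le> e K x" "\<And>K. K \<notin> verts S \<Longrightarrow> e K x = 0" "(\<Sum>K\<in>verts S. e K x) = 1"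
    "(\<Sum>K\<in>verts S. e K x *\<^sub>R K) = x" "\<And>v. v \<in> P1 \<T> \<Longrightarrow> v x = (\<Sum>K\<in>verts S. v K * e K x)"
proof -
  obtain t where t: "\<And>K. K \<in> verts S \<Longrightarrow> 0 \<le> t K" "sum t (verts S) = 1" "x = (\<Sum>K\<in>verts S. t K *\<^sub>R K)"
    "\<And>a c. a \<bullet> x + c = (\<Sum>K\<in>verts S. t K * (a \<bullet> K + c))" by (rule affine_on_simplex[OF S x]) (rule that)
  have P: "v x = (\<Sum>K\<in>verts S. t K * v K)" if v: "v \<in> P1 \<T>" for v
  proof -
    obtain a c where ac: "\<And>x. x \<in> closure S \<Longrightarrow> v x = a \<bullet> x + c" by (rule P1_affine[OF v S]) (rule that)
    have "(\<Sum>K\<in>verts S. t K * v K) = (\<Sum>K\<in>verts S. t K * (a \<bullet> K + c))"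
      by (rule sum.cong) (use ac verts_in_closure[OF S] in auto)
    then show ?thesis using ac[OF x] t(4) by simp
  qed
  have eK: "e K x = (if K \<in> verts S then t K else 0)" for K
  proof -
    have "e K x = (\<Sum>L\<in>verts S. t L * e K L)" by (rule P[OF nodal(1)])
    also have "\<dots> = (\<Sum>L\<in>verts S. if L = K then t L else 0)"
      by (rule sum.cong) (use nodal(2)[of _ K] verts_mesh_verts[OF S] in auto)
    also have "\<dots> = (if K \<in> verts S then t K else 0)" using finite_verts[OF S] by simp
    finally show ?thesis .
  qed
  show "\<And>K. 0 \<le> e K x" "\<And>K. K \<notin> verts S \<Longrightarrow> e K x = 0" "(\<Sum>K\<in>verts S. e K x) = 1"
    "(\<Sum>K\<in>verts S. e K x *\<^sub>R K) = x" "\<And>v. v \<in> P1 \<T> \<Longrightarrow> v x = (\<Sum>K\<in>verts S. v K * e K x)"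
    unfolding eK using t(1,2) t(3)[symmetric] P by (simp_all add: mult.commute)
qed

text \<open>An open simplex contains a segment in the direction g - h, along which the hypothesis
  forces g - h to have norm 0.\<close>

lemma eq_grad_if_affine_zero:
  assumes S: "S \<in> \<T>" and z: "\<And>x y. x \<in> S \<Longrightarrow> y \<in> S \<Longrightarrow> g \<bullet> (x - y) = h \<bullet> (x - y)"
  shows "g = h"
proof -
  obtain x r where r: "0 < r" "ball x r \<subseteq> S"
    using open_simplex[OF S] simplex_nonempty[OF S] by (metis ex_in_conv open_contains_ball)
  have x: "x \<in> S" using r by (meson centre_in_ball subsetD)
  have "(g - h) \<bullet> (g - h) = 0"
  proof (cases "g = h")
    case False
    let ?y = "x + (r / 2 / norm (g - h)) *\<^sub>R (g - h)"
    have "?y \<in> ball x r" using r False by (simp add: dist_norm)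
    then have "?y \<in> S" using r by blast
    from z[OF this x] have "(g - h) \<bullet> ((r / 2 / norm (g - h)) *\<^sub>R (g - h)) = 0"
      by (simp only: inner_diff_left right_minus_eq add_diff_cancel_left')
    then have "(r / 2 / norm (g - h)) * ((g - h) \<bullet> (g - h)) = 0" by (simp only: inner_scaleR_right)
    then show ?thesis using r False by simp
  qed simp
  then show ?thesis by simp
qed

text \<open>All three compare increments of affine functions over \<open>S\<close>: of the constant
  1, of the linear function given by b, and of v. The first makes discrete gradients blind to
  constants, the second makes them exact on linear functions.\<close>

lemma sum_G:
  assumes S: "S \<in> \<T>"
  shows "(\<Sum>K\<in>verts S. G S K) = 0" "(\<Sum>K\<in>verts S. (b \<bullet> K) *\<^sub>R G S K) = b"
    "v \<in> P1 \<T> \<Longrightarrow> simplex_grad S v = (\<Sum>K\<in>verts S. v K *\<^sub>R G S K)"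
proof -
  have d: "(\<Sum>K\<in>verts S. w K *\<^sub>R G S K) \<bullet> (x - y) = (\<Sum>K\<in>verts S. w K * e K x) - (\<Sum>K\<in>verts S. w K * e K y)"
    if "x \<in> S" "y \<in> S" for w x y
  proof -
    have "x \<in> closure S" "y \<in> closure S" using that closure_subset by blast+
    then show ?thesis
      by (simp add: inner_sum_left sum_subtractf[symmetric] right_diff_distrib[symmetric] P1_diff[OF nodal(1) S])
  qed
  have c: "x \<in> S \<Longrightarrow> x \<in> closure S" for x using closure_subset by blast
  show "(\<Sum>K\<in>verts S. G S K) = 0"
  proof (rule eq_grad_if_affine_zero[OF S])
    fix x y assume "x \<in> S" "y \<in> S"
    then show "(\<Sum>K\<in>verts S. G S K) \<bullet> (x - y) = 0 \<bullet> (x - y)"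
      using d[of x y "\<lambda>_. 1"] barycentric(3)[OF S c] by simp
  qed
  show "(\<Sum>K\<in>verts S. (b \<bullet> K) *\<^sub>R G S K) = b"
  proof (rule eq_grad_if_affine_zero[OF S])
    fix x y assume xy: "x \<in> S" "y \<in> S"
    have *: "(\<Sum>K\<in>verts S. (b \<bullet> K) * e K x) = b \<bullet> x" if "x \<in> S" for x
    proof -
      have "b \<bullet> x = b \<bullet> (\<Sum>K\<in>verts S. e K x *\<^sub>R K)" using barycentric(4)[OF S c[OF that]] by simp
      then show ?thesis by (simp add: inner_sum_right mult.commute)
    qed
    show "(\<Sum>K\<in>verts S. (b \<bullet> K) *\<^sub>R G S K) \<bullet> (x - y) = b \<bullet> (x - y)"
      using d[OF xy, of "\<lambda>K. b \<bullet> K"] * xy by (simp add: inner_diff_right)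
  qed
  assume v: "v \<in> P1 \<T>"
  show "simplex_grad S v = (\<Sum>K\<in>verts S. v K *\<^sub>R G S K)"
  proof (rule eq_grad_if_affine_zero[OF S])
    fix x y assume xy: "x \<in> S" "y \<in> S"
    show "simplex_grad S v \<bullet> (x - y) = (\<Sum>K\<in>verts S. v K *\<^sub>R G S K) \<bullet> (x - y)"
      using d[OF xy, of v] P1_diff[OF v S c c, OF xy] barycentric(5)[OF S c v] xy by simp
  qed
qed

lemma nodal_le_1: "S \<in> \<T> \<Longrightarrow> x \<in> closure S \<Longrightarrow> e K x \<le> 1"
proof -
  assume S: "S \<in> \<T>" and x: "x \<in> closure S"
  show "e K x \<le> 1"
  proof (cases "K \<in> verts S")
    case True
    have "e K x \<le> (\<Sum>L\<in>verts S. e L x)"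
      by (rule member_le_sum) (use True barycentric(1)[OF S x] finite_verts[OF S] in auto)
    then show ?thesis using barycentric(3)[OF S x] by simp
  qed (use barycentric(2)[OF S x] in auto)
qed

text \<open>A barycentric coordinate stays between 0 and 1, while a move of length q along its
  gradient, inside an inscribed ball, raises it by q times the norm of \<open>G S K\<close>.\<close>

lemma norm_G_inradius:
  assumes S: "S \<in> \<T>"
  shows "0 < inradius S" "norm (G S K) * inradius S \<le> 1"
proof -
  let ?R = "{r. \<exists>x. ball x r \<subseteq> S}"
  obtain x r where r: "0 < r" "ball x r \<subseteq> S"
    using open_simplex[OF S] simplex_nonempty[OF S] by (metis ex_in_conv open_contains_ball)
  \<comment> \<open>Balls of nonpositive radius are empty, so \<open>?R\<close> contains all
    nonpositive numbers; only positive members need the diameter argument.\<close>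
  have bnd: "s \<le> diameter S" if s: "s \<in> ?R" for s
  proof (cases "0 < s")
    case True
    obtain y where y: "ball y s \<subseteq> S" using s by blast
    have "diameter (ball y s) \<le> diameter S"
      by (rule diameter_subset[OF y bounded_simplex[OF S]])
    then show ?thesis using True by (simp add: diameter_ball)
  next
    case False
    then show ?thesis using diameter_ge_0[OF bounded_simplex[OF S]] by linarith
  qed
  then have "bdd_above ?R" by (auto simp: bdd_above_def)
  then have "r \<le> inradius S" unfolding inradius_def by (intro cSup_upper) (use r in auto)
  then show "0 < inradius S" using r by linarith
  show "norm (G S K) * inradius S \<le> 1"
  proof (cases "G S K = 0")
    case False
    let ?g = "G S K"
    have "s \<le> 1 / norm ?g" if s: "s \<in> ?R" for s
    proof (rule ccontr)
      assume n: "\<not> s \<le> 1 / norm ?g"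
      then have s0: "0 < s" "1 / norm ?g < s"
        by (auto simp: not_le intro: order_le_less_trans[rotated])
      obtain y where y: "ball y s \<subseteq> S" using s by blast
      \<comment> \<open>Balls are open, so the move must be strictly shorter than s and still longer
        than 1 / norm g.\<close>
      obtain q where q: "1 / norm ?g < q" "q < s" using dense s0(2) by blast
      have q0: "0 < q" using q(1) by (rule order_le_less_trans[rotated]) simp
      let ?z = "y + (q / norm ?g) *\<^sub>R ?g"
      have "?z \<in> ball y s" using q q0 False by (simp add: dist_norm)
      moreover have "y \<in> ball y s" using s0 by simp
      ultimately have c: "?z \<in> closure S" "y \<in> closure S" using y closure_subset by blast+
      have "e K ?z - e K y = ?g \<bullet> (?z - y)" by (rule P1_diff[OF nodal(1) S c])
      also have "\<dots> = q * norm ?g" using False by (simp add: dot_square_norm power2_eq_square)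
      finally have "q * norm ?g \<le> 1" using nodal_le_1[OF S c(1), of K] barycentric(1)[OF S c(2), of K] by linarith
      then show False using q(1) False by (simp add: field_simps)
    qed
    then have "inradius S \<le> 1 / norm ?g"
      unfolding inradius_def by (intro cSup_least) (use r in auto)
    then show ?thesis using False by (simp add: field_simps)
  qed simp
qed

lemma diameter_pos: "S \<in> \<T> \<Longrightarrow> 0 < diameter S"
proof -
  assume S: "S \<in> \<T>"
  have "card (verts S) \<noteq> card {x}" for x using card_verts[OF S] DIM_positive[where 'a='a] by simp
  moreover have "verts S \<noteq> {}" using card_verts[OF S] by auto
  ultimately obtain x y where "x \<in> verts S" "y \<in> verts S" "x \<noteq> y" by (metis is_singletonI' is_singleton_def)
  then have "x \<in> closure S" "y \<in> closure S" using verts_in_closure[OF S] by auto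
  then have "dist x y \<le> diameter S"
    using diameter_bounded_bound[of "closure S"] bounded_simplex[OF S] by (simp add: diameter_closure bounded_closure)
  with \<open>x \<noteq> y\<close> show "0 < diameter S" by (meson dist_pos_lt order_less_le_trans)
qed

text \<open>Shape regularity trades the inradius for the diameter, which later cancels against
  differences of nodal values over the simplex.\<close>

lemma norm_G_le:
  assumes reg: "mesh_regularity \<T> \<le> \<theta>" and S: "S \<in> \<T>"
  shows "norm (G S K) \<le> \<theta> / diameter S"
proof -
  have "diameter S / inradius S \<le> mesh_regularity \<T>"
    unfolding mesh_regularity_def by (rule Max_ge) (use finite_mesh S in auto)
  then have *: "diameter S \<le> \<theta> * inradius S"
    using norm_G_inradius(1)[OF S] mult_right_mono[OF reg less_imp_le[OF norm_G_inradius(1)[OF S]]]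
    by (simp only: pos_divide_le_eq)
  then have "norm (G S K) * diameter S \<le> norm (G S K) * (\<theta> * inradius S)"
    by (rule mult_left_mono) simp
  also have "\<dots> = \<theta> * (norm (G S K) * inradius S)" by simp
  also have "\<dots> \<le> \<theta> * 1"
  proof (rule mult_left_mono[OF norm_G_inradius(2)[OF S]])
    have "0 < \<theta> * inradius S" using diameter_pos[OF S] * by linarith
    then show "0 \<le> \<theta>" using norm_G_inradius(1)[OF S] by (simp add: zero_less_mult_iff)
  qed
  finally show ?thesis using diameter_pos[OF S] by (simp add: field_simps)
qed

lemma diameter_le_mesh_size: "S \<in> \<T> \<Longrightarrow> diameter S \<le> mesh_size \<T>"
  unfolding mesh_size_def by (rule Max_ge) (use finite_mesh in auto)

lemma mesh_size_pos: "0 < mesh_size \<T>"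
  using mesh_nonempty diameter_pos diameter_le_mesh_size by (meson all_not_in_conv order_less_le_trans)

lemma dist_simplex: "S \<in> \<T> \<Longrightarrow> x \<in> closure S \<Longrightarrow> y \<in> closure S \<Longrightarrow> norm (x - y) \<le> diameter S"
  using diameter_bounded_bound[of "closure S" x y] bounded_simplex[of S]
  by (simp add: diameter_closure dist_norm bounded_closure)

section \<open>Dual cells\<close>

abbreviation cell :: "'a \<Rightarrow> 'a set" where "cell \<equiv> dual_cell \<Omega> \<T>"

lemma continuous_on_nodal: "continuous_on \<Omega> (e K)"
  using nodal(1)[of K] closure_cover closure_subset[of \<Omega>] by (auto simp: P1_def intro: continuous_on_subset)

lemma open_cell: "open (cell K)"
proof -
  have "open {x \<in> \<Omega>. e L x < e K x}" for L
  proof -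
    have "open (\<Omega> \<inter> (\<lambda>x. e K x - e L x) -` {0<..})"
      by (rule continuous_open_preimage[OF _ open_domain]) (auto intro!: continuous_intros continuous_on_nodal)
    moreover have "\<Omega> \<inter> (\<lambda>x. e K x - e L x) -` {0<..} = {x \<in> \<Omega>. e L x < e K x}" by auto
    ultimately show ?thesis by simp
  qed
  moreover have "cell K = \<Omega> \<inter> (\<Inter>L\<in>mesh_verts \<T> - {K}. {x \<in> \<Omega>. e L x < e K x})"
    by (auto simp: dual_cell_def)
  ultimately show ?thesis using open_domain finite_mesh_verts by auto
qed

lemma cell_subset: "cell K \<subseteq> \<Omega>" by (auto simp: dual_cell_def)

lemma cell_borel: "cell K \<in> sets borel" using open_cell by simp

lemma cell_disjoint: "K \<in> mesh_verts \<T> \<Longrightarrow> L \<in> mesh_verts \<T> \<Longrightarrow> K \<noteq> L \<Longrightarrow> cell K \<inter> cell L = {}"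
proof (rule ccontr)
  assume K: "K \<in> mesh_verts \<T>" "L \<in> mesh_verts \<T>" "K \<noteq> L" and "cell K \<inter> cell L \<noteq> {}"
  then obtain x where "x \<in> cell K" "x \<in> cell L" by blast
  then have "e L x < e K x" "e K x < e L x" using K by (auto simp: dual_cell_def)
  then show False by simp
qed

lemma G_inj:
  assumes S: "S \<in> \<T>" and K: "K \<in> verts S" "L \<in> verts S" "K \<noteq> L"
  shows "G S K \<noteq> G S L"
proof
  assume eq: "G S K = G S L"
  have c: "K \<in> closure S" "L \<in> closure S" using K verts_in_closure[OF S] by auto
  have m: "K \<in> mesh_verts \<T>" "L \<in> mesh_verts \<T>" using K verts_mesh_verts[OF S] by auto
  show False
    using P1_diff[OF nodal(1) S c, of K] P1_diff[OF nodal(1) S c, of L] eq K(3)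
      nodal(2)[OF m(1)] nodal(2)[OF m(2)] by (auto split: if_splits)
qed

text \<open>A point of \<Omega> is lost only on the boundary of a simplex or where two barycentric
  coordinates of one simplex tie. Ties lie in a hyperplane, since two nodal functions of the same
  simplex have different gradients by \<open>G_inj\<close>.\<close>

lemma negligible_uncovered:
  "negligible {x \<in> \<Omega>. \<not> (\<exists>S\<in>\<T>. \<exists>K\<in>verts S. x \<in> S \<and> x \<in> cell K)}"
proof -
  let ?H = "\<lambda>S K L. {x. (G S K - G S L) \<bullet> x = (G S K - G S L) \<bullet> K - 1 + (e L K)}"
  let ?E = "\<lambda>S K L. {x \<in> S. e K x = e L x}"
  have 1: "negligible (?E S K L)" if S: "S \<in> \<T>" "K \<in> verts S" "L \<in> verts S" "K \<noteq> L" for S K L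
  proof -
    have K: "K \<in> closure S" using S verts_in_closure by blast
    have "?E S K L \<subseteq> {x. (G S K - G S L) \<bullet> x = (G S K - G S L) \<bullet> K - (e K K - e L K)}"
    proof
      fix x assume "x \<in> ?E S K L"
      then have x: "x \<in> closure S" "e K x = e L x" using closure_subset by blast+
      show "x \<in> {x. (G S K - G S L) \<bullet> x = (G S K - G S L) \<bullet> K - (e K K - e L K)}"
        using P1_diff[OF nodal(1) S(1) x(1) K, of K] P1_diff[OF nodal(1) S(1) x(1) K, of L] x(2)
        by (simp add: inner_diff_left inner_diff_right)
    qed
    moreover have "G S K - G S L \<noteq> 0" using G_inj[OF S] by simp
    ultimately show ?thesis using negligible_subset[OF negligible_hyperplane] by blast
  qed
  have 2: "negligible (frontier S)" if "S \<in> \<T>" for S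
    by (rule negligible_convex_frontier[OF convex_simplex[OF that]])
  let ?N = "(\<Union>S\<in>\<T>. frontier S) \<union> (\<Union>S\<in>\<T>. \<Union>K\<in>verts S. \<Union>L\<in>verts S - {K}. ?E S K L)"
  have "negligible ?N"
    using 1 2 finite_mesh finite_verts by (intro negligible_Un negligible_Union finite_imageI; (auto intro!: negligible_Union)?)
  moreover have "{x \<in> \<Omega>. \<not> (\<exists>S\<in>\<T>. \<exists>K\<in>verts S. x \<in> S \<and> x \<in> cell K)} \<subseteq> ?N"
  proof
    fix x assume "x \<in> {x \<in> \<Omega>. \<not> (\<exists>S\<in>\<T>. \<exists>K\<in>verts S. x \<in> S \<and> x \<in> cell K)}"
    then have x: "x \<in> \<Omega>" and n: "\<And>S K. S \<in> \<T> \<Longrightarrow> K \<in> verts S \<Longrightarrow> x \<in> S \<Longrightarrow> x \<notin> cell K" by auto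
    obtain S where S: "S \<in> \<T>" "x \<in> closure S" using x closure_cover closure_subset by blast
    show "x \<in> ?N"
    proof (cases "x \<in> S")
      case True
      have fin: "finite (verts S)" "verts S \<noteq> {}" using card_verts[OF S(1)] finite_verts[OF S(1)] by auto
      obtain K where K: "K \<in> verts S" "\<And>L. L \<in> verts S \<Longrightarrow> e L x \<le> e K x"
      proof -
        have "Max ((\<lambda>L. e L x) ` verts S) \<in> (\<lambda>L. e L x) ` verts S" using fin by (intro Max_in) auto
        then obtain K where "K \<in> verts S" "e K x = Max ((\<lambda>L. e L x) ` verts S)" by (metis imageE)
        then show thesis using fin that[of K] by simp
      qed
      \<comment> \<open>The coordinates sum to 1, so the largest is positive. Any vertex tying with
        it therefore belongs to \<open>S\<close>, as all other nodal functions vanish there.\<close>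
      have pos: "0 < e K x"
      proof (rule ccontr)
        assume "\<not> 0 < e K x"
        then have "(\<Sum>L\<in>verts S. e L x) \<le> 0"
          by (intro sum_nonpos) (use K(2) in force)
        then show False using barycentric(3)[OF S] by simp
      qed
      have "x \<notin> cell K" using n S K True by blast
      then obtain L where L: "L \<in> mesh_verts \<T>" "L \<noteq> K" "e K x \<le> e L x"
        using x by (auto simp: dual_cell_def not_less)
      have Lv: "L \<in> verts S" using barycentric(2)[OF S, of L] L(3) pos by force
      then have "e K x = e L x" using K(2) L(3) by force
      then show ?thesis using True S(1) K(1) Lv L(2) by blast
    next
      case False
      then show ?thesis using S open_simplex[OF S(1)] by (auto simp: frontier_def interior_open)
    qed
  qed
  ultimately show ?thesis by (rule negligible_subset)
qed

lemma AE_cell: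
  "AE x in lebesgue_on \<Omega>. \<exists>S\<in>\<T>. \<exists>K\<in>verts S. x \<in> S \<and> x \<in> cell K"
proof -
  have "AE x in lebesgue. x \<notin> {x \<in> \<Omega>. \<not> (\<exists>S\<in>\<T>. \<exists>K\<in>verts S. x \<in> S \<and> x \<in> cell K)}"
    using negligible_uncovered by (intro AE_not_in) (simp add: negligible_iff_null_sets)
  then have "AE x in lebesgue. x \<in> \<Omega> \<longrightarrow> (\<exists>S\<in>\<T>. \<exists>K\<in>verts S. x \<in> S \<and> x \<in> cell K)"
    by eventually_elim blast
  then show ?thesis using open_domain by (subst AE_restrict_space_iff) auto
qed

lemma simplices_disjoint: "S \<in> \<T> \<Longrightarrow> S' \<in> \<T> \<Longrightarrow> x \<in> S \<Longrightarrow> x \<in> S' \<Longrightarrow> S = S'"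
  using mesh unfolding is_mesh_def pairwise_def disjnt_def by blast

end

section \<open>Discrete gradients\<close>

context fe_mesh
begin

text \<open>The gradient on \<open>S\<close> of the P1 interpolant of w. It takes vertex values
  instead of a function, because \<mu>, sqrt u_0 and products of densities are given at the vertices
  only.\<close>

definition gr :: "'a set \<Rightarrow> ('a \<Rightarrow> real) \<Rightarrow> 'a" where
  "gr S w = (\<Sum>K\<in>verts S. w K *\<^sub>R G S K)"

lemma gr_linear: "gr S (\<lambda>K. a * v K + b * w K) = a *\<^sub>R gr S v + b *\<^sub>R gr S w"
  unfolding gr_def by (simp add: scaleR_left_distrib sum.distrib scaleR_right.sum)

lemma gr_affine: "S \<in> \<T> \<Longrightarrow> gr S (\<lambda>K. b \<bullet> K) = b"
  unfolding gr_def by (rule sum_G)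

lemma gr_const: "S \<in> \<T> \<Longrightarrow> gr S (\<lambda>K. c) = 0"
  unfolding gr_def using sum_G(1)[of S] by (simp add: scaleR_right.sum[symmetric])

lemma gr_diff:
  assumes S: "S \<in> \<T>" and x: "x \<in> closure S" "y \<in> closure S"
  shows "gr S w \<bullet> (x - y) = (\<Sum>K\<in>verts S. w K * e K x) - (\<Sum>K\<in>verts S. w K * e K y)"
  unfolding gr_def inner_sum_left sum_subtractf[symmetric] right_diff_distrib[symmetric]
  by (simp add: P1_diff[OF nodal(1) S x])

lemma sum_nodal_vertex:
  assumes S: "S \<in> \<T>" and L: "L \<in> verts S"
  shows "(\<Sum>K\<in>verts S. w K * e K L) = w L"
proof -
  have "L \<in> mesh_verts \<T>" using verts_mesh_verts[OF S] L by blast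
  then have "(\<Sum>K\<in>verts S. w K * e K L) = (\<Sum>K\<in>verts S. if K = L then w K else 0)"
    using nodal(2) by (intro sum.cong) auto
  also have "\<dots> = w L" using finite_verts[OF S] L by simp
  finally show ?thesis .
qed

lemma gr_vertices:
  assumes S: "S \<in> \<T>" and K: "K \<in> verts S" "L \<in> verts S"
  shows "\<bar>w L - w K\<bar> \<le> diameter S * norm (gr S w)"
proof -
  have c: "K \<in> closure S" "L \<in> closure S" using verts_in_closure[OF S] K by auto
  have *: "w L - w K = gr S w \<bullet> (L - K)"
    using gr_diff[OF S c(2,1), of w] sum_nodal_vertex[OF S K(1)] sum_nodal_vertex[OF S K(2)] by simp
  have "\<bar>gr S w \<bullet> (L - K)\<bar> \<le> norm (gr S w) * norm (L - K)" by (rule Cauchy_Schwarz_ineq2)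
  also have "\<dots> \<le> norm (gr S w) * diameter S"
    by (rule mult_left_mono[OF dist_simplex[OF S c(2,1)]]) simp
  finally show ?thesis by (simp add: * mult.commute)
qed

lemma norm_gr_le:
  assumes reg: "mesh_regularity \<T> \<le> \<theta>" and S: "S \<in> \<T>"
    and B: "\<And>L. L \<in> verts S \<Longrightarrow> \<bar>w L - c\<bar> \<le> B"
  shows "norm (gr S w) \<le> (real DIM('a) + 1) * \<theta> * B / diameter S"
proof -
  have "gr S w = gr S (\<lambda>K. 1 * w K + (- 1) * c)"
    unfolding gr_linear[of S 1 w "-1" "\<lambda>_. c"] using gr_const[OF S] by simp
  also have "\<dots> = (\<Sum>K\<in>verts S. (w K - c) *\<^sub>R G S K)" by (simp add: gr_def)
  finally have "norm (gr S w) \<le> (\<Sum>K\<in>verts S. norm ((w K - c) *\<^sub>R G S K))" by (simp only: norm_sum)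
  also have "\<dots> \<le> (\<Sum>K\<in>verts S. B * (\<theta> / diameter S))"
  proof (rule sum_mono)
    fix K assume K: "K \<in> verts S"
    then have "0 \<le> B" using B by force
    then show "norm ((w K - c) *\<^sub>R G S K) \<le> B * (\<theta> / diameter S)"
      using B[OF K] norm_G_le[OF reg S, of K] by (simp add: mult_mono del: times_divide_eq_right)
  qed
  also have "\<dots> = (real DIM('a) + 1) * \<theta> * B / diameter S"
    using card_verts[OF S] by (simp add: algebra_simps)
  finally show ?thesis .
qed

text \<open>The vectors \<open>G S L\<close> sum to 0, so the terms containing \<open>w K\<close>
  cancel; in the others the two minus signs compensate and leave the gradient of w.\<close>

lemma stiffness_sum:
  assumes S: "S \<in> \<T>"
  shows "(\<Sum>L\<in>verts S. stiffness \<T> S K L * (w K - w L)) = measure lebesgue S * (G S K \<bullet> gr S w)"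
proof -
  have "(\<Sum>L\<in>verts S. stiffness \<T> S K L * (w K - w L))
      = (\<Sum>L\<in>verts S. measure lebesgue S * (w L * (G S K \<bullet> G S L)) - measure lebesgue S * w K * (G S K \<bullet> G S L))"
    by (rule sum.cong) (simp_all add: stiffness_def algebra_simps)
  also have "\<dots> = measure lebesgue S * (G S K \<bullet> gr S w) - measure lebesgue S * w K * (G S K \<bullet> (\<Sum>L\<in>verts S. G S L))"
    by (simp add: sum_subtractf gr_def inner_sum_right sum_distrib_left)
  finally show ?thesis by (simp add: sum_G(1)[OF S])
qed

text \<open>Assembly by vertices is exchanged for assembly by simplices: the same incident pairs,
  summed in the other order.\<close>

lemma sum_simplices_at:
  "(\<Sum>K\<in>mesh_verts \<T>. \<Sum>S\<in>simplices_at \<T> K. f S K) = (\<Sum>S\<in>\<T>. \<Sum>K\<in>verts S. f S K)"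
  for f :: "'a set \<Rightarrow> 'a \<Rightarrow> real"
proof -
  have "(\<Sum>K\<in>mesh_verts \<T>. \<Sum>S\<in>simplices_at \<T> K. f S K)
      = (\<Sum>K\<in>mesh_verts \<T>. \<Sum>S\<in>\<T>. if K \<in> verts S then f S K else 0)"
    unfolding simplices_at_def by (intro sum.cong[OF refl] sum.inter_filter[OF finite_mesh])
  also have "\<dots> = (\<Sum>S\<in>\<T>. \<Sum>K\<in>mesh_verts \<T>. if K \<in> verts S then f S K else 0)"
    by (rule sum.swap)
  also have "\<dots> = (\<Sum>S\<in>\<T>. \<Sum>K\<in>verts S. f S K)"
  proof (rule sum.cong[OF refl])
    fix S assume S: "S \<in> \<T>"
    have "{K \<in> mesh_verts \<T>. K \<in> verts S} = verts S" using verts_mesh_verts[OF S] by blast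
    then show "(\<Sum>K\<in>mesh_verts \<T>. if K \<in> verts S then f S K else 0) = (\<Sum>K\<in>verts S. f S K)"
      using sum.inter_filter[OF finite_mesh_verts, of "\<lambda>K. f S K" "\<lambda>K. K \<in> verts S"] by simp
  qed
  finally show ?thesis .
qed

lemma gr_P1: "v \<in> P1 \<T> \<Longrightarrow> S \<in> \<T> \<Longrightarrow> simplex_grad S v = gr S v"
  unfolding gr_def by (rule sum_G(3))

lemma affine_combination_affine:
  assumes S: "S \<in> \<T>"
  obtains c where "\<And>x. x \<in> closure S \<Longrightarrow> (\<Sum>K\<in>mesh_verts \<T>. w K * e K x) = gr S w \<bullet> x + c"
    "\<And>x. x \<in> closure S \<Longrightarrow> (\<Sum>K\<in>mesh_verts \<T>. w K * e K x) = (\<Sum>K\<in>verts S. w K * e K x)"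
proof -
  obtain y where y: "y \<in> closure S" using simplex_nonempty[OF S] closure_subset by blast
  have *: "(\<Sum>K\<in>mesh_verts \<T>. w K * e K x) = (\<Sum>K\<in>verts S. w K * e K x)" if "x \<in> closure S" for x
    by (rule sum.mono_neutral_right)
      (use finite_mesh_verts verts_mesh_verts[OF S] barycentric(2)[OF S that] in auto)
  show thesis
  proof (rule that[of "(\<Sum>K\<in>verts S. w K * e K y) - gr S w \<bullet> y"])
    fix x assume x: "x \<in> closure S"
    show "(\<Sum>K\<in>mesh_verts \<T>. w K * e K x) = gr S w \<bullet> x + ((\<Sum>K\<in>verts S. w K * e K y) - gr S w \<bullet> y)"
      using gr_diff[OF S x y, of w] *[OF x] by (simp add: inner_diff_right)
  qed (rule *)
qed

lemma wgrad_P1: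
  assumes v: "v \<in> P1 \<T>" "v \<in> H1 \<Omega>"
  shows "AE x in lebesgue_on \<Omega>. \<forall>S\<in>\<T>. x \<in> S \<longrightarrow> wgrad \<Omega> v x = gr S v"
proof -
  have "AE x in lebesgue_on \<Omega>. x \<in> S \<longrightarrow> wgrad \<Omega> v x = gr S v" if S: "S \<in> \<T>" for S
  proof -
    obtain a c where ac: "\<And>x. x \<in> closure S \<Longrightarrow> v x = a \<bullet> x + c" by (rule P1_affine[OF v(1) S]) (rule that)
    have ac': "v x = a \<bullet> x + c" if "x \<in> S" for x using ac that closure_subset by blast
    have "gr S v = a"
      using simplex_grad_affine[OF open_simplex[OF S] simplex_nonempty[OF S] ac'] gr_P1[OF v(1) S] by simp
    moreover have "AE x in lebesgue_on S. wgrad \<Omega> v x = a"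
      by (rule weak_gradient_locally_affine[OF open_domain bounded_domain wgrad[OF v(2)] open_simplex[OF S] simplex_subset[OF S] ac'])
    ultimately have "AE x in lebesgue_on S. wgrad \<Omega> v x = gr S v" by simp
    then have "AE x in lborel. x \<in> S \<longrightarrow> wgrad \<Omega> v x = gr S v"
      using open_simplex[OF S] by (simp add: AE_lebesgue_on_iff)
    then have "AE x in lborel. x \<in> \<Omega> \<longrightarrow> x \<in> S \<longrightarrow> wgrad \<Omega> v x = gr S v"
      by eventually_elim simp
    then show ?thesis
      using open_domain by (simp add: AE_lebesgue_on_iff)
  qed
  then show ?thesis by (simp add: AE_ball_countable countable_finite[OF finite_mesh])
qed

end

section \<open>Space-time reconstructions\<close>

locale fe_disc =
  fixes P :: "'a::euclidean_space problem" and D :: "'a discretisation"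
  assumes problem: "admissible_problem P" and discr: "is_discretisation P D"
begin

abbreviation "\<Omega> \<equiv> dom_Omega P"
abbreviation "T \<equiv> horizon P"
abbreviation "\<T> \<equiv> mesh D"
abbreviation "N \<equiv> nsteps D"
abbreviation "I \<equiv> lebesgue_on {0<..<T}"
abbreviation "M \<equiv> lebesgue_on \<Omega>"
abbreviation "Q \<equiv> cyl T \<Omega>"
abbreviation slab :: "nat \<Rightarrow> real set" where "slab k \<equiv> {tgrid D (k - 1)<..tgrid D k}"

lemma problem_facts:
  "open \<Omega>" "bounded \<Omega>" "lipschitz_boundary \<Omega>" "0 < T" "\<Omega> \<noteq> {}" "\<Omega> \<in> sets borel"
proof -
  show o: "open \<Omega>" "bounded \<Omega>" "lipschitz_boundary \<Omega>" "0 < T" "\<Omega> \<in> sets borel"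
    using problem by (auto simp: admissible_problem_def Let_def)
  show "\<Omega> \<noteq> {}"
  proof
    assume "\<Omega> = {}"
    then have "(LINT x|M. u_ini P 0 x) = 0" by (simp add: integral_restrict_space)
    moreover have "0 < (LINT x|M. u_ini P 0 x)"
      using problem by (auto simp: admissible_problem_def Let_def)
    ultimately show False by simp
  qed
qed

sublocale fe_mesh \<Omega> \<T>
  using problem_facts discr by unfold_locales (auto simp: is_discretisation_def)

lemma tgrid: "tgrid D 0 = 0" "tgrid D N = T" "k < N \<Longrightarrow> tgrid D k < tgrid D (Suc k)"
  using discr by (auto simp: is_discretisation_def)

lemma tgrid_mono: "j \<le> k \<Longrightarrow> k \<le> N \<Longrightarrow> tgrid D j \<le> tgrid D k"
proof (induction k rule: dec_induct)
  case (step k)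
  then show ?case using tgrid(3)[of k] by simp
qed simp

lemma time_step_pos: "k \<in> {1..N} \<Longrightarrow> 0 < time_step D k"
  using tgrid(3)[of "k - 1"] by (auto simp: time_step_def)

lemma time_step_le: "k \<in> {1..N} \<Longrightarrow> time_step D k \<le> max_time_step D"
  unfolding max_time_step_def by (intro Max_ge) auto

lemma slab_subset: "k \<in> {1..N} \<Longrightarrow> slab k \<subseteq> {0<..T}"
  using tgrid_mono[of 0 "k - 1"] tgrid_mono[of k N] unfolding tgrid(1,2) by fastforce

lemma slab_unique:
  assumes "k \<in> {1..N}" "j \<in> {1..N}" "t \<in> slab k" "t \<in> slab j"
  shows "j = k"
proof (rule ccontr)
  assume "j \<noteq> k"
  then consider "j \<le> k - 1" | "k \<le> j - 1" by linarith
  then show False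
  proof cases
    case 1
    then have "tgrid D j \<le> tgrid D (k - 1)" by (rule tgrid_mono) (use assms in auto)
    then show False using assms by auto
  next
    case 2
    then have "tgrid D k \<le> tgrid D (j - 1)" by (rule tgrid_mono) (use assms in auto)
    then show False using assms by auto
  qed
qed

lemma slab_exists:
  assumes "0 < t" "t \<le> T"
  obtains k where "k \<in> {1..N}" "t \<in> slab k"
proof -
  let ?k = "LEAST k. t \<le> tgrid D k"
  have le: "t \<le> tgrid D ?k" by (rule LeastI[of _ N]) (use assms tgrid in simp)
  have "?k \<le> N" by (rule Least_le) (use assms tgrid in simp)
  moreover have "?k \<noteq> 0" using le assms tgrid(1) by (metis not_le)
  moreover have "\<not> t \<le> tgrid D (?k - 1)" by (rule not_less_Least) (use \<open>?k \<noteq> 0\<close> in simp)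
  ultimately show thesis using le that[of ?k] by auto
qed

text \<open>Almost every point lies in one slab, one simplex and one dual cell, the cell belonging
  to a vertex of that simplex. There every reconstruction takes a single discrete value, so almost
  everywhere statements reduce to finite algebra.\<close>

definition good :: "real \<times> 'a \<Rightarrow> nat \<Rightarrow> 'a set \<Rightarrow> 'a \<Rightarrow> bool" where
  "good p k S K \<longleftrightarrow> k \<in> {1..N} \<and> fst p \<in> slab k \<and> S \<in> \<T> \<and> K \<in> verts S \<and> snd p \<in> S \<and> snd p \<in> cell K"

lemma AE_good: "AE p in Q. \<exists>k S K. good p k S K"
proof -
  have "AE p in Q. \<exists>S\<in>\<T>. \<exists>K\<in>verts S. snd p \<in> S \<and> snd p \<in> cell K"
    by (rule AE_cyl_snd[OF problem_facts(6) AE_cell])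
  moreover have "AE p in Q. p \<in> space Q" by (rule AE_space)
  ultimately show ?thesis
  proof eventually_elim
    case (elim p)
    then have t: "0 < fst p" "fst p \<le> T" by (auto simp: space_cyl)
    obtain k where "k \<in> {1..N}" "fst p \<in> slab k" by (rule slab_exists[OF t])
    then show ?case using elim(1) unfolding good_def by blast
  qed
qed

lemma AE_goodI:
  assumes "\<And>p k S K. good p k S K \<Longrightarrow> R p"
  shows "AE p in Q. R p"
  using AE_good by eventually_elim (use assms in blast)

text \<open>Piecewise constant on products of slabs and simplices: the shape of gradients of P1
  reconstructions and of simplexwise mobilities, as \<open>recon_M\<close> is the shape of cell
  values.\<close>

definition step_fn :: "(nat \<Rightarrow> 'a set \<Rightarrow> 'b::euclidean_space) \<Rightarrow> real \<times> 'a \<Rightarrow> 'b" where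
  "step_fn c p = (\<Sum>k=1..N. \<Sum>S\<in>\<T>. (indicat_real (slab k) (fst p) * indicat_real S (snd p)) *\<^sub>R c k S)"

lemma sum_slab:
  assumes "k \<in> {1..N}" "t \<in> slab k"
  shows "(\<Sum>j=1..N. indicat_real (slab j) t *\<^sub>R f j) = (f k :: 'b::euclidean_space)"
proof -
  have "indicat_real (slab j) t = (if j = k then 1 else 0)" if "j \<in> {1..N}" for j
  proof (cases "j = k")
    case True
    then show ?thesis using assms(2) by auto
  next
    case False
    then have "t \<notin> slab j" using slab_unique[OF assms(1) that assms(2)] by blast
    then show ?thesis using False by auto
  qed
  then have "(\<Sum>j=1..N. indicat_real (slab j) t *\<^sub>R f j) = (\<Sum>j=1..N. if j = k then f j else 0)"
    by (intro sum.cong) auto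
  then show ?thesis using assms(1) by simp
qed

lemma step_fn_slab:
  assumes "k \<in> {1..N}" "t \<in> slab k"
  shows "step_fn c (t, x) = (\<Sum>S\<in>\<T>. indicat_real S x *\<^sub>R c k S)"
proof -
  have "step_fn c (t, x) = (\<Sum>j=1..N. indicat_real (slab j) t *\<^sub>R (\<Sum>S\<in>\<T>. indicat_real S x *\<^sub>R c j S))"
    by (simp add: step_fn_def scaleR_right.sum)
  then show ?thesis using sum_slab[OF assms] by simp
qed

lemma sum_simplex:
  assumes "S \<in> \<T>" "x \<in> S"
  shows "(\<Sum>S'\<in>\<T>. indicat_real S' x *\<^sub>R c S') = (c S :: 'b::euclidean_space)"
proof -
  have "indicat_real S' x = (if S' = S then 1 else 0)" if "S' \<in> \<T>" for S'
    using simplices_disjoint[OF assms(1) that assms(2)] assms(2) by (cases "x \<in> S'") auto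
  then have "(\<Sum>S'\<in>\<T>. indicat_real S' x *\<^sub>R c S') = (\<Sum>S'\<in>\<T>. if S' = S then c S' else 0)"
    by (intro sum.cong) auto
  then show ?thesis using assms(1) finite_mesh by simp
qed

lemma sum_cell:
  assumes "K \<in> mesh_verts \<T>" "x \<in> cell K"
  shows "(\<Sum>L\<in>mesh_verts \<T>. w L * indicat_real (cell L) x) = w K"
proof -
  have "indicat_real (cell L) x = (if L = K then 1 else 0)" if "L \<in> mesh_verts \<T>" for L
    using cell_disjoint[OF assms(1) that] assms(2) by (cases "x \<in> cell L") auto
  then have "(\<Sum>L\<in>mesh_verts \<T>. w L * indicat_real (cell L) x) = (\<Sum>L\<in>mesh_verts \<T>. if L = K then w L else 0)"
    by (intro sum.cong) auto
  then show ?thesis using assms(1) finite_mesh_verts by simp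
qed

lemma recon_M_slab:
  assumes "k \<in> {1..N}" "t \<in> slab k"
  shows "recon_M P D w (t, x) = (\<Sum>K\<in>mesh_verts \<T>. w k K * indicat_real (cell K) x)"
  unfolding recon_M_def using sum_slab[OF assms, of "\<lambda>k. \<Sum>K\<in>mesh_verts \<T>. w k K * indicat_real (cell K) x"] by simp

lemma recon_T_slab:
  assumes "k \<in> {1..N}" "t \<in> slab k"
  shows "recon_T D w (t, x) = (\<Sum>K\<in>mesh_verts \<T>. w k K * e K x)"
  unfolding recon_T_def using sum_slab[OF assms, of "\<lambda>k. \<Sum>K\<in>mesh_verts \<T>. w k K * e K x"] by simp

lemma good_eval:
  assumes g: "good p k S K"
  shows "step_fn c p = c k S" "recon_M P D w p = w k K"
proof -
  obtain t x where p: "p = (t, x)" by (cases p)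
  have *: "k \<in> {1..N}" "t \<in> slab k" "S \<in> \<T>" "K \<in> verts S" "x \<in> S" "x \<in> cell K"
    using g by (auto simp: good_def p)
  show "step_fn c p = c k S" by (simp only: p step_fn_slab[OF *(1,2)] sum_simplex[OF *(3,5)])
  have "K \<in> mesh_verts \<T>" using verts_mesh_verts[OF *(3)] *(4) by blast
  then show "recon_M P D w p = w k K" using recon_M_slab[OF *(1,2)] sum_cell[OF _ *(6)] by (simp add: p)
qed

lemma borel_measurable_pair_indicator:
  assumes "A \<in> sets borel" "B \<in> sets borel"
  shows "(\<lambda>p :: real \<times> 'a. indicat_real A (fst p) * indicat_real B (snd p)) \<in> borel_measurable borel"
proof -
  have "(\<lambda>p :: real \<times> 'a. indicat_real A (fst p) * indicat_real B (snd p)) = indicat_real (A \<times> B)"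
    by (auto simp: indicator_def fun_eq_iff)
  then show ?thesis using borel_Times[OF assms] by simp
qed

lemma step_fn_borel: "step_fn c \<in> borel_measurable borel"
  unfolding step_fn_def[abs_def]
  by (intro borel_measurable_sum borel_measurable_scaleR borel_measurable_pair_indicator borel_measurable_const)
    (use open_simplex in auto)

lemma recon_M_eq: "recon_M P D w p = (\<Sum>k=1..N. \<Sum>K\<in>mesh_verts \<T>.
    (indicat_real (slab k) (fst p) * indicat_real (cell K) (snd p)) * w k K)"
  by (simp add: recon_M_def split_beta sum_distrib_left mult_ac)

lemma recon_M_borel: "recon_M P D w \<in> borel_measurable borel"
  unfolding recon_M_eq[abs_def]
  by (intro borel_measurable_sum borel_measurable_times borel_measurable_pair_indicator borel_measurable_const)
    (use cell_borel in auto)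

lemma finite_Q: "finite_measure Q" by (rule finite_measure_cyl[OF problem_facts(6,2)])
lemma finite_M: "finite_measure M" by (rule finite_measure_lebesgue_on_bounded[OF problem_facts(6,2)])

lemma L2_Q_bounded:
  fixes f :: "real \<times> 'a \<Rightarrow> 'b::euclidean_space"
  assumes "f \<in> borel_measurable borel" "AE p in Q. norm (f p) \<le> B"
  shows "f \<in> L2 Q"
proof (rule L2_bounded[OF L2_const[OF finite_Q, of "1::real"]])
  show "f \<in> borel_measurable Q" by (rule cyl_borel_measurable[OF problem_facts(6) assms(1)])
  show "AE p in Q. norm (f p) \<le> B * norm (1::real)" using assms(2) by simp
qed

lemma step_fn_measurable: "step_fn c \<in> borel_measurable Q"
  by (rule cyl_borel_measurable[OF problem_facts(6) step_fn_borel])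

lemma recon_M_measurable: "recon_M P D w \<in> borel_measurable Q"
  by (rule cyl_borel_measurable[OF problem_facts(6) recon_M_borel])

lemma step_fn_L2: "step_fn c \<in> L2 Q"
proof (rule L2_Q_bounded[OF step_fn_borel])
  show "AE p in Q. norm (step_fn c p) \<le> (\<Sum>k=1..N. \<Sum>S\<in>\<T>. norm (c k S))"
  proof (rule AE_goodI)
    fix p k S K assume g: "good p k S K"
    then have k: "k \<in> {1..N}" "S \<in> \<T>" by (auto simp: good_def)
    have "norm (c k S) \<le> (\<Sum>S\<in>\<T>. norm (c k S))"
      by (rule member_le_sum) (use k finite_mesh in auto)
    also have "\<dots> \<le> (\<Sum>k=1..N. \<Sum>S\<in>\<T>. norm (c k S))"
      by (rule member_le_sum[of k "{1..N}" "\<lambda>k. \<Sum>S\<in>\<T>. norm (c k S)"]) (use k in \<open>auto intro: sum_nonneg\<close>)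
    finally show "norm (step_fn c p) \<le> (\<Sum>k=1..N. \<Sum>S\<in>\<T>. norm (c k S))"
      by (simp only: good_eval(1)[OF g])
  qed
qed

lemma recon_M_L2: "recon_M P D w \<in> L2 Q"
proof (rule L2_Q_bounded[OF recon_M_borel])
  show "AE p in Q. norm (recon_M P D w p) \<le> (\<Sum>k=1..N. \<Sum>K\<in>mesh_verts \<T>. norm (w k K))"
  proof (rule AE_goodI)
    fix p k S K assume g: "good p k S K"
    then have k: "k \<in> {1..N}" "K \<in> mesh_verts \<T>" using verts_mesh_verts by (auto simp: good_def)
    have "norm (w k K) \<le> (\<Sum>K\<in>mesh_verts \<T>. norm (w k K))"
      by (rule member_le_sum) (use k finite_mesh_verts in auto)
    also have "\<dots> \<le> (\<Sum>k=1..N. \<Sum>K\<in>mesh_verts \<T>. norm (w k K))"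
      by (rule member_le_sum[of k "{1..N}" "\<lambda>k. \<Sum>K\<in>mesh_verts \<T>. norm (w k K)"]) (use k in \<open>auto intro: sum_nonneg\<close>)
    finally show "norm (recon_M P D w p) \<le> (\<Sum>k=1..N. \<Sum>K\<in>mesh_verts \<T>. norm (w k K))"
      by (simp only: good_eval(2)[OF g])
  qed
qed

lemma measure_slab: "k \<in> {1..N} \<Longrightarrow> (LINT t|I. indicat_real (slab k) t) = time_step D k"
proof -
  assume k: "k \<in> {1..N}"
  have "(LINT t|I. indicat_real (slab k) t) = (LINT t|lebesgue. indicator {0<..<T} t *\<^sub>R indicat_real (slab k) t)"
    by (rule integral_restrict_space) simp
  also have "\<dots> = (LINT t|lebesgue. indicat_real ({0<..<T} \<inter> slab k) t)"
    by (intro Bochner_Integration.integral_cong) (auto simp: indicator_def)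
  also have "\<dots> = measure lebesgue ({0<..<T} \<inter> slab k)" by simp
  \<comment> \<open>The cylinder uses the open time interval while the last slab contains
    \<open>T\<close>. Compared with the closed interval, at most the left endpoint and
    \<open>T\<close> are lost.\<close>
  also have "\<dots> = measure lebesgue {tgrid D (k - 1)..tgrid D k}"
  proof (rule measure_negligible_symdiff)
    show "{tgrid D (k - 1)..tgrid D k} \<in> lmeasurable" by simp
    have "negligible {tgrid D (k - 1), T}" by simp
    moreover have "({tgrid D (k - 1)..tgrid D k} - {0<..<T} \<inter> slab k) \<union>
        ({0<..<T} \<inter> slab k - {tgrid D (k - 1)..tgrid D k}) \<subseteq> {tgrid D (k - 1), T}"
    proof -
      have "x \<in> {tgrid D (k - 1), T}" if "x \<in> {tgrid D (k - 1)..tgrid D k}" "x \<notin> {0<..<T} \<inter> slab k" for x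
      proof (cases "x = tgrid D (k - 1)")
        case False
        then have "x \<in> slab k" using that(1) by auto
        then have "x \<in> {0<..T}" "x \<notin> {0<..<T}" using slab_subset[OF k] that(2) by blast+
        then show ?thesis by auto
      qed simp
      then show ?thesis by (intro Un_least subsetI) (blast, auto)
    qed
    ultimately show "negligible (({tgrid D (k - 1)..tgrid D k} - {0<..<T} \<inter> slab k) \<union>
        ({0<..<T} \<inter> slab k - {tgrid D (k - 1)..tgrid D k}))"
      by (rule negligible_subset)
  qed
  also have "\<dots> = time_step D k"
    using time_step_pos[OF k] by (simp add: time_step_def)
  finally show ?thesis .
qed

lemma integral_indicator_M:
  assumes "A \<subseteq> \<Omega>" "open A"
  shows "(LINT x|M. indicat_real A x) = measure lebesgue A"
proof -
  have "(LINT x|M. indicat_real A x) = (LINT x|lebesgue. indicator \<Omega> x *\<^sub>R indicat_real A x)"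
    by (rule integral_restrict_space) (use problem_facts in simp)
  also have "\<dots> = (LINT x|lebesgue. indicat_real A x)"
    by (intro Bochner_Integration.integral_cong) (use assms in \<open>auto simp: indicator_def\<close>)
  finally show ?thesis by simp
qed

lemma integral_pair_indicator:
  assumes k: "k \<in> {1..N}" and A: "A \<subseteq> \<Omega>" "open A"
  shows "integrable Q (\<lambda>p. indicat_real (slab k) (fst p) * indicat_real A (snd p))"
    "(LINT p|Q. indicat_real (slab k) (fst p) * indicat_real A (snd p)) = time_step D k * measure lebesgue A"
proof -
  let ?f = "\<lambda>p. indicat_real (slab k) (fst p) * indicat_real A (snd p)"
  have "?f \<in> L2 Q"
    by (rule L2_Q_bounded[OF borel_measurable_pair_indicator, of _ _ 1]) (use A in \<open>auto simp: indicator_def\<close>)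
  then show i: "integrable Q ?f" by (rule L2_integrable[OF finite_Q])
  have "(LINT p|Q. ?f p) = (LINT t|I. LINT x|M. ?f (t, x))"
    by (rule integral_cyl_iterated[OF problem_facts(6) i, symmetric])
  also have "\<dots> = time_step D k * measure lebesgue A"
    by (simp only: fst_conv snd_conv integral_mult_right_zero integral_mult_left_zero integral_indicator_M[OF A] measure_slab[OF k])
  finally show "(LINT p|Q. ?f p) = time_step D k * measure lebesgue A" .
qed

lemma integral_step_fn:
  "(LINT p|Q. step_fn c p) = (\<Sum>k=1..N. time_step D k * (\<Sum>S\<in>\<T>. measure lebesgue S * c k S))"
  for c :: "nat \<Rightarrow> 'a set \<Rightarrow> real"
proof -
  have "(LINT p|Q. step_fn c p) = (\<Sum>k=1..N. \<Sum>S\<in>\<T>. (LINT p|Q. (indicat_real (slab k) (fst p) * indicat_real S (snd p)) *\<^sub>R c k S))"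
  proof -
    have i: "integrable Q (\<lambda>p. (indicat_real (slab k) (fst p) * indicat_real S (snd p)) *\<^sub>R c k S)"
      if "k \<in> {1..N}" "S \<in> \<T>" for k S
      by (intro integrable_scaleR_left integral_pair_indicator(1) that simplex_subset open_simplex)
    show ?thesis
      unfolding step_fn_def using i
      by (simp only: Bochner_Integration.integral_sum Bochner_Integration.integrable_sum cong: sum.cong)
  qed
  also have "\<dots> = (\<Sum>k=1..N. \<Sum>S\<in>\<T>. time_step D k * measure lebesgue S * c k S)"
    using integral_pair_indicator(2)[OF _ simplex_subset open_simplex]
    by (intro sum.cong refl) (simp only: real_scaleR_def integral_mult_left_zero)
  finally show ?thesis by (simp add: sum_distrib_left mult.assoc)
qed

lemma integral_recon_M:
  "(LINT p|Q. recon_M P D w p) = (\<Sum>k=1..N. time_step D k * (\<Sum>K\<in>mesh_verts \<T>. vol P D K * w k K))"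
proof -
  have "(LINT p|Q. recon_M P D w p) = (\<Sum>k=1..N. \<Sum>K\<in>mesh_verts \<T>. (LINT p|Q. (indicat_real (slab k) (fst p) * indicat_real (cell K) (snd p)) * w k K))"
  proof -
    have i: "integrable Q (\<lambda>p. (indicat_real (slab k) (fst p) * indicat_real (cell K) (snd p)) * w k K)"
      if "k \<in> {1..N}" for k K
      by (intro integrable_mult_left integral_pair_indicator(1) that cell_subset open_cell)
    show ?thesis
      unfolding recon_M_eq using i
      by (simp only: Bochner_Integration.integral_sum Bochner_Integration.integrable_sum cong: sum.cong)
  qed
  also have "\<dots> = (\<Sum>k=1..N. \<Sum>K\<in>mesh_verts \<T>. time_step D k * vol P D K * w k K)"
    using integral_pair_indicator(2)[OF _ cell_subset open_cell]
    by (intro sum.cong refl) (simp only: integral_mult_left_zero)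
  finally show ?thesis by (simp add: sum_distrib_left mult.assoc)
qed

text \<open>At a fixed time the reconstruction is affine on each simplex, which determines its weak
  gradient there; the slices are then glued. Membership in \<open>L2H1\<close> is assumed here and
  will come with the weak convergences.\<close>

lemma space_grad_recon_T:
  assumes w: "recon_T D w \<in> L2H1 T \<Omega>"
  shows "AE p in Q. space_grad T \<Omega> (recon_T D w) p = step_fn (\<lambda>k S. gr S (w k)) p"
proof (rule AE_cylI_eq[OF problem_facts(6) _ step_fn_measurable])
  let ?G = "space_grad T \<Omega> (recon_T D w)"
  show "?G \<in> borel_measurable Q" using space_grad_L2[OF w] by (simp add: L2_def)
  have "AE t in I. (\<lambda>x. ?G (t, x)) \<in> L2 M" by (rule L2_section[OF problem_facts(6) space_grad_L2[OF w]])
  moreover have "AE t in I. weak_gradient \<Omega> (\<lambda>x. recon_T D w (t, x)) (\<lambda>x. ?G (t, x))"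
    using space_grad[OF w] by (simp add: is_space_grad_def)
  moreover have "AE t in I. t \<in> space I" by (rule AE_space)
  ultimately show "AE t in I. AE x in M. ?G (t, x) = step_fn (\<lambda>k S. gr S (w k)) (t, x)"
  proof eventually_elim
    case (elim t)
    then have t: "0 < t" "t \<le> T" by auto
    obtain k where k: "k \<in> {1..N}" "t \<in> slab k" by (rule slab_exists[OF t])
    have "AE x in M. x \<in> S \<longrightarrow> ?G (t, x) = gr S (w k)" if S: "S \<in> \<T>" for S
    proof -
      obtain c where c: "\<And>x. x \<in> closure S \<Longrightarrow> (\<Sum>K\<in>mesh_verts \<T>. w k K * e K x) = gr S (w k) \<bullet> x + c"
        by (rule affine_combination_affine[OF S]) (rule that)
      have "AE x in lebesgue_on S. ?G (t, x) = gr S (w k)"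
      proof (rule weak_gradient_locally_affine[OF problem_facts(1,2) elim(1,2) open_simplex[OF S] simplex_subset[OF S]])
        show "recon_T D w (t, x) = gr S (w k) \<bullet> x + c" if "x \<in> S" for x
          using c[of x] that closure_subset by (auto simp: recon_T_slab[OF k])
      qed
      then have "AE x in lborel. x \<in> S \<longrightarrow> ?G (t, x) = gr S (w k)"
        using open_simplex[OF S] by (simp add: AE_lebesgue_on_iff)
      then have "AE x in lborel. x \<in> \<Omega> \<longrightarrow> x \<in> S \<longrightarrow> ?G (t, x) = gr S (w k)"
        by eventually_elim simp
      then show ?thesis
        using problem_facts(6) by (simp add: AE_lebesgue_on_iff)
    qed
    then have "AE x in M. \<forall>S\<in>\<T>. x \<in> S \<longrightarrow> ?G (t, x) = gr S (w k)"
      by (simp add: AE_ball_countable countable_finite[OF finite_mesh])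
    with AE_cell show ?case
    proof eventually_elim
      case (elim x)
      then obtain S where S: "S \<in> \<T>" "x \<in> S" by blast
      then show ?case using elim(2) by (simp add: step_fn_slab[OF k] sum_simplex[OF S])
    qed
  qed
qed

end

section \<open>The nonlinear flux\<close>

text \<open>z is the logarithmic mean of x and y, located by the mean value theorem for ln.\<close>

lemma ln_mean:
  fixes x y :: real
  assumes "0 < x" "0 < y"
  obtains z where "0 < z" "min x y \<le> z" "z \<le> max x y" "y - x = z * (ln y - ln x)"
proof -
  have *: "\<exists>z. x < z \<and> z < y \<and> ln y - ln x = (y - x) * (1 / z)" if "0 < x" "x < y" for x y :: real
    by (rule MVT2[OF that(2)]) (use that in \<open>auto intro!: derivative_eq_intros\<close>)
  consider "x = y" | "x < y" | "y < x" using linorder_less_linear[of x y] by blast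
  then show thesis
  proof cases
    case 1
    then show thesis using that[of x] assms by simp
  next
    case 2
    then obtain z where "x < z" "z < y" "ln y - ln x = (y - x) * (1 / z)" using *[OF assms(1)] by blast
    then show thesis using assms 2 by (intro that[of z]) (auto simp: field_simps)
  next
    case 3
    then obtain z where "y < z" "z < x" "ln x - ln y = (x - y) * (1 / z)" using *[OF assms(2)] by blast
    then show thesis using assms 3 by (intro that[of z]) (auto simp: field_simps)
  qed
qed

text \<open>Along an edge, \<open>U m\<close> is compared with \<open>p (q b - p a) - 3 p a (q - p)\<close>, the discrete analogue of
  \<open>u\<^sub>0 u\<^sub>i \<nabla>log (u\<^sub>i / u\<^sub>0) = \<surd>u\<^sub>0 \<nabla>(\<surd>u\<^sub>0 u\<^sub>i) - 3 \<surd>u\<^sub>0 u\<^sub>i \<nabla>\<surd>u\<^sub>0\<close>; here \<open>p, q\<close> are the values of \<open>\<surd>u\<^sub>0\<close>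
  and \<open>a, b\<close> those of \<open>u\<^sub>i\<close> at the two ends, and \<open>W\<close>, \<open>l\<close> below are the increments of
  \<open>log (\<surd>u\<^sub>0 u\<^sub>i)\<close> and \<open>log \<surd>u\<^sub>0\<close>.\<close>

lemma edge_estimate:
  fixes p q a b U0 U1 c o' \<eta> :: real
  assumes pos: "0 < p" "0 < q" "0 < a" "0 < b" "0 < U0" "0 < U1"
    and le1: "p \<le> 1" "q \<le> 1" "a \<le> 1" "b \<le> 1" "U0 \<le> 1" "U1 \<le> 1"
    and c: "1 \<le> c" and \<eta>: "0 < \<eta>"
    and o: "\<bar>q - p\<bar> \<le> o'" "\<bar>q * b - p * a\<bar> \<le> o'" "\<bar>U0 * U1 - p * (p * a)\<bar> \<le> 4 * o'"
    and U0: "p\<^sup>2 \<le> c * U0" "q\<^sup>2 \<le> c * U0" "sqrt U0 \<le> p + o'"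
    and U1: "a \<le> c * U1" "b \<le> c * U1"
    and m: "m = (ln b - 2 * ln q) - (ln a - 2 * ln p)"
  shows "\<bar>U0 * U1 * m - p * (q * b - p * a) + 3 * (p * a) * (q - p)\<bar>
    \<le> 30 * c\<^sup>2 * (\<eta> + o' / \<eta>) * (sqrt (U0 * U1) * \<bar>m\<bar> + o')"
proof -
  define U where "U = U0 * U1"
  define E where "E = sqrt U * \<bar>m\<bar>"
  define \<rho> where "\<rho> = U * m - p * (q * b - p * a) + 3 * (p * a) * (q - p)"
  have Up: "0 < U" "U \<le> 1" using pos le1 by (auto simp: U_def mult_le_one)
  have sU: "0 < sqrt U" "sqrt U \<le> 1" "sqrt U * sqrt U = U" using Up by auto
  have E0: "0 \<le> E" using sU by (simp add: E_def)
  have o0: "0 \<le> o'" using o(1) by linarith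
  have Um: "\<bar>U * m\<bar> = sqrt U * E" using sU Up by (simp add: E_def abs_mult)
  have c2: "1 \<le> c\<^sup>2" "c \<le> c\<^sup>2" using c by (auto simp: power2_eq_square mult_mono[of 1 c 1 c, simplified] mult_right_mono[of 1 c c, simplified])
  have t2: "\<bar>p * (q * b - p * a)\<bar> \<le> p * o'" using o(2) pos by (simp add: abs_mult mult_left_mono)
  have t3: "\<bar>3 * (p * a) * (q - p)\<bar> \<le> 3 * p * o'"
  proof -
    have "p * a * \<bar>q - p\<bar> \<le> p * 1 * o'" by (intro mult_mono) (use pos le1 o(1) in auto)
    then show ?thesis using pos by (simp add: abs_mult)
  qed
  \<comment> \<open>A crude bound in which nothing cancels. It suffices when sqrt U and p are of
    order \<eta>, or when o' / \<eta> is not small.\<close>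
  have tri: "\<bar>\<rho>\<bar> \<le> sqrt U * E + 4 * p * o'"
  proof -
    have "\<bar>\<rho>\<bar> \<le> \<bar>U * m\<bar> + \<bar>p * (q * b - p * a)\<bar> + \<bar>3 * (p * a) * (q - p)\<bar>" unfolding \<rho>_def by linarith
    then show ?thesis using t2 t3 Um by linarith
  qed
  have fin: "x \<le> 30 * c\<^sup>2 * (\<eta> + o' / \<eta>) * (E + o')" if "x \<le> 12 * c\<^sup>2 * \<eta> * (E + o') + 30 * c\<^sup>2 * (o' / \<eta>) * (E + o')" for x
  proof -
    have "12 * c\<^sup>2 * \<eta> * (E + o') \<le> 30 * c\<^sup>2 * \<eta> * (E + o')"
      using E0 o0 \<eta> c2 by (intro mult_right_mono) auto
    then show ?thesis using that by (simp add: algebra_simps)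
  qed
  have nn: "0 \<le> o' / \<eta> * (E + o')" "0 \<le> \<eta> * (E + o')" using o0 \<eta> E0 by auto
  have key: "\<bar>\<rho>\<bar> \<le> 12 * c\<^sup>2 * \<eta> * (E + o') + 30 * c\<^sup>2 * (o' / \<eta>) * (E + o')"
  proof (cases "sqrt U0 \<le> \<eta>")
    \<comment> \<open>The degenerate regime: sqrt U is at most \<eta>, and p at most c \<eta>
      because p^2 is at most c U0.\<close>
    case True
    have "sqrt U \<le> sqrt U0" unfolding U_def using pos le1 by (simp add: mult_left_le)
    then have 1: "sqrt U * E \<le> \<eta> * E" using E0 by (intro mult_right_mono order_trans[OF _ True]) auto
    have "p\<^sup>2 \<le> (c * \<eta>)\<^sup>2"
    proof -
      have "c * U0 \<le> c\<^sup>2 * \<eta>\<^sup>2"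
      proof (rule mult_mono[OF c2(2)])
        have "(sqrt U0)\<^sup>2 \<le> \<eta>\<^sup>2" by (rule power_mono[OF True]) (use pos in simp)
        then show "U0 \<le> \<eta>\<^sup>2" using pos(5) by simp
      qed (use pos(5) in simp_all)
      then show ?thesis using U0(1) by (simp add: power_mult_distrib)
    qed
    moreover have "0 \<le> c * \<eta>" using c \<eta> by simp
    ultimately have "p \<le> c * \<eta>" by (rule power2_le_imp_le)
    then have "4 * p * o' \<le> 4 * (c * \<eta>) * o'" using o0 by (intro mult_right_mono) auto
    then have "\<bar>\<rho>\<bar> \<le> \<eta> * E + 4 * c * (\<eta> * o')" using tri 1 by (simp add: algebra_simps)
    moreover have "\<eta> * E \<le> 4 * c\<^sup>2 * (\<eta> * E)" using mult_right_mono[of 1 "4 * c\<^sup>2" "\<eta> * E"] c2 E0 \<eta> by auto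
    moreover have "4 * c * (\<eta> * o') \<le> 4 * c\<^sup>2 * (\<eta> * o')" using c2 o0 \<eta> by (intro mult_right_mono) auto
    moreover have "4 * c\<^sup>2 * (\<eta> * E) + 4 * c\<^sup>2 * (\<eta> * o') \<le> 12 * c\<^sup>2 * \<eta> * (E + o')"
      using E0 o0 \<eta> c2 by (simp add: algebra_simps)
    moreover have "0 \<le> 30 * c\<^sup>2 * (o' / \<eta>) * (E + o')" using o0 E0 \<eta> by simp
    ultimately show ?thesis by linarith
  next
    case False
    then have big: "\<eta> < p + o'" using U0(3) by linarith
    show ?thesis
    proof (cases "p \<le> \<eta> / 4 \<or> q \<le> \<eta> / 4")
      case True
      \<comment> \<open>The simplex value exceeds the threshold while one end lies well below it.
        Then the oscillation bound o' is at least \<eta> / 4, and the crude bound is paid for by the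
        factor o' / \<eta>.\<close>
      then have "\<eta> \<le> 4 * o'" using big o(1) by auto
      then have r1: "1 \<le> 4 * (o' / \<eta>)" using \<eta> by (simp add: field_simps)
      have "sqrt U * E \<le> E" using mult_right_mono[OF sU(2) E0] by simp
      moreover have "4 * p * o' \<le> 4 * o'" using mult_right_mono[OF le1(1) o0] by simp
      ultimately have "\<bar>\<rho>\<bar> \<le> E + 4 * o'" by (rule order_trans[OF tri add_mono])
      then have "\<bar>\<rho>\<bar> \<le> 4 * (E + o')" using E0 by simp
      also have "\<dots> \<le> 4 * (o' / \<eta>) * (4 * (E + o'))" using mult_right_mono[OF r1, of "4 * (E + o')"] E0 o0 by simp
      also have "\<dots> = 16 * (o' / \<eta> * (E + o'))" by simp
      also have "\<dots> \<le> 30 * c\<^sup>2 * (o' / \<eta> * (E + o'))" using nn(1) c2 by (intro mult_right_mono) auto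
      finally have "\<bar>\<rho>\<bar> \<le> 30 * c\<^sup>2 * (o' / \<eta>) * (E + o')" by (simp only: mult.assoc)
      moreover have "0 \<le> 12 * c\<^sup>2 * \<eta> * (E + o')" using nn c2 E0 \<eta> o0 by simp
      ultimately show ?thesis by linarith
    next
      case False
      then have pq: "\<eta> / 4 < p" "\<eta> / 4 < q" by auto
      obtain lw where lw: "0 < lw" "min (p * a) (q * b) \<le> lw" "lw \<le> max (p * a) (q * b)"
        "q * b - p * a = lw * (ln (q * b) - ln (p * a))"
        by (rule ln_mean[of "p * a" "q * b"]) (use pos in auto)
      obtain lp where lp: "0 < lp" "min p q \<le> lp" "lp \<le> max p q" "q - p = lp * (ln q - ln p)"
        by (rule ln_mean[of p q]) (use pos in auto)
      define l where "l = ln q - ln p"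
      have W: "ln (q * b) - ln (p * a) = m + 3 * l" using pos by (simp add: m l_def ln_mult)
      \<comment> \<open>Both increments are written through logarithmic means. Since W = m + 3 l,
        the coefficient 3 of the last term is exactly the one for which the l-terms combine into a
        difference of two approximations of p * p * a.\<close>
      have "\<rho> = (U - p * lw) * m + 3 * l * (p * a * lp - p * lw)"
        unfolding \<rho>_def lw(4) W lp(4) l_def[symmetric] by (simp add: algebra_simps)
      then have split: "\<bar>\<rho>\<bar> \<le> \<bar>(U - p * lw) * m\<bar> + \<bar>3 * l * (p * a * lp - p * lw)\<bar>" by linarith
      have lwo: "\<bar>p * a - lw\<bar> \<le> o'" using lw(2,3) o(2) by linarith
      have lpo: "\<bar>lp - p\<bar> \<le> o'" using lp(2,3) o(1) by linarith
      have plw: "\<bar>p * (p * a - lw)\<bar> \<le> o'"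
      proof -
        have "p * \<bar>p * a - lw\<bar> \<le> 1 * o'" using lwo le1 pos by (intro mult_mono) auto
        then show ?thesis using pos by (simp add: abs_mult)
      qed
      \<comment> \<open>The mean lp of p and q exceeds \<eta> / 4, so |l| is at most 4 o' / \<eta>.
        The constant 24 is 3 * 4 * 2.\<close>
      have s2: "\<bar>3 * l * (p * a * lp - p * lw)\<bar> \<le> 24 * (o' / \<eta>) * o'"
      proof -
        have lpe: "\<eta> / 4 < lp" using lp(2) pq by linarith
        have "\<bar>l\<bar> = \<bar>q - p\<bar> / lp" using lp(1,4) by (simp add: l_def abs_mult)
        also have "\<dots> \<le> o' / (\<eta> / 4)" using o(1) lpe \<eta> o0 by (intro frac_le) auto
        finally have l: "\<bar>l\<bar> \<le> 4 * (o' / \<eta>)" by (simp add: mult.commute)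
        have "\<bar>p * a * (lp - p)\<bar> \<le> o'"
        proof -
          have "p * a * \<bar>lp - p\<bar> \<le> 1 * o'" using lpo le1 pos by (intro mult_mono mult_le_one) auto
          then show ?thesis using pos by (simp add: abs_mult)
        qed
        moreover have "p * a * lp - p * lw = p * a * (lp - p) + p * (p * a - lw)" by (simp add: algebra_simps)
        ultimately have d: "\<bar>p * a * lp - p * lw\<bar> \<le> 2 * o'" using plw by linarith
        have "\<bar>l\<bar> * \<bar>p * a * lp - p * lw\<bar> \<le> (4 * (o' / \<eta>)) * (2 * o')"
          using l d o0 \<eta> by (intro mult_mono) auto
        then show ?thesis by (simp add: abs_mult mult.assoc)
      qed
      \<comment> \<open>If sqrt U is at least \<eta>, the error U - p lw is at most 5 o' and a
        factor sqrt U is divided out of E. Otherwise U and p lw are both bounded by multiples of U,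
        and U |m| = sqrt U E is at most \<eta> E.\<close>
      have s1: "\<bar>(U - p * lw) * m\<bar> \<le> (1 + c\<^sup>2) * \<eta> * E + 5 * (o' / \<eta>) * E"
      proof (cases "\<eta> \<le> sqrt U")
        case True
        have "\<bar>U - p * lw\<bar> \<le> 5 * o'"
        proof -
          have "U - p * lw = (U - p * (p * a)) + p * (p * a - lw)" by (simp add: algebra_simps)
          then show ?thesis using o(3) plw unfolding U_def by linarith
        qed
        then have "\<bar>U - p * lw\<bar> * \<bar>m\<bar> \<le> 5 * o' * \<bar>m\<bar>" by (intro mult_right_mono) auto
        also have "\<dots> = 5 * (o' / sqrt U) * E" using sU by (simp add: E_def)
        also have "\<dots> \<le> 5 * (o' / \<eta>) * E" using True \<eta> o0 E0 by (intro mult_right_mono mult_left_mono frac_le) auto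
        finally have "\<bar>(U - p * lw) * m\<bar> \<le> 5 * (o' / \<eta>) * E" by (simp add: abs_mult)
        moreover have "0 \<le> (1 + c\<^sup>2) * \<eta> * E" using E0 \<eta> c2 by simp
        ultimately show ?thesis by simp
      next
        case False
        have "p * lw \<le> c\<^sup>2 * U"
        proof -
          have mx: "(max p q)\<^sup>2 \<le> c * U0" using U0(1,2) by (simp add: max_def)
          have "lw \<le> max p q * max a b"
          proof -
          have "p * a \<le> max p q * max a b" "q * b \<le> max p q * max a b"
            by (rule mult_mono; use pos in \<open>simp add: le_max_iff_disj\<close>)+
          then show ?thesis using lw(3) by linarith
        qed
          then have "p * lw \<le> max p q * (max p q * max a b)" using pos lw(1) by (intro mult_mono) auto
          also have "\<dots> = (max p q)\<^sup>2 * max a b" by (simp add: power2_eq_square)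
          also have "\<dots> \<le> (c * U0) * (c * U1)" using mx U1 pos c by (intro mult_mono) auto
          finally show ?thesis by (simp add: U_def power2_eq_square algebra_simps)
        qed
        moreover have "0 \<le> p * lw" using pos lw(1) by simp
        moreover have "1 * U \<le> (1 + c\<^sup>2) * U" "c\<^sup>2 * U \<le> (1 + c\<^sup>2) * U" using Up c2 by (auto intro!: mult_right_mono)
        ultimately have "\<bar>U - p * lw\<bar> \<le> (1 + c\<^sup>2) * U" using Up by (auto simp: algebra_simps)
        then have "\<bar>U - p * lw\<bar> * \<bar>m\<bar> \<le> (1 + c\<^sup>2) * U * \<bar>m\<bar>" by (intro mult_right_mono) auto
        also have "\<dots> = (1 + c\<^sup>2) * (sqrt U * E)" using Um Up by (simp add: abs_mult)
        also have "\<dots> \<le> (1 + c\<^sup>2) * (\<eta> * E)" using False E0 c2 by (intro mult_left_mono mult_right_mono) auto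
        finally have "\<bar>(U - p * lw) * m\<bar> \<le> (1 + c\<^sup>2) * \<eta> * E" by (simp add: abs_mult mult.assoc)
        moreover have "0 \<le> 5 * (o' / \<eta>) * E" using E0 \<eta> o0 by simp
        ultimately show ?thesis by simp
      qed
      have "(1 + c\<^sup>2) * \<eta> * E \<le> 12 * c\<^sup>2 * \<eta> * (E + o')"
        using c2 E0 \<eta> o0 by (intro mult_mono) auto
      moreover have "5 * (o' / \<eta>) * E + 24 * (o' / \<eta>) * o' \<le> 30 * c\<^sup>2 * (o' / \<eta>) * (E + o')"
      proof -
        have "5 * (o' / \<eta>) * E + 24 * (o' / \<eta>) * o' \<le> 30 * (o' / \<eta> * (E + o'))"
        proof -
          have "0 \<le> o' / \<eta> * E" "0 \<le> o' / \<eta> * o'" using E0 \<eta> o0 by simp_all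
          moreover have "5 * x + 24 * y \<le> 30 * x + 30 * y" if "0 \<le> x" "0 \<le> y" for x y :: real
            using that by simp
          ultimately show ?thesis unfolding distrib_left mult.assoc by blast
        qed
        also have "\<dots> \<le> 30 * c\<^sup>2 * (o' / \<eta> * (E + o'))" using nn(1) c2 by (intro mult_right_mono) auto
        finally show ?thesis by (simp only: mult.assoc)
      qed
      ultimately show ?thesis using split s1 s2 by linarith
    qed
  qed
  show ?thesis using fin[OF key] unfolding \<rho>_def U_def E_def .
qed

text \<open>Equal weights for the average, a unit weight at a maximiser for the maximum. Seen as
  convex combinations, the two rules can be treated together.\<close>

lemma simplex_value_convex:
  fixes S :: "'a::euclidean_space set"
  assumes "finite (verts S)" "card (verts S) = Suc DIM('a)"
  obtains t where "\<And>L. L \<in> verts S \<Longrightarrow> 0 \<le> t L" "sum t (verts S) = 1"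
    "simplex_value \<rho> S w = (\<Sum>L\<in>verts S. t L * w L)"
proof (cases \<rho>)
  case Maximum
  have ne: "verts S \<noteq> {}" using assms by auto
  have "Max (w ` verts S) \<in> w ` verts S" using assms(1) ne by (intro Max_in) auto
  then obtain J where J: "J \<in> verts S" "Max (w ` verts S) = w J" by (metis imageE)
  show thesis
  proof (rule that[of "\<lambda>L. if L = J then 1 else 0"])
    show "simplex_value \<rho> S w = (\<Sum>L\<in>verts S. (if L = J then 1 else 0) * w L)"
      using J assms(1) Maximum by (simp add: simplex_value_def if_distrib[of "\<lambda>x. x * _"] cong: if_cong)
  qed (use J assms(1) in auto)
next
  case Average
  show thesis
  proof (rule that[of "\<lambda>L. 1 / (real DIM('a) + 1)"])
    show "simplex_value \<rho> S w = (\<Sum>L\<in>verts S. 1 / (real DIM('a) + 1) * w L)"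
      using Average by (simp add: simplex_value_def sum_distrib_left sum_divide_distrib)
  qed (use assms(2) in \<open>auto simp: field_simps\<close>)
qed

text \<open>The third bound is where the rules differ: the maximum dominates every vertex value
  outright, the average only up to the factor d+1.\<close>

lemma simplex_value_bounds:
  fixes S :: "'a::euclidean_space set"
  assumes V: "finite (verts S)" "card (verts S) = Suc DIM('a)"
  shows "(\<And>L. L \<in> verts S \<Longrightarrow> l \<le> w L) \<Longrightarrow> l \<le> simplex_value \<rho> S w"
    and "(\<And>L. L \<in> verts S \<Longrightarrow> w L \<le> l) \<Longrightarrow> simplex_value \<rho> S w \<le> l"
    and "(\<And>L. L \<in> verts S \<Longrightarrow> 0 \<le> w L) \<Longrightarrow> L \<in> verts S \<Longrightarrow> w L \<le> (real DIM('a) + 1) * simplex_value \<rho> S w"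
proof -
  obtain t where t: "\<And>L. L \<in> verts S \<Longrightarrow> 0 \<le> t L" "sum t (verts S) = 1"
    "simplex_value \<rho> S w = (\<Sum>L\<in>verts S. t L * w L)" by (rule simplex_value_convex[OF V, where w = w]) (rule that)
  show "l \<le> simplex_value \<rho> S w" if "\<And>L. L \<in> verts S \<Longrightarrow> l \<le> w L"
  proof -
    have "(\<Sum>L\<in>verts S. t L * l) \<le> (\<Sum>L\<in>verts S. t L * w L)"
      by (intro sum_mono mult_left_mono that t)
    then show ?thesis using t(2,3) by (simp add: sum_distrib_right[symmetric])
  qed
  show "simplex_value \<rho> S w \<le> l" if "\<And>L. L \<in> verts S \<Longrightarrow> w L \<le> l"
  proof -
    have "(\<Sum>L\<in>verts S. t L * w L) \<le> (\<Sum>L\<in>verts S. t L * l)"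
      by (intro sum_mono mult_left_mono that t)
    then show ?thesis using t(2,3) by (simp add: sum_distrib_right[symmetric])
  qed
  show "w L \<le> (real DIM('a) + 1) * simplex_value \<rho> S w"
    if w: "\<And>L. L \<in> verts S \<Longrightarrow> 0 \<le> w L" and L: "L \<in> verts S"
  proof (cases \<rho>)
    case Maximum
    have "w L \<le> Max (w ` verts S)" using V(1) L by (intro Max_ge) auto
    moreover from this have "0 \<le> Max (w ` verts S)" using w[OF L] by linarith
    ultimately show ?thesis using Maximum by (simp add: simplex_value_def algebra_simps add_increasing2)
  next
    case Average
    have "w L \<le> sum w (verts S)" by (rule member_le_sum) (use w L V(1) in auto)
    then show ?thesis using Average by (simp add: simplex_value_def)
  qed
qed

text \<open>Only the oscillations of \<open>\<surd>u\<^sub>0\<close> and \<open>\<surd>u\<^sub>0 u\<^sub>i\<close> may enter here: those of \<open>u\<^sub>i\<close> are not controlled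
  where \<open>u\<^sub>0\<close> degenerates.\<close>

lemma simplex_product_deviation:
  fixes S :: "'a::euclidean_space set" and \<rho> :: simplex_rule
  assumes V: "finite (verts S)" "card (verts S) = Suc DIM('a)"
    and s: "\<And>L. L \<in> verts S \<Longrightarrow> 0 < s L" "\<And>L. L \<in> verts S \<Longrightarrow> s L \<le> 1"
    and a: "\<And>L. L \<in> verts S \<Longrightarrow> 0 < a L" "\<And>L. L \<in> verts S \<Longrightarrow> a L \<le> 1"
    and K: "K \<in> verts S"
    and o: "\<And>L. L \<in> verts S \<Longrightarrow> \<bar>s L - s K\<bar> \<le> o'" "\<And>L. L \<in> verts S \<Longrightarrow> \<bar>s L * a L - s K * a K\<bar> \<le> o'"
  defines "U0 \<equiv> simplex_value \<rho> S (\<lambda>L. (s L)\<^sup>2)" and "U1 \<equiv> simplex_value \<rho> S a"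
  shows "\<bar>U0 * U1 - s K * (s K * a K)\<bar> \<le> 4 * o'" "0 < U0" "U0 \<le> 1" "0 < U1" "U1 \<le> 1" "sqrt U0 \<le> s K + o'"
proof -
  have o0: "0 \<le> o'" using o(1)[OF K] by simp
  have pos: "0 < simplex_value \<rho> S w" if w: "\<And>L. L \<in> verts S \<Longrightarrow> 0 < w L" for w
  proof -
    have "w K \<le> (real DIM('a) + 1) * simplex_value \<rho> S w"
      by (rule simplex_value_bounds(3)[OF V _ K]) (use w in \<open>auto intro: less_imp_le\<close>)
    then have "0 < (real DIM('a) + 1) * simplex_value \<rho> S w" using w[OF K] by linarith
    then show ?thesis by (simp add: zero_less_mult_iff add_pos_pos)
  qed
  show U0: "0 < U0" unfolding U0_def by (rule pos) (rule zero_less_power[OF s(1)])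
  show "U0 \<le> 1" unfolding U0_def
    by (rule simplex_value_bounds(2)[OF V]) (use s in \<open>auto simp: power_le_one less_imp_le\<close>)
  show U1: "0 < U1" "U1 \<le> 1" unfolding U1_def using pos[OF a(1)] simplex_value_bounds(2)[OF V, of a 1 \<rho>] a by auto
  have "U0 \<le> (s K + o')\<^sup>2" unfolding U0_def
  proof (rule simplex_value_bounds(2)[OF V])
    fix L assume L: "L \<in> verts S"
    have "s L \<le> s K + o'" using o(1)[OF L] by linarith
    then show "(s L)\<^sup>2 \<le> (s K + o')\<^sup>2" using s(1)[OF L] by (intro power_mono) auto
  qed
  then show "sqrt U0 \<le> s K + o'" using s(1)[OF K] o0 by (intro real_le_lsqrt) auto
  have d0: "\<bar>(s L)\<^sup>2 - (s K)\<^sup>2\<bar> \<le> 2 * o'" if L: "L \<in> verts S" for L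
  proof -
    have "(s L)\<^sup>2 - (s K)\<^sup>2 = (s L + s K) * (s L - s K)" by (simp add: power2_eq_square algebra_simps)
    moreover have "\<bar>s L + s K\<bar> * \<bar>s L - s K\<bar> \<le> 2 * o'"
      using s(1)[OF L] s(2)[OF L] s(1)[OF K] s(2)[OF K] o(1)[OF L] by (intro mult_mono) auto
    ultimately show ?thesis by (simp add: abs_mult)
  qed
  have "(s K)\<^sup>2 - 2 * o' \<le> U0" unfolding U0_def
    by (rule simplex_value_bounds(1)[OF V]) (use d0 in force)
  moreover have "U0 \<le> (s K)\<^sup>2 + 2 * o'" unfolding U0_def
    by (rule simplex_value_bounds(2)[OF V]) (use d0 in force)
  ultimately have 1: "\<bar>U0 - (s K)\<^sup>2\<bar> \<le> 2 * o'" by linarith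
  obtain t where t: "\<And>L. L \<in> verts S \<Longrightarrow> 0 \<le> t L" "sum t (verts S) = 1" "simplex_value \<rho> S a = (\<Sum>L\<in>verts S. t L * a L)"
    by (rule simplex_value_convex[OF V, where w = a and \<rho> = \<rho>]) (rule that)
  have d1: "\<bar>(s K)\<^sup>2 * a L - s K * (s K * a K)\<bar> \<le> 2 * o'" if L: "L \<in> verts S" for L
  proof -
    \<comment> \<open>The increment a L - a K is never isolated: it is expressed through the
      increments of s and of s * a, with bounded coefficients.\<close>
    have "(s K)\<^sup>2 * a L - s K * (s K * a K) = s K * a L * (s K - s L) + s K * (s L * a L - s K * a K)"
      by (simp add: power2_eq_square algebra_simps)
    moreover have "\<bar>s K * a L\<bar> * \<bar>s K - s L\<bar> \<le> 1 * o'"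
      using s(1)[OF K] s(2)[OF K] a(1)[OF L] a(2)[OF L] o(1)[OF L] by (intro mult_mono) (auto simp: mult_le_one)
    moreover have "\<bar>s K\<bar> * \<bar>s L * a L - s K * a K\<bar> \<le> 1 * o'"
      using s(1)[OF K] s(2)[OF K] o(2)[OF L] by (intro mult_mono) auto
    ultimately show ?thesis unfolding abs_mult[symmetric] by linarith
  qed
  have "(s K)\<^sup>2 * U1 - s K * (s K * a K) = (\<Sum>L\<in>verts S. t L * ((s K)\<^sup>2 * a L - s K * (s K * a K)))"
  proof -
    have "(\<Sum>L\<in>verts S. t L * ((s K)\<^sup>2 * a L - s K * (s K * a K)))
        = (\<Sum>L\<in>verts S. (s K)\<^sup>2 * (t L * a L) - t L * (s K * (s K * a K)))"
      by (rule sum.cong) (simp_all add: algebra_simps)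
    also have "\<dots> = (s K)\<^sup>2 * (\<Sum>L\<in>verts S. t L * a L) - sum t (verts S) * (s K * (s K * a K))"
      by (simp only: sum_subtractf sum_distrib_left sum_distrib_right)
    finally show ?thesis using t by (simp add: U1_def)
  qed
  also have "\<bar>\<dots>\<bar> \<le> (\<Sum>L\<in>verts S. t L * (2 * o'))"
    by (rule order_trans[OF sum_abs], rule sum_mono)
      (use t(1) d1 in \<open>simp add: abs_mult mult_left_mono\<close>)
  also have "\<dots> = 2 * o'" using t(2) by (simp add: sum_distrib_right[symmetric])
  finally have 2: "\<bar>(s K)\<^sup>2 * U1 - s K * (s K * a K)\<bar> \<le> 2 * o'" .
  \<comment> \<open>First \<open>U0\<close> is replaced by its vertex value, then \<open>U1\<close>;
    each replacement costs 2 o'.\<close>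
  have "U0 * U1 - s K * (s K * a K) = (U0 - (s K)\<^sup>2) * U1 + ((s K)\<^sup>2 * U1 - s K * (s K * a K))"
    by (simp add: algebra_simps)
  moreover have "\<bar>U0 - (s K)\<^sup>2\<bar> * \<bar>U1\<bar> \<le> (2 * o') * 1" using 1 U1 o0 by (intro mult_mono) auto
  ultimately show "\<bar>U0 * U1 - s K * (s K * a K)\<bar> \<le> 4 * o'" using 2 unfolding abs_mult[symmetric] by linarith
qed

context fe_mesh
begin

text \<open>The remainder is the discrete gradient of a single nodal function, with the coefficients
  U, s K and w K frozen on the simplex. \<open>edge_estimate\<close> along the edges from K bounds
  its oscillation by a multiple of the diameter, which the inverse inequality divides out
  again.\<close>

lemma flux_remainder:
  fixes \<rho> :: simplex_rule
  assumes reg: "mesh_regularity \<T> \<le> \<theta>" and S: "S \<in> \<T>" and K: "K \<in> verts S"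
    and s: "\<And>L. L \<in> verts S \<Longrightarrow> 0 < s L" "\<And>L. L \<in> verts S \<Longrightarrow> s L \<le> 1"
    and a: "\<And>L. L \<in> verts S \<Longrightarrow> 0 < a L" "\<And>L. L \<in> verts S \<Longrightarrow> a L \<le> 1"
    and m: "\<And>L. L \<in> verts S \<Longrightarrow> m L = ln (a L) - 2 * ln (s L)"
  defines "U \<equiv> simplex_value \<rho> S (\<lambda>L. (s L)\<^sup>2) * simplex_value \<rho> S a"
    and "w \<equiv> \<lambda>L. s L * a L"
  shows "norm (U *\<^sub>R gr S m - s K *\<^sub>R gr S w + (3 * w K) *\<^sub>R gr S s)
    \<le> 240 * (real DIM('a) + 1)^3 * \<theta> * sqrt (mesh_size \<T>) *
      (1 + U * (norm (gr S m))\<^sup>2 + (norm (gr S s))\<^sup>2 + (norm (gr S w))\<^sup>2)"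
    "\<bar>U - s K * w K\<bar> \<le> 4 * mesh_size \<T> * (norm (gr S s) + norm (gr S w))" "0 < U" "U \<le> 1"
proof -
  define c where "c = real DIM('a) + 1"
  define h where "h = diameter S"
  define g where "g = norm (gr S s) + norm (gr S w)"
  define E where "E = sqrt U * norm (gr S m)"
  \<comment> \<open>With o' = h g, this choice makes \<eta> and o' / \<eta> both of the order of the
    square root of the mesh size, up to the gradient factor g.\<close>
  define \<eta> where "\<eta> = sqrt (mesh_size \<T>)"
  have h0: "0 < h" "h \<le> mesh_size \<T>" using diameter_pos[OF S] diameter_le_mesh_size[OF S] by (auto simp: h_def)
  have \<eta>0: "0 < \<eta>" using mesh_size_pos by (simp add: \<eta>_def)
  have g0: "0 \<le> g" by (simp add: g_def)
  have c1: "1 \<le> c" by (simp add: c_def)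
  note V = finite_verts[OF S] card_verts[OF S]
  have os: "\<bar>s L - s J\<bar> \<le> h * g" "\<bar>s L * a L - s J * a J\<bar> \<le> h * g" if "J \<in> verts S" "L \<in> verts S" for J L
  proof -
    have "h * norm (gr S s) \<le> h * g" "h * norm (gr S w) \<le> h * g"
      using h0 by (auto simp: g_def intro!: mult_left_mono)
    then show "\<bar>s L - s J\<bar> \<le> h * g" "\<bar>s L * a L - s J * a J\<bar> \<le> h * g"
      using gr_vertices[OF S that, of s] gr_vertices[OF S that, of w] unfolding h_def w_def by linarith+
  qed
  define U0 where "U0 = simplex_value \<rho> S (\<lambda>L. (s L)\<^sup>2)"
  define U1 where "U1 = simplex_value \<rho> S a"
  have dev: "\<bar>U0 * U1 - s K * (s K * a K)\<bar> \<le> 4 * (h * g)" "0 < U0" "U0 \<le> 1" "0 < U1" "U1 \<le> 1"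
      "sqrt U0 \<le> s K + h * g"
    unfolding U0_def U1_def
    using simplex_product_deviation[OF V, where s = s and a = a and K = K and o' = "h * g" and \<rho> = \<rho>]
      s a K os[OF K] by simp_all
  have UU: "U = U0 * U1" by (simp add: U_def U0_def U1_def)
  show U: "0 < U" "U \<le> 1" using dev by (auto simp: UU mult_le_one)
  have "4 * (h * g) \<le> 4 * (mesh_size \<T> * g)" using h0 g0 by (intro mult_left_mono mult_right_mono) auto
  then show "\<bar>U - s K * w K\<bar> \<le> 4 * mesh_size \<T> * (norm (gr S s) + norm (gr S w))"
    using dev(1) unfolding UU w_def g_def by (simp only: mult.assoc)
  let ?R = "\<lambda>L. 1 * (U * m L + (- s K) * w L) + (3 * w K) * s L"
  have grR: "gr S ?R = U *\<^sub>R gr S m - s K *\<^sub>R gr S w + (3 * w K) *\<^sub>R gr S s"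
    unfolding gr_linear by simp
  let ?B = "30 * c\<^sup>2 * (\<eta> + h * g / \<eta>) * (h * E + h * g)"
  have "norm (gr S ?R) \<le> (real DIM('a) + 1) * \<theta> * ?B / diameter S"
  proof (rule norm_gr_le[OF reg S, of _ "?R K"])
    fix L assume L: "L \<in> verts S"
    have e1: "\<bar>m L - m K\<bar> \<le> h * norm (gr S m)" using gr_vertices[OF S K L] by (simp add: h_def)
    have "\<bar>?R L - ?R K\<bar> = \<bar>U0 * U1 * (m L - m K) - s K * (s L * a L - s K * a K) + 3 * (s K * a K) * (s L - s K)\<bar>"
      by (simp add: UU w_def algebra_simps)
    also have "\<dots> \<le> 30 * c\<^sup>2 * (\<eta> + h * g / \<eta>) * (sqrt (U0 * U1) * \<bar>m L - m K\<bar> + h * g)"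
    proof (rule edge_estimate)
      show "0 < s K" "0 < s L" "0 < a K" "0 < a L" "0 < U0" "0 < U1" "s K \<le> 1" "s L \<le> 1" "a K \<le> 1" "a L \<le> 1"
        "U0 \<le> 1" "U1 \<le> 1" using s a K L dev by auto
      show "1 \<le> c" "0 < \<eta>" by (rule c1, rule \<eta>0)
      show "\<bar>s L - s K\<bar> \<le> h * g" "\<bar>s L * a L - s K * a K\<bar> \<le> h * g" using os[OF K L] by auto
      show "\<bar>U0 * U1 - s K * (s K * a K)\<bar> \<le> 4 * (h * g)" "sqrt U0 \<le> s K + h * g" using dev by auto
      show "(s K)\<^sup>2 \<le> c * U0" "(s L)\<^sup>2 \<le> c * U0"
        unfolding c_def U0_def using simplex_value_bounds(3)[OF V, of "\<lambda>L. (s L)\<^sup>2"] K L by auto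
      show "a K \<le> c * U1" "a L \<le> c * U1"
        unfolding c_def U1_def using simplex_value_bounds(3)[OF V, of a] a(1) K L by (auto intro: less_imp_le)
      show "m L - m K = (ln (a L) - 2 * ln (s L)) - (ln (a K) - 2 * ln (s K))" using m K L by simp
    qed
    also have "\<dots> \<le> ?B"
    proof (rule mult_left_mono)
      have "sqrt (U0 * U1) * \<bar>m L - m K\<bar> \<le> sqrt U * (h * norm (gr S m))"
        unfolding UU using e1 U by (intro mult_left_mono) (auto simp: UU)
      then show "sqrt (U0 * U1) * \<bar>m L - m K\<bar> + h * g \<le> h * E + h * g" by (simp add: E_def mult_ac)
      show "0 \<le> 30 * c\<^sup>2 * (\<eta> + h * g / \<eta>)" using \<eta>0 h0 g0 by simp
    qed
    finally show "\<bar>?R L - ?R K\<bar> \<le> ?B" .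
  qed
  also have "\<dots> = 30 * c^3 * \<theta> * (\<eta> + h * g / \<eta>) * (E + g)"
    using h0 unfolding h_def[symmetric] c_def[symmetric] by (simp add: field_simps power2_eq_square power3_eq_cube)
  also have "\<dots> \<le> 30 * c^3 * \<theta> * (\<eta> * (8 * (1 + U * (norm (gr S m))\<^sup>2 + (norm (gr S s))\<^sup>2 + (norm (gr S w))\<^sup>2)))"
  proof -
    have "h * g / \<eta> \<le> \<eta> * g"
    proof -
      have "\<eta> * \<eta> = mesh_size \<T>" using mesh_size_pos by (simp add: \<eta>_def)
      then have "h * g \<le> \<eta> * \<eta> * g" using mult_right_mono[OF h0(2) g0] by (simp only:)
      then have "h * g \<le> \<eta> * g * \<eta>" by (simp only: mult_ac)
      then show ?thesis using \<eta>0 by (simp add: pos_divide_le_eq)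
    qed
    then have "\<eta> + h * g / \<eta> \<le> \<eta> * (1 + g)" by (simp add: algebra_simps)
    moreover have E0: "0 \<le> E" using U by (simp add: E_def)
    ultimately have "(\<eta> + h * g / \<eta>) * (E + g) \<le> \<eta> * (1 + g) * (E + g)" using g0 by (intro mult_right_mono) auto
    also have "\<dots> = \<eta> * ((1 + g) * (E + g))" by simp
    also have "\<dots> \<le> \<eta> * (8 * (1 + U * (norm (gr S m))\<^sup>2 + (norm (gr S s))\<^sup>2 + (norm (gr S w))\<^sup>2))"
    proof (rule mult_left_mono)
      have E2: "E\<^sup>2 = U * (norm (gr S m))\<^sup>2" using U by (simp add: E_def power_mult_distrib)
      have g2: "g\<^sup>2 \<le> 2 * (norm (gr S s))\<^sup>2 + 2 * (norm (gr S w))\<^sup>2"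
        unfolding g_def using zero_le_power2[of "norm (gr S s) - norm (gr S w)"]
        by (simp add: power2_sum power2_diff)
      \<comment> \<open>Young's inequality for each product. As g^2 is at most twice the sum of the
        two squared gradients, all coefficients stay below 8, and 30 * 8 = 240.\<close>
      have "(1 + g) * (E + g) \<le> 1 + 2 * E\<^sup>2 + 3 * g\<^sup>2"
      proof -
        have "2 * E \<le> 1 + E\<^sup>2" "2 * g \<le> 1 + g\<^sup>2" "2 * (g * E) \<le> g\<^sup>2 + E\<^sup>2"
          using zero_le_power2[of "1 - E"] zero_le_power2[of "1 - g"] zero_le_power2[of "g - E"]
          by (simp_all add: power2_diff)
        moreover have "(1 + g) * (E + g) = E + g + g * E + g\<^sup>2"
          by (simp add: algebra_simps power2_eq_square)
        moreover have "0 \<le> E\<^sup>2" "0 \<le> g\<^sup>2" by simp_all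
        ultimately show ?thesis by linarith
      qed
      then show "(1 + g) * (E + g) \<le> 8 * (1 + U * (norm (gr S m))\<^sup>2 + (norm (gr S s))\<^sup>2 + (norm (gr S w))\<^sup>2)"
      proof (rule order_trans)
        show "1 + 2 * E\<^sup>2 + 3 * g\<^sup>2 \<le> 8 * (1 + U * (norm (gr S m))\<^sup>2 + (norm (gr S s))\<^sup>2 + (norm (gr S w))\<^sup>2)"
          using g2 zero_le_power2[of E] zero_le_power2[of "norm (gr S s)"] zero_le_power2[of "norm (gr S w)"]
          unfolding distrib_left E2[symmetric] by linarith
      qed
    qed (use \<eta>0 in simp)
    finally have "(\<eta> + h * g / \<eta>) * (E + g) \<le> \<eta> * (8 * (1 + U * (norm (gr S m))\<^sup>2 + (norm (gr S s))\<^sup>2 + (norm (gr S w))\<^sup>2))" .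
    moreover have "0 \<le> \<theta>"
    proof -
      have "0 \<le> norm (G S K)" by simp
      also have "\<dots> \<le> \<theta> / diameter S" by (rule norm_G_le[OF reg S])
      finally show ?thesis using diameter_pos[OF S] by (simp add: zero_le_divide_iff)
    qed
    ultimately show ?thesis using c1 by (simp add: mult.assoc mult_left_mono)
  qed
  also have "\<dots> = 240 * c^3 * \<theta> * \<eta> * (1 + U * (norm (gr S m))\<^sup>2 + (norm (gr S s))\<^sup>2 + (norm (gr S w))\<^sup>2)"
    by simp
  finally show "norm (U *\<^sub>R gr S m - s K *\<^sub>R gr S w + (3 * w K) *\<^sub>R gr S s)
    \<le> 240 * (real DIM('a) + 1)^3 * \<theta> * sqrt (mesh_size \<T>) *
      (1 + U * (norm (gr S m))\<^sup>2 + (norm (gr S s))\<^sup>2 + (norm (gr S w))\<^sup>2)"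
    unfolding grR c_def \<eta>_def .
qed

end

section \<open>Entropy dissipation\<close>

lemma entropy_convex:
  fixes x y :: real
  assumes "0 < x" "0 \<le> y"
  shows "x * ln x - y * ln y - (x - y) \<le> ln x * (x - y)"
proof (cases "y = 0")
  case False
  then have y: "0 < y" using assms by simp
  have "ln (x / y) \<le> x / y - 1" by (rule ln_le_minus_one) (use y assms in simp)
  then have "y * (ln x - ln y) \<le> y * (x / y - 1)" using y assms by (intro mult_left_mono) (simp_all add: ln_div)
  then show ?thesis using y by (simp add: algebra_simps)
qed (use assms in \<open>simp add: algebra_simps\<close>)

lemma entropy_bounds:
  fixes x :: real
  assumes "0 \<le> x" "x \<le> 1"
  shows "- 1 \<le> x * ln x" "x * ln x \<le> 0"
proof -
  show "- 1 \<le> x * ln x"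
  proof (cases "x = 0")
    case False
    then have x: "0 < x" using assms by simp
    have "ln (1 / x) \<le> 1 / x - 1" by (rule ln_le_minus_one) (use x in simp)
    then have "x * (1 - 1 / x) \<le> x * ln x" using x by (intro mult_left_mono) (simp_all add: ln_div)
    then show ?thesis using x assms by (simp add: algebra_simps)
  qed simp
  show "x * ln x \<le> 0"
  proof (cases "x = 0")
    case False
    then show ?thesis using assms by (intro mult_nonneg_nonpos) simp_all
  qed simp
qed

text \<open>Expanding the nonnegative square of a + b bounds a . b from below.\<close>

lemma inner_add_ge:
  fixes a b :: "'a::real_inner"
  shows "1/2 * (norm a)\<^sup>2 - 1/2 * (norm b)\<^sup>2 \<le> (a + b) \<bullet> a"
proof -
  have "0 \<le> (a + b) \<bullet> (a + b)" by simp
  then show ?thesis by (simp add: power2_norm_eq_inner inner_add_left inner_add_right inner_commute)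
qed

locale fe_scheme = fe_disc P D for P :: "'a::euclidean_space problem" and D +
  fixes \<rho> :: simplex_rule and \<mu> :: "nat \<Rightarrow> nat \<Rightarrow> 'a \<Rightarrow> real" and \<phi> :: "nat \<Rightarrow> 'a \<Rightarrow> real"
  assumes scheme: "scheme_solution \<rho> P D \<mu> \<phi>"
begin

abbreviation n :: nat where "n \<equiv> nspec P"
abbreviation u :: "nat \<Rightarrow> nat \<Rightarrow> 'a \<Rightarrow> real" where "u \<equiv> u_disc P D \<mu>"
abbreviation s :: "nat \<Rightarrow> 'a \<Rightarrow> real" where "s \<equiv> \<lambda>k K. sqrt (u 0 k K)"
abbreviation w :: "nat \<Rightarrow> nat \<Rightarrow> 'a \<Rightarrow> real" where "w \<equiv> \<lambda>i k K. sqrt (u 0 k K) * u i k K"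

text \<open>The mobility multiplying the gradient of the electrochemical potential on a
  simplex.\<close>

definition U :: "nat \<Rightarrow> nat \<Rightarrow> 'a set \<Rightarrow> real" where
  "U i k S = simplex_value \<rho> S (u 0 k) * simplex_value \<rho> S (u i k)"

lemma u_pos: "1 \<le> k \<Longrightarrow> 0 < u i k K"
proof -
  assume k: "1 \<le> k"
  have "0 < 1 + (\<Sum>j=1..n. exp (\<mu> j k K))" by (intro add_pos_nonneg sum_nonneg) auto
  then show "0 < u i k K" using k by (auto simp: u_disc_def u0_disc_def)
qed

lemma u_sum: "1 \<le> k \<Longrightarrow> (\<Sum>i=0..n. u i k K) = 1"
proof -
  assume k: "1 \<le> k"
  have pos: "0 < 1 + (\<Sum>j=1..n. exp (\<mu> j k K))" by (intro add_pos_nonneg sum_nonneg) auto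
  have "(\<Sum>i=0..n. u i k K) = u 0 k K + (\<Sum>i=1..n. u i k K)"
    by (simp add: sum.atLeast_Suc_atMost)
  also have "(\<Sum>i=1..n. u i k K) = u0_disc P \<mu> k K * (\<Sum>i=1..n. exp (\<mu> i k K))"
    unfolding sum_distrib_left by (rule sum.cong) (use k in \<open>auto simp: u_disc_def\<close>)
  also have "u 0 k K = u0_disc P \<mu> k K" using k by (simp add: u_disc_def)
  also have "u0_disc P \<mu> k K + u0_disc P \<mu> k K * (\<Sum>i=1..n. exp (\<mu> i k K))
      = u0_disc P \<mu> k K * (1 + (\<Sum>i=1..n. exp (\<mu> i k K)))" by (simp add: algebra_simps)
  also have "\<dots> = 1" unfolding u0_disc_def using pos by simp
  finally show "(\<Sum>i=0..n. u i k K) = 1" .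
qed

lemma u_le_1: "1 \<le> k \<Longrightarrow> i \<in> {0..n} \<Longrightarrow> u i k K \<le> 1"
proof -
  assume k: "1 \<le> k" and i: "i \<in> {0..n}"
  have "u i k K \<le> (\<Sum>i=0..n. u i k K)"
    by (rule member_le_sum) (use i u_pos[OF k] in \<open>auto intro: less_imp_le\<close>)
  then show "u i k K \<le> 1" using u_sum[OF k] by simp
qed

lemma mu_eq: "1 \<le> k \<Longrightarrow> i \<in> {1..n} \<Longrightarrow> \<mu> i k K = ln (u i k K) - ln (u 0 k K)"
proof -
  assume k: "1 \<le> k" and i: "i \<in> {1..n}"
  have "u i k K = u 0 k K * exp (\<mu> i k K)" using k i by (simp add: u_disc_def)
  then have "ln (u i k K) = ln (u 0 k K) + \<mu> i k K" using u_pos[OF k, of 0 K] by (simp add: ln_mult)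
  then show "\<mu> i k K = ln (u i k K) - ln (u 0 k K)" by simp
qed

section \<open>Initial data and their cell averages\<close>

lemma ini:
  assumes i: "i \<in> {0..n}"
  shows "u_ini P i \<in> borel_measurable M" "AE x in M. 0 \<le> u_ini P i x" "AE x in M. u_ini P i x \<le> 1"
    "AE x in M. (\<Sum>i=0..n. u_ini P i x) = 1" "integrable M (u_ini P i)"
proof -
  have all: "AE x in M. 0 \<le> u_ini P j x" if "j \<in> {0..n}" for j
    using problem that by (auto simp: admissible_problem_def Let_def)
  show m: "u_ini P i \<in> borel_measurable M" "AE x in M. 0 \<le> u_ini P i x"
    and sum1: "AE x in M. (\<Sum>i=0..n. u_ini P i x) = 1"
    using problem i by (auto simp: admissible_problem_def Let_def Linf_def)
  have "AE x in M. \<forall>j\<in>{0..n}. 0 \<le> u_ini P j x" using all by (simp add: AE_ball_countable)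
  with sum1 show le: "AE x in M. u_ini P i x \<le> 1"
  proof eventually_elim
    case (elim x)
    have "u_ini P i x \<le> (\<Sum>i=0..n. u_ini P i x)" by (rule member_le_sum) (use i elim in auto)
    then show ?case using elim by simp
  qed
  show "integrable M (u_ini P i)"
  proof (rule Bochner_Integration.integrable_bound)
    show "integrable M (\<lambda>x. 1::real)" using finite_M by (simp add: finite_measure.integrable_const)
    show "AE x in M. norm (u_ini P i x) \<le> norm (1::real)" using m(2) le by eventually_elim simp
  qed (rule m)
qed

lemma integral_cell: "(LINT x|lebesgue_on (cell K). f x) = (LINT x|M. indicat_real (cell K) x * f x)"
proof -
  have "(\<lambda>x. indicat_real (cell K) x *\<^sub>R f x) = (\<lambda>x. indicat_real \<Omega> x *\<^sub>R (indicat_real (cell K) x * f x))"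
    using cell_subset[of K] by (auto simp: indicator_def fun_eq_iff)
  then show ?thesis
    using cell_borel problem_facts(6) by (simp add: integral_restrict_space del: real_scaleR_def)
qed

text \<open>Positivity of the cell volumes is not established. If a cell has measure 0, the
  convention 1 / 0 = 0 makes the initial value 0, and the integral over the cell vanishes as
  well.\<close>

lemma vol_u_ini: "vol P D K * u i 0 K = (LINT x|lebesgue_on (cell K). u_ini P i x)"
proof (cases "vol P D K = 0")
  case True
  then have "negligible (cell K)"
    using open_cell[of K] cell_subset[of K] bounded_domain
    by (meson bounded_subset lmeasurable_open negligible_iff_measure)
  then have "AE x in lebesgue_on (cell K). u_ini P i x = 0"
    using cell_borel by (subst AE_restrict_space_iff)
      (auto simp: negligible_iff_null_sets dest!: AE_not_in elim: eventually_mono)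
  then have "(LINT x|lebesgue_on (cell K). u_ini P i x) = 0" by (rule integral_eq_zero_AE)
  then show ?thesis using True by (simp add: u_disc_def)
qed (simp add: u_disc_def)

lemma u0_bounds:
  assumes i: "i \<in> {0..n}" and v: "0 < vol P D K"
  shows "0 \<le> u i 0 K" "u i 0 K \<le> 1"
proof -
  have l: "(LINT x|lebesgue_on (cell K). u_ini P i x) = (LINT x|M. indicat_real (cell K) x * u_ini P i x)"
    by (rule integral_cell)
  have "0 \<le> (LINT x|M. indicat_real (cell K) x * u_ini P i x)"
    by (rule integral_nonneg_AE) (use ini(2)[OF i] in \<open>eventually_elim, simp\<close>)
  then have "0 \<le> vol P D K * u i 0 K" using l by (simp add: vol_u_ini)
  then show "0 \<le> u i 0 K" using v by (simp add: zero_le_mult_iff)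
  have "(LINT x|M. indicat_real (cell K) x * u_ini P i x) \<le> (LINT x|M. indicat_real (cell K) x)"
  proof (rule integral_mono_AE)
    show "integrable M (\<lambda>x. indicat_real (cell K) x * u_ini P i x)"
      using integrable_mult_indicator[OF _ ini(5)[OF i], of "cell K"] cell_borel[of K] cell_subset[of K] problem_facts(6)
      by (simp add: sets_restrict_space_iff Int_absorb2)
    show "integrable M (indicat_real (cell K))"
      using integrable_mult_indicator[OF _ finite_measure.integrable_const[OF finite_M, of "1::real"], of "cell K"]
        cell_borel[of K] cell_subset[of K] problem_facts(6)
      by (simp add: sets_restrict_space_iff Int_absorb2)
    show "AE x in M. indicat_real (cell K) x * u_ini P i x \<le> indicat_real (cell K) x"
      using ini(3)[OF i] by eventually_elim (simp add: indicator_def)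
  qed
  also have "\<dots> = vol P D K" by (rule integral_indicator_M[OF cell_subset open_cell])
  finally have "vol P D K * u i 0 K \<le> vol P D K * 1" using l by (simp add: vol_u_ini)
  then show "u i 0 K \<le> 1" using v by (simp only: mult_le_cancel_left_pos)
qed

lemma u0_sum:
  assumes v: "0 < vol P D K"
  shows "(\<Sum>i=0..n. u i 0 K) = 1"
proof -
  have i: "integrable M (\<lambda>x. indicat_real (cell K) x * u_ini P i x)" if "i \<in> {0..n}" for i
    using integrable_mult_indicator[OF _ ini(5)[OF that], of "cell K"] cell_borel[of K] cell_subset[of K] problem_facts(6)
    by (simp add: sets_restrict_space_iff Int_absorb2)
  have "vol P D K * (\<Sum>i=0..n. u i 0 K) = (\<Sum>i=0..n. (LINT x|M. indicat_real (cell K) x * u_ini P i x))"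
    unfolding sum_distrib_left by (intro sum.cong refl) (simp add: vol_u_ini integral_cell)
  also have "\<dots> = (LINT x|M. (\<Sum>i=0..n. indicat_real (cell K) x * u_ini P i x))"
    by (rule Bochner_Integration.integral_sum[symmetric]) (rule i)
  also have "\<dots> = (LINT x|M. indicat_real (cell K) x)"
  proof (rule integral_cong_AE)
    show "(\<lambda>x. \<Sum>i=0..n. indicat_real (cell K) x * u_ini P i x) \<in> borel_measurable M"
      using i by (intro borel_measurable_sum borel_measurable_integrable)
    show "indicat_real (cell K) \<in> borel_measurable M"
      using cell_borel[of K] cell_subset[of K] problem_facts(6)
      by (intro borel_measurable_indicator) (simp add: sets_restrict_space_iff)
    show "AE x in M. (\<Sum>i=0..n. indicat_real (cell K) x * u_ini P i x) = indicat_real (cell K) x"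
      using ini(4)[of 0] by (auto simp: sum_distrib_left[symmetric] elim: eventually_mono)
  qed
  also have "\<dots> = vol P D K" by (rule integral_indicator_M[OF cell_subset open_cell])
  finally show ?thesis using v by simp
qed

text \<open>The discrete weak formulation: multiply by v K, sum over the vertices, regroup by
  simplices. The flux is linear in the electrochemical potential \<mu> + \<beta> z \<phi>, so a
  single use of \<open>stiffness_sum\<close> turns it into a gradient.\<close>

lemma tested_transport:
  assumes i: "i \<in> {1..n}" and k: "k \<in> {1..N}"
  shows "(\<Sum>K\<in>mesh_verts \<T>. vol P D K * (u i k K - u i (k - 1) K) * v K)
    + time_step D k * (diffus P i * (\<Sum>S\<in>\<T>. measure lebesgue S *
        (U i k S * ((gr S (\<mu> i k) + (beta P * charge P i) *\<^sub>R gr S (\<phi> k)) \<bullet> gr S v)))) = 0"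
proof -
  let ?\<beta> = "beta P * charge P i"
  let ?\<xi> = "\<lambda>K. 1 * \<mu> i k K + ?\<beta> * \<phi> k K"
  have \<tau>: "0 < time_step D k" by (rule time_step_pos[OF k])
  have eq: "vol P D K * ((u i k K - u i (k - 1) K) / time_step D k)
        + (\<Sum>S\<in>simplices_at \<T> K. \<Sum>L\<in>verts S.
             simplex_value \<rho> S (u 0 k) * simplex_value \<rho> S (u i k) * flux P D \<mu> \<phi> i k S K L) = 0"
    if "K \<in> mesh_verts \<T>" for K
    using scheme i k that by (auto simp: scheme_solution_def Let_def)
  have fl: "(\<Sum>L\<in>verts S. simplex_value \<rho> S (u 0 k) * simplex_value \<rho> S (u i k) * flux P D \<mu> \<phi> i k S K L)
      = diffus P i * U i k S * (measure lebesgue S * (G S K \<bullet> gr S ?\<xi>))" if S: "S \<in> \<T>" for S K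
  proof -
    have "(\<Sum>L\<in>verts S. simplex_value \<rho> S (u 0 k) * simplex_value \<rho> S (u i k) * flux P D \<mu> \<phi> i k S K L)
        = diffus P i * U i k S * (\<Sum>L\<in>verts S. stiffness \<T> S K L * (?\<xi> K - ?\<xi> L))"
      unfolding sum_distrib_left U_def flux_def by (rule sum.cong) (simp_all add: algebra_simps)
    then show ?thesis by (simp only: stiffness_sum[OF S, of K ?\<xi>])
  qed
  have grx: "gr S ?\<xi> = gr S (\<mu> i k) + ?\<beta> *\<^sub>R gr S (\<phi> k)" for S unfolding gr_linear by simp
  have "0 = (\<Sum>K\<in>mesh_verts \<T>. (vol P D K * ((u i k K - u i (k - 1) K) / time_step D k)
        + (\<Sum>S\<in>simplices_at \<T> K. \<Sum>L\<in>verts S.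
             simplex_value \<rho> S (u 0 k) * simplex_value \<rho> S (u i k) * flux P D \<mu> \<phi> i k S K L)) * v K)"
    using eq by simp
  also have "\<dots> = (\<Sum>K\<in>mesh_verts \<T>. vol P D K * ((u i k K - u i (k - 1) K) / time_step D k) * v K)
      + (\<Sum>K\<in>mesh_verts \<T>. \<Sum>S\<in>simplices_at \<T> K. (\<Sum>L\<in>verts S.
             simplex_value \<rho> S (u 0 k) * simplex_value \<rho> S (u i k) * flux P D \<mu> \<phi> i k S K L) * v K)"
    by (simp only: distrib_right sum.distrib sum_distrib_right)
  also have "(\<Sum>K\<in>mesh_verts \<T>. \<Sum>S\<in>simplices_at \<T> K. (\<Sum>L\<in>verts S.
             simplex_value \<rho> S (u 0 k) * simplex_value \<rho> S (u i k) * flux P D \<mu> \<phi> i k S K L) * v K)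
      = (\<Sum>S\<in>\<T>. \<Sum>K\<in>verts S. (\<Sum>L\<in>verts S.
             simplex_value \<rho> S (u 0 k) * simplex_value \<rho> S (u i k) * flux P D \<mu> \<phi> i k S K L) * v K)"
    by (rule sum_simplices_at)
  also have "\<dots> = (\<Sum>S\<in>\<T>. diffus P i * (measure lebesgue S * (U i k S * (gr S ?\<xi> \<bullet> gr S v))))"
  proof (rule sum.cong[OF refl])
    fix S assume S: "S \<in> \<T>"
    have "(\<Sum>K\<in>verts S. (\<Sum>L\<in>verts S.
             simplex_value \<rho> S (u 0 k) * simplex_value \<rho> S (u i k) * flux P D \<mu> \<phi> i k S K L) * v K)
        = (\<Sum>K\<in>verts S. diffus P i * (measure lebesgue S * (U i k S * (gr S ?\<xi> \<bullet> (v K *\<^sub>R G S K)))))"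
      unfolding fl[OF S] by (rule sum.cong) (simp_all add: inner_commute)
    also have "\<dots> = diffus P i * (measure lebesgue S * (U i k S * (gr S ?\<xi> \<bullet> gr S v)))"
      by (simp only: gr_def[of S v] inner_sum_right sum_distrib_left)
    finally show "(\<Sum>K\<in>verts S. (\<Sum>L\<in>verts S.
             simplex_value \<rho> S (u 0 k) * simplex_value \<rho> S (u i k) * flux P D \<mu> \<phi> i k S K L) * v K)
        = diffus P i * (measure lebesgue S * (U i k S * (gr S ?\<xi> \<bullet> gr S v)))" .
  qed
  finally have "0 = time_step D k * ((\<Sum>K\<in>mesh_verts \<T>. vol P D K * ((u i k K - u i (k - 1) K) / time_step D k) * v K)
      + (\<Sum>S\<in>\<T>. diffus P i * (measure lebesgue S * (U i k S * ((gr S (\<mu> i k) + ?\<beta> *\<^sub>R gr S (\<phi> k)) \<bullet> gr S v)))))"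
    unfolding grx by simp
  also have "\<dots> = (\<Sum>K\<in>mesh_verts \<T>. vol P D K * (u i k K - u i (k - 1) K) * v K)
    + time_step D k * (diffus P i * (\<Sum>S\<in>\<T>. measure lebesgue S *
        (U i k S * ((gr S (\<mu> i k) + ?\<beta> *\<^sub>R gr S (\<phi> k)) \<bullet> gr S v))))"
    unfolding distrib_left using \<tau> by (simp add: sum_distrib_left)
  finally show ?thesis by simp
qed

text \<open>At Dirichlet vertices the scheme prescribes \<phi> instead of an equation; these rows
  are multiplied by v K = 0.\<close>

lemma tested_poisson:
  assumes k: "k \<in> {1..N}" and v: "\<And>K. K \<in> mesh_verts \<T> \<inter> Gamma_D P \<Longrightarrow> v K = 0"
  shows "(lam P)\<^sup>2 * (\<Sum>S\<in>\<T>. measure lebesgue S * (gr S (\<phi> k) \<bullet> gr S v))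
    = (\<Sum>K\<in>mesh_verts \<T>. (vol P D K * (\<Sum>i=1..n. charge P i * u i k K)
        + (LINT x|lebesgue_on (cell K). f_source P x)) * v K)"
proof -
  have eq: "(lam P)\<^sup>2 * (\<Sum>S\<in>simplices_at \<T> K. \<Sum>L\<in>verts S. stiffness \<T> S K L * (\<phi> k K - \<phi> k L)) * v K
             = (vol P D K * (\<Sum>i=1..n. charge P i * u i k K)
               + (LINT x|lebesgue_on (cell K). f_source P x)) * v K"
    if K: "K \<in> mesh_verts \<T>" for K
  proof (cases "K \<in> Gamma_D P")
    case True
    then show ?thesis using v K by simp
  next
    case False
    then show ?thesis using scheme k K by (auto simp: scheme_solution_def Let_def)
  qed
  have "(\<Sum>K\<in>mesh_verts \<T>. (vol P D K * (\<Sum>i=1..n. charge P i * u i k K)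
        + (LINT x|lebesgue_on (cell K). f_source P x)) * v K)
      = (\<Sum>K\<in>mesh_verts \<T>. (lam P)\<^sup>2 * (\<Sum>S\<in>simplices_at \<T> K. \<Sum>L\<in>verts S. stiffness \<T> S K L * (\<phi> k K - \<phi> k L)) * v K)"
    by (rule sum.cong[OF refl]) (rule eq[symmetric])
  also have "\<dots> = (lam P)\<^sup>2 * (\<Sum>K\<in>mesh_verts \<T>. \<Sum>S\<in>simplices_at \<T> K. (\<Sum>L\<in>verts S. stiffness \<T> S K L * (\<phi> k K - \<phi> k L)) * v K)"
    by (simp only: sum_distrib_left sum_distrib_right mult.assoc)
  also have "(\<Sum>K\<in>mesh_verts \<T>. \<Sum>S\<in>simplices_at \<T> K. (\<Sum>L\<in>verts S. stiffness \<T> S K L * (\<phi> k K - \<phi> k L)) * v K)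
      = (\<Sum>S\<in>\<T>. \<Sum>K\<in>verts S. (\<Sum>L\<in>verts S. stiffness \<T> S K L * (\<phi> k K - \<phi> k L)) * v K)"
    by (rule sum_simplices_at)
  also have "\<dots> = (\<Sum>S\<in>\<T>. measure lebesgue S * (gr S (\<phi> k) \<bullet> gr S v))"
  proof (rule sum.cong[OF refl])
    fix S assume S: "S \<in> \<T>"
    have "(\<Sum>K\<in>verts S. (\<Sum>L\<in>verts S. stiffness \<T> S K L * (\<phi> k K - \<phi> k L)) * v K)
        = (\<Sum>K\<in>verts S. measure lebesgue S * (gr S (\<phi> k) \<bullet> (v K *\<^sub>R G S K)))"
      unfolding stiffness_sum[OF S] by (rule sum.cong) (simp_all add: inner_commute)
    also have "\<dots> = measure lebesgue S * (gr S (\<phi> k) \<bullet> gr S v)"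
      by (simp only: gr_def[of S v] inner_sum_right sum_distrib_left)
    finally show "(\<Sum>K\<in>verts S. (\<Sum>L\<in>verts S. stiffness \<T> S K L * (\<phi> k K - \<phi> k L)) * v K)
        = measure lebesgue S * (gr S (\<phi> k) \<bullet> gr S v)" .
  qed
  finally show ?thesis by simp
qed

lemma sum_vol_le: "(\<Sum>K\<in>mesh_verts \<T>. vol P D K) \<le> measure M \<Omega>"
proof -
  have i: "integrable M (indicat_real (cell K))" for K
    using integrable_mult_indicator[OF _ finite_measure.integrable_const[OF finite_M, of "1::real"], of "cell K"]
        cell_borel[of K] cell_subset[of K] problem_facts(6)
    by (simp add: sets_restrict_space_iff Int_absorb2)
  have "(\<Sum>K\<in>mesh_verts \<T>. vol P D K) = (LINT x|M. (\<Sum>K\<in>mesh_verts \<T>. indicat_real (cell K) x))"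
    by (simp only: Bochner_Integration.integral_sum[OF i] integral_indicator_M[OF cell_subset open_cell])
  also have "\<dots> \<le> (LINT x|M. 1)"
  proof (rule integral_mono)
    fix x
    show "(\<Sum>K\<in>mesh_verts \<T>. indicat_real (cell K) x) \<le> 1"
    proof (cases "\<exists>K\<in>mesh_verts \<T>. x \<in> cell K")
      case True
      then obtain K where "K \<in> mesh_verts \<T>" "x \<in> cell K" by blast
      from sum_cell[OF this, of "\<lambda>_. 1"] show ?thesis by simp
    next
      case False
      then have "(\<Sum>K\<in>mesh_verts \<T>. indicat_real (cell K) x) = 0" by (intro sum.neutral) auto
      then show ?thesis by simp
    qed
  qed (use i finite_M in \<open>auto simp: finite_measure.integrable_const\<close>)
  also have "\<dots> = measure M \<Omega>" by simp
  finally show ?thesis .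
qed

text \<open>Species 0 has no transport equation. Since the increments over all species sum to 0, ln
  u_0 may be subtracted from every tangent slope; this removes species 0 and turns the remaining
  slopes into \<mu>.\<close>

lemma entropy_step:
  assumes k: "k \<in> {1..N}" and v: "0 < vol P D K"
  shows "(\<Sum>i=0..n. u i k K * ln (u i k K)) - (\<Sum>i=0..n. u i (k - 1) K * ln (u i (k - 1) K))
    \<le> (\<Sum>i=1..n. (u i k K - u i (k - 1) K) * \<mu> i k K)"
proof -
  have k1: "1 \<le> k" using k by simp
  let ?d = "\<lambda>i. u i k K - u i (k - 1) K"
  have nn: "0 \<le> u i (k - 1) K" if "i \<in> {0..n}" for i
    using u0_bounds[OF that v] u_pos[of "k - 1" i K] by (cases "k - 1 = 0") (auto intro: less_imp_le)
  have "(\<Sum>i=0..n. u i (k - 1) K) = 1" using u0_sum[OF v] u_sum[of "k - 1" K] by (cases "k - 1 = 0") auto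
  then have d0: "(\<Sum>i=0..n. ?d i) = 0" using u_sum[OF k1] by (simp add: sum_subtractf)
  then have d1: "(\<Sum>i=1..n. ?d i) = - ?d 0" by (simp add: sum.atLeast_Suc_atMost)
  have "(\<Sum>i=0..n. u i k K * ln (u i k K)) - (\<Sum>i=0..n. u i (k - 1) K * ln (u i (k - 1) K))
      = (\<Sum>i=0..n. u i k K * ln (u i k K) - u i (k - 1) K * ln (u i (k - 1) K) - ?d i)"
    using d0 by (simp add: sum_subtractf)
  also have "\<dots> \<le> (\<Sum>i=0..n. ln (u i k K) * ?d i)"
    by (rule sum_mono) (rule entropy_convex[OF u_pos[OF k1] nn], simp)
  also have "\<dots> = ln (u 0 k K) * ?d 0 + (\<Sum>i=1..n. ln (u i k K) * ?d i)"
    by (simp add: sum.atLeast_Suc_atMost)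
  also have "\<dots> = (\<Sum>i=1..n. ln (u i k K) * ?d i) - ln (u 0 k K) * (\<Sum>i=1..n. ?d i)"
    unfolding d1 by (simp add: algebra_simps)
  also have "\<dots> = (\<Sum>i=1..n. ln (u i k K) * ?d i - ln (u 0 k K) * ?d i)"
    by (simp only: sum_distrib_left
        sum_subtractf[of "\<lambda>i. ln (u i k K) * ?d i" "\<lambda>i. ln (u 0 k K) * ?d i"])
  also have "\<dots> = (\<Sum>i=1..n. ?d i * \<mu> i k K)"
    by (rule sum.cong) (auto simp: mu_eq[OF k1] algebra_simps)
  finally show ?thesis .
qed

lemma U_bounds:
  assumes "k \<in> {1..N}" "i \<in> {1..n}" "S \<in> \<T>"
  shows "0 \<le> U i k S" "U i k S \<le> 1"
proof -
  note V = finite_verts[OF assms(3)] card_verts[OF assms(3)]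
  have "0 \<le> simplex_value \<rho> S (u j k)" "simplex_value \<rho> S (u j k) \<le> 1" if "j \<in> {0..n}" for j
    using simplex_value_bounds(1)[OF V, of 0 "u j k"] simplex_value_bounds(2)[OF V, of "u j k" 1]
      u_pos[of k j] u_le_1[of k j] assms(1) that by (auto intro: less_imp_le)
  then show "0 \<le> U i k S" "U i k S \<le> 1" using assms(2) by (auto simp: U_def mult_le_one)
qed

text \<open>Testing with \<mu> gives the dissipation and a cross term with \<phi>, which Young's
  inequality absorbs at the price of half the dissipation; the entropies telescope in time. Doubling
  the result restores the full dissipation.\<close>

lemma entropy_dissipation:
  "(\<Sum>i=1..n. diffus P i * (\<Sum>k=1..N. time_step D k * (\<Sum>S\<in>\<T>. measure lebesgue S * (U i k S * (norm (gr S (\<mu> i k)))\<^sup>2))))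
   \<le> 2 * (real n + 1) * measure M \<Omega>
     + (\<Sum>i=1..n. diffus P i * (beta P * charge P i)\<^sup>2) *
       (\<Sum>k=1..N. time_step D k * (\<Sum>S\<in>\<T>. measure lebesgue S * (norm (gr S (\<phi> k)))\<^sup>2))"
proof -
  let ?H = "\<lambda>k K. \<Sum>i=0..n. u i k K * ln (u i k K)"
  let ?b = "\<lambda>i. beta P * charge P i"
  let ?A = "\<lambda>i k. \<Sum>S\<in>\<T>. measure lebesgue S * (U i k S * (norm (gr S (\<mu> i k)))\<^sup>2)"
  let ?F = "\<lambda>k. \<Sum>S\<in>\<T>. measure lebesgue S * (norm (gr S (\<phi> k)))\<^sup>2"
  have Dpos: "0 < diffus P i" if "i \<in> {1..n}" for i
    using problem that by (auto simp: admissible_problem_def Let_def)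
  have step: "(\<Sum>K\<in>mesh_verts \<T>. vol P D K * (?H k K - ?H (k - 1) K))
      + (\<Sum>i=1..n. time_step D k * (diffus P i * (1/2 * ?A i k - 1/2 * (?b i)\<^sup>2 * ?F k))) \<le> 0" if k: "k \<in> {1..N}" for k
  proof -
    have "(\<Sum>K\<in>mesh_verts \<T>. vol P D K * (?H k K - ?H (k - 1) K))
        \<le> (\<Sum>K\<in>mesh_verts \<T>. vol P D K * (\<Sum>i=1..n. (u i k K - u i (k - 1) K) * \<mu> i k K))"
    proof (rule sum_mono)
      fix K
      \<comment> \<open>\<open>entropy_step\<close> concerns cells of positive volume; a null cell
        contributes 0 to both sides.\<close>
      have "0 \<le> vol P D K" by simp
      then consider "vol P D K = 0" | "0 < vol P D K" by linarith
      then show "vol P D K * (?H k K - ?H (k - 1) K) \<le> vol P D K * (\<Sum>i=1..n. (u i k K - u i (k - 1) K) * \<mu> i k K)"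
        by cases (simp, rule mult_left_mono[OF entropy_step[OF k]], auto)
    qed
    also have "\<dots> = (\<Sum>i=1..n. \<Sum>K\<in>mesh_verts \<T>. vol P D K * (u i k K - u i (k - 1) K) * \<mu> i k K)"
      unfolding sum_distrib_left by (subst sum.swap) (simp add: mult.assoc)
    finally have 1: "(\<Sum>K\<in>mesh_verts \<T>. vol P D K * (?H k K - ?H (k - 1) K))
        \<le> (\<Sum>i=1..n. \<Sum>K\<in>mesh_verts \<T>. vol P D K * (u i k K - u i (k - 1) K) * \<mu> i k K)" .
    have "(\<Sum>i=1..n. time_step D k * (diffus P i * (1/2 * ?A i k - 1/2 * (?b i)\<^sup>2 * ?F k)))
        \<le> (\<Sum>i=1..n. time_step D k * (diffus P i * (\<Sum>S\<in>\<T>. measure lebesgue S *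
        (U i k S * ((gr S (\<mu> i k) + ?b i *\<^sub>R gr S (\<phi> k)) \<bullet> gr S (\<mu> i k))))))"
    proof (intro sum_mono mult_left_mono)
      fix i assume i: "i \<in> {1..n}"
      have "1/2 * ?A i k - 1/2 * (?b i)\<^sup>2 * ?F k
          = (\<Sum>S\<in>\<T>. measure lebesgue S * (1/2 * (U i k S * (norm (gr S (\<mu> i k)))\<^sup>2) - 1/2 * (?b i)\<^sup>2 * (norm (gr S (\<phi> k)))\<^sup>2))"
        by (simp add: sum_distrib_left sum_subtractf algebra_simps)
      also have "\<dots> \<le> (\<Sum>S\<in>\<T>. measure lebesgue S *
        (U i k S * ((gr S (\<mu> i k) + ?b i *\<^sub>R gr S (\<phi> k)) \<bullet> gr S (\<mu> i k))))"
      proof (intro sum_mono mult_left_mono)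
        fix S assume S: "S \<in> \<T>"
        let ?g = "gr S (\<mu> i k)" and ?f = "?b i *\<^sub>R gr S (\<phi> k)"
        note Ub = U_bounds[OF k i S]
        have y: "1/2 * (norm ?g)\<^sup>2 - 1/2 * (norm ?f)\<^sup>2 \<le> (?g + ?f) \<bullet> ?g"
          by (rule inner_add_ge)
        have nf: "(norm ?f)\<^sup>2 = (?b i)\<^sup>2 * (norm (gr S (\<phi> k)))\<^sup>2" by (simp add: power_mult_distrib)
        \<comment> \<open>Here U <= 1 frees the \<phi> term from the mobility, so that the plain
          gradient of \<phi> controls it.\<close>
        have "1/2 * (U i k S * (norm ?g)\<^sup>2) - 1/2 * (?b i)\<^sup>2 * (norm (gr S (\<phi> k)))\<^sup>2
            \<le> 1/2 * (U i k S * (norm ?g)\<^sup>2) - 1/2 * (U i k S * (norm ?f)\<^sup>2)"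
          using mult_right_mono[OF Ub(2), of "(norm ?f)\<^sup>2"] nf by simp
        also have "\<dots> = U i k S * (1/2 * (norm ?g)\<^sup>2 - 1/2 * (norm ?f)\<^sup>2)" by (simp add: algebra_simps)
        also have "\<dots> \<le> U i k S * ((?g + ?f) \<bullet> ?g)" by (rule mult_left_mono[OF y Ub(1)])
        finally show "1/2 * (U i k S * (norm ?g)\<^sup>2) - 1/2 * (?b i)\<^sup>2 * (norm (gr S (\<phi> k)))\<^sup>2 \<le> U i k S * ((?g + ?f) \<bullet> ?g)" .
      qed simp
      finally show "1/2 * ?A i k - 1/2 * (?b i)\<^sup>2 * ?F k \<le> (\<Sum>S\<in>\<T>. measure lebesgue S *
        (U i k S * ((gr S (\<mu> i k) + ?b i *\<^sub>R gr S (\<phi> k)) \<bullet> gr S (\<mu> i k))))" .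
    qed (use Dpos time_step_pos[OF k] in \<open>auto intro: less_imp_le\<close>)
    moreover have "(\<Sum>i=1..n. (\<Sum>K\<in>mesh_verts \<T>. vol P D K * (u i k K - u i (k - 1) K) * \<mu> i k K)
      + time_step D k * (diffus P i * (\<Sum>S\<in>\<T>. measure lebesgue S *
        (U i k S * ((gr S (\<mu> i k) + ?b i *\<^sub>R gr S (\<phi> k)) \<bullet> gr S (\<mu> i k)))))) = 0"
      by (rule sum.neutral) (use tested_transport[OF _ k] in blast)
    ultimately show ?thesis using 1 unfolding sum.distrib by linarith
  qed
  have "(\<Sum>k=1..N. (\<Sum>K\<in>mesh_verts \<T>. vol P D K * (?H k K - ?H (k - 1) K))
      + (\<Sum>i=1..n. time_step D k * (diffus P i * (1/2 * ?A i k - 1/2 * (?b i)\<^sup>2 * ?F k)))) \<le> 0"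
    by (rule sum_nonpos) (rule step)
  then have tot: "(\<Sum>k=1..N. \<Sum>K\<in>mesh_verts \<T>. vol P D K * (?H k K - ?H (k - 1) K))
      + (\<Sum>k=1..N. \<Sum>i=1..n. time_step D k * (diffus P i * (1/2 * ?A i k - 1/2 * (?b i)\<^sup>2 * ?F k))) \<le> 0"
    by (simp only: sum.distrib)
  have "(\<Sum>k=1..N. \<Sum>K\<in>mesh_verts \<T>. vol P D K * (?H k K - ?H (k - 1) K))
      = (\<Sum>K\<in>mesh_verts \<T>. vol P D K * (?H N K - ?H 0 K))"
  proof -
    have tel: "(\<Sum>k=1..N. ?H k K - ?H (k - 1) K) = ?H N K - ?H 0 K" for K
      using sum_telescope''[of 0 N "\<lambda>k. ?H k K"] by simp
    show ?thesis by (subst sum.swap) (simp only: sum_distrib_left[symmetric] tel)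
  qed
  \<comment> \<open>For x in [0, 1] the value x ln x lies in [-1, 0]. Over n + 1 species the final
    entropy is thus at least - (n + 1), and the initial one at most 0.\<close>
  moreover have "- ((real n + 1) * measure M \<Omega>) \<le> (\<Sum>K\<in>mesh_verts \<T>. vol P D K * (?H N K - ?H 0 K))"
  proof -
    have N1: "1 \<le> N" using tgrid problem_facts(4) by (cases N) auto
    have "- ((real n + 1) * measure M \<Omega>) \<le> (\<Sum>K\<in>mesh_verts \<T>. vol P D K * (- (real n + 1)))"
    proof -
      have "(real n + 1) * (\<Sum>K\<in>mesh_verts \<T>. vol P D K) \<le> (real n + 1) * measure M \<Omega>"
        by (rule mult_left_mono[OF sum_vol_le]) simp
      then show ?thesis unfolding sum_distrib_right[symmetric] by (simp add: algebra_simps)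
    qed
    also have "\<dots> \<le> (\<Sum>K\<in>mesh_verts \<T>. vol P D K * (?H N K - ?H 0 K))"
    proof (rule sum_mono)
      fix K
      have "0 \<le> vol P D K" by simp
      then consider "vol P D K = 0" | "0 < vol P D K" by linarith
      then show "vol P D K * (- (real n + 1)) \<le> vol P D K * (?H N K - ?H 0 K)"
      proof cases
        case 2
        have "(\<Sum>i=0..n. - 1) \<le> ?H N K"
          by (rule sum_mono) (rule entropy_bounds(1), use u_pos[OF N1] u_le_1[OF N1] in \<open>auto intro: less_imp_le\<close>)
        moreover have "?H 0 K \<le> 0"
          by (rule sum_nonpos) (rule entropy_bounds(2), use u0_bounds[OF _ 2] in auto)
        ultimately have "- (real n + 1) \<le> ?H N K - ?H 0 K" by simp
        then show ?thesis by (rule mult_left_mono) simp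
      qed simp
    qed
    finally show ?thesis .
  qed
  ultimately have "(\<Sum>k=1..N. \<Sum>i=1..n. time_step D k * (diffus P i * (1/2 * ?A i k - 1/2 * (?b i)\<^sup>2 * ?F k)))
      \<le> (real n + 1) * measure M \<Omega>" using tot by linarith
  moreover have "(\<Sum>k=1..N. \<Sum>i=1..n. time_step D k * (diffus P i * (1/2 * ?A i k - 1/2 * (?b i)\<^sup>2 * ?F k)))
      = 1/2 * (\<Sum>i=1..n. diffus P i * (\<Sum>k=1..N. time_step D k * ?A i k))
        - 1/2 * ((\<Sum>i=1..n. diffus P i * (?b i)\<^sup>2) * (\<Sum>k=1..N. time_step D k * ?F k))"
  proof -
    have "(\<Sum>k=1..N. \<Sum>i=1..n. time_step D k * (diffus P i * (1/2 * ?A i k - 1/2 * (?b i)\<^sup>2 * ?F k)))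
        = (\<Sum>i=1..n. \<Sum>k=1..N. 1/2 * (diffus P i * (time_step D k * ?A i k)) - 1/2 * (diffus P i * (?b i)\<^sup>2 * (time_step D k * ?F k)))"
      by (subst sum.swap) (intro sum.cong refl, simp add: algebra_simps)
    then show ?thesis by (simp only: sum_subtractf sum_distrib_left[symmetric] sum_distrib_right[symmetric])
  qed
  ultimately show ?thesis by linarith
qed

end

section \<open>Consistency of the discrete test functions\<close>

lemma uniformly_continuous_compact_support:
  fixes g :: "'a::euclidean_space \<Rightarrow> 'b::euclidean_space"
  assumes g: "continuous_on UNIV g" and K: "compact K" "\<And>x. x \<notin> K \<Longrightarrow> g x = 0"
  shows "uniformly_continuous_on UNIV g"
proof -
  obtain R where R: "\<And>x. x \<in> K \<Longrightarrow> norm x \<le> R" using compact_imp_bounded[OF K(1)] by (auto simp: bounded_iff)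
  \<comment> \<open>With the margin 1, if one of two points at distance less than 1 leaves this
    ball, both lie outside the ball of radius R, where g vanishes.\<close>
  let ?C = "cball (0::'a) (R + 1)"
  have uc: "uniformly_continuous_on ?C g"
    by (rule compact_uniformly_continuous) (use g in \<open>auto intro: continuous_on_subset\<close>)
  show ?thesis
    unfolding uniformly_continuous_on_def
  proof (intro allI impI)
    fix \<epsilon> :: real assume \<epsilon>: "0 < \<epsilon>"
    then obtain d where d: "0 < d" "\<And>x y. x \<in> ?C \<Longrightarrow> y \<in> ?C \<Longrightarrow> dist y x < d \<Longrightarrow> dist (g y) (g x) < \<epsilon>"
      using uc unfolding uniformly_continuous_on_def by metis
    have z: "g x = 0" if "R < norm x" for x using that R K(2) by (meson not_le)
    have "dist (g y) (g x) < \<epsilon>" if xy: "dist y x < min d 1" for x y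
    proof (cases "x \<in> ?C \<and> y \<in> ?C")
      case False
      have "\<bar>norm y - norm x\<bar> < 1" using xy norm_triangle_ineq3[of y x] by (simp add: dist_norm)
      then have "R < norm x" "R < norm y" using False by auto
      then show ?thesis using z \<epsilon> by simp
    qed (use d(2) xy in auto)
    then show "\<exists>d>0. \<forall>x\<in>UNIV. \<forall>x'\<in>UNIV. dist x' x < d \<longrightarrow> dist (g x') (g x) < \<epsilon>"
      using d(1) by (intro exI[of _ "min d 1"]) auto
  qed
qed

lemma GDERIV_mean_value:
  fixes f :: "'a::euclidean_space \<Rightarrow> real"
  assumes d: "\<And>x. GDERIV f x :> g x"
  obtains z where "z \<in> closed_segment x y" "f y - f x = g z \<bullet> (y - x)"
proof -
  have "DERIV (\<lambda>t. f (x + t *\<^sub>R (y - x))) t :> (y - x) \<bullet> g (x + t *\<^sub>R (y - x))" for t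
  proof -
    have "((\<lambda>t::real. x + t *\<^sub>R (y - x)) has_derivative (\<lambda>t. t *\<^sub>R (y - x))) (at t)"
      by (auto intro!: derivative_eq_intros)
    moreover have "(f has_derivative (\<lambda>h. h \<bullet> g (x + t *\<^sub>R (y - x)))) (at (x + t *\<^sub>R (y - x)))"
      using d by (simp add: gderiv_def)
    ultimately have "((\<lambda>t. f (x + t *\<^sub>R (y - x))) has_derivative (\<lambda>h. (h *\<^sub>R (y - x)) \<bullet> g (x + t *\<^sub>R (y - x)))) (at t)"
      by (rule has_derivative_compose)
    then show ?thesis
      by (simp add: has_field_derivative_def mult_commute_abs)
  qed
  then obtain t where t: "0 < t" "t < 1"
    "f (x + 1 *\<^sub>R (y - x)) - f (x + 0 *\<^sub>R (y - x)) = (1 - 0) * ((y - x) \<bullet> g (x + t *\<^sub>R (y - x)))"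
    using MVT2[of 0 1 "\<lambda>t. f (x + t *\<^sub>R (y - x))" "\<lambda>t. (y - x) \<bullet> g (x + t *\<^sub>R (y - x))"] by auto
  have "x + t *\<^sub>R (y - x) = (1 - t) *\<^sub>R x + t *\<^sub>R y" by (simp add: algebra_simps)
  then have "x + t *\<^sub>R (y - x) \<in> closed_segment x y" using t(1,2) by (auto simp: in_segment intro!: exI[of _ t])
  then show thesis using t(3) that by (simp add: inner_commute)
qed

lemma norm_snd_fst:
  fixes p :: "'a::real_normed_vector \<times> 'b::real_normed_vector"
  shows "norm (fst p) \<le> norm p" "norm (snd p) \<le> norm p"
  by (metis norm_fst_le prod.collapse, metis norm_snd_le prod.collapse)

text \<open>Consistency is estimated with the joint gradient, while the weak formulation separates
  time derivative and space gradient.\<close>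

lemma partial_derivatives:
  fixes \<psi> :: "real \<times> 'a::euclidean_space \<Rightarrow> real"
  assumes \<psi>: "smooth \<psi>"
  shows "deriv (\<lambda>r. \<psi> (r, x)) t = fst (grad \<psi> (t, x))" "grad (\<lambda>y. \<psi> (t, y)) x = snd (grad \<psi> (t, x))"
proof -
  have d: "(\<psi> has_derivative (\<lambda>h. h \<bullet> grad \<psi> (t, x))) (at (t, x))"
    using smooth_GDERIV[OF \<psi>] by (simp add: gderiv_def)
  have "((\<lambda>r. (r, x)) has_derivative (\<lambda>r. (r, 0))) (at t)" by (auto intro!: derivative_eq_intros)
  from has_derivative_compose[OF this d]
  have "((\<lambda>r. \<psi> (r, x)) has_derivative (\<lambda>r. fst (grad \<psi> (t, x)) * r)) (at t)"
    by (simp add: inner_prod_def mult.commute)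
  then have "DERIV (\<lambda>r. \<psi> (r, x)) t :> fst (grad \<psi> (t, x))"
    by (simp add: has_field_derivative_def)
  then show "deriv (\<lambda>r. \<psi> (r, x)) t = fst (grad \<psi> (t, x))" by (rule DERIV_imp_deriv)
  have "((\<lambda>y. (t, y)) has_derivative (\<lambda>y. (0, y))) (at x)" by (auto intro!: derivative_eq_intros)
  from has_derivative_compose[OF this d]
  have "((\<lambda>y. \<psi> (t, y)) has_derivative (\<lambda>h. h \<bullet> snd (grad \<psi> (t, x)))) (at x)"
    by (simp add: inner_prod_def)
  then show "grad (\<lambda>y. \<psi> (t, y)) x = snd (grad \<psi> (t, x))"
    by (intro grad_eq) (simp add: gderiv_def)
qed

context fe_disc
begin

text \<open>The spatial counterpart of \<open>step_fn\<close>, as \<open>cell_fn\<close> is that of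
  \<open>recon_M\<close>; they serve for the initial datum and for test functions independent of
  time.\<close>

definition simplex_fn :: "('a set \<Rightarrow> 'b::euclidean_space) \<Rightarrow> 'a \<Rightarrow> 'b" where
  "simplex_fn c x = (\<Sum>S\<in>\<T>. indicat_real S x *\<^sub>R c S)"

definition cell_fn :: "('a \<Rightarrow> real) \<Rightarrow> 'a \<Rightarrow> real" where
  "cell_fn v x = (\<Sum>K\<in>mesh_verts \<T>. v K * indicat_real (cell K) x)"

lemma simplex_fn_eval: "S \<in> \<T> \<Longrightarrow> x \<in> S \<Longrightarrow> simplex_fn c x = c S"
  unfolding simplex_fn_def by (rule sum_simplex)

lemma cell_fn_eval: "K \<in> mesh_verts \<T> \<Longrightarrow> x \<in> cell K \<Longrightarrow> cell_fn v x = v K"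
  unfolding cell_fn_def by (rule sum_cell)

lemma simplex_fn_borel: "simplex_fn c \<in> borel_measurable borel"
  unfolding simplex_fn_def[abs_def]
  by (intro borel_measurable_sum borel_measurable_scaleR borel_measurable_indicator borel_measurable_const)
    (use open_simplex in auto)

lemma cell_fn_borel: "cell_fn v \<in> borel_measurable borel"
  unfolding cell_fn_def[abs_def]
  by (intro borel_measurable_sum borel_measurable_times borel_measurable_indicator borel_measurable_const)
    (use cell_borel in auto)

lemma L2_M_bounded:
  fixes f :: "'a \<Rightarrow> 'b::euclidean_space"
  assumes "f \<in> borel_measurable borel" "AE x in M. norm (f x) \<le> B"
  shows "f \<in> L2 M"
proof (rule L2_bounded[OF L2_const[OF finite_M, of "1::real"]])
  show "f \<in> borel_measurable M" by (rule measurable_lebesgue_onI[OF problem_facts(6) assms(1)]) simp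
  show "AE x in M. norm (f x) \<le> B * norm (1::real)" using assms(2) by simp
qed

lemma AE_cellI:
  assumes "\<And>x S K. S \<in> \<T> \<Longrightarrow> K \<in> verts S \<Longrightarrow> K \<in> mesh_verts \<T> \<Longrightarrow> x \<in> S \<Longrightarrow> x \<in> closure S \<Longrightarrow> x \<in> cell K \<Longrightarrow> R x"
  shows "AE x in M. R x"
  using AE_cell by eventually_elim (use assms verts_mesh_verts closure_subset in blast)

lemma simplex_fn_L2: "simplex_fn c \<in> L2 M"
proof (rule L2_M_bounded[OF simplex_fn_borel])
  show "AE x in M. norm (simplex_fn c x) \<le> (\<Sum>S\<in>\<T>. norm (c S))"
  proof (rule AE_cellI)
    fix x S K assume "S \<in> \<T>" "x \<in> S"
    then show "norm (simplex_fn c x) \<le> (\<Sum>S\<in>\<T>. norm (c S))"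
      using member_le_sum[of S \<T> "\<lambda>S. norm (c S)"] finite_mesh by (simp add: simplex_fn_eval)
  qed
qed

lemma cell_fn_L2: "cell_fn v \<in> L2 M"
proof (rule L2_M_bounded[OF cell_fn_borel])
  show "AE x in M. norm (cell_fn v x) \<le> (\<Sum>K\<in>mesh_verts \<T>. norm (v K))"
  proof (rule AE_cellI)
    fix x S K assume "K \<in> mesh_verts \<T>" "x \<in> cell K"
    then show "norm (cell_fn v x) \<le> (\<Sum>K\<in>mesh_verts \<T>. norm (v K))"
      using member_le_sum[of K "mesh_verts \<T>" "\<lambda>K. norm (v K)"] finite_mesh_verts by (simp add: cell_fn_eval)
  qed
qed

lemma goodD:
  assumes "good (t, x) k S K"
  shows "k \<in> {1..N}" "1 \<le> k" "S \<in> \<T>" "K \<in> verts S" "K \<in> mesh_verts \<T>" "K \<in> closure S" "x \<in> S" "x \<in> closure S"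
    "x \<in> cell K" "tgrid D (k - 1) < t" "t \<le> tgrid D k"
  using assms verts_mesh_verts[of S] verts_in_closure[of S] closure_subset[of S] by (auto simp: good_def)

lemma time_dist:
  assumes "good (t, x) k S K"
  shows "\<bar>tgrid D (k - 1) - t\<bar> \<le> max_time_step D" "\<bar>tgrid D k - t\<bar> \<le> max_time_step D"
  using goodD[OF assms] time_step_le[of k] by (auto simp: time_step_def)

text \<open>Discrete gradients are exact on linear functions. Subtracting the linear function whose
  gradient is that of \<psi> at p leaves nodal differences of size \<epsilon> times the diameter,
  which the inverse inequality converts into a multiple of \<epsilon>.\<close>

lemma test_function_consistency:
  fixes \<psi> :: "real \<times> 'a \<Rightarrow> real"
  assumes \<psi>: "smooth \<psi>" and reg: "mesh_regularity \<T> \<le> \<theta>"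
    and mod: "\<And>p q. dist p q < d \<Longrightarrow> dist (grad \<psi> p) (grad \<psi> q) \<le> \<epsilon>"
    and small: "mesh_size \<T> + max_time_step D < d" and g: "good p k S K"
  shows "norm (gr S (\<lambda>L. \<psi> (tgrid D (k - 1), L)) - snd (grad \<psi> p)) \<le> (real DIM('a) + 1) * \<theta> * \<epsilon>"
    "\<bar>(\<psi> (tgrid D k, K) - \<psi> (tgrid D (k - 1), K)) / time_step D k - fst (grad \<psi> p)\<bar> \<le> \<epsilon>"
proof -
  obtain t x where p: "p = (t, x)" by (cases p)
  note gd = goodD[OF g[unfolded p]] and td = time_dist[OF g[unfolded p]]
  let ?b = "snd (grad \<psi> p)"
  have h: "0 < diameter S" by (rule diameter_pos[OF gd(3)])
  have close: "dist (r, y) p < d" if "\<bar>r - t\<bar> \<le> max_time_step D" "y \<in> closure S" for r y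
  proof -
    have "norm (y - x) \<le> mesh_size \<T>"
      using dist_simplex[OF gd(3) that(2) gd(8)] diameter_le_mesh_size[OF gd(3)] by linarith
    then have "norm ((r, y) - (t, x)) \<le> max_time_step D + mesh_size \<T>"
      using norm_Pair_le[of "r - t" "y - x"] that(1) by simp
    then show ?thesis using small by (simp add: dist_norm p)
  qed
  have "gr S (\<lambda>L. \<psi> (tgrid D (k - 1), L)) - ?b = gr S (\<lambda>L. 1 * \<psi> (tgrid D (k - 1), L) + (- 1) * (?b \<bullet> L))"
    unfolding gr_linear by (simp add: gr_affine[OF gd(3)])
  also have "norm \<dots> \<le> (real DIM('a) + 1) * \<theta> * (\<epsilon> * diameter S) / diameter S"
  proof (rule norm_gr_le[OF reg gd(3)])
    fix L assume L: "L \<in> verts S"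
    have Lc: "L \<in> closure S" using verts_in_closure[OF gd(3)] L by blast
    \<comment> \<open>The mean value theorem along an edge at frozen time; convexity keeps z over
      the closed simplex, hence within distance d of p.\<close>
    obtain z where z: "z \<in> closed_segment (tgrid D (k - 1), K) (tgrid D (k - 1), L)"
      "\<psi> (tgrid D (k - 1), L) - \<psi> (tgrid D (k - 1), K) = grad \<psi> z \<bullet> ((tgrid D (k - 1), L) - (tgrid D (k - 1), K))"
      by (rule GDERIV_mean_value[OF smooth_GDERIV[OF \<psi>]]) (rule that)
    have zz: "fst z = tgrid D (k - 1)" "snd z \<in> closed_segment K L"
      using z(1) by (auto simp: in_segment algebra_simps)
    have "closed_segment K L \<subseteq> closure S"
      by (rule closed_segment_subset[OF gd(6) Lc]) (simp add: convex_closure convex_simplex[OF gd(3)])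
    then have "dist z p < d" using close[OF td(1), of "snd z"] zz by (metis prod.collapse subsetD)
    then have "dist (grad \<psi> z) (grad \<psi> p) \<le> \<epsilon>" by (rule mod)
    then have ge: "norm (snd (grad \<psi> z) - ?b) \<le> \<epsilon>"
      using norm_snd_fst(2)[of "grad \<psi> z - grad \<psi> p"] by (simp add: dist_norm)
    have "(1 * \<psi> (tgrid D (k - 1), L) + (- 1) * (?b \<bullet> L)) - (1 * \<psi> (tgrid D (k - 1), K) + (- 1) * (?b \<bullet> K))
        = (snd (grad \<psi> z) - ?b) \<bullet> (L - K)"
      using z(2) by (simp add: inner_prod_def inner_diff_left inner_diff_right)
    also have "\<bar>\<dots>\<bar> \<le> norm (snd (grad \<psi> z) - ?b) * norm (L - K)" by (rule Cauchy_Schwarz_ineq2)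
    also have "\<dots> \<le> \<epsilon> * diameter S"
      by (rule mult_mono) (use ge dist_simplex[OF gd(3) Lc gd(6)] order_trans[OF norm_ge_zero ge] in auto)
    finally show "\<bar>(1 * \<psi> (tgrid D (k - 1), L) + (- 1) * (?b \<bullet> L)) - (1 * \<psi> (tgrid D (k - 1), K) + (- 1) * (?b \<bullet> K))\<bar>
        \<le> \<epsilon> * diameter S" .
  qed
  finally show "norm (gr S (\<lambda>L. \<psi> (tgrid D (k - 1), L)) - snd (grad \<psi> p)) \<le> (real DIM('a) + 1) * \<theta> * \<epsilon>"
    using h by simp
  obtain z where z: "z \<in> closed_segment (tgrid D (k - 1), K) (tgrid D k, K)"
    "\<psi> (tgrid D k, K) - \<psi> (tgrid D (k - 1), K) = grad \<psi> z \<bullet> ((tgrid D k, K) - (tgrid D (k - 1), K))"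
    by (rule GDERIV_mean_value[OF smooth_GDERIV[OF \<psi>]]) (rule that)
  have \<tau>: "0 < time_step D k" by (rule time_step_pos[OF gd(1)])
  have snd_z: "snd z = K" using z(1) by (auto simp: in_segment algebra_simps)
  have "fst z \<in> closed_segment (tgrid D (k - 1)) (tgrid D k)" using z(1) by (auto simp: in_segment)
  then have "tgrid D (k - 1) \<le> fst z" "fst z \<le> tgrid D k"
    using \<tau> by (auto simp: time_step_def closed_segment_eq_real_ivl)
  then have "\<bar>fst z - t\<bar> \<le> max_time_step D" using gd(10,11) td by linarith
  then have "dist z p < d" using close[of "fst z" K] gd(6) snd_z by (metis prod.collapse)
  then have "dist (grad \<psi> z) (grad \<psi> p) \<le> \<epsilon>" by (rule mod)
  then have ge: "\<bar>fst (grad \<psi> z) - fst (grad \<psi> p)\<bar> \<le> \<epsilon>"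
    using norm_snd_fst(1)[of "grad \<psi> z - grad \<psi> p"] by (simp add: dist_norm)
  have "(\<psi> (tgrid D k, K) - \<psi> (tgrid D (k - 1), K)) / time_step D k = fst (grad \<psi> z)"
    using z(2) \<tau> by (simp add: inner_prod_def time_step_def)
  then show "\<bar>(\<psi> (tgrid D k, K) - \<psi> (tgrid D (k - 1), K)) / time_step D k - fst (grad \<psi> p)\<bar> \<le> \<epsilon>"
    using ge by simp
qed

end

context fe_scheme
begin

lemma integral_initial:
  assumes i: "i \<in> {0..n}"
  shows "(\<Sum>K\<in>mesh_verts \<T>. vol P D K * u i 0 K * v K) = (LINT x|M. u_ini P i x * cell_fn v x)"
proof -
  have int: "integrable M (\<lambda>x. indicat_real (cell K) x * u_ini P i x)" for K
    using integrable_mult_indicator[OF _ ini(5)[OF i], of "cell K"] cell_borel[of K] cell_subset[of K] problem_facts(6)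
    by (simp add: sets_restrict_space_iff Int_absorb2)
  have "(\<Sum>K\<in>mesh_verts \<T>. vol P D K * u i 0 K * v K)
      = (\<Sum>K\<in>mesh_verts \<T>. (LINT x|M. indicat_real (cell K) x * u_ini P i x * v K))"
    by (rule sum.cong[OF refl]) (simp only: vol_u_ini integral_cell integral_mult_left_zero)
  also have "\<dots> = (LINT x|M. (\<Sum>K\<in>mesh_verts \<T>. indicat_real (cell K) x * u_ini P i x * v K))"
    by (rule Bochner_Integration.integral_sum[symmetric]) (intro integrable_mult_left int)
  also have "\<dots> = (LINT x|M. u_ini P i x * cell_fn v x)"
    unfolding cell_fn_def sum_distrib_left by (simp add: mult_ac)
  finally show ?thesis .
qed

text \<open>The test function is taken at the earlier time of each step. Abel summation then pairs
  the new densities with its difference quotient over the step and leaves just the initial term, the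
  final one vanishing with \<psi> at \<open>T\<close>.\<close>

lemma discrete_transport:
  fixes \<psi> :: "real \<times> 'a \<Rightarrow> real"
  assumes i: "i \<in> {1..n}" and \<psi>: "\<And>x. \<psi> (T, x) = 0"
  shows "- (LINT p|Q. recon_M P D (u i) p
        * recon_M P D (\<lambda>k K. (\<psi> (tgrid D k, K) - \<psi> (tgrid D (k - 1), K)) / time_step D k) p)
     - (LINT x|M. u_ini P i x * cell_fn (\<lambda>K. \<psi> (0, K)) x)
     + diffus P i * (LINT p|Q. step_fn (\<lambda>k S. U i k S * ((gr S (\<mu> i k) + (beta P * charge P i) *\<^sub>R gr S (\<phi> k))
          \<bullet> gr S (\<lambda>L. \<psi> (tgrid D (k - 1), L)))) p) = 0"
proof -
  let ?\<psi> = "\<lambda>k K. \<psi> (tgrid D k, K)"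
  let ?\<delta> = "\<lambda>k K. (?\<psi> k K - ?\<psi> (k - 1) K) / time_step D k"
  let ?F = "\<lambda>k S. U i k S * ((gr S (\<mu> i k) + (beta P * charge P i) *\<^sub>R gr S (\<phi> k)) \<bullet> gr S (?\<psi> (k - 1)))"
  have "(\<Sum>k=1..N. (\<Sum>K\<in>mesh_verts \<T>. vol P D K * (u i k K - u i (k - 1) K) * ?\<psi> (k - 1) K)
      + time_step D k * (diffus P i * (\<Sum>S\<in>\<T>. measure lebesgue S * ?F k S))) = 0"
    by (rule sum.neutral) (intro ballI tested_transport[OF i])
  then have "(\<Sum>k=1..N. \<Sum>K\<in>mesh_verts \<T>. vol P D K * (u i k K - u i (k - 1) K) * ?\<psi> (k - 1) K)
      + diffus P i * (\<Sum>k=1..N. time_step D k * (\<Sum>S\<in>\<T>. measure lebesgue S * ?F k S)) = 0"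
    by (simp add: sum.distrib sum_distrib_left mult_ac)
  moreover have "(LINT p|Q. step_fn ?F p) = (\<Sum>k=1..N. time_step D k * (\<Sum>S\<in>\<T>. measure lebesgue S * ?F k S))"
    by (rule integral_step_fn)
  moreover have "(\<Sum>k=1..N. \<Sum>K\<in>mesh_verts \<T>. vol P D K * (u i k K - u i (k - 1) K) * ?\<psi> (k - 1) K)
      = - (LINT p|Q. recon_M P D (\<lambda>k K. u i k K * ?\<delta> k K) p) - (LINT x|M. u_ini P i x * cell_fn (?\<psi> 0) x)"
  proof -
    have summation_by_parts: "(\<Sum>k=1..N. (u i k K - u i (k - 1) K) * ?\<psi> (k - 1) K)
        = - (\<Sum>k=1..N. u i k K * (?\<psi> k K - ?\<psi> (k - 1) K)) - u i 0 K * ?\<psi> 0 K" for K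
    proof -
      have "(\<Sum>k=1..N. u i k K * ?\<psi> k K - u i (k - 1) K * ?\<psi> (k - 1) K) = u i N K * ?\<psi> N K - u i 0 K * ?\<psi> 0 K"
        using sum_telescope''[of 0 N "\<lambda>k. u i k K * ?\<psi> k K"] by simp
      moreover have "?\<psi> N K = 0" by (simp add: tgrid(2) \<psi>)
      moreover have "(\<Sum>k=1..N. u i k K * ?\<psi> k K - u i (k - 1) K * ?\<psi> (k - 1) K)
          = (\<Sum>k=1..N. (u i k K - u i (k - 1) K) * ?\<psi> (k - 1) K) + (\<Sum>k=1..N. u i k K * (?\<psi> k K - ?\<psi> (k - 1) K))"
        unfolding sum.distrib[symmetric] by (rule sum.cong) (simp_all add: algebra_simps)
      ultimately show ?thesis by simp
    qed
    have "(\<Sum>k=1..N. \<Sum>K\<in>mesh_verts \<T>. vol P D K * (u i k K - u i (k - 1) K) * ?\<psi> (k - 1) K)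
        = (\<Sum>K\<in>mesh_verts \<T>. vol P D K * (\<Sum>k=1..N. (u i k K - u i (k - 1) K) * ?\<psi> (k - 1) K))"
      by (subst sum.swap) (simp add: sum_distrib_left mult.assoc)
    also have "\<dots> = (\<Sum>K\<in>mesh_verts \<T>. - (\<Sum>k=1..N. vol P D K * (u i k K * (?\<psi> k K - ?\<psi> (k - 1) K))) - vol P D K * u i 0 K * ?\<psi> 0 K)"
      unfolding summation_by_parts by (rule sum.cong) (simp_all add: right_diff_distrib sum_distrib_left mult.assoc)
    also have "\<dots> = - (\<Sum>K\<in>mesh_verts \<T>. \<Sum>k=1..N. vol P D K * (u i k K * (?\<psi> k K - ?\<psi> (k - 1) K)))
        - (\<Sum>K\<in>mesh_verts \<T>. vol P D K * u i 0 K * ?\<psi> 0 K)"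
      by (simp only: sum_subtractf sum_negf)
    also have "(\<Sum>K\<in>mesh_verts \<T>. vol P D K * u i 0 K * ?\<psi> 0 K) = (LINT x|M. u_ini P i x * cell_fn (?\<psi> 0) x)"
      by (rule integral_initial) (use i in auto)
    also have "(\<Sum>K\<in>mesh_verts \<T>. \<Sum>k=1..N. vol P D K * (u i k K * (?\<psi> k K - ?\<psi> (k - 1) K)))
        = (\<Sum>k=1..N. time_step D k * (\<Sum>K\<in>mesh_verts \<T>. vol P D K * (u i k K * ?\<delta> k K)))"
    proof (subst sum.swap, rule sum.cong[OF refl])
      fix k assume "k \<in> {1..N}"
      then have "0 < time_step D k" by (rule time_step_pos)
      then show "(\<Sum>K\<in>mesh_verts \<T>. vol P D K * (u i k K * (?\<psi> k K - ?\<psi> (k - 1) K)))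
          = time_step D k * (\<Sum>K\<in>mesh_verts \<T>. vol P D K * (u i k K * ?\<delta> k K))"
        by (simp add: sum_distrib_left)
    qed
    also have "\<dots> = (LINT p|Q. recon_M P D (\<lambda>k K. u i k K * ?\<delta> k K) p)"
      by (rule integral_recon_M[symmetric])
    finally show ?thesis .
  qed
  \<comment> \<open>At good points the reconstruction of a product is the product of the
    reconstructions; this separates the weakly convergent factor from the smooth one.\<close>
  moreover have "(LINT p|Q. recon_M P D (\<lambda>k K. u i k K * ?\<delta> k K) p)
      = (LINT p|Q. recon_M P D (u i) p * recon_M P D ?\<delta> p)"
  proof (rule integral_cong_AE)
    show "recon_M P D (\<lambda>k K. u i k K * ?\<delta> k K) \<in> borel_measurable Q" by (rule recon_M_measurable)
    show "(\<lambda>p. recon_M P D (u i) p * recon_M P D ?\<delta> p) \<in> borel_measurable Q"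
      by (intro borel_measurable_times recon_M_measurable)
    show "AE p in Q. recon_M P D (\<lambda>k K. u i k K * ?\<delta> k K) p = recon_M P D (u i) p * recon_M P D ?\<delta> p"
      by (rule AE_goodI) (simp only: good_eval(2))
  qed
  ultimately show ?thesis by (simp add: tgrid(1))
qed

text \<open>\<open>tested_poisson\<close> at the time index of t, with the sums written as
  integrals. The right-hand side sees v through its cell values because the scheme lumps the
  mass.\<close>

lemma discrete_poisson:
  assumes k: "k \<in> {1..N}" "t \<in> slab k" and v: "\<And>K. K \<in> mesh_verts \<T> \<inter> Gamma_D P \<Longrightarrow> v K = 0"
  shows "(lam P)\<^sup>2 * (LINT x|M. step_fn (\<lambda>k S. gr S (\<phi> k)) (t, x) \<bullet> simplex_fn (\<lambda>S. gr S v) x)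
    = (LINT x|M. ((\<Sum>i=1..n. charge P i * recon_M P D (u i) (t, x)) + f_source P x) * cell_fn v x)"
proof -
  have f: "f_source P \<in> L2 M" using problem by (auto simp: admissible_problem_def Let_def)
  have ind: "integrable M (indicat_real A)" if "A \<subseteq> \<Omega>" "open A" for A
    using integrable_mult_indicator[OF _ finite_measure.integrable_const[OF finite_M, of "1::real"], of A]
      that problem_facts(6) by (simp add: sets_restrict_space_iff Int_absorb2)
  have "(LINT x|M. step_fn (\<lambda>k S. gr S (\<phi> k)) (t, x) \<bullet> simplex_fn (\<lambda>S. gr S v) x)
      = (LINT x|M. (\<Sum>S\<in>\<T>. indicat_real S x * (gr S (\<phi> k) \<bullet> gr S v)))"
  proof (rule integral_cong_AE)
    have eq: "step_fn (\<lambda>k S. gr S (\<phi> k)) (t, x) = simplex_fn (\<lambda>S. gr S (\<phi> k)) x" for x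
      unfolding simplex_fn_def by (rule step_fn_slab[OF k])
    show "(\<lambda>x. step_fn (\<lambda>k S. gr S (\<phi> k)) (t, x) \<bullet> simplex_fn (\<lambda>S. gr S v) x) \<in> borel_measurable M"
      unfolding eq using simplex_fn_L2[of "\<lambda>S. gr S (\<phi> k)"] simplex_fn_L2[of "\<lambda>S. gr S v"]
      by (auto simp: L2_def)
    show "(\<lambda>x. \<Sum>S\<in>\<T>. indicat_real S x * (gr S (\<phi> k) \<bullet> gr S v)) \<in> borel_measurable M"
      using simplex_fn_L2[of "\<lambda>S. gr S (\<phi> k) \<bullet> gr S v"] by (auto simp: L2_def simplex_fn_def[abs_def])
    show "AE x in M. step_fn (\<lambda>k S. gr S (\<phi> k)) (t, x) \<bullet> simplex_fn (\<lambda>S. gr S v) x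
        = (\<Sum>S\<in>\<T>. indicat_real S x * (gr S (\<phi> k) \<bullet> gr S v))"
    proof (rule AE_cellI)
      fix x S K assume S: "S \<in> \<T>" "x \<in> S"
      show "step_fn (\<lambda>k S. gr S (\<phi> k)) (t, x) \<bullet> simplex_fn (\<lambda>S. gr S v) x
        = (\<Sum>S\<in>\<T>. indicat_real S x * (gr S (\<phi> k) \<bullet> gr S v))"
        using sum_simplex[OF S, of "\<lambda>S. gr S (\<phi> k) \<bullet> gr S v"]
        by (simp only: step_fn_slab[OF k] simplex_fn_eval[OF S] sum_simplex[OF S] real_scaleR_def)
    qed
  qed
  also have "\<dots> = (\<Sum>S\<in>\<T>. (LINT x|M. indicat_real S x * (gr S (\<phi> k) \<bullet> gr S v)))"
    by (rule Bochner_Integration.integral_sum) (intro integrable_mult_left ind simplex_subset open_simplex)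
  also have "\<dots> = (\<Sum>S\<in>\<T>. measure lebesgue S * (gr S (\<phi> k) \<bullet> gr S v))"
    by (rule sum.cong[OF refl]) (simp only: integral_mult_left_zero integral_indicator_M[OF simplex_subset open_simplex])
  finally have L: "(LINT x|M. step_fn (\<lambda>k S. gr S (\<phi> k)) (t, x) \<bullet> simplex_fn (\<lambda>S. gr S v) x)
      = (\<Sum>S\<in>\<T>. measure lebesgue S * (gr S (\<phi> k) \<bullet> gr S v))" .
  let ?z = "\<lambda>K. \<Sum>i=1..n. charge P i * u i k K"
  have if': "integrable M (\<lambda>x. indicat_real (cell K) x * f_source P x)" for K
    using integrable_mult_indicator[OF _ L2_integrable[OF finite_M f], of "cell K"] cell_borel[of K] cell_subset[of K] problem_facts(6)
    by (simp add: sets_restrict_space_iff Int_absorb2)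
  have "(LINT x|M. ((\<Sum>i=1..n. charge P i * recon_M P D (u i) (t, x)) + f_source P x) * cell_fn v x)
      = (LINT x|M. (\<Sum>K\<in>mesh_verts \<T>. indicat_real (cell K) x * (?z K * v K) + indicat_real (cell K) x * f_source P x * v K))"
  proof (rule integral_cong_AE)
    have m1: "(\<lambda>x. recon_M P D (u i) (t, x)) \<in> borel_measurable M" for i
    proof -
      have "(\<lambda>x. recon_M P D (u i) (t, x)) = cell_fn (u i k)"
        unfolding cell_fn_def by (rule ext) (rule recon_M_slab[OF k])
      then show ?thesis using cell_fn_L2[of "u i k"] by (simp add: L2_def)
    qed
    have m2: "f_source P \<in> borel_measurable M" "cell_fn v \<in> borel_measurable M"
      using f cell_fn_L2[of v] by (auto simp: L2_def)
    show "(\<lambda>x. ((\<Sum>i=1..n. charge P i * recon_M P D (u i) (t, x)) + f_source P x) * cell_fn v x) \<in> borel_measurable M"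
      by (intro borel_measurable_times borel_measurable_add borel_measurable_sum borel_measurable_const m1 m2)
    show "(\<lambda>x. \<Sum>K\<in>mesh_verts \<T>. indicat_real (cell K) x * (?z K * v K) + indicat_real (cell K) x * f_source P x * v K)
        \<in> borel_measurable M"
      by (intro borel_measurable_sum borel_measurable_add borel_measurable_times borel_measurable_const
          borel_measurable_integrable[OF ind[OF cell_subset open_cell]] m2)
    show "AE x in M. ((\<Sum>i=1..n. charge P i * recon_M P D (u i) (t, x)) + f_source P x) * cell_fn v x
       = (\<Sum>K\<in>mesh_verts \<T>. indicat_real (cell K) x * (?z K * v K) + indicat_real (cell K) x * f_source P x * v K)"
    proof (rule AE_cellI)
      fix x S K assume K: "K \<in> mesh_verts \<T>" "x \<in> cell K"
      have "(\<Sum>L\<in>mesh_verts \<T>. indicat_real (cell L) x * (?z L * v L) + indicat_real (cell L) x * f_source P x * v L)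
          = (\<Sum>L\<in>mesh_verts \<T>. ((?z L + f_source P x) * v L) * indicat_real (cell L) x)"
        by (rule sum.cong) (simp_all add: algebra_simps)
      also have "\<dots> = (?z K + f_source P x) * v K" by (rule sum_cell[OF K])
      also have "\<dots> = ((\<Sum>i=1..n. charge P i * recon_M P D (u i) (t, x)) + f_source P x) * cell_fn v x"
        by (simp only: recon_M_slab[OF k] sum_cell[OF K] cell_fn_eval[OF K])
      finally show "((\<Sum>i=1..n. charge P i * recon_M P D (u i) (t, x)) + f_source P x) * cell_fn v x
       = (\<Sum>K\<in>mesh_verts \<T>. indicat_real (cell K) x * (?z K * v K) + indicat_real (cell K) x * f_source P x * v K)" by simp
    qed
  qed
  also have "\<dots> = (\<Sum>K\<in>mesh_verts \<T>. (LINT x|M. indicat_real (cell K) x * (?z K * v K) + indicat_real (cell K) x * f_source P x * v K))"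
    by (rule Bochner_Integration.integral_sum)
      (intro Bochner_Integration.integrable_add integrable_mult_left if' ind cell_subset open_cell)
  also have "\<dots> = (\<Sum>K\<in>mesh_verts \<T>. (vol P D K * ?z K + (LINT x|lebesgue_on (cell K). f_source P x)) * v K)"
  proof (rule sum.cong[OF refl])
    fix K
    have "(LINT x|M. indicat_real (cell K) x * (?z K * v K) + indicat_real (cell K) x * f_source P x * v K)
        = (LINT x|M. indicat_real (cell K) x * (?z K * v K)) + (LINT x|M. indicat_real (cell K) x * f_source P x * v K)"
      by (intro Bochner_Integration.integral_add integrable_mult_left if' ind cell_subset open_cell)
    also have "\<dots> = vol P D K * (?z K * v K) + (LINT x|lebesgue_on (cell K). f_source P x) * v K"
      by (simp only: integral_mult_left_zero integral_indicator_M[OF cell_subset open_cell]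
          integral_cell)
    finally show "(LINT x|M. indicat_real (cell K) x * (?z K * v K) + indicat_real (cell K) x * f_source P x * v K)
        = (vol P D K * ?z K + (LINT x|lebesgue_on (cell K). f_source P x)) * v K" by (simp add: algebra_simps)
  qed
  finally show ?thesis using tested_poisson[OF k(1) v] L by simp
qed

end

section \<open>Passage to the limit\<close>

lemma L2_mult_bounded:
  fixes f :: "'a \<Rightarrow> real" and g :: "'a \<Rightarrow> 'b::euclidean_space"
  assumes f: "f \<in> borel_measurable M" "AE x in M. \<bar>f x\<bar> \<le> C" and g: "g \<in> L2 M"
  shows "(\<lambda>x. f x *\<^sub>R g x) \<in> L2 M"
proof (rule L2_bounded[OF g])
  show "(\<lambda>x. f x *\<^sub>R g x) \<in> borel_measurable M" using f g by (auto simp: L2_def)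
  show "AE x in M. norm (f x *\<^sub>R g x) \<le> C * norm (g x)"
    using f(2) by eventually_elim (auto intro: mult_right_mono)
qed

lemma norm_scaleR_le:
  fixes y :: "'a::real_normed_vector"
  assumes "norm y \<le> C"
  shows "norm (c *\<^sub>R y) \<le> C * norm c"
  using mult_left_mono[OF assms, of "\<bar>c\<bar>"] by (simp add: mult.commute)

text \<open>A g - a h = A (g - h) + (A - a) h: the first term is small since A is bounded and g
  tends uniformly to h, the second since h is bounded and A tends to a in L^2.\<close>

lemma L2_conv_product:
  fixes A :: "nat \<Rightarrow> 'a \<Rightarrow> real" and g :: "nat \<Rightarrow> 'a \<Rightarrow> 'b::euclidean_space"
  assumes fin: "finite_measure M"
    and A: "\<And>m. A m \<in> L2 M" "a \<in> L2 M" "\<And>m. AE x in M. \<bar>A m x\<bar> \<le> 1"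
      "(\<lambda>m. L2_norm M (\<lambda>x. A m x - a x)) \<longlonglongrightarrow> 0"
    and g: "\<And>m. g m \<in> borel_measurable M" "h \<in> borel_measurable M" "AE x in M. norm (h x) \<le> B"
      "\<And>m. AE x in M. norm (g m x - h x) \<le> \<epsilon> m" "\<epsilon> \<longlonglongrightarrow> 0"
  shows "\<And>m. (\<lambda>x. A m x *\<^sub>R g m x) \<in> L2 M" "(\<lambda>x. a x *\<^sub>R h x) \<in> L2 M"
    "(\<lambda>m. L2_norm M (\<lambda>x. A m x *\<^sub>R g m x - a x *\<^sub>R h x)) \<longlonglongrightarrow> 0"
proof -
  have gb: "AE x in M. norm (g m x) \<le> \<epsilon> m + B" for m
    using g(3) g(4)[of m]
  proof eventually_elim
    case (elim x)
    have "norm (g m x) \<le> norm (g m x - h x) + norm (h x)" using norm_triangle_ineq[of "g m x - h x" "h x"] by simp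
    then show ?case using elim by linarith
  qed
  have bm: "A m \<in> borel_measurable M" "a \<in> borel_measurable M" for m using A by (auto simp: L2_def)
  show AL: "(\<lambda>x. A m x *\<^sub>R g m x) \<in> L2 M" for m
  proof (rule L2_bounded[OF A(1)[of m]])
    show "(\<lambda>x. A m x *\<^sub>R g m x) \<in> borel_measurable M" using bm g by auto
    show "AE x in M. norm (A m x *\<^sub>R g m x) \<le> (\<epsilon> m + B) * norm (A m x)"
      using gb[of m] by eventually_elim (rule norm_scaleR_le)
  qed
  show aL: "(\<lambda>x. a x *\<^sub>R h x) \<in> L2 M"
  proof (rule L2_bounded[OF A(2)])
    show "(\<lambda>x. a x *\<^sub>R h x) \<in> borel_measurable M" using bm g by auto
    show "AE x in M. norm (a x *\<^sub>R h x) \<le> B * norm (a x)"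
      using g(3) by eventually_elim (rule norm_scaleR_le)
  qed
  have 1: "(\<lambda>m. L2_norm M (\<lambda>x. A m x *\<^sub>R (g m x - h x))) \<longlonglongrightarrow> 0"
  proof (rule L2_conv_zero_dominated[where B = "\<lambda>m x. \<epsilon> m" and C = 1])
    show "(\<lambda>m. L2_norm M (\<lambda>x. \<epsilon> m)) \<longlonglongrightarrow> 0"
    proof (rule L2_conv_zeroI)
      show "(LINT x|M. (norm (\<epsilon> m))\<^sup>2) \<le> (\<epsilon> m)\<^sup>2 * measure M (space M)" for m by (simp add: mult.commute)
      show "(\<lambda>m. (\<epsilon> m)\<^sup>2 * measure M (space M)) \<longlonglongrightarrow> 0"
      proof -
        have "(\<lambda>m. (\<epsilon> m)\<^sup>2 * measure M (space M)) \<longlonglongrightarrow> 0\<^sup>2 * measure M (space M)"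
          by (intro tendsto_intros g(5))
        then show ?thesis by simp
      qed
    qed
    show "(\<lambda>x. A m x *\<^sub>R (g m x - h x)) \<in> borel_measurable M" for m using bm g by auto
    show "AE x in M. norm (A m x *\<^sub>R (g m x - h x)) \<le> 1 * norm (\<epsilon> m)" for m
      using A(3)[of m] g(4)[of m]
    proof eventually_elim
      case (elim x)
      have "\<bar>A m x\<bar> * norm (g m x - h x) \<le> 1 * \<epsilon> m" using elim by (intro mult_mono) auto
      then show ?case by simp
    qed
  qed (rule L2_const[OF fin])
  have 2: "(\<lambda>m. L2_norm M (\<lambda>x. (A m x - a x) *\<^sub>R h x)) \<longlonglongrightarrow> 0"
  proof (rule L2_conv_zero_dominated[OF L2_diff[OF A(1,2)] A(4), where C = B])
    show "(\<lambda>x. (A m x - a x) *\<^sub>R h x) \<in> borel_measurable M" for m using bm g by auto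
    show "AE x in M. norm ((A m x - a x) *\<^sub>R h x) \<le> B * norm (A m x - a x)" for m
      using g(3) by eventually_elim (rule norm_scaleR_le)
  qed
  have L1: "(\<lambda>x. A m x *\<^sub>R (g m x - h x)) \<in> L2 M" for m
  proof (rule L2_bounded[OF A(1)[of m]])
    show "(\<lambda>x. A m x *\<^sub>R (g m x - h x)) \<in> borel_measurable M" using bm g by auto
    show "AE x in M. norm (A m x *\<^sub>R (g m x - h x)) \<le> \<epsilon> m * norm (A m x)"
      using g(4)[of m] by eventually_elim (rule norm_scaleR_le)
  qed
  have L2': "(\<lambda>x. (A m x - a x) *\<^sub>R h x) \<in> L2 M" for m
  proof (rule L2_bounded[OF L2_diff[OF A(1)[of m] A(2)]])
    show "(\<lambda>x. (A m x - a x) *\<^sub>R h x) \<in> borel_measurable M" using bm g by auto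
    show "AE x in M. norm ((A m x - a x) *\<^sub>R h x) \<le> B * norm (A m x - a x)"
      using g(3) by eventually_elim (rule norm_scaleR_le)
  qed
  have "(\<lambda>m. L2_norm M (\<lambda>x. A m x *\<^sub>R (g m x - h x) + (A m x - a x) *\<^sub>R h x)) \<longlonglongrightarrow> 0"
    by (rule L2_conv_zero_add[OF L1 L2' 1 2])
  moreover have "A m x *\<^sub>R (g m x - h x) + (A m x - a x) *\<^sub>R h x = A m x *\<^sub>R g m x - a x *\<^sub>R h x" for m x
    by (simp add: algebra_simps)
  ultimately show "(\<lambda>m. L2_norm M (\<lambda>x. A m x *\<^sub>R g m x - a x *\<^sub>R h x)) \<longlonglongrightarrow> 0" by simp
qed

text \<open>Tested with the indicator of the set where f is negative, the pairing is nonnegative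
  along the sequence and nonpositive in the limit.\<close>

lemma weak_limit_nonneg:
  fixes f :: "'a \<Rightarrow> real"
  assumes fin: "finite_measure M" and F: "\<And>m. AE x in M. 0 \<le> F m x" and f: "f \<in> L2 M"
    and weak: "\<And>g :: 'a \<Rightarrow> real. g \<in> L2 M \<Longrightarrow> (\<lambda>m. LINT x|M. F m x * g x) \<longlonglongrightarrow> (LINT x|M. f x * g x)"
  shows "AE x in M. 0 \<le> f x"
proof -
  let ?g = "indicat_real {x \<in> space M. f x < 0}"
  have fm: "f \<in> borel_measurable M" using f by (simp add: L2_def)
  have set: "{x \<in> space M. f x < 0} \<in> sets M" using fm by measurable
  have g: "?g \<in> L2 M"
    by (rule L2_bounded[OF L2_const[OF fin, of "1::real"], of _ 1]) (use set in \<open>auto simp: indicator_def\<close>)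
  have "0 \<le> (LINT x|M. f x * ?g x)"
  proof (rule LIMSEQ_le_const[OF weak[OF g]], intro exI allI impI)
    show "0 \<le> (LINT x|M. F m x * ?g x)" for m
      by (rule integral_nonneg_AE) (use F[of m] in \<open>eventually_elim, simp\<close>)
  qed
  moreover have i: "integrable M (\<lambda>x. f x * ?g x)" using L2_inner_integrable[OF f g] by simp
  ultimately have "(LINT x|M. - (f x * ?g x)) \<le> 0" by simp
  moreover have nn: "AE x in M. 0 \<le> - (f x * ?g x)" by (rule AE_I2) (auto simp: indicator_def)
  ultimately have "(LINT x|M. - (f x * ?g x)) = 0" using integral_nonneg_AE[OF nn] by linarith
  then have "AE x in M. - (f x * ?g x) = 0"
    using integral_nonneg_eq_0_iff_AE[OF _ nn] i by simp
  moreover have "AE x in M. x \<in> space M" by (rule AE_space)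
  ultimately show ?thesis by eventually_elim (auto simp: indicator_def split: if_splits)
qed

lemma sqrt_diff_sq_le:
  fixes a b :: real
  assumes "0 \<le> a" "0 \<le> b"
  shows "(sqrt a - sqrt b)\<^sup>2 \<le> \<bar>a - b\<bar>"
proof -
  have "a - b = (sqrt a - sqrt b) * (sqrt a + sqrt b)" using assms by (simp add: algebra_simps)
  then have "\<bar>a - b\<bar> = \<bar>sqrt a - sqrt b\<bar> * \<bar>sqrt a + sqrt b\<bar>" by (simp add: abs_mult)
  moreover have "\<bar>sqrt a - sqrt b\<bar> \<le> \<bar>sqrt a + sqrt b\<bar>"
    using assms real_sqrt_ge_zero[of a] real_sqrt_ge_zero[of b] by linarith
  ultimately show ?thesis
    using mult_left_mono[of "\<bar>sqrt a - sqrt b\<bar>" "\<bar>sqrt a + sqrt b\<bar>" "\<bar>sqrt a - sqrt b\<bar>"]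
    by (simp add: power2_eq_square abs_mult_self_eq flip: abs_mult)
qed

text \<open>The subsequence is already absorbed into the index m. Discrete test spaces stay outside
  this setting and enter through the approximants of \<open>poisson_limit\<close>.\<close>

locale fe_limit =
  fixes P :: "'a::euclidean_space problem" and D :: "nat \<Rightarrow> 'a discretisation" and \<rho> :: simplex_rule
    and \<mu> :: "nat \<Rightarrow> nat \<Rightarrow> nat \<Rightarrow> 'a \<Rightarrow> real" and \<phi>d :: "nat \<Rightarrow> nat \<Rightarrow> 'a \<Rightarrow> real" and \<theta> :: real
    and u :: "nat \<Rightarrow> real \<times> 'a \<Rightarrow> real" and \<phi> :: "real \<times> 'a \<Rightarrow> real"
  assumes sch: "fe_scheme P (D m) \<rho> (\<mu> m) (\<phi>d m)"
    and size_lim: "(\<lambda>m. mesh_size (mesh (D m))) \<longlonglongrightarrow> 0"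
    and step_lim: "(\<lambda>m. max_time_step (D m)) \<longlonglongrightarrow> 0"
    and reg: "mesh_regularity (mesh (D m)) \<le> \<theta>" and theta_nonneg: "0 \<le> \<theta>"
    and conv_u: "\<And>i. i \<in> {1..nspec P} \<Longrightarrow>
      Linf_weak_star_conv (cyl (horizon P) (dom_Omega P)) (\<lambda>m. recon_M P (D m) (u_disc P (D m) (\<mu> m) i)) (u i)"
    and conv_u0: "L2_conv (cyl (horizon P) (dom_Omega P)) (\<lambda>m. recon_M P (D m) (u_disc P (D m) (\<mu> m) 0)) (u 0)"
    and weak_s: "L2H1_weak_conv (horizon P) (dom_Omega P)
             (\<lambda>m. recon_T (D m) (\<lambda>k K. sqrt (u_disc P (D m) (\<mu> m) 0 k K))) (\<lambda>p. sqrt (u 0 p))"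
    and conv_w: "\<And>i. i \<in> {1..nspec P} \<Longrightarrow> L2_conv (cyl (horizon P) (dom_Omega P))
        (\<lambda>m. recon_M P (D m) (\<lambda>k K. sqrt (u_disc P (D m) (\<mu> m) 0 k K) * u_disc P (D m) (\<mu> m) i k K))
            (\<lambda>p. sqrt (u 0 p) * u i p)"
    and weak_w: "\<And>i. i \<in> {1..nspec P} \<Longrightarrow> L2H1_weak_conv (horizon P) (dom_Omega P)
        (\<lambda>m. recon_T (D m) (\<lambda>k K. sqrt (u_disc P (D m) (\<mu> m) 0 k K) * u_disc P (D m) (\<mu> m) i k K))
            (\<lambda>p. sqrt (u 0 p) * u i p)"
    and weak_phi: "L2H1_weak_conv (horizon P) (dom_Omega P) (\<lambda>m. recon_T (D m) (\<phi>d m)) \<phi>"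
begin

abbreviation "\<Omega> \<equiv> dom_Omega P"
abbreviation "T \<equiv> horizon P"
abbreviation "n \<equiv> nspec P"
abbreviation "M \<equiv> lebesgue_on \<Omega>"
abbreviation "Q \<equiv> cyl T \<Omega>"
abbreviation "step \<equiv> \<lambda>m. fe_disc.step_fn (D m)"
abbreviation "grd \<equiv> \<lambda>m. fe_mesh.gr (mesh (D m))"
abbreviation "ud \<equiv> \<lambda>m. u_disc P (D m) (\<mu> m)"
abbreviation "sd \<equiv> \<lambda>m k K. sqrt (u_disc P (D m) (\<mu> m) 0 k K)"
abbreviation "wd \<equiv> \<lambda>m i k K. sqrt (u_disc P (D m) (\<mu> m) 0 k K) * u_disc P (D m) (\<mu> m) i k K"
abbreviation "UU \<equiv> \<lambda>m. fe_scheme.U P (D m) \<rho> (\<mu> m)"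
abbreviation "h \<equiv> \<lambda>m. mesh_size (mesh (D m))"

sublocale X: fe_scheme P "D m" \<rho> "\<mu> m" "\<phi>d m" for m by (rule sch)

lemmas open_dom = X.problem_facts(1) and bounded_dom = X.problem_facts(2)
  and borel_dom = X.problem_facts(6) and fin_Q = X.finite_Q and fin_M = X.finite_M

section \<open>Bounds and constraints inherited by the limit\<close>

lemma recon_M_bounds:
  "AE p in Q. 0 \<le> recon_M P (D m) (ud m i) p"
  "i \<in> {0..n} \<Longrightarrow> AE p in Q. recon_M P (D m) (ud m i) p \<le> 1"
  "AE p in Q. \<bar>recon_M P (D m) (sd m) p\<bar> \<le> 1"
  "i \<in> {0..n} \<Longrightarrow> AE p in Q. \<bar>recon_M P (D m) (wd m i) p\<bar> \<le> 1"
  "AE p in Q. recon_M P (D m) (sd m) p = sqrt (recon_M P (D m) (ud m 0) p)"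
  "AE p in Q. (\<Sum>i=0..n. recon_M P (D m) (ud m i) p) = 1"
proof -
  have k1: "1 \<le> k" if "X.good m p k S K" for p k S K using that by (simp add: X.good_def)
  show "AE p in Q. 0 \<le> recon_M P (D m) (ud m i) p"
    by (rule X.AE_goodI[of m]) (simp only: X.good_eval(2), blast intro: less_imp_le X.u_pos k1)
  show "AE p in Q. recon_M P (D m) (ud m i) p \<le> 1" if "i \<in> {0..n}"
    by (rule X.AE_goodI[of m]) (simp only: X.good_eval(2), blast intro: X.u_le_1 k1 that)
  show "AE p in Q. \<bar>recon_M P (D m) (sd m) p\<bar> \<le> 1"
  proof (rule X.AE_goodI[of m])
    fix p k S K assume g: "X.good m p k S K"
    show "\<bar>recon_M P (D m) (sd m) p\<bar> \<le> 1"
      using X.u_pos[OF k1[OF g], of m 0 K] X.u_le_1[OF k1[OF g], of 0 m K] by (simp add: X.good_eval(2)[OF g])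
  qed
  show "AE p in Q. \<bar>recon_M P (D m) (wd m i) p\<bar> \<le> 1" if "i \<in> {0..n}"
  proof (rule X.AE_goodI[of m])
    fix p k S K assume g: "X.good m p k S K"
    show "\<bar>recon_M P (D m) (wd m i) p\<bar> \<le> 1"
      using X.u_pos[OF k1[OF g], of m 0 K] X.u_le_1[OF k1[OF g], of 0 m K]
        X.u_pos[OF k1[OF g], of m i K] X.u_le_1[OF k1[OF g] that, of m K]
      by (simp add: X.good_eval(2)[OF g] abs_mult mult_le_one)
  qed
  show "AE p in Q. recon_M P (D m) (sd m) p = sqrt (recon_M P (D m) (ud m 0) p)"
    by (rule X.AE_goodI[of m]) (simp only: X.good_eval(2))
  show "AE p in Q. (\<Sum>i=0..n. recon_M P (D m) (ud m i) p) = 1"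
    by (rule X.AE_goodI[of m]) (simp only: X.good_eval(2), blast intro: X.u_sum k1)
qed

lemma u_L2: "i \<in> {0..n} \<Longrightarrow> u i \<in> L2 Q"
proof -
  assume i: "i \<in> {0..n}"
  show "u i \<in> L2 Q"
  proof (cases "i = 0")
    case True
    then show ?thesis using conv_u0 by (simp add: L2_conv_def)
  next
    case False
    then have "u i \<in> Linf Q" using conv_u[of i] i by (simp add: Linf_weak_star_conv_def)
    then obtain C where C: "u i \<in> borel_measurable Q" "AE x in Q. \<bar>u i x\<bar> \<le> C" by (auto simp: Linf_def)
    show ?thesis
      by (rule L2_bounded[OF L2_const[OF fin_Q, of "1::real"] C(1), of C]) (use C(2) in simp)
  qed
qed

text \<open>Species 0 converges strongly, the others weakly-star; pairing with L^2 functions, which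
  are integrable on the bounded cylinder, is common to both.\<close>

lemma conv_weak:
  assumes i: "i \<in> {0..n}" and g: "g \<in> L2 Q"
  shows "(\<lambda>m. LINT p|Q. recon_M P (D m) (ud m i) p * g p) \<longlonglongrightarrow> (LINT p|Q. u i p * g p)"
proof (cases "i = 0")
  case True
  then show ?thesis
    using L2_tendsto_inner_const[of "\<lambda>m. recon_M P (D m) (ud m 0)" Q "u 0" g] conv_u0 g
    by (simp add: L2_conv_def)
next
  case False
  then show ?thesis using conv_u[of i] i L2_integrable[OF fin_Q g] by (simp add: Linf_weak_star_conv_def)
qed

lemma u_bounds:
  assumes i: "i \<in> {0..n}"
  shows "AE p in Q. 0 \<le> u i p" "AE p in Q. u i p \<le> 1"
proof -
  show "AE p in Q. 0 \<le> u i p"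
    by (rule weak_limit_nonneg[OF fin_Q recon_M_bounds(1) u_L2[OF i] conv_weak[OF i]])
  have "AE p in Q. 0 \<le> 1 - u i p"
  proof (rule weak_limit_nonneg[OF fin_Q _ L2_diff[OF L2_const[OF fin_Q] u_L2[OF i]]])
    show "AE p in Q. 0 \<le> 1 - recon_M P (D m) (ud m i) p" for m
      using recon_M_bounds(2)[OF i, of m] by eventually_elim simp
    fix g :: "real \<times> 'a \<Rightarrow> real" assume g: "g \<in> L2 Q"
    have eq: "(LINT p|Q. (1 - f p) * g p) = (LINT p|Q. g p) - (LINT p|Q. f p * g p)" if "f \<in> L2 Q" for f :: "real \<times> 'a \<Rightarrow> real"
      using L2_inner_integrable[OF that g] L2_integrable[OF fin_Q g] by (simp add: left_diff_distrib)
    show "(\<lambda>m. LINT p|Q. (1 - recon_M P (D m) (ud m i) p) * g p) \<longlonglongrightarrow> (LINT p|Q. (1 - u i p) * g p)"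
      unfolding eq[OF X.recon_M_L2] eq[OF u_L2[OF i]] by (intro tendsto_intros conv_weak[OF i g])
  qed
  then show "AE p in Q. u i p \<le> 1" by eventually_elim simp
qed

text \<open>The constraint is affine and so survives weak convergence: tested with its own defect,
  it says in the limit that the defect has L^2 norm 0.\<close>

lemma u_sum: "AE p in Q. (\<Sum>i=0..n. u i p) = 1"
proof -
  let ?g = "\<lambda>p. (\<Sum>i=0..n. u i p) - 1"
  have sL: "(\<lambda>p. \<Sum>i=0..n. f i p) \<in> L2 Q" if "\<And>i. i \<in> {0..n} \<Longrightarrow> f i \<in> L2 Q" for f :: "nat \<Rightarrow> real \<times> 'a \<Rightarrow> real"
  proof -
    have "(\<lambda>p. \<Sum>i\<in>A. f i p) \<in> L2 Q" if "finite A" "A \<subseteq> {0..n}" for A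
      using that
    proof (induction A rule: finite_induct)
      case (insert i A)
      then have "(\<lambda>p. f i p + (\<Sum>i\<in>A. f i p)) \<in> L2 Q" using \<open>\<And>i. i \<in> {0..n} \<Longrightarrow> f i \<in> L2 Q\<close> by (intro L2_add) auto
      then show ?case using insert by simp
    qed (use L2_const[OF fin_Q, of "0::real"] in simp)
    then show ?thesis by simp
  qed
  have g: "?g \<in> L2 Q" by (intro L2_diff sL u_L2 L2_const[OF fin_Q])
  have exp: "(LINT p|Q. (\<Sum>i=0..n. f i p) * ?g p) = (\<Sum>i=0..n. (LINT p|Q. f i p * ?g p))"
    if "\<And>i. i \<in> {0..n} \<Longrightarrow> f i \<in> L2 Q" for f :: "nat \<Rightarrow> real \<times> 'a \<Rightarrow> real"
    unfolding sum_distrib_right using L2_inner_integrable[OF that g] by (intro Bochner_Integration.integral_sum) auto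
  have "(\<lambda>m. (LINT p|Q. (\<Sum>i=0..n. recon_M P (D m) (ud m i) p) * ?g p)) \<longlonglongrightarrow> (LINT p|Q. (\<Sum>i=0..n. u i p) * ?g p)"
  proof -
    have "(LINT p|Q. (\<Sum>i=0..n. recon_M P (D m) (ud m i) p) * ?g p) = (\<Sum>i=0..n. (LINT p|Q. recon_M P (D m) (ud m i) p * ?g p))" for m
      by (rule exp) (rule X.recon_M_L2)
    moreover have "(LINT p|Q. (\<Sum>i=0..n. u i p) * ?g p) = (\<Sum>i=0..n. (LINT p|Q. u i p * ?g p))"
      by (rule exp) (rule u_L2)
    ultimately show ?thesis by (simp only:) (intro tendsto_sum conv_weak g)
  qed
  moreover have "(LINT p|Q. (\<Sum>i=0..n. recon_M P (D m) (ud m i) p) * ?g p) = (LINT p|Q. ?g p)" for m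
  proof (rule integral_cong_AE)
    show "(\<lambda>p. (\<Sum>i=0..n. recon_M P (D m) (ud m i) p) * ?g p) \<in> borel_measurable Q" "?g \<in> borel_measurable Q"
      using g sL[of "\<lambda>i. recon_M P (D m) (ud m i)", OF X.recon_M_L2] by (auto simp: L2_def)
    show "AE p in Q. (\<Sum>i=0..n. recon_M P (D m) (ud m i) p) * ?g p = ?g p"
      using recon_M_bounds(6)[of m] by eventually_elim simp
  qed
  ultimately have "(LINT p|Q. (\<Sum>i=0..n. u i p) * ?g p) = (LINT p|Q. ?g p)"
    by (simp add: LIMSEQ_const_iff)
  moreover have i: "integrable Q (\<lambda>p. (\<Sum>i=0..n. u i p) * ?g p)" "integrable Q ?g"
    using L2_inner_integrable[OF sL[OF u_L2] g] L2_integrable[OF fin_Q g] by auto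
  ultimately have "(LINT p|Q. (\<Sum>i=0..n. u i p) * ?g p - ?g p) = 0" by (simp add: Bochner_Integration.integral_diff)
  then have "(LINT p|Q. (?g p)\<^sup>2) = 0" by (simp add: power2_eq_square algebra_simps)
  moreover have "integrable Q (\<lambda>p. (?g p)\<^sup>2)" using g by (simp add: L2_def)
  ultimately have "AE p in Q. (?g p)\<^sup>2 = 0" using integral_nonneg_eq_0_iff_AE[of Q "\<lambda>p. (?g p)\<^sup>2"] by simp
  then show ?thesis by eventually_elim simp
qed

abbreviation "s \<equiv> \<lambda>p. sqrt (u 0 p)"
abbreviation "w \<equiv> \<lambda>i p. sqrt (u 0 p) * u i p"

lemma s_L2: "s \<in> L2 Q"
  using weak_s by (simp add: L2H1_weak_conv_def L2H1_def)

lemma w_L2: "i \<in> {1..n} \<Longrightarrow> w i \<in> L2 Q"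
  using weak_w[of i] by (simp add: L2H1_weak_conv_def L2H1_def)

lemma s_bound: "AE p in Q. \<bar>s p\<bar> \<le> 1"
  using u_bounds[of 0] by (auto elim: eventually_elim2)

lemma w_bound: "i \<in> {1..n} \<Longrightarrow> AE p in Q. \<bar>w i p\<bar> \<le> 1"
proof -
  assume i: "i \<in> {1..n}"
  then have "i \<in> {0..n}" by auto
  from s_bound u_bounds[OF this] show ?thesis
    by eventually_elim (simp add: abs_mult mult_le_one)
qed

text \<open>Strong convergence of the cell values of sqrt u_0 is inferred from that of u_0: squared
  differences of square roots are bounded by differences, and the L^1 norm by the L^2 norm.\<close>

lemma conv_s: "(\<lambda>m. L2_norm Q (\<lambda>p. recon_M P (D m) (sd m) p - s p)) \<longlonglongrightarrow> 0"
proof (rule L2_conv_zeroI)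
  let ?F = "\<lambda>m. recon_M P (D m) (ud m 0)"
  have d: "(\<lambda>p. ?F m p - u 0 p) \<in> L2 Q" for m by (intro L2_diff X.recon_M_L2 u_L2) simp
  show "(\<lambda>m. L2_norm Q (\<lambda>p. ?F m p - u 0 p) * L2_norm Q (\<lambda>p. 1::real)) \<longlonglongrightarrow> 0"
    using conv_u0 by (intro tendsto_mult_left_zero) (simp add: L2_conv_def)
  fix m
  have "(LINT p|Q. (norm (recon_M P (D m) (sd m) p - s p))\<^sup>2) \<le> (LINT p|Q. norm (?F m p - u 0 p))"
  proof (rule integral_mono_AE)
    show "integrable Q (\<lambda>p. (norm (recon_M P (D m) (sd m) p - s p))\<^sup>2)"
      using L2_diff[OF X.recon_M_L2 s_L2] by (simp add: L2_def)
    show "integrable Q (\<lambda>p. norm (?F m p - u 0 p))" using L2_integrable[OF fin_Q d[of m]] by simp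
    have "AE p in Q. 0 \<le> u 0 p" by (rule u_bounds) simp
    with recon_M_bounds(5)[of m] recon_M_bounds(1)[of m 0]
    show "AE p in Q. (norm (recon_M P (D m) (sd m) p - s p))\<^sup>2 \<le> norm (?F m p - u 0 p)"
      by eventually_elim (simp add: sqrt_diff_sq_le)
  qed
  also have "\<dots> = (LINT p|Q. norm (?F m p - u 0 p) \<bullet> (1::real))" by simp
  also have "\<dots> \<le> \<bar>LINT p|Q. norm (?F m p - u 0 p) \<bullet> (1::real)\<bar>" by simp
  also have "\<dots> \<le> L2_norm Q (\<lambda>p. norm (?F m p - u 0 p)) * L2_norm Q (\<lambda>p. 1::real)"
    by (rule L2_Cauchy_Schwarz[OF L2_norm_fun[OF d] L2_const[OF fin_Q]])
  also have "L2_norm Q (\<lambda>p. norm (?F m p - u 0 p)) = L2_norm Q (\<lambda>p. ?F m p - u 0 p)"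
    by (simp add: L2_norm_def)
  finally show "(LINT p|Q. (norm (recon_M P (D m) (sd m) p - s p))\<^sup>2)
      \<le> L2_norm Q (\<lambda>p. ?F m p - u 0 p) * L2_norm Q (\<lambda>p. 1::real)" .
qed

text \<open>Transfers weak convergence and boundedness from the chosen space gradients to the
  explicit piecewise constant ones.\<close>

lemma step_gradient:
  assumes W: "L2H1_weak_conv T \<Omega> (\<lambda>m. recon_T (D m) (v m)) f"
  shows "\<And>H. H \<in> L2 Q \<Longrightarrow> (\<lambda>m. LINT p|Q. H p \<bullet> step m (\<lambda>k S. grd m S (v m k)) p) \<longlonglongrightarrow> (LINT p|Q. H p \<bullet> space_grad T \<Omega> f p)"
    and "\<exists>C\<ge>0. \<forall>m. L2_norm Q (step m (\<lambda>k S. grd m S (v m k))) \<le> C"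
proof -
  have mem: "recon_T (D m) (v m) \<in> L2H1 T \<Omega>" for m using W by (simp add: L2H1_weak_conv_def)
  have ae: "AE p in Q. space_grad T \<Omega> (recon_T (D m) (v m)) p = step m (\<lambda>k S. grd m S (v m k)) p" for m
    by (rule X.space_grad_recon_T[OF mem])
  have m1: "space_grad T \<Omega> (recon_T (D m) (v m)) \<in> borel_measurable Q" for m
    using space_grad_L2[OF mem] by (simp add: L2_def)
  show "(\<lambda>m. LINT p|Q. H p \<bullet> step m (\<lambda>k S. grd m S (v m k)) p) \<longlonglongrightarrow> (LINT p|Q. H p \<bullet> space_grad T \<Omega> f p)"
    if H: "H \<in> L2 Q" for H
  proof -
    have "(LINT p|Q. H p \<bullet> space_grad T \<Omega> (recon_T (D m) (v m)) p) = (LINT p|Q. H p \<bullet> step m (\<lambda>k S. grd m S (v m k)) p)" for m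
    proof (rule integral_cong_AE)
      show "(\<lambda>p. H p \<bullet> space_grad T \<Omega> (recon_T (D m) (v m)) p) \<in> borel_measurable Q"
        "(\<lambda>p. H p \<bullet> step m (\<lambda>k S. grd m S (v m k)) p) \<in> borel_measurable Q"
        using H by (auto simp: L2_def intro!: borel_measurable_inner m1 X.step_fn_measurable)
      show "AE p in Q. H p \<bullet> space_grad T \<Omega> (recon_T (D m) (v m)) p = H p \<bullet> step m (\<lambda>k S. grd m S (v m k)) p"
        using ae[of m] by eventually_elim simp
    qed
    then show ?thesis using L2H1_weak_conv_grad[OF open_dom bounded_dom W H] by simp
  qed
  obtain C where C: "0 \<le> C" "\<And>m. L2_norm Q (space_grad T \<Omega> (recon_T (D m) (v m))) \<le> C"
    by (rule L2H1_weak_conv_bounded[OF open_dom bounded_dom W]) (rule that)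
  have "L2_norm Q (step m (\<lambda>k S. grd m S (v m k))) = L2_norm Q (space_grad T \<Omega> (recon_T (D m) (v m)))" for m
  proof -
    have "(LINT p|Q. (norm (step m (\<lambda>k S. grd m S (v m k)) p))\<^sup>2) = (LINT p|Q. (norm (space_grad T \<Omega> (recon_T (D m) (v m)) p))\<^sup>2)"
    proof (rule integral_cong_AE)
      show "AE p in Q. (norm (step m (\<lambda>k S. grd m S (v m k)) p))\<^sup>2 = (norm (space_grad T \<Omega> (recon_T (D m) (v m)) p))\<^sup>2"
        using ae[of m] by eventually_elim simp
    next
      show "(\<lambda>p. (norm (step m (\<lambda>k S. grd m S (v m k)) p))\<^sup>2) \<in> borel_measurable Q"
        using X.step_fn_measurable[of m "\<lambda>k S. grd m S (v m k)"] by measurable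
      show "(\<lambda>p. (norm (space_grad T \<Omega> (recon_T (D m) (v m)) p))\<^sup>2) \<in> borel_measurable Q"
        using m1[of m] by measurable
    qed
    then show ?thesis by (simp add: L2_norm_def)
  qed
  then show "\<exists>C\<ge>0. \<forall>m. L2_norm Q (step m (\<lambda>k S. grd m S (v m k))) \<le> C" using C by auto
qed

text \<open>The entropy inequality bounds the dissipation by the gradients of \<phi>, which are
  bounded because they converge weakly. All species enter it with positive weights and nonnegative
  terms, so one of them can be isolated.\<close>

lemma energy_bound:
  assumes i: "i \<in> {1..n}"
  shows "\<exists>C. \<forall>m. (LINT p|Q. step m (\<lambda>k S. UU m i k S * (norm (grd m S (\<mu> m i k)))\<^sup>2) p) \<le> C"
proof -
  obtain C where C: "0 \<le> C" "\<And>m. L2_norm Q (step m (\<lambda>k S. grd m S (\<phi>d m k))) \<le> C"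
    using step_gradient(2)[OF weak_phi] by blast
  have Dpos: "0 < diffus P j" if "j \<in> {1..n}" for j
    using X.problem that by (auto simp: admissible_problem_def Let_def)
  let ?c = "\<Sum>i=1..n. diffus P i * (beta P * charge P i)\<^sup>2"
  have c0: "0 \<le> ?c" by (intro sum_nonneg mult_nonneg_nonneg zero_le_power2 less_imp_le[OF Dpos])
  let ?I = "\<lambda>m i. LINT p|Q. step m (\<lambda>k S. UU m i k S * (norm (grd m S (\<mu> m i k)))\<^sup>2) p"
  have nn: "0 \<le> ?I m j" if "j \<in> {1..n}" for m j
  proof (rule integral_nonneg_AE, rule X.AE_goodI[of m])
    fix p k S K assume g: "X.good m p k S K"
    then have "0 \<le> UU m j k S" by (intro X.U_bounds that) (auto simp: X.good_def)
    then show "0 \<le> step m (\<lambda>k S. UU m j k S * (norm (grd m S (\<mu> m j k)))\<^sup>2) p"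
      by (simp add: X.good_eval(1)[OF g])
  qed
  have "?I m i \<le> (2 * (real n + 1) * measure M \<Omega> + ?c * C\<^sup>2) / diffus P i" for m
  proof -
    have "(LINT p|Q. step m (\<lambda>k S. (norm (grd m S (\<phi>d m k)))\<^sup>2) p) = (L2_norm Q (step m (\<lambda>k S. grd m S (\<phi>d m k))))\<^sup>2"
      unfolding L2_norm_power2
    proof (rule integral_cong_AE)
      show "AE p in Q. step m (\<lambda>k S. (norm (grd m S (\<phi>d m k)))\<^sup>2) p = (norm (step m (\<lambda>k S. grd m S (\<phi>d m k)) p))\<^sup>2"
        by (rule X.AE_goodI[of m]) (simp only: X.good_eval(1))
    next
      show "step m (\<lambda>k S. (norm (grd m S (\<phi>d m k)))\<^sup>2) \<in> borel_measurable Q" by (rule X.step_fn_measurable)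
      show "(\<lambda>p. (norm (step m (\<lambda>k S. grd m S (\<phi>d m k)) p))\<^sup>2) \<in> borel_measurable Q"
        using X.step_fn_measurable[of m "\<lambda>k S. grd m S (\<phi>d m k)"] by measurable
    qed
    also have "\<dots> \<le> C\<^sup>2" using C(2)[of m] by (intro power_mono) auto
    finally have ph: "(LINT p|Q. step m (\<lambda>k S. (norm (grd m S (\<phi>d m k)))\<^sup>2) p) \<le> C\<^sup>2" .
    have "diffus P i * ?I m i \<le> (\<Sum>j=1..n. diffus P j * ?I m j)"
      by (rule member_le_sum[of i "{1..n}" "\<lambda>j. diffus P j * ?I m j"]) (use i nn Dpos in \<open>auto intro!: mult_nonneg_nonneg less_imp_le[OF Dpos]\<close>)
    also have "\<dots> \<le> 2 * (real n + 1) * measure M \<Omega> + ?c * (LINT p|Q. step m (\<lambda>k S. (norm (grd m S (\<phi>d m k)))\<^sup>2) p)"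
      unfolding X.integral_step_fn by (rule X.entropy_dissipation)
    also have "\<dots> \<le> 2 * (real n + 1) * measure M \<Omega> + ?c * C\<^sup>2" using mult_left_mono[OF ph c0] by simp
    finally show ?thesis using Dpos[OF i] by (simp add: pos_le_divide_eq mult.commute)
  qed
  then show ?thesis by blast
qed

end

text \<open>With an explicit modulus, one function of the scale d serves for every m. It is a
  supremum over pairs of points, finite because g is bounded.\<close>

lemma modulus_of_continuity:
  fixes g :: "'a::euclidean_space \<Rightarrow> 'b::euclidean_space"
  assumes uc: "uniformly_continuous_on UNIV g" and B: "\<And>x. norm (g x) \<le> B"
  obtains \<omega> :: "real \<Rightarrow> real" where "\<And>d p q. dist p q < d \<Longrightarrow> dist (g p) (g q) \<le> \<omega> d"
    "\<And>d. 0 < d \<Longrightarrow> 0 \<le> \<omega> d" "(\<omega> \<longlongrightarrow> 0) (at_right 0)"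
proof -
  define \<omega> where "\<omega> d = Sup ((\<lambda>(p, q). dist (g p) (g q)) ` {(p, q). dist p q < d})" for d
  have bdd: "bdd_above ((\<lambda>(p, q). dist (g p) (g q)) ` {(p, q). dist p q < d})" for d
  proof (rule bdd_aboveI2)
    fix x :: "'a \<times> 'a"
    have "dist (g (fst x)) (g (snd x)) \<le> norm (g (fst x)) + norm (g (snd x))" by (simp add: dist_norm norm_triangle_ineq4)
    then show "(\<lambda>(p, q). dist (g p) (g q)) x \<le> 2 * B" using B[of "fst x"] B[of "snd x"] by (simp add: split_beta)
  qed
  have le: "dist (g p) (g q) \<le> \<omega> d" if "dist p q < d" for d p q
    unfolding \<omega>_def by (rule cSup_upper[OF _ bdd]) (use that in force)
  have nn: "0 \<le> \<omega> d" if "0 < d" for d using le[of 0 0 d] that by simp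
  have "(\<omega> \<longlongrightarrow> 0) (at_right 0)"
    unfolding tendsto_iff
  proof (intro allI impI)
    fix \<epsilon> :: real assume \<epsilon>: "0 < \<epsilon>"
    then obtain d where d: "0 < d" "\<And>x y. dist y x < d \<Longrightarrow> dist (g y) (g x) < \<epsilon> / 2"
      using uc unfolding uniformly_continuous_on_def by (metis UNIV_I half_gt_zero)
    have "dist (\<omega> r) 0 < \<epsilon>" if r: "0 < r" "r < d" for r
    proof -
      have "\<omega> r \<le> \<epsilon> / 2" unfolding \<omega>_def
      proof (rule cSup_least)
        have "(0, 0) \<in> {(p, q). dist p q < r}" using r by simp
        then show "(\<lambda>(p, q). dist (g p) (g q)) ` {(p, q). dist p q < r} \<noteq> {}" by blast
        fix x assume "x \<in> (\<lambda>(p, q). dist (g p) (g q)) ` {(p, q). dist p q < r}"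
        then show "x \<le> \<epsilon> / 2" using d(2) r(2) by (force intro: less_imp_le)
      qed
      then show ?thesis using nn[OF r(1)] \<epsilon> by simp
    qed
    then show "\<forall>\<^sub>F r in at_right 0. dist (\<omega> r) 0 < \<epsilon>"
      using d(1) by (auto simp: eventually_at_right_field intro!: exI[of _ d])
  qed
  then show thesis using that[of \<omega>] le nn by blast
qed

lemma L2_norm_le_of_bound:
  assumes fin: "finite_measure M" and f: "f \<in> L2 M" "AE x in M. \<bar>f x\<bar> \<le> (1::real)"
  shows "L2_norm M f \<le> sqrt (measure M (space M))"
proof -
  have "(LINT x|M. (norm (f x))\<^sup>2) \<le> (LINT x|M. 1)"
  proof (rule integral_mono_AE)
    show "AE x in M. (norm (f x))\<^sup>2 \<le> 1" using f(2) by eventually_elim (simp add: abs_square_le_1)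
  qed (use f(1) fin in \<open>auto simp: L2_def finite_measure.integrable_const\<close>)
  then show ?thesis by (simp add: L2_norm_def)
qed

context fe_limit
begin

section \<open>Discrete test functions and the transport equation\<close>

abbreviation grad_test :: "(real \<times> 'a \<Rightarrow> real) \<Rightarrow> nat \<Rightarrow> real \<times> 'a \<Rightarrow> 'a" where
  "grad_test \<psi> m \<equiv> step m (\<lambda>k S. grd m S (\<lambda>L. \<psi> (tgrid (D m) (k - 1), L)))"

abbreviation diff_test :: "(real \<times> 'a \<Rightarrow> real) \<Rightarrow> nat \<Rightarrow> real \<times> 'a \<Rightarrow> real" where
  "diff_test \<psi> m \<equiv> recon_M P (D m)
     (\<lambda>k K. (\<psi> (tgrid (D m) k, K) - \<psi> (tgrid (D m) (k - 1), K)) / time_step (D m) k)"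

abbreviation cell_test :: "nat \<Rightarrow> ('a \<Rightarrow> real) \<Rightarrow> 'a \<Rightarrow> real" where
  "cell_test m \<equiv> fe_disc.cell_fn P (D m)"

lemma test_functions_uniform:
  fixes \<psi> :: "real \<times> 'a \<Rightarrow> real"
  assumes \<psi>: "\<psi> \<in> Cc_infty V"
  obtains \<epsilon> :: "nat \<Rightarrow> real" where "\<epsilon> \<longlonglongrightarrow> 0" "\<And>m. 0 \<le> \<epsilon> m"
    "\<And>m. AE p in Q. norm (grad_test \<psi> m p - snd (grad \<psi> p)) \<le> \<epsilon> m"
    "\<And>m. AE p in Q. norm (diff_test \<psi> m p - fst (grad \<psi> p)) \<le> \<epsilon> m"
    "\<And>m. AE x in M. norm (cell_test m (\<lambda>K. \<psi> (0, K)) x - \<psi> (0, x)) \<le> \<epsilon> m"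
proof -
  note sm = Cc_infty_D(1)[OF \<psi>]
  obtain B where B: "0 \<le> B" "\<And>p. norm (grad \<psi> p) \<le> B" using Cc_infty_bounded[OF \<psi>] by metis
  have "uniformly_continuous_on UNIV (grad \<psi>)"
    by (rule uniformly_continuous_compact_support[OF smooth_grad_continuous[OF sm] Cc_infty_D(2)[OF \<psi>]])
      (rule grad_outside_support)
  then obtain \<omega> where \<omega>: "\<And>d p q. dist p q < d \<Longrightarrow> dist (grad \<psi> p) (grad \<psi> q) \<le> \<omega> d"
    "\<And>d. 0 < d \<Longrightarrow> 0 \<le> \<omega> d" "(\<omega> \<longlongrightarrow> 0) (at_right 0)"
    by (rule modulus_of_continuity[OF _ B(2)]) (rule that)
  \<comment> \<open>The factor 2 makes the scale strictly larger than mesh size plus time step, as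
    \<open>test_function_consistency\<close> demands.\<close>
  define d where "d m = 2 * (h m + max_time_step (D m))" for m
  have hp: "0 < h m" for m by (rule X.mesh_size_pos)
  have tp: "0 < max_time_step (D m)" for m
  proof -
    have "1 \<in> {1..nsteps (D m)}" using X.tgrid[of m] X.problem_facts(4) by (cases "nsteps (D m)") auto
    from X.time_step_pos[OF this] X.time_step_le[OF this] show ?thesis by linarith
  qed
  have dp: "0 < d m" "h m + max_time_step (D m) < d m" for m using hp[of m] tp[of m] by (auto simp: d_def)
  have "d \<longlonglongrightarrow> 2 * (0 + 0)" unfolding d_def by (intro tendsto_intros size_lim step_lim)
  then have "filterlim d (at_right 0) sequentially" using dp(1) by (intro tendsto_imp_filterlim_at_right) auto
  from filterlim_compose[OF \<omega>(3) this] have \<omega>d: "(\<lambda>m. \<omega> (d m)) \<longlonglongrightarrow> 0" .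
  \<comment> \<open>One rate for three errors: interpolated gradients, time differences, and cell
    values at time 0.\<close>
  define \<epsilon> where "\<epsilon> m = (real DIM('a) + 1) * \<theta> * \<omega> (d m) + \<omega> (d m) + B * h m" for m
  have nn: "0 \<le> (real DIM('a) + 1) * \<theta> * \<omega> (d m)" "0 \<le> \<omega> (d m)" "0 \<le> B * h m" for m
    using theta_nonneg \<omega>(2)[OF dp(1)] hp[of m] B(1) by simp_all
  show thesis
  proof (rule that[of \<epsilon>])
    have "\<epsilon> \<longlonglongrightarrow> (real DIM('a) + 1) * \<theta> * 0 + 0 + B * 0"
      unfolding \<epsilon>_def by (intro tendsto_intros \<omega>d size_lim)
    then show "\<epsilon> \<longlonglongrightarrow> 0" by simp
    fix m
    show "0 \<le> \<epsilon> m" using nn[of m] by (simp add: \<epsilon>_def)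
    show "AE p in Q. norm (grad_test \<psi> m p - snd (grad \<psi> p)) \<le> \<epsilon> m"
    proof (rule X.AE_goodI[of m])
      fix p k S K assume g: "X.good m p k S K"
      from X.test_function_consistency(1)[where d = "d m" and \<epsilon> = "\<omega> (d m)", OF sm reg \<omega>(1) dp(2) g]
      show "norm (grad_test \<psi> m p - snd (grad \<psi> p)) \<le> \<epsilon> m"
        using nn[of m] by (simp add: X.good_eval(1)[OF g] \<epsilon>_def)
    qed
    show "AE p in Q. norm (diff_test \<psi> m p - fst (grad \<psi> p)) \<le> \<epsilon> m"
    proof (rule X.AE_goodI[of m])
      fix p k S K assume g: "X.good m p k S K"
      from X.test_function_consistency(2)[where d = "d m" and \<epsilon> = "\<omega> (d m)", OF sm reg \<omega>(1) dp(2) g]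
      show "norm (diff_test \<psi> m p - fst (grad \<psi> p)) \<le> \<epsilon> m"
        using nn[of m] by (simp add: X.good_eval(2)[OF g] \<epsilon>_def)
    qed
    show "AE x in M. norm (cell_test m (\<lambda>K. \<psi> (0, K)) x - \<psi> (0, x)) \<le> \<epsilon> m"
    proof (rule X.AE_cellI[of m])
      fix x S K assume S: "S \<in> mesh (D m)" "K \<in> verts S" "K \<in> mesh_verts (mesh (D m))" "x \<in> closure S"
        "x \<in> dual_cell \<Omega> (mesh (D m)) K"
      have Kc: "K \<in> closure S" using X.verts_in_closure[OF S(1)] S(2) by blast
      have "\<bar>\<psi> (0, K) - \<psi> (0, x)\<bar> \<le> B * norm ((0::real, K) - (0, x))"
        by (rule differentiable_bound_GDERIV[OF smooth_GDERIV[OF sm] B(2)])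
      also have "\<dots> = B * norm (K - x)" by (simp add: norm_Pair)
      also have "\<dots> \<le> B * h m"
        using X.dist_simplex[OF S(1) Kc S(4)] X.diameter_le_mesh_size[OF S(1)] B(1) by (intro mult_left_mono) auto
      finally show "norm (cell_test m (\<lambda>K. \<psi> (0, K)) x - \<psi> (0, x)) \<le> \<epsilon> m"
        using nn[of m] by (simp add: X.cell_fn_eval[OF S(3,5)] \<epsilon>_def)
    qed
  qed
qed

lemma uniform_L2_conv:
  fixes g :: "nat \<Rightarrow> 'c \<Rightarrow> 'b::euclidean_space"
  assumes "finite_measure N" "\<And>m. g m \<in> borel_measurable N" "g' \<in> borel_measurable N" "AE x in N. norm (g' x) \<le> B"
      "\<And>m. AE x in N. norm (g m x - g' x) \<le> \<epsilon> m" "\<epsilon> \<longlonglongrightarrow> 0"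
  shows "\<And>m. g m \<in> L2 N" "g' \<in> L2 N" "(\<lambda>m. L2_norm N (\<lambda>x. g m x - g' x)) \<longlonglongrightarrow> 0"
proof -
  have one: "(\<lambda>x. 1::real) \<in> L2 N" by (rule L2_const[OF assms(1)])
  have z: "(\<lambda>m. L2_norm N (\<lambda>x. (1::real) - 1)) \<longlonglongrightarrow> 0" by (simp add: L2_norm_def)
  note * = L2_conv_product[of N "\<lambda>m x. 1" "\<lambda>x. 1" g g' B \<epsilon>, OF assms(1) one one _ z assms(2-6)]
  show "\<And>m. g m \<in> L2 N" "g' \<in> L2 N" "(\<lambda>m. L2_norm N (\<lambda>x. g m x - g' x)) \<longlonglongrightarrow> 0"
    using * by simp_all
qed

text \<open>The diffusive flux minus its replacement, whose coefficients are cell values with strong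
  limits.\<close>

definition remainder :: "nat \<Rightarrow> nat \<Rightarrow> real \<times> 'a \<Rightarrow> 'a" where
  "remainder i m p = step m (\<lambda>k S. UU m i k S *\<^sub>R grd m S (\<mu> m i k)) p
     - recon_M P (D m) (sd m) p *\<^sub>R step m (\<lambda>k S. grd m S (wd m i k)) p
     + (3 * recon_M P (D m) (wd m i) p) *\<^sub>R step m (\<lambda>k S. grd m S (sd m k)) p"

text \<open>The density that dominates the remainder in \<open>flux_remainder\<close>.\<close>

definition energy :: "nat \<Rightarrow> nat \<Rightarrow> real \<times> 'a \<Rightarrow> real" where
  "energy i m p = 1 + step m (\<lambda>k S. UU m i k S * (norm (grd m S (\<mu> m i k)))\<^sup>2) p
     + (norm (step m (\<lambda>k S. grd m S (sd m k)) p))\<^sup>2 + (norm (step m (\<lambda>k S. grd m S (wd m i k)) p))\<^sup>2"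

lemma flux_good:
  assumes i: "i \<in> {1..n}" and g: "X.good m p k S K"
  shows "norm (remainder i m p) \<le> 240 * (real DIM('a) + 1)^3 * \<theta> * sqrt (h m) * energy i m p"
    "\<bar>step m (UU m i) p - recon_M P (D m) (sd m) p * recon_M P (D m) (wd m i) p\<bar>
      \<le> 4 * h m * (norm (step m (\<lambda>k S. grd m S (sd m k)) p) + norm (step m (\<lambda>k S. grd m S (wd m i k)) p))"
    "0 \<le> step m (UU m i) p" "step m (UU m i) p \<le> 1"
proof -
  have S: "S \<in> mesh (D m)" "K \<in> verts S" and k: "1 \<le> k" using g by (auto simp: X.good_def)
  have i0: "i \<in> {0..n}" "0 \<in> {0..n}" using i by auto
  have sq: "(\<lambda>L. (sd m k L)\<^sup>2) = ud m 0 k" using X.u_pos[OF k] by (intro ext) (simp add: less_imp_le)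
  have s: "0 < sd m k L" "sd m k L \<le> 1" and a: "0 < ud m i k L" "ud m i k L \<le> 1" for L
    using X.u_pos[OF k] X.u_le_1[OF k i0(1)] X.u_le_1[OF k i0(2)] by simp_all
  have ml: "\<mu> m i k L = ln (ud m i k L) - 2 * ln (sd m k L)" for L
    using X.mu_eq[OF k i, of m L] X.u_pos[OF k, of m 0 L] by (simp add: ln_sqrt)
  have U: "UU m i k S = simplex_value \<rho> S (ud m 0 k) * simplex_value \<rho> S (ud m i k)" by (rule X.U_def)
  \<comment> \<open>\<open>flux_remainder\<close> builds the mobility from the squares of s;
    \<open>sq\<close> identifies these with u_0.\<close>
  note fr = X.flux_remainder[OF reg S, where s = "sd m k" and a = "ud m i k" and m = "\<mu> m i k" and \<rho> = \<rho>,
      OF s a ml, unfolded sq, folded U]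
  note ev = X.good_eval[OF g]
  show "norm (remainder i m p) \<le> 240 * (real DIM('a) + 1)^3 * \<theta> * sqrt (h m) * energy i m p"
    unfolding remainder_def energy_def ev using fr(1) by simp
  show "\<bar>step m (UU m i) p - recon_M P (D m) (sd m) p * recon_M P (D m) (wd m i) p\<bar>
      \<le> 4 * h m * (norm (step m (\<lambda>k S. grd m S (sd m k)) p) + norm (step m (\<lambda>k S. grd m S (wd m i k)) p))"
    unfolding ev using fr(2) by simp
  show "0 \<le> step m (UU m i) p" "step m (UU m i) p \<le> 1" unfolding ev using fr(3,4) by simp_all
qed

lemma bounded_mult_L2:
  assumes i: "i \<in> {0..n}" and g: "g \<in> L2 Q"
  shows "(\<lambda>p. recon_M P (D m) (sd m) p *\<^sub>R g p) \<in> L2 Q" "(\<lambda>p. recon_M P (D m) (wd m i) p *\<^sub>R g p) \<in> L2 Q"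
  by (rule L2_mult_bounded[OF X.recon_M_measurable recon_M_bounds(3) g],
      rule L2_mult_bounded[OF X.recon_M_measurable recon_M_bounds(4)[OF i] g])

lemma remainder_L2: "i \<in> {1..n} \<Longrightarrow> remainder i m \<in> L2 Q"
proof -
  assume i: "i \<in> {1..n}"
  then have i0: "i \<in> {0..n}" by auto
  have "(\<lambda>p. step m (\<lambda>k S. UU m i k S *\<^sub>R grd m S (\<mu> m i k)) p
     - recon_M P (D m) (sd m) p *\<^sub>R step m (\<lambda>k S. grd m S (wd m i k)) p
     + 3 *\<^sub>R (recon_M P (D m) (wd m i) p *\<^sub>R step m (\<lambda>k S. grd m S (sd m k)) p)) \<in> L2 Q"
    by (intro L2_add L2_diff L2_scaleR bounded_mult_L2[OF i0] X.step_fn_L2)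
  then show ?thesis by (simp add: remainder_def[abs_def])
qed

lemma energy_integral:
  assumes i: "i \<in> {1..n}"
  shows "\<And>m. integrable Q (energy i m)" "\<exists>C. \<forall>m. (LINT p|Q. energy i m p) \<le> C"
proof -
  have sqi: "integrable Q (\<lambda>p. (norm (step m c p))\<^sup>2)" for m and c :: "nat \<Rightarrow> 'a set \<Rightarrow> 'a"
    using X.step_fn_L2[of m c] by (simp add: L2_def)
  have i1: "integrable Q (step m (\<lambda>k S. UU m i k S * (norm (grd m S (\<mu> m i k)))\<^sup>2))" for m
    by (rule L2_integrable[OF fin_Q X.step_fn_L2])
  have i0: "integrable Q (\<lambda>p. 1::real)" using fin_Q by (simp add: finite_measure.integrable_const)
  show "integrable Q (energy i m)" for m
    unfolding energy_def[abs_def] by (intro Bochner_Integration.integrable_add i0 i1 sqi)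
  obtain C1 where C1: "\<And>m. (LINT p|Q. step m (\<lambda>k S. UU m i k S * (norm (grd m S (\<mu> m i k)))\<^sup>2) p) \<le> C1"
    using energy_bound[OF i] by blast
  obtain C2 where C2: "0 \<le> C2" "\<And>m. L2_norm Q (step m (\<lambda>k S. grd m S (sd m k))) \<le> C2"
    using step_gradient(2)[OF weak_s] by blast
  obtain C3 where C3: "0 \<le> C3" "\<And>m. L2_norm Q (step m (\<lambda>k S. grd m S (wd m i k))) \<le> C3"
    using step_gradient(2)[OF weak_w[OF i]] by blast
  have "(LINT p|Q. energy i m p) \<le> measure Q (space Q) + C1 + C2\<^sup>2 + C3\<^sup>2" for m
  proof -
    have "(LINT p|Q. energy i m p) = (LINT p|Q. 1) + (LINT p|Q. step m (\<lambda>k S. UU m i k S * (norm (grd m S (\<mu> m i k)))\<^sup>2) p)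
       + (LINT p|Q. (norm (step m (\<lambda>k S. grd m S (sd m k)) p))\<^sup>2) + (LINT p|Q. (norm (step m (\<lambda>k S. grd m S (wd m i k)) p))\<^sup>2)"
      unfolding energy_def using i0 i1[of m] sqi[of m] by (simp only: Bochner_Integration.integral_add Bochner_Integration.integrable_add)
    also have "\<dots> \<le> measure Q (space Q) + C1 + C2\<^sup>2 + C3\<^sup>2"
      unfolding L2_norm_power2[symmetric]
      by (intro add_mono C1 power_mono C2 C3) auto
    finally show ?thesis .
  qed
  then show "\<exists>C. \<forall>m. (LINT p|Q. energy i m p) \<le> C" by blast
qed

text \<open>The remainder is small in L^1 only, so the test fields have to be bounded almost
  everywhere uniformly in m, and not merely in L^2.\<close>

lemma remainder_tendsto:
  assumes i: "i \<in> {1..n}" and g: "\<And>m. g m \<in> L2 Q" "\<And>m. AE p in Q. norm (g m p) \<le> B"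
  shows "(\<lambda>m. LINT p|Q. remainder i m p \<bullet> g m p) \<longlonglongrightarrow> 0"
proof -
  obtain C where C: "\<And>m. (LINT p|Q. energy i m p) \<le> C" using energy_integral(2)[OF i] by blast
  \<comment> \<open>\<open>max B 0\<close> because the sign of B is not given: it bounds norms only
    almost everywhere.\<close>
  define c where "c m = 240 * (real DIM('a) + 1)^3 * \<theta> * sqrt (h m) * max B 0" for m
  have c0: "0 \<le> c m" for m using theta_nonneg X.mesh_size_pos[of m] by (simp add: c_def)
  show ?thesis
  proof (rule Lim_null_comparison)
    show "\<forall>\<^sub>F m in sequentially. norm (LINT p|Q. remainder i m p \<bullet> g m p) \<le> c m * C"
    proof (rule always_eventually, intro allI)
      fix m
      have "norm (LINT p|Q. remainder i m p \<bullet> g m p) \<le> (LINT p|Q. norm (remainder i m p \<bullet> g m p))"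
        by (rule integral_norm_bound)
      also have "\<dots> \<le> (LINT p|Q. c m * energy i m p)"
      proof (rule integral_mono_AE)
        show "integrable Q (\<lambda>p. norm (remainder i m p \<bullet> g m p))"
          using L2_inner_integrable[OF remainder_L2[OF i] g(1)] by simp
        show "integrable Q (\<lambda>p. c m * energy i m p)" using energy_integral(1)[OF i] by simp
        have "AE p in Q. norm (remainder i m p) \<le> 240 * (real DIM('a) + 1)^3 * \<theta> * sqrt (h m) * energy i m p"
          by (rule X.AE_goodI[of m]) (rule flux_good(1)[OF i])
        with g(2)[of m] show "AE p in Q. norm (remainder i m p \<bullet> g m p) \<le> c m * energy i m p"
        proof eventually_elim
          case (elim p)
          have "norm (remainder i m p \<bullet> g m p) \<le> norm (remainder i m p) * norm (g m p)"
            by (simp add: Cauchy_Schwarz_ineq2)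
          also have "\<dots> \<le> (240 * (real DIM('a) + 1)^3 * \<theta> * sqrt (h m) * energy i m p) * max B 0"
            by (rule mult_mono[OF elim(2)]) (use elim order_trans[OF norm_ge_zero elim(2)] in auto)
          finally show ?case by (simp add: c_def mult_ac)
        qed
      qed
      also have "\<dots> \<le> c m * C" using mult_left_mono[OF C c0] by simp
      finally show "norm (LINT p|Q. remainder i m p \<bullet> g m p) \<le> c m * C" .
    qed
    have "(\<lambda>m. c m * C) \<longlonglongrightarrow> 240 * (real DIM('a) + 1)^3 * \<theta> * sqrt 0 * max B 0 * C"
      unfolding c_def by (intro tendsto_intros size_lim)
    then show "(\<lambda>m. c m * C) \<longlonglongrightarrow> 0" by simp
  qed
qed

text \<open>The mobility converges strongly although u_i is only known to converge weakly: up to h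
  times gradients bounded in L^2, it is the product of the cell values of sqrt u_0 and sqrt u_0 u_i,
  both bounded by 1 and strongly convergent.\<close>

lemma conv_U:
  assumes i: "i \<in> {1..n}"
  shows "(\<lambda>p. s p * w i p) \<in> L2 Q"
    "(\<lambda>m. L2_norm Q (\<lambda>p. step m (UU m i) p - s p * w i p)) \<longlonglongrightarrow> 0"
proof -
  let ?s = "\<lambda>m. recon_M P (D m) (sd m)" and ?w = "\<lambda>m. recon_M P (D m) (wd m i)"
  have i0: "i \<in> {0..n}" using i by auto
  have sm: "s \<in> borel_measurable Q" "w i \<in> borel_measurable Q" using s_L2 w_L2[OF i] by (auto simp: L2_def)
  have dS: "(\<lambda>p. ?s m p - s p) \<in> L2 Q" for m by (intro L2_diff X.recon_M_L2 s_L2)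
  have dW: "(\<lambda>p. ?w m p - w i p) \<in> L2 Q" for m by (intro L2_diff X.recon_M_L2 w_L2 i)
  show sw: "(\<lambda>p. s p * w i p) \<in> L2 Q" using L2_mult_bounded[OF sm(1) s_bound w_L2[OF i]] by simp
  have a1: "(\<lambda>p. ?s m p *\<^sub>R (?w m p - w i p)) \<in> L2 Q" for m by (rule bounded_mult_L2[OF i0 dW])
  have a2: "(\<lambda>p. w i p *\<^sub>R (?s m p - s p)) \<in> L2 Q" for m by (rule L2_mult_bounded[OF sm(2) w_bound[OF i] dS])
  have c1: "(\<lambda>m. L2_norm Q (\<lambda>p. ?s m p *\<^sub>R (?w m p - w i p))) \<longlonglongrightarrow> 0"
  proof (rule L2_conv_zero_dominated[OF dW])
    show "(\<lambda>m. L2_norm Q (\<lambda>p. ?w m p - w i p)) \<longlonglongrightarrow> 0" using conv_w[OF i] by (simp add: L2_conv_def)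
    show "AE p in Q. norm (?s m p *\<^sub>R (?w m p - w i p)) \<le> 1 * norm (?w m p - w i p)" for m
      using recon_M_bounds(3)[of m] by eventually_elim (simp add: abs_mult mult_left_le_one_le)
  qed (use a1 in \<open>auto simp: L2_def\<close>)
  have c2: "(\<lambda>m. L2_norm Q (\<lambda>p. w i p *\<^sub>R (?s m p - s p))) \<longlonglongrightarrow> 0"
  proof (rule L2_conv_zero_dominated[OF dS conv_s])
    show "AE p in Q. norm (w i p *\<^sub>R (?s m p - s p)) \<le> 1 * norm (?s m p - s p)" for m
      using w_bound[OF i] by eventually_elim (simp only: norm_scaleR mult_1, rule mult_left_le_one_le, auto)
  qed (use a2 in \<open>auto simp: L2_def\<close>)
  let ?e = "\<lambda>m p. step m (UU m i) p - ?s m p *\<^sub>R ?w m p"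
  have e: "?e m \<in> L2 Q" for m by (intro L2_diff X.step_fn_L2 bounded_mult_L2[OF i0] X.recon_M_L2)
  obtain C2 where C2: "0 \<le> C2" "\<And>m. L2_norm Q (step m (\<lambda>k S. grd m S (sd m k))) \<le> C2"
    using step_gradient(2)[OF weak_s] by blast
  obtain C3 where C3: "0 \<le> C3" "\<And>m. L2_norm Q (step m (\<lambda>k S. grd m S (wd m i k))) \<le> C3"
    using step_gradient(2)[OF weak_w[OF i]] by blast
  have ce: "(\<lambda>m. L2_norm Q (?e m)) \<longlonglongrightarrow> 0"
  proof (rule L2_conv_zeroI)
    fix m
    let ?a = "\<lambda>p. norm (step m (\<lambda>k S. grd m S (sd m k)) p)" and ?b = "\<lambda>p. norm (step m (\<lambda>k S. grd m S (wd m i k)) p)"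
    have ab: "integrable Q (\<lambda>p. (?a p)\<^sup>2)" "integrable Q (\<lambda>p. (?b p)\<^sup>2)"
      using X.step_fn_L2[of m "\<lambda>k S. grd m S (sd m k)"] X.step_fn_L2[of m "\<lambda>k S. grd m S (wd m i k)"] by (simp_all add: L2_def)
    \<comment> \<open>32 is 4^2 times the 2 from (a + b)^2 <= 2 (a^2 + b^2).\<close>
    have "(LINT p|Q. (norm (?e m p))\<^sup>2) \<le> (LINT p|Q. 32 * (h m)\<^sup>2 * ((?a p)\<^sup>2 + (?b p)\<^sup>2))"
    proof (rule integral_mono_AE)
      show "AE p in Q. (norm (?e m p))\<^sup>2 \<le> 32 * (h m)\<^sup>2 * ((?a p)\<^sup>2 + (?b p)\<^sup>2)"
      proof (rule X.AE_goodI[of m])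
        fix p k S K assume g: "X.good m p k S K"
        have "(norm (?e m p))\<^sup>2 \<le> (4 * h m * (?a p + ?b p))\<^sup>2"
          by (rule power_mono) (use flux_good(2)[OF i g] in simp_all)
        also have "\<dots> = 16 * (h m)\<^sup>2 * (?a p + ?b p)\<^sup>2" by (simp add: power_mult_distrib)
        also have "\<dots> \<le> 16 * (h m)\<^sup>2 * (2 * ((?a p)\<^sup>2 + (?b p)\<^sup>2))"
        proof (rule mult_left_mono)
          show "(?a p + ?b p)\<^sup>2 \<le> 2 * ((?a p)\<^sup>2 + (?b p)\<^sup>2)"
            using zero_le_power2[of "?a p - ?b p"] by (simp add: power2_sum power2_diff)
        qed simp
        finally show "(norm (?e m p))\<^sup>2 \<le> 32 * (h m)\<^sup>2 * ((?a p)\<^sup>2 + (?b p)\<^sup>2)" by (simp add: algebra_simps)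
      qed
    qed (use e ab in \<open>auto simp: L2_def\<close>)
    also have "\<dots> = 32 * (h m)\<^sup>2 * ((LINT p|Q. (?a p)\<^sup>2) + (LINT p|Q. (?b p)\<^sup>2))" using ab by simp
    also have "\<dots> \<le> 32 * (h m)\<^sup>2 * (C2\<^sup>2 + C3\<^sup>2)"
      unfolding L2_norm_power2[symmetric] by (intro mult_left_mono add_mono power_mono C2 C3) auto
    finally show "(LINT p|Q. (norm (?e m p))\<^sup>2) \<le> 32 * (h m)\<^sup>2 * (C2\<^sup>2 + C3\<^sup>2)" .
  next
    have "(\<lambda>m. 32 * (h m)\<^sup>2 * (C2\<^sup>2 + C3\<^sup>2)) \<longlonglongrightarrow> 32 * 0\<^sup>2 * (C2\<^sup>2 + C3\<^sup>2)"
      by (intro tendsto_intros size_lim)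
    then show "(\<lambda>m. 32 * (h m)\<^sup>2 * (C2\<^sup>2 + C3\<^sup>2)) \<longlonglongrightarrow> 0" by simp
  qed
  have "(\<lambda>m. L2_norm Q (\<lambda>p. ?e m p + (?s m p *\<^sub>R (?w m p - w i p) + w i p *\<^sub>R (?s m p - s p)))) \<longlonglongrightarrow> 0"
    by (intro L2_conv_zero_add L2_add e a1 a2 ce c1 c2)
  moreover have "?e m p + (?s m p *\<^sub>R (?w m p - w i p) + w i p *\<^sub>R (?s m p - s p)) = step m (UU m i) p - s p * w i p" for m p
    by (simp add: algebra_simps)
  ultimately show "(\<lambda>m. L2_norm Q (\<lambda>p. step m (UU m i) p - s p * w i p)) \<longlonglongrightarrow> 0" by (simp only:)
qed

text \<open>In each flux term a strongly convergent coefficient times the uniformly convergent test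
  gradient is paired with a weakly convergent discrete gradient. In the time term the weakly
  convergent densities are paired with a uniformly convergent difference quotient.\<close>

lemma transport_limit:
  assumes i: "i \<in> {1..n}" and \<psi>: "\<psi> \<in> Cc_infty ({..<T} \<times> UNIV)"
  shows "- (LINT p|Q. u i p * fst (grad \<psi> p)) - (LINT x|M. u_ini P i x * \<psi> (0, x))
    + diffus P i * ((LINT p|Q. (s p *\<^sub>R snd (grad \<psi> p)) \<bullet> space_grad T \<Omega> (w i) p)
       - 3 * (LINT p|Q. (w i p *\<^sub>R snd (grad \<psi> p)) \<bullet> space_grad T \<Omega> s p)
       + beta P * charge P i * (LINT p|Q. ((s p * w i p) *\<^sub>R snd (grad \<psi> p)) \<bullet> space_grad T \<Omega> \<phi> p)) = 0"
proof -
  note sm = Cc_infty_D(1)[OF \<psi>]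
  have i0: "i \<in> {0..n}" using i by auto
  obtain B where B: "0 \<le> B" "\<And>p. \<bar>\<psi> p\<bar> \<le> B" "\<And>p. norm (grad \<psi> p) \<le> B" using Cc_infty_bounded[OF \<psi>] by metis
  obtain \<epsilon> where \<epsilon>: "\<epsilon> \<longlonglongrightarrow> 0" "\<And>m. 0 \<le> \<epsilon> m"
    "\<And>m. AE p in Q. norm (grad_test \<psi> m p - snd (grad \<psi> p)) \<le> \<epsilon> m"
    "\<And>m. AE p in Q. norm (diff_test \<psi> m p - fst (grad \<psi> p)) \<le> \<epsilon> m"
    "\<And>m. AE x in M. norm (cell_test m (\<lambda>K. \<psi> (0, K)) x - \<psi> (0, x)) \<le> \<epsilon> m"
    by (rule test_functions_uniform[OF \<psi>]) (rule that)
  have gc: "grad \<psi> \<in> borel_measurable borel"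
    by (rule borel_measurable_continuous_onI[OF smooth_grad_continuous[OF sm]])
  have mfst: "(\<lambda>p. fst (grad \<psi> p)) \<in> borel_measurable Q" and msnd: "(\<lambda>p. snd (grad \<psi> p)) \<in> borel_measurable Q"
    using smooth_grad_continuous[OF sm, of UNIV]
    by (auto intro!: cyl_borel_measurable[OF borel_dom] borel_measurable_continuous_onI continuous_intros)
  have bfst: "AE p in Q. norm (fst (grad \<psi> p)) \<le> B" and bsnd: "AE p in Q. norm (snd (grad \<psi> p)) \<le> B"
    using B(3) norm_snd_fst order_trans by (blast intro: AE_I2)+
  have m0: "(\<lambda>x. \<psi> (0, x)) \<in> borel_measurable M"
  proof (rule measurable_lebesgue_onI[OF borel_dom])
    have "continuous_on UNIV (\<lambda>x. \<psi> (0, x))"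
      by (rule continuous_on_compose2[OF smooth_continuous[OF sm, of UNIV]]) (auto intro!: continuous_intros)
    then show "(\<lambda>x. \<psi> (0, x)) \<in> borel_measurable borel" by (rule borel_measurable_continuous_onI)
  qed simp
  have b0: "AE x in M. norm (\<psi> (0, x)) \<le> B" using B(2) by simp
  have cm: "cell_test m (\<lambda>K. \<psi> (0, K)) \<in> borel_measurable M" for m using X.cell_fn_L2[of m] by (simp add: L2_def)
  note diff = uniform_L2_conv[OF fin_Q X.recon_M_measurable mfst bfst \<epsilon>(4,1)]
  note ini = uniform_L2_conv[OF fin_M cm m0 b0 \<epsilon>(5,1)]
  have uiniL: "u_ini P i \<in> L2 M"
  proof (rule L2_bounded[OF L2_const[OF fin_M, of "1::real"], of _ 1])
    show "AE x in M. norm (u_ini P i x) \<le> 1 * norm (1::real)"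
      using X.ini(2)[OF i0] X.ini(3)[OF i0] by eventually_elim simp
  qed (rule X.ini(1)[OF i0])
  have A: "(\<lambda>m. LINT p|Q. recon_M P (D m) (ud m i) p * diff_test \<psi> m p) \<longlonglongrightarrow> (LINT p|Q. u i p * fst (grad \<psi> p))"
  proof -
    have ub: "AE p in Q. \<bar>recon_M P (D m) (ud m i) p\<bar> \<le> 1" for m
      using recon_M_bounds(1)[of m i] recon_M_bounds(2)[OF i0, of m] by eventually_elim simp
    have "(\<lambda>m. LINT p|Q. diff_test \<psi> m p \<bullet> recon_M P (D m) (ud m i) p) \<longlonglongrightarrow> (LINT p|Q. u i p * fst (grad \<psi> p))"
    proof (rule L2_strong_weak[OF diff X.recon_M_L2 L2_norm_le_of_bound[OF fin_Q X.recon_M_L2 ub]])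
      show "(\<lambda>m. LINT p|Q. fst (grad \<psi> p) \<bullet> recon_M P (D m) (ud m i) p) \<longlonglongrightarrow> (LINT p|Q. u i p * fst (grad \<psi> p))"
        using conv_weak[OF i0 diff(2)] by (simp add: mult.commute)
    qed
    then show ?thesis by (simp add: mult.commute)
  qed
  have I: "(\<lambda>m. LINT x|M. u_ini P i x * cell_test m (\<lambda>K. \<psi> (0, K)) x) \<longlonglongrightarrow> (LINT x|M. u_ini P i x * \<psi> (0, x))"
    using L2_tendsto_inner_const[OF ini uiniL] by (simp add: mult.commute)
  let ?g = "grad_test \<psi>"
  have gL: "?g m \<in> L2 Q" for m by (rule X.step_fn_L2)
  have gm: "?g m \<in> borel_measurable Q" for m by (rule X.step_fn_measurable)
  \<comment> \<open>A convergent rate is bounded, which gives the uniform bound on the test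
    gradients required by \<open>remainder_tendsto\<close>.\<close>
  obtain E where E: "\<And>m. \<epsilon> m \<le> E" using convergent_imp_Bseq[OF convergentI[OF \<epsilon>(1)]] by (auto simp: Bseq_def abs_le_iff)
  have gb: "AE p in Q. norm (?g m p) \<le> E + B" for m
    using \<epsilon>(3)[of m] bsnd
  proof eventually_elim
    case (elim p)
    have "norm (?g m p) \<le> norm (?g m p - snd (grad \<psi> p)) + norm (snd (grad \<psi> p))"
      using norm_triangle_ineq[of "?g m p - snd (grad \<psi> p)" "snd (grad \<psi> p)"] by simp
    then show ?case using elim E[of m] by linarith
  qed
  let ?Gs = "\<lambda>m. step m (\<lambda>k S. grd m S (sd m k))" and ?Gw = "\<lambda>m. step m (\<lambda>k S. grd m S (wd m i k))"
    and ?Gp = "\<lambda>m. step m (\<lambda>k S. grd m S (\<phi>d m k))"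
  let ?s = "\<lambda>m. recon_M P (D m) (sd m)" and ?w = "\<lambda>m. recon_M P (D m) (wd m i)" and ?U = "\<lambda>m. step m (UU m i)"
  have Ub: "AE p in Q. \<bar>?U m p\<bar> \<le> 1" for m
    by (rule X.AE_goodI[of m]) (use flux_good(3,4)[OF i] in force)
  have cw: "(\<lambda>m. L2_norm Q (\<lambda>p. ?w m p - w i p)) \<longlonglongrightarrow> 0" using conv_w[OF i] by (simp add: L2_conv_def)
  note Ps = L2_conv_product[OF fin_Q X.recon_M_L2 s_L2 recon_M_bounds(3) conv_s gm msnd bsnd \<epsilon>(3,1)]
  note Pw = L2_conv_product[OF fin_Q X.recon_M_L2 w_L2[OF i] recon_M_bounds(4)[OF i0] cw gm msnd bsnd \<epsilon>(3,1)]
  note PU = L2_conv_product[OF fin_Q X.step_fn_L2 conv_U(1)[OF i] Ub conv_U(2)[OF i] gm msnd bsnd \<epsilon>(3,1)]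
  obtain C2 where C2: "\<And>m. L2_norm Q (?Gs m) \<le> C2" using step_gradient(2)[OF weak_s] by blast
  obtain C3 where C3: "\<And>m. L2_norm Q (?Gw m) \<le> C3" using step_gradient(2)[OF weak_w[OF i]] by blast
  obtain C4 where C4: "\<And>m. L2_norm Q (?Gp m) \<le> C4" using step_gradient(2)[OF weak_phi] by blast
  have T1: "(\<lambda>m. LINT p|Q. (?s m p *\<^sub>R ?g m p) \<bullet> ?Gw m p) \<longlonglongrightarrow> (LINT p|Q. (s p *\<^sub>R snd (grad \<psi> p)) \<bullet> space_grad T \<Omega> (w i) p)"
    by (rule L2_strong_weak[OF Ps X.step_fn_L2 C3 step_gradient(1)[OF weak_w[OF i] Ps(2)]])
  have T2: "(\<lambda>m. LINT p|Q. (?w m p *\<^sub>R ?g m p) \<bullet> ?Gs m p) \<longlonglongrightarrow> (LINT p|Q. (w i p *\<^sub>R snd (grad \<psi> p)) \<bullet> space_grad T \<Omega> s p)"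
    by (rule L2_strong_weak[OF Pw X.step_fn_L2 C2 step_gradient(1)[OF weak_s Pw(2)]])
  have T3: "(\<lambda>m. LINT p|Q. (?U m p *\<^sub>R ?g m p) \<bullet> ?Gp m p) \<longlonglongrightarrow> (LINT p|Q. ((s p * w i p) *\<^sub>R snd (grad \<psi> p)) \<bullet> space_grad T \<Omega> \<phi> p)"
    by (rule L2_strong_weak[OF PU X.step_fn_L2 C4 step_gradient(1)[OF weak_phi PU(2)]])
  have T4: "(\<lambda>m. LINT p|Q. remainder i m p \<bullet> ?g m p) \<longlonglongrightarrow> 0"
    by (rule remainder_tendsto[OF i gL gb])
  let ?b = "beta P * charge P i"
  let ?F = "\<lambda>m k S. UU m i k S * ((grd m S (\<mu> m i k) + ?b *\<^sub>R grd m S (\<phi>d m k)) \<bullet> grd m S (\<lambda>L. \<psi> (tgrid (D m) (k - 1), L)))"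
  \<comment> \<open>Only the \<mu> part of the flux is exchanged through \<open>remainder\<close>;
    the \<phi> part keeps its mobility, which converges strongly by \<open>conv_U\<close>.\<close>
  have dec: "(LINT p|Q. step m (?F m) p) = (LINT p|Q. remainder i m p \<bullet> ?g m p)
      + (LINT p|Q. (?s m p *\<^sub>R ?g m p) \<bullet> ?Gw m p) - 3 * (LINT p|Q. (?w m p *\<^sub>R ?g m p) \<bullet> ?Gs m p)
      + ?b * (LINT p|Q. (?U m p *\<^sub>R ?g m p) \<bullet> ?Gp m p)" for m
  proof -
    have i1: "integrable Q (\<lambda>p. remainder i m p \<bullet> ?g m p)" by (rule L2_inner_integrable[OF remainder_L2[OF i] gL])
    have i2: "integrable Q (\<lambda>p. (?s m p *\<^sub>R ?g m p) \<bullet> ?Gw m p)" by (rule L2_inner_integrable[OF Ps(1) X.step_fn_L2])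
    have i3: "integrable Q (\<lambda>p. (?w m p *\<^sub>R ?g m p) \<bullet> ?Gs m p)" by (rule L2_inner_integrable[OF Pw(1) X.step_fn_L2])
    have i4: "integrable Q (\<lambda>p. (?U m p *\<^sub>R ?g m p) \<bullet> ?Gp m p)" by (rule L2_inner_integrable[OF PU(1) X.step_fn_L2])
    have "(LINT p|Q. step m (?F m) p) = (LINT p|Q. remainder i m p \<bullet> ?g m p + (?s m p *\<^sub>R ?g m p) \<bullet> ?Gw m p
        - 3 * ((?w m p *\<^sub>R ?g m p) \<bullet> ?Gs m p) + ?b * ((?U m p *\<^sub>R ?g m p) \<bullet> ?Gp m p))"
    proof (rule integral_cong_AE)
      show "step m (?F m) \<in> borel_measurable Q" by (rule X.step_fn_measurable)
      show "(\<lambda>p. remainder i m p \<bullet> ?g m p + (?s m p *\<^sub>R ?g m p) \<bullet> ?Gw m p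
        - 3 * ((?w m p *\<^sub>R ?g m p) \<bullet> ?Gs m p) + ?b * ((?U m p *\<^sub>R ?g m p) \<bullet> ?Gp m p)) \<in> borel_measurable Q"
        using i1 i2 i3 i4 by (intro borel_measurable_add borel_measurable_diff borel_measurable_times borel_measurable_const) auto
      show "AE p in Q. step m (?F m) p = remainder i m p \<bullet> ?g m p + (?s m p *\<^sub>R ?g m p) \<bullet> ?Gw m p
        - 3 * ((?w m p *\<^sub>R ?g m p) \<bullet> ?Gs m p) + ?b * ((?U m p *\<^sub>R ?g m p) \<bullet> ?Gp m p)"
      proof (rule X.AE_goodI[of m])
        fix p k S K assume g: "X.good m p k S K"
        have "U * ((a + b *\<^sub>R f) \<bullet> g) = (U *\<^sub>R a - s' *\<^sub>R gw + (3 * w') *\<^sub>R gs) \<bullet> g + (s' *\<^sub>R g) \<bullet> gw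
          - 3 * ((w' *\<^sub>R g) \<bullet> gs) + b * ((U *\<^sub>R g) \<bullet> f)" for U b s' w' :: real and a f g gw gs :: 'a
          by (simp add: inner_add_left inner_diff_left inner_commute algebra_simps)
        then show "step m (?F m) p = remainder i m p \<bullet> ?g m p + (?s m p *\<^sub>R ?g m p) \<bullet> ?Gw m p
          - 3 * ((?w m p *\<^sub>R ?g m p) \<bullet> ?Gs m p) + ?b * ((?U m p *\<^sub>R ?g m p) \<bullet> ?Gp m p)"
          unfolding remainder_def X.good_eval[OF g] .
      qed
    qed
    also have "\<dots> = (LINT p|Q. remainder i m p \<bullet> ?g m p)
      + (LINT p|Q. (?s m p *\<^sub>R ?g m p) \<bullet> ?Gw m p) - 3 * (LINT p|Q. (?w m p *\<^sub>R ?g m p) \<bullet> ?Gs m p)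
      + ?b * (LINT p|Q. (?U m p *\<^sub>R ?g m p) \<bullet> ?Gp m p)"
      using i1 i2 i3 i4 by (simp only: Bochner_Integration.integral_add Bochner_Integration.integral_diff
        Bochner_Integration.integrable_add Bochner_Integration.integrable_diff integrable_mult_right integral_mult_right_zero)
    finally show ?thesis .
  qed
  have \<psi>T: "\<psi> (T, x) = 0" for x using Cc_infty_D(4)[OF \<psi>, of "(T, x)"] by simp
  have zero: "- (LINT p|Q. recon_M P (D m) (ud m i) p * diff_test \<psi> m p)
     - (LINT x|M. u_ini P i x * cell_test m (\<lambda>K. \<psi> (0, K)) x)
     + diffus P i * (LINT p|Q. step m (?F m) p) = 0" for m
    by (rule X.discrete_transport[of i \<psi>, OF i \<psi>T])
  have "(\<lambda>m. - (LINT p|Q. recon_M P (D m) (ud m i) p * diff_test \<psi> m p)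
     - (LINT x|M. u_ini P i x * cell_test m (\<lambda>K. \<psi> (0, K)) x)
     + diffus P i * (LINT p|Q. step m (?F m) p)) \<longlonglongrightarrow>
     - (LINT p|Q. u i p * fst (grad \<psi> p)) - (LINT x|M. u_ini P i x * \<psi> (0, x))
    + diffus P i * (0 + (LINT p|Q. (s p *\<^sub>R snd (grad \<psi> p)) \<bullet> space_grad T \<Omega> (w i) p)
       - 3 * (LINT p|Q. (w i p *\<^sub>R snd (grad \<psi> p)) \<bullet> space_grad T \<Omega> s p)
       + ?b * (LINT p|Q. ((s p * w i p) *\<^sub>R snd (grad \<psi> p)) \<bullet> space_grad T \<Omega> \<phi> p))"
    unfolding dec by (intro tendsto_intros A I T1 T2 T3 T4)
  then show ?thesis unfolding zero by (simp add: LIMSEQ_const_iff)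
qed


section \<open>The Poisson equation\<close>

abbreviation simplex_test :: "nat \<Rightarrow> ('a set \<Rightarrow> 'a) \<Rightarrow> 'a \<Rightarrow> 'a" where
  "simplex_test m \<equiv> fe_disc.simplex_fn (D m)"

text \<open>The discrete gradients of the approximants are their weak gradients, so convergence in
  H^1 gives the first claim. Cell values differ from an approximant by at most h times its gradient,
  and these gradients are bounded in L^2.\<close>

lemma projected_test_functions:
  assumes v: "v \<in> H1 \<Omega>" and vm: "\<And>m. v' m \<in> P1 (mesh (D m))" "\<And>m. v' m \<in> H1 \<Omega>"
    and conv: "(\<lambda>m. H1_norm \<Omega> (\<lambda>x. v x - v' m x)) \<longlonglongrightarrow> 0"
  shows "(\<lambda>m. L2_norm M (\<lambda>x. simplex_test m (\<lambda>S. grd m S (v' m)) x - wgrad \<Omega> v x)) \<longlonglongrightarrow> 0"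
    and "(\<lambda>m. L2_norm M (\<lambda>x. cell_test m (v' m) x - v x)) \<longlonglongrightarrow> 0"
proof -
  let ?A = "\<lambda>m. simplex_test m (\<lambda>S. grd m S (v' m))" and ?d = "\<lambda>m x. v x - v' m x"
  have dH: "?d m \<in> H1 \<Omega>" for m by (rule H1_diff(1)[OF open_dom bounded_dom v vm(2)])
  have dL: "?d m \<in> L2 M" "wgrad \<Omega> (?d m) \<in> L2 M" for m using dH[of m] wgrad(1)[OF dH] by (auto simp: H1_def)
  have small: "(\<lambda>m. L2_norm M (?d m)) \<longlonglongrightarrow> 0" "(\<lambda>m. L2_norm M (wgrad \<Omega> (?d m))) \<longlonglongrightarrow> 0"
    by (rule tendsto_sandwich[OF _ _ tendsto_const conv], simp, use H1_norm_bounds[OF dH] in simp)+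
  have AL: "?A m \<in> L2 M" for m by (rule X.simplex_fn_L2)
  have gL: "wgrad \<Omega> v \<in> L2 M" by (rule wgrad(1)[OF v])
  have vL: "v \<in> L2 M" using v by (simp add: H1_def)
  have v'L: "v' m \<in> L2 M" for m using vm(2)[of m] by (simp add: H1_def)
  show A: "(\<lambda>m. L2_norm M (\<lambda>x. ?A m x - wgrad \<Omega> v x)) \<longlonglongrightarrow> 0"
  proof (rule L2_conv_zero_dominated[OF dL(2) small(2), where C = 1])
    show "(\<lambda>x. ?A m x - wgrad \<Omega> v x) \<in> borel_measurable M" for m
      using L2_diff[OF AL gL] by (simp add: L2_def)
    show "AE x in M. norm (?A m x - wgrad \<Omega> v x) \<le> 1 * norm (wgrad \<Omega> (?d m) x)" for m
      using X.AE_cell[of m] X.wgrad_P1[OF vm(1) vm(2), of m] H1_diff(2)[OF open_dom bounded_dom v vm(2)[of m]]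
    proof eventually_elim
      case (elim x)
      then obtain S where S: "S \<in> mesh (D m)" "x \<in> S" by blast
      have "?A m x = wgrad \<Omega> (v' m) x" using elim(2) S by (simp add: X.simplex_fn_eval[OF S])
      then show ?case using elim(3) by (simp add: norm_minus_commute)
    qed
  qed
  \<comment> \<open>h times the discrete gradient, split around the gradient of v so that both parts
    tend to 0.\<close>
  let ?B = "\<lambda>m x. h m *\<^sub>R (?A m x - wgrad \<Omega> v x) + h m *\<^sub>R wgrad \<Omega> v x"
  have "(\<lambda>m. \<bar>h m\<bar> * L2_norm M (\<lambda>x. ?A m x - wgrad \<Omega> v x)) \<longlonglongrightarrow> \<bar>0\<bar> * 0"
    "(\<lambda>m. \<bar>h m\<bar> * L2_norm M (wgrad \<Omega> v)) \<longlonglongrightarrow> \<bar>0\<bar> * L2_norm M (wgrad \<Omega> v)"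
    by (intro tendsto_intros size_lim A)+
  then have B0: "(\<lambda>m. L2_norm M (?B m)) \<longlonglongrightarrow> 0"
    by (intro L2_conv_zero_add L2_scaleR L2_diff AL gL) (simp_all add: L2_norm_scaleR)
  have BL: "?B m \<in> L2 M" for m by (intro L2_add L2_scaleR L2_diff AL gL)
  have 1: "(\<lambda>m. L2_norm M (\<lambda>x. cell_test m (v' m) x - v' m x)) \<longlonglongrightarrow> 0"
  proof (rule L2_conv_zero_dominated[OF BL B0, where C = 1])
    show "(\<lambda>x. cell_test m (v' m) x - v' m x) \<in> borel_measurable M" for m
      using L2_diff[OF X.cell_fn_L2[of m] v'L] by (simp add: L2_def)
    show "AE x in M. norm (cell_test m (v' m) x - v' m x) \<le> 1 * norm (?B m x)" for m
    proof (rule X.AE_cellI[of m])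
      fix x S K assume S: "S \<in> mesh (D m)" "K \<in> verts S" "K \<in> mesh_verts (mesh (D m))" "x \<in> S" "x \<in> closure S"
        "x \<in> dual_cell \<Omega> (mesh (D m)) K"
      have Kc: "K \<in> closure S" using X.verts_in_closure[OF S(1)] S(2) by blast
      have "\<bar>v' m K - v' m x\<bar> \<le> norm (grd m S (v' m)) * norm (K - x)"
        using X.P1_diff[OF vm(1) S(1) Kc S(5)] X.gr_P1[OF vm(1) S(1)] by (simp add: Cauchy_Schwarz_ineq2)
      also have "\<dots> \<le> norm (grd m S (v' m)) * h m"
        using X.dist_simplex[OF S(1) Kc S(5)] X.diameter_le_mesh_size[OF S(1)] by (intro mult_left_mono) auto
      finally show "norm (cell_test m (v' m) x - v' m x) \<le> 1 * norm (?B m x)"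
        using X.mesh_size_pos[of m]
        by (simp add: X.cell_fn_eval[OF S(3,6)] X.simplex_fn_eval[OF S(1,4)] mult.commute flip: scaleR_add_right)
    qed
  qed
  have 2: "(\<lambda>m. L2_norm M (\<lambda>x. v' m x - v x)) \<longlonglongrightarrow> 0"
    using small(1) by (simp add: L2_norm_def power2_commute)
  have "(\<lambda>m. L2_norm M (\<lambda>x. (cell_test m (v' m) x - v' m x) + (v' m x - v x))) \<longlonglongrightarrow> 0"
    by (intro L2_conv_zero_add L2_diff X.cell_fn_L2 v'L vL 1 2)
  then show "(\<lambda>m. L2_norm M (\<lambda>x. cell_test m (v' m) x - v x)) \<longlonglongrightarrow> 0" by simp
qed

text \<open>Spatial L^2 convergence passes to the cylinder, where a function constant in time has
  its norm multiplied by sqrt T; the bounded weight in time then does no harm.\<close>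

lemma time_weighted_L2:
  fixes F :: "'a \<Rightarrow> 'b::euclidean_space"
  assumes \<xi>: "\<xi> \<in> Cc_infty J" and F: "F \<in> L2 M"
  shows "(\<lambda>p. \<xi> (fst p) *\<^sub>R F (snd p)) \<in> L2 Q"
    and "\<And>A. (\<And>m. A m \<in> L2 M) \<Longrightarrow> (\<lambda>m. L2_norm M (\<lambda>x. A m x - F x)) \<longlonglongrightarrow> 0
      \<Longrightarrow> (\<lambda>m. L2_norm Q (\<lambda>p. \<xi> (fst p) *\<^sub>R A m (snd p) - \<xi> (fst p) *\<^sub>R F (snd p))) \<longlonglongrightarrow> 0"
proof -
  obtain B where B: "0 \<le> B" "\<And>t. \<bar>\<xi> t\<bar> \<le> B" using Cc_infty_bounded[OF \<xi>] by metis
  have c: "continuous_on UNIV (\<lambda>p :: real \<times> 'a. \<xi> (fst p))"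
    by (rule continuous_on_compose2[OF smooth_continuous[OF Cc_infty_D(1)[OF \<xi>], of UNIV]]) (auto intro!: continuous_intros)
  have m: "(\<lambda>p. \<xi> (fst p) *\<^sub>R G (snd p)) \<in> borel_measurable Q" if "G \<in> L2 M" for G :: "'a \<Rightarrow> 'b"
    by (rule borel_measurable_scaleR[OF cyl_borel_measurable[OF borel_dom borel_measurable_continuous_onI[OF c]]
          measurable_cyl_snd[OF borel_dom]]) (use that in \<open>simp add: L2_def\<close>)
  have L: "(\<lambda>p. \<xi> (fst p) *\<^sub>R G (snd p)) \<in> L2 Q" if "G \<in> L2 M" for G :: "'a \<Rightarrow> 'b"
    by (rule L2_bounded[OF L2_cyl_snd[OF borel_dom that] m[OF that], of B]) (use B in \<open>auto intro!: mult_right_mono\<close>)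
  show "(\<lambda>p. \<xi> (fst p) *\<^sub>R F (snd p)) \<in> L2 Q" by (rule L[OF F])
  fix A assume A: "\<And>m. A m \<in> L2 M" "(\<lambda>m. L2_norm M (\<lambda>x. A m x - F x)) \<longlonglongrightarrow> 0"
  show "(\<lambda>m. L2_norm Q (\<lambda>p. \<xi> (fst p) *\<^sub>R A m (snd p) - \<xi> (fst p) *\<^sub>R F (snd p))) \<longlonglongrightarrow> 0"
  proof (rule L2_conv_zero_dominated[where B = "\<lambda>m p. A m (snd p) - F (snd p)" and C = B])
    show "(\<lambda>p. A m (snd p) - F (snd p)) \<in> L2 Q" for m
      by (rule L2_cyl_snd[OF borel_dom L2_diff[OF A(1) F]])
    have "L2_norm Q (\<lambda>p. A m (snd p) - F (snd p)) = sqrt T * L2_norm M (\<lambda>x. A m x - F x)" for m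
      using L2_norm_cyl_snd[OF borel_dom L2_diff[OF A(1) F], of T m] X.problem_facts(4) by simp
    moreover have "(\<lambda>m. sqrt T * L2_norm M (\<lambda>x. A m x - F x)) \<longlonglongrightarrow> sqrt T * 0" by (intro tendsto_intros A(2))
    ultimately show "(\<lambda>m. L2_norm Q (\<lambda>p. A m (snd p) - F (snd p))) \<longlonglongrightarrow> 0" by simp
    show "(\<lambda>p. \<xi> (fst p) *\<^sub>R A m (snd p) - \<xi> (fst p) *\<^sub>R F (snd p)) \<in> borel_measurable Q" for m
      using m[OF A(1)] m[OF F] by (rule borel_measurable_diff)
    show "AE p in Q. norm (\<xi> (fst p) *\<^sub>R A m (snd p) - \<xi> (fst p) *\<^sub>R F (snd p)) \<le> B * norm (A m (snd p) - F (snd p))" for m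
      using B by (auto intro!: mult_right_mono simp flip: scaleR_diff_right)
  qed
qed

text \<open>The equation is linear in the discrete unknowns, so their weak convergence suffices once
  the test functions converge strongly. The approximants may be any conforming discrete functions
  tending to v in H^1.\<close>

lemma poisson_limit:
  assumes v: "v \<in> H1 \<Omega>" and vm: "\<And>m. v' m \<in> P1D (Gamma_D P) (mesh (D m))" "\<And>m. v' m \<in> H1 \<Omega>"
    and conv: "(\<lambda>m. H1_norm \<Omega> (\<lambda>x. v x - v' m x)) \<longlonglongrightarrow> 0" and \<xi>: "\<xi> \<in> Cc_infty J"
  shows "(lam P)\<^sup>2 * (LINT t|lebesgue_on {0<..<T}. \<xi> t * (LINT x|M. space_grad T \<Omega> \<phi> (t, x) \<bullet> wgrad \<Omega> v x))
    = (LINT t|lebesgue_on {0<..<T}. \<xi> t * (LINT x|M. ((\<Sum>i=1..n. charge P i * u i (t, x)) + f_source P x) * v x))"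
proof -
  have vP: "v' m \<in> P1 (mesh (D m))" "\<And>K. K \<in> mesh_verts (mesh (D m)) \<inter> Gamma_D P \<Longrightarrow> v' m K = 0" for m
    using vm(1)[of m] by (auto simp: P1D_def)
  note pt = projected_test_functions[OF v vP(1) vm(2) conv]
  let ?A = "\<lambda>m. simplex_test m (\<lambda>S. grd m S (v' m))" and ?c = "\<lambda>m. cell_test m (v' m)"
  let ?Gp = "\<lambda>m. step m (\<lambda>k S. grd m S (\<phi>d m k))" and ?r = "\<lambda>m i. recon_M P (D m) (ud m i)"
  have vL: "v \<in> L2 M" using v by (simp add: H1_def)
  have fL: "f_source P \<in> L2 M" using X.problem by (auto simp: admissible_problem_def Let_def)
  have fQ: "(\<lambda>p. f_source P (snd p)) \<in> L2 Q" by (rule L2_cyl_snd[OF borel_dom fL])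
  note L\<xi> = time_weighted_L2(1)[OF \<xi>]
  have c\<xi>: "(\<lambda>p. \<xi> (fst p) * ?c m (snd p)) \<in> L2 Q" "(\<lambda>p. \<xi> (fst p) * v (snd p)) \<in> L2 Q" for m
    using L\<xi>[OF X.cell_fn_L2, of m "v' m"] L\<xi>[OF vL] by simp_all
  have cc: "(\<lambda>m. L2_norm Q (\<lambda>p. \<xi> (fst p) * ?c m (snd p) - \<xi> (fst p) * v (snd p))) \<longlonglongrightarrow> 0"
    using time_weighted_L2(2)[OF \<xi> vL X.cell_fn_L2 pt(2)] by simp
  have \<phi>L: "space_grad T \<Omega> \<phi> \<in> L2 Q" by (rule space_grad_L2) (use weak_phi in \<open>simp add: L2H1_weak_conv_def\<close>)
  \<comment> \<open>Stated for general F and G, as \<open>exp\<close> is for general r and F, so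
    that the same rewriting serves the discrete equation and the limit.\<close>
  have lhs: "(LINT t|lebesgue_on {0<..<T}. \<xi> t * (LINT x|M. G (t, x) \<bullet> F x)) = (LINT p|Q. (\<xi> (fst p) *\<^sub>R F (snd p)) \<bullet> G p)"
    if "F \<in> L2 M" "G \<in> L2 Q" for F :: "'a \<Rightarrow> 'a" and G
    using integral_cyl_iterated[OF borel_dom L2_inner_integrable[OF L\<xi>[OF that(1)] that(2)]]
    by (simp add: inner_commute)
  have exp: "(LINT t|lebesgue_on {0<..<T}. \<xi> t * (LINT x|M. ((\<Sum>i=1..n. charge P i * r i (t, x)) + f_source P x) * F x))
      = (\<Sum>i=1..n. charge P i * (LINT p|Q. (\<xi> (fst p) * F (snd p)) \<bullet> r i p)) + (LINT p|Q. (\<xi> (fst p) * F (snd p)) \<bullet> f_source P (snd p))"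
    if r: "\<And>i. i \<in> {1..n} \<Longrightarrow> r i \<in> L2 Q" and F: "(\<lambda>p. \<xi> (fst p) * F (snd p)) \<in> L2 Q" for r F
  proof -
    have i1: "integrable Q (\<lambda>p. (\<xi> (fst p) * F (snd p)) \<bullet> r i p)" if "i \<in> {1..n}" for i
      by (rule L2_inner_integrable[OF F r[OF that]])
    have i2: "integrable Q (\<lambda>p. (\<xi> (fst p) * F (snd p)) \<bullet> f_source P (snd p))" by (rule L2_inner_integrable[OF F fQ])
    let ?H = "\<lambda>p. (\<Sum>i=1..n. charge P i * ((\<xi> (fst p) * F (snd p)) \<bullet> r i p)) + (\<xi> (fst p) * F (snd p)) \<bullet> f_source P (snd p)"
    have iH: "integrable Q ?H"
      by (intro Bochner_Integration.integrable_add Bochner_Integration.integrable_sum integrable_mult_right i1 i2)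
    have "?H (t, x) = \<xi> t * (((\<Sum>i=1..n. charge P i * r i (t, x)) + f_source P x) * F x)" for t x
      by (simp add: sum_distrib_left sum_distrib_right algebra_simps)
    then have "(LINT t|lebesgue_on {0<..<T}. \<xi> t * (LINT x|M. ((\<Sum>i=1..n. charge P i * r i (t, x)) + f_source P x) * F x)) = (LINT p|Q. ?H p)"
      using integral_cyl_iterated[OF borel_dom iH] by (simp only: integral_mult_right_zero)
    also have "\<dots> = (LINT p|Q. (\<Sum>i=1..n. charge P i * ((\<xi> (fst p) * F (snd p)) \<bullet> r i p))) + (LINT p|Q. (\<xi> (fst p) * F (snd p)) \<bullet> f_source P (snd p))"
      by (intro Bochner_Integration.integral_add Bochner_Integration.integrable_sum integrable_mult_right i1 i2)
    also have "(LINT p|Q. (\<Sum>i=1..n. charge P i * ((\<xi> (fst p) * F (snd p)) \<bullet> r i p)))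
        = (\<Sum>i=1..n. LINT p|Q. charge P i * ((\<xi> (fst p) * F (snd p)) \<bullet> r i p))"
      by (intro Bochner_Integration.integral_sum integrable_mult_right i1)
    finally show ?thesis by (simp only: integral_mult_right_zero)
  qed
  have u1: "u i \<in> L2 Q" "i \<in> {0..n}" if "i \<in> {1..n}" for i using u_L2[of i] that by auto
  obtain C where C: "\<And>m. L2_norm Q (?Gp m) \<le> C" using step_gradient(2)[OF weak_phi] by blast
  have 1: "(\<lambda>m. LINT p|Q. (\<xi> (fst p) *\<^sub>R ?A m (snd p)) \<bullet> ?Gp m p) \<longlonglongrightarrow> (LINT p|Q. (\<xi> (fst p) *\<^sub>R wgrad \<Omega> v (snd p)) \<bullet> space_grad T \<Omega> \<phi> p)"
    by (rule L2_strong_weak[OF L\<xi>[OF X.simplex_fn_L2] L\<xi>[OF wgrad(1)[OF v]]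
          time_weighted_L2(2)[OF \<xi> wgrad(1)[OF v] X.simplex_fn_L2 pt(1)] X.step_fn_L2 C
          step_gradient(1)[OF weak_phi L\<xi>[OF wgrad(1)[OF v]]]])
  have 2: "(\<lambda>m. LINT p|Q. (\<xi> (fst p) * ?c m (snd p)) \<bullet> ?r m i p) \<longlonglongrightarrow> (LINT p|Q. (\<xi> (fst p) * v (snd p)) \<bullet> u i p)"
    if i: "i \<in> {1..n}" for i
  proof (rule L2_strong_weak[OF c\<xi> cc X.recon_M_L2 L2_norm_le_of_bound[OF fin_Q X.recon_M_L2]])
    show "AE p in Q. \<bar>?r m i p\<bar> \<le> 1" for m
      using recon_M_bounds(1)[of m i] recon_M_bounds(2)[OF u1(2)[OF i], of m] by eventually_elim simp
    show "(\<lambda>m. LINT p|Q. (\<xi> (fst p) * v (snd p)) \<bullet> ?r m i p) \<longlonglongrightarrow> (LINT p|Q. (\<xi> (fst p) * v (snd p)) \<bullet> u i p)"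
      using conv_weak[OF u1(2)[OF i] c\<xi>(2)] by (simp add: mult.commute)
  qed
  have 3: "(\<lambda>m. LINT p|Q. (\<xi> (fst p) * ?c m (snd p)) \<bullet> f_source P (snd p)) \<longlonglongrightarrow> (LINT p|Q. (\<xi> (fst p) * v (snd p)) \<bullet> f_source P (snd p))"
    by (rule L2_tendsto_inner_const[OF c\<xi> cc fQ])
  have eq: "(lam P)\<^sup>2 * (LINT p|Q. (\<xi> (fst p) *\<^sub>R ?A m (snd p)) \<bullet> ?Gp m p)
     = (\<Sum>i=1..n. charge P i * (LINT p|Q. (\<xi> (fst p) * ?c m (snd p)) \<bullet> ?r m i p)) + (LINT p|Q. (\<xi> (fst p) * ?c m (snd p)) \<bullet> f_source P (snd p))" for m
  proof -
    have "(lam P)\<^sup>2 * (LINT t|lebesgue_on {0<..<T}. \<xi> t * (LINT x|M. ?Gp m (t, x) \<bullet> ?A m x))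
      = (LINT t|lebesgue_on {0<..<T}. \<xi> t * ((lam P)\<^sup>2 * (LINT x|M. ?Gp m (t, x) \<bullet> ?A m x)))"
      by (simp only: integral_mult_right_zero[symmetric] mult.left_commute)
    also have "\<dots> = (LINT t|lebesgue_on {0<..<T}. \<xi> t * (LINT x|M. ((\<Sum>i=1..n. charge P i * ?r m i (t, x)) + f_source P x) * ?c m x))"
    \<comment> \<open>Every time in the open interval lies in a slab, so the discrete equation holds
      at each t and no null set of times is discarded.\<close>
    proof (rule Bochner_Integration.integral_cong[OF refl])
      fix t assume "t \<in> space (lebesgue_on {0<..<T})"
      then have t: "0 < t" "t \<le> T" by auto
      obtain k where k: "k \<in> {1..nsteps (D m)}" "t \<in> {tgrid (D m) (k - 1)<..tgrid (D m) k}"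
        by (rule X.slab_exists[OF t, of m]) (rule that)
      show "\<xi> t * ((lam P)\<^sup>2 * (LINT x|M. ?Gp m (t, x) \<bullet> ?A m x))
        = \<xi> t * (LINT x|M. ((\<Sum>i=1..n. charge P i * ?r m i (t, x)) + f_source P x) * ?c m x)"
        using X.discrete_poisson[OF k vP(2)] by simp
    qed
    finally show ?thesis unfolding lhs[OF X.simplex_fn_L2 X.step_fn_L2] exp[OF X.recon_M_L2 c\<xi>(1)] .
  qed
  have "(\<lambda>m. (lam P)\<^sup>2 * (LINT p|Q. (\<xi> (fst p) *\<^sub>R ?A m (snd p)) \<bullet> ?Gp m p))
    \<longlonglongrightarrow> (lam P)\<^sup>2 * (LINT p|Q. (\<xi> (fst p) *\<^sub>R wgrad \<Omega> v (snd p)) \<bullet> space_grad T \<Omega> \<phi> p)"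
    by (intro tendsto_intros 1)
  moreover have "(\<lambda>m. (lam P)\<^sup>2 * (LINT p|Q. (\<xi> (fst p) *\<^sub>R ?A m (snd p)) \<bullet> ?Gp m p))
    \<longlonglongrightarrow> (\<Sum>i=1..n. charge P i * (LINT p|Q. (\<xi> (fst p) * v (snd p)) \<bullet> u i p)) + (LINT p|Q. (\<xi> (fst p) * v (snd p)) \<bullet> f_source P (snd p))"
    unfolding eq by (intro tendsto_intros 2 3)
  ultimately have "(lam P)\<^sup>2 * (LINT p|Q. (\<xi> (fst p) *\<^sub>R wgrad \<Omega> v (snd p)) \<bullet> space_grad T \<Omega> \<phi> p)
     = (\<Sum>i=1..n. charge P i * (LINT p|Q. (\<xi> (fst p) * v (snd p)) \<bullet> u i p)) + (LINT p|Q. (\<xi> (fst p) * v (snd p)) \<bullet> f_source P (snd p))"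
    by (rule LIMSEQ_unique)
  moreover have "(LINT t|lebesgue_on {0<..<T}. \<xi> t * (LINT x|M. ((\<Sum>i=1..n. charge P i * u i (t, x)) + f_source P x) * v x))
     = (\<Sum>i=1..n. charge P i * (LINT p|Q. (\<xi> (fst p) * v (snd p)) \<bullet> u i p)) + (LINT p|Q. (\<xi> (fst p) * v (snd p)) \<bullet> f_source P (snd p))"
    by (rule exp[OF u1(1) c\<xi>(2)])
  ultimately show ?thesis unfolding lhs[OF wgrad(1)[OF v] \<phi>L] by simp
qed

text \<open>The iterated integrals of \<open>weak_solution\<close> become those of
  \<open>transport_limit\<close> by Fubini and by s * s = u 0, valid almost everywhere because u 0
  is nonnegative there.\<close>

lemma transport_clause:
  assumes i: "i \<in> {1..n}" and \<psi>: "\<psi> \<in> Cc_infty ({..<T} \<times> UNIV)"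
  shows "- (LINT t|lebesgue_on {0<..<T}. LINT x|M. u i (t, x) * deriv (\<lambda>r. \<psi> (r, x)) t)
        - (LINT x|M. u_ini P i x * \<psi> (0, x))
        + diffus P i * (LINT t|lebesgue_on {0<..<T}. LINT x|M.
            (s (t, x) *\<^sub>R space_grad T \<Omega> (w i) (t, x)
             - (3 * s (t, x) * u i (t, x)) *\<^sub>R space_grad T \<Omega> s (t, x)
             + (u 0 (t, x) * u i (t, x) * beta P * charge P i) *\<^sub>R space_grad T \<Omega> \<phi> (t, x))
            \<bullet> grad (\<lambda>y. \<psi> (t, y)) x) = 0"
proof -
  note sm = Cc_infty_D(1)[OF \<psi>]
  have i0: "i \<in> {0..n}" "0 \<in> {0..n}" using i by auto
  obtain B where B: "0 \<le> B" "\<And>p. norm (grad \<psi> p) \<le> B" using Cc_infty_bounded[OF \<psi>] by metis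
  have L: "(\<lambda>p. g (grad \<psi> p)) \<in> L2 Q" if g: "continuous_on UNIV g" "\<And>x. norm (g x) \<le> norm x"
    for g :: "real \<times> 'a \<Rightarrow> 'b::euclidean_space"
  proof (rule L2_bounded[OF L2_const[OF fin_Q, of "1::real"], of _ B])
    show "(\<lambda>p. g (grad \<psi> p)) \<in> borel_measurable Q"
      by (rule cyl_borel_measurable[OF borel_dom borel_measurable_continuous_onI])
        (rule continuous_on_compose2[OF g(1) smooth_grad_continuous[OF sm]], simp)
    show "AE p in Q. norm (g (grad \<psi> p)) \<le> B * norm (1::real)"
      using order_trans[OF g(2) B(2)] by simp
  qed
  have f: "(\<lambda>p. fst (grad \<psi> p)) \<in> L2 Q"
    by (rule L[OF continuous_on_fst[OF continuous_on_id]]) (simp only: norm_snd_fst)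
  have g: "(\<lambda>p. snd (grad \<psi> p)) \<in> L2 Q"
    by (rule L[OF continuous_on_snd[OF continuous_on_id]]) (simp only: norm_snd_fst)
  have sG: "space_grad T \<Omega> (w i) \<in> L2 Q" "space_grad T \<Omega> s \<in> L2 Q" "space_grad T \<Omega> \<phi> \<in> L2 Q"
    using weak_w[OF i] weak_s weak_phi by (auto intro!: space_grad_L2 simp: L2H1_weak_conv_def)
  have mm: "s \<in> borel_measurable Q" "w i \<in> borel_measurable Q" using s_L2 w_L2[OF i] by (auto simp: L2_def)
  have sw: "AE p in Q. \<bar>s p * w i p\<bar> \<le> 1"
    using s_bound w_bound[OF i]
  proof eventually_elim
    case (elim p)
    then show ?case using mult_le_one[of "\<bar>s p\<bar>" "\<bar>w i p\<bar>"] by (simp add: abs_mult)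
  qed
  have i1: "integrable Q (\<lambda>p. (s p *\<^sub>R snd (grad \<psi> p)) \<bullet> space_grad T \<Omega> (w i) p)"
    by (rule L2_inner_integrable[OF L2_mult_bounded[OF mm(1) s_bound g] sG(1)])
  have i2: "integrable Q (\<lambda>p. (w i p *\<^sub>R snd (grad \<psi> p)) \<bullet> space_grad T \<Omega> s p)"
    by (rule L2_inner_integrable[OF L2_mult_bounded[OF mm(2) w_bound[OF i] g] sG(2)])
  have i3: "integrable Q (\<lambda>p. ((s p * w i p) *\<^sub>R snd (grad \<psi> p)) \<bullet> space_grad T \<Omega> \<phi> p)"
    by (rule L2_inner_integrable[OF L2_mult_bounded[OF borel_measurable_times[OF mm] sw g] sG(3)])
  let ?b = "beta P * charge P i"
  let ?H = "\<lambda>p. (s p *\<^sub>R snd (grad \<psi> p)) \<bullet> space_grad T \<Omega> (w i) p - 3 * ((w i p *\<^sub>R snd (grad \<psi> p)) \<bullet> space_grad T \<Omega> s p)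
     + ?b * (((s p * w i p) *\<^sub>R snd (grad \<psi> p)) \<bullet> space_grad T \<Omega> \<phi> p)"
  let ?K = "\<lambda>p. (s p *\<^sub>R space_grad T \<Omega> (w i) p - (3 * s p * u i p) *\<^sub>R space_grad T \<Omega> s p
             + (u 0 p * u i p * beta P * charge P i) *\<^sub>R space_grad T \<Omega> \<phi> p) \<bullet> snd (grad \<psi> p)"
  have iH: "integrable Q ?H"
    by (intro Bochner_Integration.integrable_add Bochner_Integration.integrable_diff integrable_mult_right i1 i2 i3)
  have um: "u i \<in> borel_measurable Q" "u 0 \<in> borel_measurable Q" using u_L2[OF i0(1)] u_L2[OF i0(2)] by (auto simp: L2_def)
  have gm: "space_grad T \<Omega> (w i) \<in> borel_measurable Q" "space_grad T \<Omega> s \<in> borel_measurable Q"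
    "space_grad T \<Omega> \<phi> \<in> borel_measurable Q" "(\<lambda>p. snd (grad \<psi> p)) \<in> borel_measurable Q"
    using sG g by (auto simp: L2_def)
  have Km: "?K \<in> borel_measurable Q"
    by (intro borel_measurable_inner borel_measurable_add borel_measurable_diff borel_measurable_scaleR
        borel_measurable_times borel_measurable_const um gm mm)
  have HK: "AE p in Q. ?H p = ?K p"
    using u_bounds(1)[OF i0(2)]
  proof eventually_elim
    case (elim p)
    then have "s p * s p = u 0 p" by simp
    moreover have "(a *\<^sub>R g) \<bullet> x - 3 * (((a * c) *\<^sub>R g) \<bullet> y) + b1 * b2 * (((a * (a * c)) *\<^sub>R g) \<bullet> z)
       = (a *\<^sub>R x - (3 * a * c) *\<^sub>R y + ((a * a) * c * b1 * b2) *\<^sub>R z) \<bullet> g" for a b1 b2 c :: real and g x y z :: 'a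
      by (simp add: inner_add_left inner_diff_left inner_commute algebra_simps)
    ultimately show ?case by simp
  qed
  have iK: "integrable Q ?K" using integrable_cong_AE[of ?H Q ?K] iH Km HK by auto
  have "(LINT t|lebesgue_on {0<..<T}. LINT x|M. ?K (t, x)) = (LINT p|Q. ?H p)"
    unfolding integral_cyl_iterated[OF borel_dom iK] using iH Km HK by (intro integral_cong_AE) auto
  also have "\<dots> = (LINT p|Q. (s p *\<^sub>R snd (grad \<psi> p)) \<bullet> space_grad T \<Omega> (w i) p)
       - 3 * (LINT p|Q. (w i p *\<^sub>R snd (grad \<psi> p)) \<bullet> space_grad T \<Omega> s p)
       + ?b * (LINT p|Q. ((s p * w i p) *\<^sub>R snd (grad \<psi> p)) \<bullet> space_grad T \<Omega> \<phi> p)"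
    using i1 i2 i3 by (simp only: Bochner_Integration.integral_add Bochner_Integration.integral_diff
        Bochner_Integration.integrable_diff integrable_mult_right integral_mult_right_zero)
  finally have K: "(LINT t|lebesgue_on {0<..<T}. LINT x|M. ?K (t, x)) = \<dots>" .
  have "integrable Q (\<lambda>p. u i p * fst (grad \<psi> p))" using L2_inner_integrable[OF u_L2[OF i0(1)] f] by simp
  note F = integral_cyl_iterated[OF borel_dom this]
  show ?thesis
    unfolding partial_derivatives[OF sm] F K by (rule transport_limit[OF i \<psi>])
qed

end

theorem theorem4p2:
  fixes P :: "(real ^ 'd::finite) problem"
    and \<D> :: "nat \<Rightarrow> (real ^ 'd) discretisation"
    and \<rho> :: simplex_rule
    and \<mu> :: "nat \<Rightarrow> nat \<Rightarrow> nat \<Rightarrow> real ^ 'd \<Rightarrow> real"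
    and \<phi>d :: "nat \<Rightarrow> nat \<Rightarrow> real ^ 'd \<Rightarrow> real"
    and proj :: "nat \<Rightarrow> (real ^ 'd \<Rightarrow> real) \<Rightarrow> real ^ 'd \<Rightarrow> real"
    and sub :: "nat \<Rightarrow> nat"
    and u :: "nat \<Rightarrow> real \<times> (real ^ 'd) \<Rightarrow> real"
    and \<phi> :: "real \<times> (real ^ 'd) \<Rightarrow> real"
  defines "\<Omega> \<equiv> dom_Omega P" and "T \<equiv> horizon P" and "n \<equiv> nspec P"
    and "Q \<equiv> cyl (horizon P) (dom_Omega P)"
    and "ud \<equiv> \<lambda>m. u_disc P (\<D> m) (\<mu> m)"
  assumes dim: "CARD('d) \<in> {2, 3}"
    and problem: "admissible_problem P"
    and discr: "\<And>m. is_discretisation P (\<D> m)"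
    and size_lim: "(\<lambda>m. mesh_size (mesh (\<D> m))) \<longlonglongrightarrow> 0"
    and step_lim: "(\<lambda>m. max_time_step (\<D> m)) \<longlonglongrightarrow> 0"
    and regularity: "\<exists>\<theta>>0. \<forall>m. mesh_regularity (mesh (\<D> m)) \<le> \<theta>"
    and conforming: "\<And>m. P1D (Gamma_D P) (mesh (\<D> m)) \<subseteq> H1D \<Omega> (Gamma_D P)"
    and proj: "\<And>m. H1_orthogonal_projection \<Omega> (H1D \<Omega> (Gamma_D P))
                      (P1D (Gamma_D P) (mesh (\<D> m))) (proj m)"
    and proj_lim: "\<And>v. v \<in> H1D \<Omega> (Gamma_D P) \<Longrightarrow>
                      (\<lambda>m. H1_norm \<Omega> (\<lambda>x. v x - proj m v x)) \<longlonglongrightarrow> 0"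
    and lift_lim: "H1_conv \<Omega> (\<lambda>m. lift_D (\<D> m)) (phi_D P)"
    and scheme: "\<And>m. scheme_solution \<rho> P (\<D> m) (\<mu> m) (\<phi>d m)"
    and sub: "strict_mono sub"
    and u_Linf: "\<And>i. i \<in> {0..n} \<Longrightarrow> u i \<in> Linf Q"
    and u0_H1: "u 0 \<in> L2H1 T \<Omega>"
    and sqrt_u0_H1: "(\<lambda>p. sqrt (u 0 p)) \<in> L2H1 T \<Omega>"
    and sqrt_u0_ui_H1: "\<And>i. i \<in> {1..n} \<Longrightarrow> (\<lambda>p. sqrt (u 0 p) * u i p) \<in> L2H1 T \<Omega>"
    and phi_H1: "\<phi> \<in> L2H1D_shift T \<Omega> (Gamma_D P) (phi_D P)"
    and conv_i: "\<And>i. i \<in> {1..n} \<Longrightarrow>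
          Linf_weak_star_conv Q (\<lambda>m. recon_M P (\<D> (sub m)) (ud (sub m) i)) (u i)"
    and conv_ii:
          "L2_conv Q (\<lambda>m. recon_M P (\<D> (sub m)) (ud (sub m) 0)) (u 0)"
          "L2_conv Q (\<lambda>m. recon_T (\<D> (sub m)) (ud (sub m) 0)) (u 0)"
          "L2H1_weak_conv T \<Omega> (\<lambda>m. recon_T (\<D> (sub m)) (ud (sub m) 0)) (u 0)"
          "L2H1_weak_conv T \<Omega>
             (\<lambda>m. recon_T (\<D> (sub m)) (\<lambda>k K. sqrt (ud (sub m) 0 k K))) (\<lambda>p. sqrt (u 0 p))"
    and conv_iii: "\<And>i. i \<in> {1..n} \<Longrightarrow>
          L2_conv Q (\<lambda>m. recon_M P (\<D> (sub m)) (\<lambda>k K. sqrt (ud (sub m) 0 k K) * ud (sub m) i k K))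
            (\<lambda>p. sqrt (u 0 p) * u i p) \<and>
          L2_conv Q (\<lambda>m. recon_T (\<D> (sub m)) (\<lambda>k K. sqrt (ud (sub m) 0 k K) * ud (sub m) i k K))
            (\<lambda>p. sqrt (u 0 p) * u i p) \<and>
          L2H1_weak_conv T \<Omega>
            (\<lambda>m. recon_T (\<D> (sub m)) (\<lambda>k K. sqrt (ud (sub m) 0 k K) * ud (sub m) i k K))
            (\<lambda>p. sqrt (u 0 p) * u i p)"
    and conv_iv:
          "L2_conv Q (\<lambda>m. recon_T (\<D> (sub m)) (\<phi>d (sub m))) \<phi>"
          "L2H1_weak_conv T \<Omega> (\<lambda>m. recon_T (\<D> (sub m)) (\<phi>d (sub m))) \<phi>"
  shows "weak_solution P u \<phi>"
proof -
  let ?D = "\<lambda>m. \<D> (sub m)"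
  obtain \<theta> where \<theta>: "0 < \<theta>" "\<And>m. mesh_regularity (mesh (\<D> m)) \<le> \<theta>" using regularity by blast
  have sch: "fe_scheme P (\<D> m) \<rho> (\<mu> m) (\<phi>d m)" for m
    by unfold_locales (rule problem discr scheme)+
  \<comment> \<open>All discrete data are reindexed along the subsequence; the limits of mesh size
    and time step are composed with it.\<close>
  interpret L: fe_limit P ?D \<rho> "\<lambda>m. \<mu> (sub m)" "\<lambda>m. \<phi>d (sub m)" \<theta> u \<phi>
  proof (rule fe_limit.intro)
    show "(\<lambda>m. mesh_size (mesh (?D m))) \<longlonglongrightarrow> 0" "(\<lambda>m. max_time_step (?D m)) \<longlonglongrightarrow> 0"
      using LIMSEQ_subseq_LIMSEQ[OF size_lim sub] LIMSEQ_subseq_LIMSEQ[OF step_lim sub] by (simp_all add: comp_def)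
  qed (use sch \<theta> conv_i conv_ii conv_iii conv_iv in \<open>simp_all add: Q_def T_def \<Omega>_def n_def ud_def\<close>)
  have meas: "u i \<in> borel_measurable L.Q" if "i \<in> {0..n}" for i
    using L.u_L2[of i] that by (simp add: L2_def n_def)
  have poisson: "(lam P)\<^sup>2 * (LINT t|lebesgue_on {0<..<horizon P}. \<xi> t *
        (LINT x|lebesgue_on \<Omega>. space_grad T \<Omega> \<phi> (t, x) \<bullet> wgrad \<Omega> v x))
      = (LINT t|lebesgue_on {0<..<horizon P}. \<xi> t *
        (LINT x|lebesgue_on \<Omega>. ((\<Sum>i=1..n. charge P i * u i (t, x)) + f_source P x) * v x))"
    if v: "v \<in> H1D \<Omega> (Gamma_D P)" and \<xi>: "\<xi> \<in> Cc_infty {0<..<T}" for v \<xi>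
  proof -
    \<comment> \<open>The projections supply test functions vanishing at the Dirichlet vertices, and
      conformity places them in H^1.\<close>
    have V: "proj m v \<in> P1D (Gamma_D P) (mesh (\<D> m))" for m
      using proj[of m] v by (simp add: H1_orthogonal_projection_def)
    have H: "proj m v \<in> H1 \<Omega>" for m using V[of m] conforming[of m] by (auto simp: H1D_def)
    have "v \<in> H1 \<Omega>" using v by (simp add: H1D_def)
    moreover have "(\<lambda>m. H1_norm \<Omega> (\<lambda>x. v x - proj (sub m) v x)) \<longlonglongrightarrow> 0"
      using LIMSEQ_subseq_LIMSEQ[OF proj_lim[OF v] sub] by (simp add: comp_def)
    ultimately show ?thesis
      unfolding \<Omega>_def T_def n_def using L.poisson_limit[OF _ V _ _ \<xi>, where v = v] H by (simp add: \<Omega>_def)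
  qed
  show ?thesis
    unfolding weak_solution_def Let_def
    using meas L.u_bounds L.u_sum L.transport_clause poisson sqrt_u0_H1 sqrt_u0_ui_H1 phi_H1
    by (auto simp: \<Omega>_def T_def n_def L2H1D_shift_def L2H1_def L2_def intro: eventually_conj)
qed

end
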